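(* Let $A>0$. For all positive real numbers $x$ and $Q$ satisfying $x(\log x)^{-A}\le Q\le x$, \[\sum_{q\le Q}\ \sum_{\substack{a\le q\\ (a,q)=1}}\ \max_{\pi\in\mathcal{P}_x}\ \sum_{I\in\pi}\left(\theta(I;q,a)-\frac{|I|}{\phi(q)}\right)^2 \ll_A xQ\log^3(x),\] where the implied constant depends only on $A$.
   Context: $\phi$ is Euler's totient function and $\log$ is the natural logarithm. For an interval $I$ and positive integers $q,a$, $\theta(I;q,a)=\sum_{p\in I,\ p\equiv a \bmod q}\log p$, the sum over primes $p$. $|I|$ denotes the number of integers contained in $I$. $\mathcal{P}_x$ denotes the set of all partitions of $\{1,2,\ldots,\lfloor x\rfloor\}$ into disjoint intervals (of consecutive integers). *)

theory Defs
  imports Complex_Main "HOL-Number_Theory.Number_Theory"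
begin

definition theta :: "nat set \<Rightarrow> nat \<Rightarrow> nat \<Rightarrow> real" where
  "theta I q a = (\<Sum>p \<in> {p. p \<in> I \<and> prime p \<and> [p = a] (mod q)}. ln (real p))"

definition interval_partitions :: "nat \<Rightarrow> nat set set set" where
  "interval_partitions n = {P. (\<forall>I\<in>P. \<exists>a b. a \<le> b \<and> I = {a..b}) \<and>
       pairwise disjnt P \<and> \<Union>P = {1..n}}"

end

theory Submission
  imports Defs "HOL-Complex_Analysis.Complex_Analysis"
begin

text \<open>
  Decompose every interval into dyadic blocks, at most two of each length. By Cauchy's inequality the
  square attached to an interval is at most \<open>O(log x)\<close> times the sum of the squares attached to the
  dyadic blocks it contains, and disjoint intervals contain different blocks. Hence the maximum over
  all partitions is bounded by \<open>O(log x)\<close> times a sum over all dyadic blocks; as there are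
  \<open>O(log x)\<close> lengths, it suffices to bound the total variance over the blocks of one length by
  \<open>O(x Q log x)\<close>, a theorem of Barban--Davenport--Halberstam type.

  For one block, Parseval's identity turns the variance over the residue classes modulo \<open>q\<close> into a
  sum over the fractions \<open>b / d\<close> with \<open>d dvd q\<close>. Denominators \<open>d \<ge> R\<close> are controlled by the large
  sieve. If the block is short, \<open>R = 1\<close> suffices; if it is long, \<open>R\<close> is a power of \<open>log x\<close> and for
  \<open>d < R\<close> the Siegel--Walfisz theorem shows that the exponential sum over primes cancels against the
  main term. The Siegel--Walfisz theorem itself is derived from Siegel's lower bound for \<open>L(1)\<close>
  (by Estermann's method), the \<open>3-4-1\<close> inequality, and a contour shift for the Riesz mean of the
  von Mangoldt function twisted by a character.
\<close>

section \<open>Dirichlet series\<close>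

text \<open>The three logarithms have three sources: the Cauchy step, the number of dyadic lengths,
  and the sum of \<open>(ln p)^2\<close> over the primes up to \<open>x\<close>. For a block of
  \<open>H\<close> integers with \<open>H ln x <= Q\<close> the large sieve over all denominators
  fits into this, and so does the square of the expected value. For a longer block it does not; but
  then \<open>Q >= x / (ln x)^r\<close> forces \<open>H\<close> to be at least \<open>x\<close> over
  a power of \<open>ln x\<close>, so an error that saves a higher power is affordable, and
  Siegel--Walfisz supplies one. The contour is closed only to evaluate the kernel of the Riesz mean;
  the integral itself stays on \<open>Re s = c > 1\<close>. The saving comes from weighting the
  coefficients by \<open>(ln n)^(2 j)\<close>, that is, from differentiating the logarithmic
  derivative \<open>2 j\<close> times. Each such derivative is at most a constant times
  \<open>(q (|t| + 2))^(1/2)\<close>, because L is at most a tiny power of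
  \<open>q (|t| + 2)\<close> slightly left of the line through 1 and at least a tiny negative power
  just right of it. The kernel decays like \<open>1 / t^2\<close> and tolerates the exponent
  1/2.\<close>

definition dser :: "(nat \<Rightarrow> complex) \<Rightarrow> complex \<Rightarrow> complex" where
  "dser a s = (\<Sum>n. a n * of_nat n powr (-s))"

text \<open>Absolute convergence in the half plane \<open>Re s > 1\<close>. The index 0 is harmless
  in all these series because \<open>0 powr z = 0\<close>.\<close>

definition slow :: "(nat \<Rightarrow> complex) \<Rightarrow> bool" where
  "slow a \<longleftrightarrow> (\<forall>\<sigma>>1. summable (\<lambda>n. norm (a n) * real n powr (-\<sigma>)))"

lemma norm_nat_powr [simp]: "norm (of_nat n powr s :: complex) = real n powr Re s"
  by (simp add: norm_powr_real_powr)

lemma slow_norm_summable: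
  assumes "slow a" "Re s > 1"
  shows "summable (\<lambda>n. norm (a n * of_nat n powr (-s)))"
  using assms by (simp add: slow_def norm_mult)

lemma slow_summable:
  assumes "slow a" "Re s > 1"
  shows "summable (\<lambda>n. a n * of_nat n powr (-s))"
  using summable_norm_cancel[OF slow_norm_summable[OF assms]] .

lemma slow_sums:
  assumes "slow a" "Re s > 1"
  shows "(\<lambda>n. a n * of_nat n powr (-s)) sums dser a s"
  unfolding dser_def using slow_summable[OF assms] by (rule summable_sums)

lemma slow_mono:
  assumes "slow a" "\<And>n. n \<ge> 1 \<Longrightarrow> norm (b n) \<le> C * norm (a n)"
  shows "slow b"
  unfolding slow_def
proof (intro allI impI)
  fix \<sigma> :: real assume \<sigma>: "\<sigma> > 1"
  have "summable (\<lambda>n. C * (norm (a n) * real n powr (-\<sigma>)))"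
    using assms(1) \<sigma> by (intro summable_mult) (auto simp: slow_def)
  then show "summable (\<lambda>n. norm (b n) * real n powr (-\<sigma>))"
  proof (rule summable_comparison_test')
    fix n :: nat assume "n \<ge> 1"
    show "norm (norm (b n) * real n powr - \<sigma>) \<le> C * (norm (a n) * real n powr - \<sigma>)"
      using mult_right_mono[OF assms(2)[OF \<open>n \<ge> 1\<close>], of "real n powr - \<sigma>"] by (simp add: mult_ac)
  qed
qed

lemma slow_1: "slow (\<lambda>_. 1)"
  unfolding slow_def by (simp add: summable_real_powr_iff)

lemma slow_bounded:
  assumes "\<And>n. n \<ge> 1 \<Longrightarrow> norm (b n) \<le> C"
  shows "slow b"
  by (rule slow_mono[OF slow_1, where C = C]) (use assms in auto)

lemma slow_ln:
  assumes "slow a"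
  shows "slow (\<lambda>n. of_real (ln (real n)) * a n)"
  unfolding slow_def
proof (intro allI impI)
  fix \<sigma> :: real assume \<sigma>: "\<sigma> > 1"
  define d where "d = (\<sigma> - 1) / 2"
  have d: "d > 0" using \<sigma> by (simp add: d_def)
  have "summable (\<lambda>n. (1/d) * (norm (a n) * real n powr (-(\<sigma> - d))))"
    using assms \<sigma> by (intro summable_mult) (auto simp: slow_def d_def field_simps)
  then show "summable (\<lambda>n. norm (of_real (ln (real n)) * a n) * real n powr (-\<sigma>))"
  proof (rule summable_comparison_test')
    fix n :: nat assume n: "n \<ge> 1"
    have "ln (real n) \<le> real n powr d / d" using n d by (intro ln_powr_bound) auto
    then have "\<bar>ln (real n)\<bar> * (norm (a n) * real n powr (-\<sigma>)) \<le> real n powr d / d * (norm (a n) * real n powr (-\<sigma>))"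
      using n by (intro mult_right_mono) auto
    also have "\<dots> = 1 / d * (norm (a n) * (real n powr d * real n powr (-\<sigma>)))" by simp
    also have "real n powr d * real n powr (-\<sigma>) = real n powr - (\<sigma> - d)" by (simp add: powr_add[symmetric])
    finally show "norm (norm (of_real (ln (real n)) * a n) * real n powr - \<sigma>) \<le> 1 / d * (norm (a n) * real n powr - (\<sigma> - d))"
      by (simp add: norm_mult mult_ac)
  qed
qed

lemma slow_ln_power:
  assumes "slow a"
  shows "slow (\<lambda>n. of_real (ln (real n)) ^ k * a n)"
proof (induction k)
  case (Suc k)
  from slow_ln[OF Suc] show ?case by (simp add: mult_ac)
qed (use assms in simp)

lemma slow_uminus: "slow a \<Longrightarrow> slow (\<lambda>n. - a n)"
  by (simp add: slow_def)

lemma dser_add: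
  assumes "slow a" "slow b" "Re s > 1"
  shows "dser (\<lambda>n. a n + b n) s = dser a s + dser b s"
  using sums_add[OF slow_sums[OF assms(1,3)] slow_sums[OF assms(2,3)]]
  by (simp add: dser_def sums_iff algebra_simps)

lemma dser_uminus: "dser (\<lambda>n. - a n) s = - dser a s" if "slow a" "Re s > 1"
  using sums_minus[OF slow_sums[OF that]] by (simp add: dser_def sums_iff)

lemma dser_cmult: "dser (\<lambda>n. c * a n) s = c * dser a s" if "slow a" "Re s > 1"
  using sums_mult[OF slow_sums[OF that], of c] by (simp add: dser_def sums_iff mult_ac)

lemma slow_add:
  assumes "slow a" "slow b" shows "slow (\<lambda>n. a n + b n)"
  unfolding slow_def
proof (intro allI impI)
  fix \<sigma> :: real assume \<sigma>: "\<sigma> > 1"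
  have "summable (\<lambda>n. norm (a n) * real n powr (-\<sigma>) + norm (b n) * real n powr (-\<sigma>))"
    using assms \<sigma> by (intro summable_add) (auto simp: slow_def)
  then show "summable (\<lambda>n. norm (a n + b n) * real n powr (-\<sigma>))"
    by (rule summable_comparison_test')
       (auto simp: distrib_right[symmetric] intro!: mult_right_mono norm_triangle_ineq)
qed

lemma DERIV_nat_powr:
  fixes s :: complex
  shows "((\<lambda>s. a * of_nat n powr (-s)) has_field_derivative - of_real (ln (real n)) * a * of_nat n powr (-s)) (at s within S)"
proof (cases "n = 0")
  case False
  have "((\<lambda>z. (of_nat n :: complex) powr z) has_field_derivative Ln (of_nat n) * (of_nat n :: complex) powr (-s)) (at (-s))"
    by (rule has_field_derivative_powr_right) (use False in auto)
  from DERIV_chain2[where f = "(powr) (of_nat n)" and g = uminus and Db = "-1", OF this, of S] have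
    "((\<lambda>s. (of_nat n :: complex) powr (-s)) has_field_derivative - (Ln (of_nat n) * of_nat n powr (-s))) (at s within S)"
    by (simp add: DERIV_minus[OF DERIV_ident])
  from DERIV_cmult[OF this, of a] show ?thesis
    using False by (simp add: Ln_of_nat mult_ac)
qed simp

lemma dser_has_deriv:
  assumes "slow a" "Re s > 1"
  shows "(dser a has_field_derivative dser (\<lambda>n. - of_real (ln (real n)) * a n) s) (at s)"
proof -
  define \<sigma> where "\<sigma> = (1 + Re s) / 2"
  have \<sigma>: "1 < \<sigma>" "\<sigma> < Re s" using assms by (auto simp: \<sigma>_def)
  define S where "S = {z. Re z > \<sigma>}"
  have S: "open S" "convex S" "s \<in> S" using \<sigma>(2) by (auto simp: S_def open_halfspace_Re_gt convex_halfspace_Re_gt)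
  define b where "b = (\<lambda>n. - of_real (ln (real n)) * a n)"
  have slb: "slow b" unfolding b_def using slow_uminus[OF slow_ln[OF assms(1)]] by simp
  have unif: "uniformly_convergent_on S (\<lambda>n z. \<Sum>i<n. b i * of_nat i powr (-z))"
  proof (rule Weierstrass_m_test'[where M = "\<lambda>n. norm (b n) * real n powr (-\<sigma>)"])
    fix n z assume z: "z \<in> S"
    show "norm (b n * of_nat n powr - z) \<le> norm (b n) * real n powr - \<sigma>"
    proof (cases "n = 0")
      case False
      then have "real n powr (- Re z) \<le> real n powr - \<sigma>" using z by (intro powr_mono) (auto simp: S_def)
      then show ?thesis by (simp add: norm_mult mult_left_mono)
    qed simp
  next
    show "summable (\<lambda>n. norm (b n) * real n powr - \<sigma>)" using slb \<sigma> by (auto simp: slow_def)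
  qed
  have int: "s \<in> interior S" using S by (simp add: interior_open)
  have "((\<lambda>x. \<Sum>n. a n * of_nat n powr (-x)) has_field_derivative (\<Sum>n. b n * of_nat n powr (-s))) (at s)"
  proof (rule has_field_derivative_series'(2)[where S = S and x0 = s])
    show "summable (\<lambda>n. a n * of_nat n powr - s)" by (rule slow_summable[OF assms])
    show "((\<lambda>x. a n * of_nat n powr - x) has_field_derivative b n * of_nat n powr - x) (at x within S)" for n x
      using DERIV_nat_powr[of "a n" n x S] by (simp add: b_def)
  qed (use S unif int in auto)
  then show ?thesis unfolding dser_def[abs_def] b_def by simp
qed

lemma dser_holomorphic:
  assumes "slow a" shows "dser a holomorphic_on {s. Re s > 1}"
  using dser_has_deriv[OF assms]
  by (auto simp: holomorphic_on_def field_differentiable_def intro: has_field_derivative_at_within)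

lemma open_Re_gt: "open {s. Re s > c}"
  by (rule open_halfspace_Re_gt)

lemma dser_higher_deriv:
  assumes "slow a" "Re s > 1"
  shows "(deriv ^^ k) (dser a) s = dser (\<lambda>n. (- of_real (ln (real n))) ^ k * a n) s"
  using assms(2)
proof (induction k arbitrary: s)
  case (Suc k)
  have sl: "slow (\<lambda>n. (- of_real (ln (real n))) ^ k * a n)"
    by (rule slow_mono[OF slow_ln_power[OF assms(1), of k], where C = 1])
       (auto simp: norm_mult norm_power)
  have "eventually (\<lambda>z. z \<in> {s. Re s > 1}) (nhds s)"
    using Suc.prems by (intro eventually_nhds_in_open open_Re_gt) auto
  then have "eventually (\<lambda>z. (deriv ^^ k) (dser a) z = dser (\<lambda>n. (- of_real (ln (real n))) ^ k * a n) z) (nhds s)"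
    by eventually_elim (use Suc.IH in auto)
  then have "deriv ((deriv ^^ k) (dser a)) s = deriv (dser (\<lambda>n. (- of_real (ln (real n))) ^ k * a n)) s"
    by (rule deriv_cong_ev) simp
  also have "\<dots> = dser (\<lambda>n. - of_real (ln (real n)) * ((- of_real (ln (real n))) ^ k * a n)) s"
    by (rule DERIV_imp_deriv[OF dser_has_deriv[OF sl Suc.prems]])
  finally show ?case by (simp add: mult_ac)
qed simp

text \<open>Far to the right only the term \<open>n = 1\<close> survives. This limit fixes the
  constant of integration in \<open>dser_eq_exp\<close>.\<close>

lemma dser_at_top:
  assumes "slow a"
  shows "(\<lambda>k. dser a (of_nat k)) \<longlonglongrightarrow> a 1"
proof -
  define M where "M = (\<Sum>n. norm (a n) * real n powr (-2))"
  have sM: "summable (\<lambda>n. norm (a n) * real n powr (-2))" using assms by (auto simp: slow_def)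
  have bnd: "norm (dser a (of_nat k) - a 1) \<le> 4 * M * (1/2) ^ k" if k: "k \<ge> 2" for k
  proof -
    have s1: "(\<lambda>n. if n = 1 then a n else 0) sums a 1" by (rule sums_single)
    have s2: "(\<lambda>n. a n * of_nat n powr (-of_nat k)) sums dser a (of_nat k)"
      using slow_sums[OF assms, of "of_nat k"] k by simp
    have s3: "(\<lambda>n. a n * of_nat n powr (-of_nat k) - (if n = 1 then a n else 0)) sums (dser a (of_nat k) - a 1)"
      by (rule sums_diff[OF s2 s1])
    have le: "norm (a n * of_nat n powr (-of_nat k) - (if n = 1 then a n else 0)) \<le> 4 * (1/2)^k * (norm (a n) * real n powr (-2))" for n
    proof -
      consider "n = 0" | "n = 1" | "n \<ge> 2" by linarith
      then show ?thesis
      proof cases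
        case 3
        have "real n powr (- real k) = real n powr (-2) * real n powr (- real (k - 2))"
          using k by (simp add: powr_add[symmetric] of_nat_diff)
        also have "real n powr (- real (k - 2)) \<le> 2 powr (- real (k - 2))"
          using 3 by (intro powr_mono2') auto
        also have "(2::real) powr (- real (k - 2)) = 4 * (1/2) ^ k"
          using k by (simp only: powr_minus powr_realpow) (simp add: power_diff field_simps)
        finally have "real n powr (- real k) \<le> real n powr (-2) * (4 * (1/2) ^ k)" by (simp add: mult_left_mono)
        then have "norm (a n) * real n powr (- real k) \<le> norm (a n) * (real n powr (-2) * (4 * (1/2) ^ k))"
          by (rule mult_left_mono) simp
        then show ?thesis using 3 by (simp add: norm_mult mult_ac)
      qed auto
    qed
    have "norm (dser a (of_nat k) - a 1) \<le> (\<Sum>n. 4 * (1/2)^k * (norm (a n) * real n powr (-2)))"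
      unfolding sums_unique[OF s3] by (rule norm_suminf_le[OF le]) (intro summable_mult sM)
    also have "\<dots> = 4 * M * (1/2)^k" unfolding M_def using sM by (subst suminf_mult) auto
    finally show ?thesis .
  qed
  have lim: "(\<lambda>k. 4 * M * (1/2) ^ k) \<longlonglongrightarrow> 0"
    using tendsto_mult[OF tendsto_const[of "4 * M"] LIMSEQ_realpow_zero[of "1/2"]] by simp
  have "eventually (\<lambda>k. norm (dser a (of_nat k) - a 1) \<le> 4 * M * (1/2) ^ k) sequentially"
    using eventually_ge_at_top[of 2] by eventually_elim (rule bnd)
  from Lim_null_comparison[OF this lim] have "(\<lambda>k. dser a (of_nat k) - a 1) \<longlonglongrightarrow> 0" .
  then show ?thesis by (simp add: LIM_zero_iff)
qed

lemma dser_mult: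
  assumes "slow a" "slow b" "Re s > 1"
  shows "dser a s * dser b s = dser (\<lambda>n. \<Sum>d | d dvd n. a d * b (n div d)) s" (is "_ = dser ?c s")
proof -
  let ?f = "\<lambda>n. a n * of_nat n powr (-s)" and ?g = "\<lambda>n. b n * of_nat n powr (-s)"
  have hf: "(?f has_sum dser a s) UNIV"
    by (rule norm_summable_imp_has_sum[OF slow_norm_summable slow_sums]) (use assms in auto)
  have hg: "(?g has_sum dser b s) UNIV"
    by (rule norm_summable_imp_has_sum[OF slow_norm_summable slow_sums]) (use assms in auto)
  \<comment> \<open>Every number divides 0, so pairs of factors correspond to pairs (product,
    divisor) with finite fibres only on positive indices; the vanishing terms at 0 are removed
    first.\<close>
  have hf1: "(?f has_sum dser a s) {1..}"
    by (rule has_sum_cong_neutral[THEN iffD1, OF _ _ _ hf]) (auto simp: not_less_eq_eq)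
  have hg1: "(?g has_sum dser b s) {1..}"
    by (rule has_sum_cong_neutral[THEN iffD1, OF _ _ _ hg]) (auto simp: not_less_eq_eq)
  have inner: "((\<lambda>y. case (x, y) of (x, y) \<Rightarrow> ?f x * ?g y) has_sum ?f x * dser b s) {1..}" for x
    using has_sum_cmult_right[OF hg1, of "?f x"] by simp
  have outer: "((\<lambda>x. ?f x * dser b s) has_sum dser a s * dser b s) {1..}"
    using has_sum_cmult_left[OF hf1] .
  have sn: "(\<lambda>n. norm (?f n)) summable_on {1..}" "(\<lambda>n. norm (?g n)) summable_on {1..}"
    by (rule summable_on_subset_banach[OF _ subset_UNIV], rule norm_summable_imp_summable_on,
        use slow_norm_summable assms in simp)+
  have sig: "(\<lambda>z. norm (case z of (x, y) \<Rightarrow> ?f x * ?g y)) summable_on ({1..} \<times> {1..}) \<longleftrightarrow>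
      (\<forall>x\<in>{1..}. (\<lambda>y. norm (?f x * ?g y)) summable_on {1..}) \<and>
      (\<lambda>x. norm (\<Sum>\<^sub>\<infinity>y\<in>{1..}. norm (?f x * ?g y))) summable_on {1..}"
    using Infinite_Sum.abs_summable_on_Sigma_iff[of "\<lambda>(x, y). ?f x * ?g y" "{1..}" "\<lambda>_. {1..}"] by simp
  have summ: "(\<lambda>(x, y). ?f x * ?g y) summable_on ({1..} \<times> {1..})"
  proof (rule abs_summable_summable, unfold sig, intro conjI ballI)
    fix x :: nat
    show "(\<lambda>y. norm (?f x * ?g y)) summable_on {1..}"
      using summable_on_cmult_right[OF sn(2), of "norm (?f x)"] by (simp add: norm_mult mult_ac)
  next
    have "(\<lambda>x. norm (?f x) * (\<Sum>\<^sub>\<infinity>y\<in>{1..}. norm (?g y))) summable_on {1..}"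
      by (rule summable_on_cmult_left[OF sn(1)])
    also have "(\<lambda>x. norm (?f x) * (\<Sum>\<^sub>\<infinity>y\<in>{1..}. norm (?g y))) =
      (\<lambda>x. norm (\<Sum>\<^sub>\<infinity>y\<in>{1..}. norm (?f x * ?g y)))"
    proof
      fix x
      have "(\<Sum>\<^sub>\<infinity>y\<in>{1..}. norm (?f x * ?g y)) = (\<Sum>\<^sub>\<infinity>y\<in>{1..}. norm (?f x) * norm (?g y))"
        by (simp only: norm_mult)
      also have "\<dots> = norm (?f x) * (\<Sum>\<^sub>\<infinity>y\<in>{1..}. norm (?g y))"
        by (rule infsum_cmult_right) (use sn in auto)
      finally have e: "(\<Sum>\<^sub>\<infinity>y\<in>{1..}. norm (?f x * ?g y)) = norm (?f x) * (\<Sum>\<^sub>\<infinity>y\<in>{1..}. norm (?g y))" .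
      show "norm (?f x) * (\<Sum>\<^sub>\<infinity>y\<in>{1..}. norm (?g y)) =
         norm (\<Sum>\<^sub>\<infinity>y\<in>{1..}. norm (?f x * ?g y))"
        unfolding e by (simp add: abs_mult infsum_nonneg)
    qed
    finally show "(\<lambda>x. norm (\<Sum>\<^sub>\<infinity>y\<in>{1..}. norm (?f x * ?g y))) summable_on {1..}" .
  qed
  have "((\<lambda>(x, y). ?f x * ?g y) has_sum dser a s * dser b s) ({1..} \<times> {1..})"
    by (rule has_sum_SigmaI[OF inner outer summ])
  also have "?this \<longleftrightarrow> ((\<lambda>(n, d). a d * b (n div d) * of_nat n powr (-s)) has_sum dser a s * dser b s) (SIGMA n:{1..}. {d. d dvd n})"
  proof (rule has_sum_reindex_bij_witness[of _ "\<lambda>(n, d). (d, n div d)" "\<lambda>(x, y). (x * y, x)"])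
    fix z :: "nat \<times> nat" assume "z \<in> {1..} \<times> {1..}"
    then obtain x y where z: "z = (x, y)" "x \<in> {1..}" "y \<in> {1..}" by auto
    have "of_nat (x * y) powr (-s) = of_nat x powr (-s) * of_nat y powr (-s)"
      using powr_times_real[of "of_nat x" "of_nat y" "-s"] by simp
    then show "(case case z of (x, y) \<Rightarrow> (x * y, x) of (n, d) \<Rightarrow> a d * b (n div d) * of_nat n powr - s) = (case z of (x, y) \<Rightarrow> ?f x * ?g y)"
      using z by simp
    show "(case case z of (x, y) \<Rightarrow> (x * y, x) of (n, d) \<Rightarrow> (d, n div d)) = z" using z by simp
    show "(case z of (x, y) \<Rightarrow> (x * y, x)) \<in> (SIGMA n:{1..}. {d. d dvd n})" using z by simp
  next
    fix z :: "nat \<times> nat" assume "z \<in> (SIGMA n:{1..}. {d. d dvd n})"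
    then obtain d e where z: "z = (d * e, d)" "d \<ge> 1" "e \<ge> 1" by (fastforce simp: Suc_le_eq elim!: dvdE)
    show "(case case z of (n, d) \<Rightarrow> (d, n div d) of (x, y) \<Rightarrow> (x * y, x)) = z" using z by simp
    show "(case z of (n, d) \<Rightarrow> (d, n div d)) \<in> {1..} \<times> {1..}" using z by simp
  qed simp
  finally have "((\<lambda>n. ?c n * of_nat n powr (-s)) has_sum dser a s * dser b s) {1..}"
  proof (rule has_sum_SigmaD)
    fix n :: nat assume "n \<in> {1..}"
    then have "finite {d. d dvd n}" by simp
    then show "((\<lambda>d. case (n, d) of (n, d) \<Rightarrow> a d * b (n div d) * of_nat n powr - s) has_sum ?c n * of_nat n powr - s) {d. d dvd n}"
      by (auto simp: sum_distrib_right intro!: has_sum_finiteI)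
  qed
  then have "((\<lambda>n. ?c n * of_nat n powr (-s)) has_sum dser a s * dser b s) UNIV"
    by (rule has_sum_cong_neutral[THEN iffD1, rotated 3]) (auto simp: not_less_eq_eq)
  from has_sum_imp_sums[OF this] show ?thesis by (simp add: dser_def sums_iff)
qed

section \<open>Completely multiplicative coefficients and the logarithm of their series\<close>

definition cmul :: "(nat \<Rightarrow> complex) \<Rightarrow> bool" where
  "cmul f \<longleftrightarrow> f 1 = 1 \<and> (\<forall>m n. f (m * n) = f m * f n) \<and> (\<forall>n. norm (f n) \<le> 1)"

lemma cmul_one: "cmul (\<lambda>_. 1)"
  by (simp add: cmul_def)

lemma cmul_times: "cmul f \<Longrightarrow> cmul g \<Longrightarrow> cmul (\<lambda>n. f n * g n)"
  by (auto simp: cmul_def norm_mult intro!: mult_le_one)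

lemma cmul_slow: "cmul f \<Longrightarrow> slow f"
  by (rule slow_bounded[of _ 1]) (simp add: cmul_def)

lemma slow_mangoldt: "slow f \<Longrightarrow> slow (\<lambda>n. mangoldt n * f n)"
  by (erule slow_mono[OF slow_ln, where C = 1])
     (auto simp: norm_mult mangoldt_le intro!: mult_right_mono)

text \<open>\<open>1 / k\<close> at a prime power \<open>p ^ k\<close>: the coefficients of \<open>log \<zeta>\<close>.\<close>

definition kap :: "nat \<Rightarrow> real" where
  "kap n = mangoldt n / ln (real n)"

lemma kap_nonneg: "kap n \<ge> 0"
  by (cases "n = 0") (auto simp: kap_def mangoldt_nonneg)

lemma kap_le_1: "kap n \<le> 1"
proof (cases "n \<le> 1")
  case False
  then show ?thesis using mangoldt_le[of n] by (simp add: kap_def divide_le_eq)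
qed (auto simp: kap_def le_Suc_eq)

lemma ln_kap: "ln (real n) * kap n = mangoldt n"
  by (cases "n \<le> 1") (auto simp: kap_def le_Suc_eq)

lemma slow_kap:
  assumes "slow f" shows "slow (\<lambda>n. of_real (kap n) * f n)"
  by (rule slow_mono[OF assms, where C = 1])
     (use kap_nonneg kap_le_1 in \<open>auto simp: norm_mult intro!: mult_left_le_one_le\<close>)

lemma dser_kap_deriv:
  assumes "slow f" "Re s > 1"
  shows "(dser (\<lambda>n. of_real (kap n) * f n) has_field_derivative - dser (\<lambda>n. mangoldt n * f n) s) (at s)"
proof -
  have "(\<lambda>n. - complex_of_real (ln (real n)) * (of_real (kap n) * f n)) = (\<lambda>n. - (mangoldt n * f n))"
  proof
    fix n
    have "complex_of_real (ln (real n)) * of_real (kap n) = mangoldt n"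
      unfolding of_real_mult[symmetric] ln_kap by simp
    then show "- complex_of_real (ln (real n)) * (of_real (kap n) * f n) = - (mangoldt n * f n)"
      by (simp add: mult.assoc[symmetric])
  qed
  with dser_has_deriv[OF slow_kap[OF assms(1)] assms(2)] show ?thesis
    using dser_uminus[OF slow_mangoldt[OF assms(1)] assms(2)] by simp
qed

text \<open>The divisor-sum identity for \<open>mangoldt\<close>, twisted by \<open>f\<close>:
  complete multiplicativity lets \<open>f d * f (n div d) = f n\<close> leave the
  convolution.\<close>

lemma dser_mangoldt_mult:
  assumes "cmul f" "Re s > 1"
  shows "dser (\<lambda>n. mangoldt n * f n) s * dser f s = dser (\<lambda>n. of_real (ln (real n)) * f n) s"
proof -
  have "dser (\<lambda>n. mangoldt n * f n) s * dser f s = dser (\<lambda>n. \<Sum>d | d dvd n. mangoldt d * f d * f (n div d)) s"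
    by (rule dser_mult) (use assms cmul_slow slow_mangoldt in auto)
  also have "\<dots> = dser (\<lambda>n. of_real (ln (real n)) * f n) s"
    unfolding dser_def
  proof (intro suminf_cong)
    fix n :: nat
    show "(\<Sum>d | d dvd n. mangoldt d * f d * f (n div d)) * of_nat n powr - s = of_real (ln (real n)) * f n * of_nat n powr - s"
    proof (cases "n = 0")
      case False
      have "(\<Sum>d | d dvd n. mangoldt d * f d * f (n div d)) = (\<Sum>d | d dvd n. mangoldt d * f n)"
      proof (rule sum.cong)
        fix d assume "d \<in> {d. d dvd n}"
        then have "f d * f (n div d) = f (d * (n div d))" using assms(1) by (simp only: cmul_def)
        with \<open>d \<in> {d. d dvd n}\<close> show "mangoldt d * f d * f (n div d) = mangoldt d * f n" by (simp add: mult.assoc)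
      qed simp
      also have "\<dots> = of_real (ln (real n)) * f n"
        using mangoldt_sum[of n, where 'a = complex] False by (simp add: sum_distrib_right[symmetric])
      finally show ?thesis by simp
    qed simp
  qed
  finally show ?thesis .
qed

lemma dser_deriv_mangoldt:
  assumes "cmul f" "Re s > 1"
  shows "(dser f has_field_derivative - (dser (\<lambda>n. mangoldt n * f n) s * dser f s)) (at s)"
  using dser_has_deriv[OF cmul_slow[OF assms(1)] assms(2)] dser_mangoldt_mult[OF assms]
    dser_uminus[OF slow_ln[OF cmul_slow[OF assms(1)]] assms(2)] by simp

text \<open>Both sides have the same logarithmic derivative, so their quotient is constant on the
  half plane; its limit along the integers is 1. Nonvanishing for \<open>Re s > 1\<close> comes for
  free.\<close>

lemma dser_eq_exp:
  assumes "cmul f" "Re s > 1"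
  shows "dser f s = exp (dser (\<lambda>n. of_real (kap n) * f n) s)"
proof -
  let ?P = "dser (\<lambda>n. of_real (kap n) * f n)"
  define h where "h = (\<lambda>s. dser f s * exp (- ?P s))"
  have sl: "slow f" using assms cmul_slow by auto
  have "\<exists>c. \<forall>x\<in>{s. Re s > 1}. h x = c"
  proof (rule has_field_derivative_zero_constant)
    show "convex {s. Re s > 1}" by (rule convex_halfspace_Re_gt)
    fix x assume "x \<in> {s. Re s > 1}"
    then have x: "Re x > 1" by simp
    have "(h has_field_derivative dser f x * (exp (- ?P x) * - (- dser (\<lambda>n. mangoldt n * f n) x)) +
        - (dser (\<lambda>n. mangoldt n * f n) x * dser f x) * exp (- ?P x)) (at x)"
      unfolding h_def
      by (rule DERIV_mult'[OF dser_deriv_mangoldt[OF assms(1) x] DERIV_chain2[OF DERIV_exp DERIV_minus[OF dser_kap_deriv[OF sl x]]]])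
    then show "(h has_field_derivative 0) (at x within {s. Re s > 1})"
      by (rule has_field_derivative_at_within[THEN DERIV_cong]) (simp add: algebra_simps)
  qed
  then obtain c where c: "\<And>x. Re x > 1 \<Longrightarrow> h x = c" by auto
  have "(\<lambda>k. h (of_nat k)) \<longlonglongrightarrow> f 1 * exp (- (of_real (kap 1) * f 1))"
    unfolding h_def by (intro tendsto_intros dser_at_top[OF sl] dser_at_top[OF slow_kap[OF sl]])
  also have "f 1 * exp (- (of_real (kap 1) * f 1)) = 1" using assms(1) by (simp add: cmul_def kap_def)
  finally have "(\<lambda>k. h (of_nat k)) \<longlonglongrightarrow> 1" .
  moreover have "(\<lambda>k. h (of_nat k)) \<longlonglongrightarrow> c"
    by (rule tendsto_eventually) (auto intro!: eventually_mono[OF eventually_ge_at_top[of 2]] c)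
  ultimately have "c = 1" using LIMSEQ_unique by blast
  with c[OF assms(2)] show ?thesis by (simp add: h_def exp_minus field_simps)
qed

lemma dser_nonzero: "cmul f \<Longrightarrow> Re s > 1 \<Longrightarrow> dser f s \<noteq> 0"
  by (simp add: dser_eq_exp)

lemma Re_dser:
  assumes "slow a" "Re s > 1"
  shows "(\<lambda>n. Re (a n * of_nat n powr (-s))) sums Re (dser a s)"
  by (rule sums_Re[OF slow_sums[OF assms]])

text \<open>By \<open>dser_eq_exp\<close> the product is the exponential of a series whose terms are
  \<open>kap n * n powr (-\<sigma>)\<close> times \<open>3 + 4 Re w + Re (w^2)\<close> with
  \<open>w = f n * n powr (-i t)\<close>, and each term is nonnegative.\<close>

lemma three_four_one:
  assumes "cmul f" "\<sigma> > 1"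
  shows "1 \<le> norm (dser (\<lambda>_. 1) (of_real \<sigma>)) ^ 3 * norm (dser f (Complex \<sigma> t)) ^ 4 *
             norm (dser (\<lambda>n. f n ^ 2) (Complex \<sigma> (2 * t)))"
proof -
  have c2: "cmul (\<lambda>n. f n ^ 2)" using cmul_times[OF assms(1) assms(1)] by (simp add: power2_eq_square)
  define P0 where "P0 = dser (\<lambda>n. of_real (kap n) * 1) (of_real \<sigma>)"
  define P1 where "P1 = dser (\<lambda>n. of_real (kap n) * f n) (Complex \<sigma> t)"
  define P2 where "P2 = dser (\<lambda>n. of_real (kap n) * f n ^ 2) (Complex \<sigma> (2 * t))"
  have s: "(\<lambda>n. 3 * Re (of_real (kap n) * 1 * of_nat n powr (-of_real \<sigma>)) +
      4 * Re (of_real (kap n) * f n * of_nat n powr (-Complex \<sigma> t)) +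
      Re (of_real (kap n) * f n ^ 2 * of_nat n powr (-Complex \<sigma> (2 * t)))) sums (3 * Re P0 + 4 * Re P1 + Re P2)"
    unfolding P0_def P1_def P2_def using assms
    by (intro sums_add sums_mult Re_dser slow_kap cmul_slow c2 cmul_one) auto
  have nn: "0 \<le> 3 * Re (of_real (kap n) * 1 * of_nat n powr (-of_real \<sigma>)) +
      4 * Re (of_real (kap n) * f n * of_nat n powr (-Complex \<sigma> t)) +
      Re (of_real (kap n) * f n ^ 2 * of_nat n powr (-Complex \<sigma> (2 * t)))" for n
  proof (cases "n = 0")
    case False
    define w where "w = f n * of_nat n powr (- (\<i> * of_real t))"
    define r where "r = real n powr (-\<sigma>)"
    have r: "of_nat n powr (-of_real \<sigma>) = complex_of_real r"
      unfolding r_def by (simp add: powr_of_real[symmetric])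
    have e1: "Complex \<sigma> t = of_real \<sigma> + \<i> * of_real t" "Complex \<sigma> (2*t) = of_real \<sigma> + (\<i> * of_real t + \<i> * of_real t)"
      by (auto simp: complex_eq_iff)
    have f1: "f n * of_nat n powr (-Complex \<sigma> t) = of_real r * w"
      unfolding e1 minus_add_distrib powr_add r by (simp add: w_def mult_ac)
    have f2: "f n ^ 2 * of_nat n powr (-Complex \<sigma> (2*t)) = of_real r * w ^ 2"
      unfolding e1 minus_add_distrib powr_add r by (simp add: w_def power2_eq_square mult_ac)
    have "norm w \<le> 1" using assms(1) False by (auto simp: w_def norm_mult cmul_def)
    then have "(norm w)\<^sup>2 \<le> 1" by (simp add: power_le_one)
    then have xy: "(Re w)\<^sup>2 + (Im w)\<^sup>2 \<le> 1" by (simp add: cmod_power2)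
    \<comment> \<open>Since \<open>f\<close> may vanish, \<open>w\<close> need not lie on the unit
      circle. The trigonometric identity becomes an inequality, valid on the whole closed unit
      disc.\<close>
    have "0 \<le> 2 * (1 + Re w)\<^sup>2" by simp
    also have "\<dots> \<le> 3 + 4 * Re w + Re (w^2)" using xy by (simp add: power2_eq_square algebra_simps)
    finally have "0 \<le> kap n * (r * (3 + 4 * Re w + Re (w^2)))"
      using kap_nonneg[of n] by (intro mult_nonneg_nonneg) (auto simp: r_def)
    also have "\<dots> = 3 * Re (of_real (kap n) * complex_of_real r) + 4 * Re (of_real (kap n) * (of_real r * w)) +
      Re (of_real (kap n) * (of_real r * w^2))" by (simp add: algebra_simps)
    finally show ?thesis unfolding mult.assoc f1 f2 r by simp
  qed simp
  have "0 \<le> 3 * Re P0 + 4 * Re P1 + Re P2"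
    using sums_le[OF nn sums_zero s] .
  then have "1 \<le> exp (3 * Re P0 + 4 * Re P1 + Re P2)" by simp
  also have "\<dots> = exp (Re P0) ^ 3 * exp (Re P1) ^ 4 * exp (Re P2)"
    by (simp add: exp_add exp_of_nat_mult[symmetric])
  also have "exp (Re P0) = norm (dser (\<lambda>_. 1) (of_real \<sigma>))"
    using dser_eq_exp[OF cmul_one, of "of_real \<sigma>"] assms by (simp add: P0_def)
  also have "exp (Re P1) = norm (dser f (Complex \<sigma> t))"
    using dser_eq_exp[OF assms(1), of "Complex \<sigma> t"] assms by (simp add: P1_def)
  also have "exp (Re P2) = norm (dser (\<lambda>n. f n ^ 2) (Complex \<sigma> (2 * t)))"
    using dser_eq_exp[OF c2, of "Complex \<sigma> (2*t)"] assms by (simp add: P2_def)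
  finally show ?thesis .
qed

text \<open>The bound is a difference of real powers, not a multiple of \<open>y - x\<close>, so
  that it telescopes when summed over consecutive integers.\<close>

lemma norm_powr_diff_le:
  fixes s :: complex
  assumes "0 < x" "x \<le> y" "Re s > 0"
  shows "norm (of_real x powr (-s) - of_real y powr (-s)) \<le> norm s / Re s * (x powr (- Re s) - y powr (- Re s))"
proof (cases "x = y")
  case False
  with assms have xy: "x < y" by simp
  have d1: "((\<lambda>u. complex_of_real u powr (-s)) has_vector_derivative - s * of_real u powr (- s - 1)) (at u)" if "u > 0" for u
  proof -
    have "((\<lambda>z. z powr (-s)) has_field_derivative - s * of_real u powr (- s - 1)) (at (complex_of_real u))"
      by (rule has_field_derivative_powr) (use that in \<open>auto simp: complex_nonpos_Reals_iff\<close>)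
    then show ?thesis by (rule has_vector_derivative_real_field)
  qed
  have d2: "((\<lambda>u. - (norm s / Re s) * u powr (- Re s)) has_vector_derivative norm s * u powr (- Re s - 1)) (at u)" if "u > 0" for u
  proof -
    have "((\<lambda>u. u powr (- Re s)) has_real_derivative - Re s * u powr (- Re s - 1)) (at u)"
      by (rule has_real_derivative_powr[OF that])
    from DERIV_cmult[OF this, of "- (norm s / Re s)"] show ?thesis
      using assms by (simp add: has_real_derivative_iff_has_vector_derivative)
  qed
  have "norm (of_real y powr (-s) - of_real x powr (-s)) \<le> - (norm s / Re s) * y powr (- Re s) - (- (norm s / Re s) * x powr (- Re s))"
  proof (rule differentiable_bound_general[OF xy])
    show "continuous_on {x..y} (\<lambda>u. complex_of_real u powr (-s))"
      using assms(1) by (intro continuous_at_imp_continuous_on ballI has_vector_derivative_continuous[OF d1]) auto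
    show "continuous_on {x..y} (\<lambda>u. - (norm s / Re s) * u powr (- Re s))"
      using assms(1) by (intro continuous_at_imp_continuous_on ballI has_vector_derivative_continuous[OF d2]) auto
    show "norm (- s * complex_of_real u powr (- s - 1)) \<le> norm s * u powr (- Re s - 1)" if "x < u" "u < y" for u
      using that assms by (simp add: norm_mult norm_powr_real_powr)
  qed (use assms d1 d2 in auto)
  then show ?thesis by (simp add: norm_minus_commute algebra_simps)
qed simp

section \<open>Analytic continuation to the right half plane\<close>

text \<open>Bounded partial sums, uniformly over all blocks of consecutive integers; nonprincipal
  characters satisfy this with \<open>K\<close> equal to the modulus.\<close>

definition bps :: "real \<Rightarrow> (nat \<Rightarrow> complex) \<Rightarrow> bool" where
  "bps K f \<longleftrightarrow> (\<forall>M N. norm (\<Sum>n\<in>{M<..N}. f n) \<le> K)"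

lemma bps_nonneg: "bps K f \<Longrightarrow> K \<ge> 0"
  unfolding bps_def using norm_ge_zero order_trans by blast

text \<open>Summation by parts against the block sums that start after \<open>N\<close>; the
  differences of consecutive powers telescope by \<open>norm_powr_diff_le\<close>.\<close>

lemma bps_partial_tail:
  assumes "bps K f" "Re s > 0"
  shows "norm (\<Sum>n\<in>{N<..N+m}. f n * of_nat n powr (-s)) \<le> K * norm s / Re s * real (N + 1) powr (- Re s)"
proof -
  define T where "T = (\<lambda>n. \<Sum>k\<in>{N<..n}. f k)"
  define g where "g = (\<lambda>n. complex_of_nat n powr (-s))"
  have T: "norm (T n) \<le> K" for n using assms(1) by (simp add: bps_def T_def)
  have K: "K \<ge> 0" using bps_nonneg[OF assms(1)] .
  have eq: "(\<Sum>n\<in>{N<..N+m}. f n * g n) = T (N+m) * g (N+m+1) + (\<Sum>n\<in>{N<..N+m}. T n * (g n - g (n+1)))"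
  proof (induction m)
    case (Suc m)
    have s: "{N<..N + Suc m} = insert (N + Suc m) {N<..N+m}" by auto
    have "T (N + Suc m) = T (N+m) + f (N + Suc m)" unfolding T_def s by (subst sum.insert) auto
    then show ?case unfolding s by (subst sum.insert, simp, simp)+ (simp add: Suc[simplified] algebra_simps)
  qed (simp add: T_def)
  have tel: "(\<Sum>n\<in>{N<..N+m}. real n powr (- Re s) - real (n+1) powr (- Re s)) = real (N+1) powr (- Re s) - real (N+m+1) powr (- Re s)"
  proof (induction m)
    case (Suc m)
    have s: "{N<..N + Suc m} = insert (N + Suc m) {N<..N+m}" by auto
    show ?case unfolding s by (subst sum.insert, simp, simp) (use Suc in simp)
  qed simp
  have r1: "1 \<le> norm s / Re s" using assms(2) complex_Re_le_cmod[of s] by simp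
  have "norm (\<Sum>n\<in>{N<..N+m}. f n * g n) \<le> norm (T (N+m) * g (N+m+1)) + (\<Sum>n\<in>{N<..N+m}. norm (T n * (g n - g (n+1))))"
    unfolding eq by (intro order_trans[OF norm_triangle_ineq] add_left_mono norm_sum)
  also have "norm (T (N+m) * g (N+m+1)) \<le> K * (norm s / Re s * real (N+m+1) powr (- Re s))"
  proof -
    have "norm (g (N+m+1)) = 1 * real (N+m+1) powr (- Re s)" unfolding g_def norm_nat_powr by simp
    also have "\<dots> \<le> norm s / Re s * real (N+m+1) powr (- Re s)" by (intro mult_right_mono r1) simp
    finally show ?thesis unfolding norm_mult using T K by (intro mult_mono) auto
  qed
  also have "(\<Sum>n\<in>{N<..N+m}. norm (T n * (g n - g (n+1)))) \<le> (\<Sum>n\<in>{N<..N+m}. K * (norm s / Re s * (real n powr (- Re s) - real (n+1) powr (- Re s))))"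
  proof (rule sum_mono)
    fix n assume "n \<in> {N<..N+m}"
    then have "norm (g n - g (n+1)) \<le> norm s / Re s * (real n powr (- Re s) - real (n+1) powr (- Re s))"
      using norm_powr_diff_le[of "real n" "real (n+1)" s] assms(2) by (simp add: g_def)
    then show "norm (T n * (g n - g (n+1))) \<le> K * (norm s / Re s * (real n powr (- Re s) - real (n+1) powr (- Re s)))"
      unfolding norm_mult using T K by (intro mult_mono) auto
  qed
  also have "\<dots> = K * (norm s / Re s * (real (N+1) powr (- Re s) - real (N+m+1) powr (- Re s)))"
    by (simp only: sum_distrib_left[symmetric] tel)
  finally show ?thesis unfolding g_def by (simp add: algebra_simps)
qed

lemma bps_summable:
  assumes "bps K f" "Re s > 0"
  shows "summable (\<lambda>n. f n * of_nat n powr (-s))"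
proof -
  have lim: "(\<lambda>N. K * norm s / Re s * real (N + 1) powr (- Re s)) \<longlonglongrightarrow> 0"
    using assms(2) by (intro tendsto_mult_right_zero tendsto_neg_powr filterlim_compose[OF filterlim_real_sequentially filterlim_add_const_nat_at_top]) auto
  show ?thesis unfolding summable_Cauchy
  proof (intro allI impI)
    fix e :: real assume "e > 0"
    from order_tendstoD(2)[OF lim this] obtain N0 where N0: "\<And>N. N \<ge> N0 \<Longrightarrow> K * norm s / Re s * real (N + 1) powr (- Re s) < e"
      by (auto simp: eventually_at_top_linorder)
    show "\<exists>N. \<forall>m\<ge>N. \<forall>n. norm (sum (\<lambda>n. f n * of_nat n powr (-s)) {m..<n}) < e"
    proof (intro exI[of _ "N0 + 1"] allI impI)
      fix m n assume m: "m \<ge> N0 + 1"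
      show "norm (sum (\<lambda>n. f n * of_nat n powr (-s)) {m..<n}) < e"
      proof (cases "m < n")
        case True
        then have "{m..<n} = {m-1<..(m-1) + (n-m)}" using m by auto
        moreover have "N0 \<le> m - 1" using m by simp
        ultimately show ?thesis using bps_partial_tail[OF assms, of "m-1" "n-m"] N0[of "m-1"] by simp
      qed (use \<open>e > 0\<close> in simp)
    qed
  qed
qed

lemma bps_tail:
  assumes "bps K f" "Re s > 0"
  shows "norm (dser f s - (\<Sum>n\<in>{1..N}. f n * of_nat n powr (-s))) \<le> K * norm s / Re s * real (N + 1) powr (- Re s)"
proof -
  let ?h = "\<lambda>n. f n * of_nat n powr (-s)"
  have "(\<lambda>n. sum ?h {..<n}) \<longlonglongrightarrow> dser f s"
    using summable_LIMSEQ[OF bps_summable[OF assms]] by (simp add: dser_def)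
  then have "(\<lambda>m. sum ?h {..<m + (N + 1)}) \<longlonglongrightarrow> dser f s" by (rule LIMSEQ_ignore_initial_segment)
  then have lim: "(\<lambda>m. norm (sum ?h {..<m + (N + 1)} - sum ?h {1..N})) \<longlonglongrightarrow> norm (dser f s - sum ?h {1..N})"
    by (intro tendsto_intros)
  show ?thesis
  proof (rule LIMSEQ_le_const2[OF lim], intro exI[of _ 0] allI impI)
    fix m :: nat
    have "sum ?h {..<m + (N + 1)} = ?h 0 + sum ?h {1..N+m}"
      using sum.atLeast_Suc_atMost[of 0 "N+m" ?h] by (simp add: lessThan_Suc_atMost atLeast0AtMost[symmetric] add.commute)
    also have "sum ?h {1..N+m} = sum ?h {1..N} + sum ?h {N<..N+m}"
      by (subst sum.union_disjoint[symmetric]) (auto intro!: sum.cong)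
    finally have "sum ?h {..<m + (N + 1)} - sum ?h {1..N} = sum ?h {N<..N+m}" by simp
    then show "norm (sum ?h {..<m + (N + 1)} - sum ?h {1..N}) \<le> K * norm s / Re s * real (N + 1) powr (- Re s)"
      using bps_partial_tail[OF assms, of N m] by simp
  qed
qed

lemma dser_bps_bound:
  assumes "bps K f" "Re s > 0"
  shows "norm (dser f s) \<le> K * norm s / Re s"
  using bps_tail[OF assms, of 0] by simp

text \<open>The error term is shaped to serve both continuations: it is linear in
  \<open>norm s\<close> for series with bounded partial sums and quadratic for
  \<open>zg\<close>.\<close>

lemma holomorphic_from_tail:
  assumes "\<And>n. F n holomorphic_on {s. Re s > 0}"
    and "\<And>n s. Re s > 0 \<Longrightarrow> norm (G s - F n s) \<le> c * (norm s + 1)^2 / Re s * real (n + 1) powr (- Re s)"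
    and "c \<ge> 0"
  shows "G holomorphic_on {s. Re s > 0}"
proof (rule holomorphic_uniform_sequence[OF open_Re_gt assms(1)])
  fix x assume "x \<in> {s. Re s > 0}"
  then have x: "Re x > 0" by simp
  define d where "d = Re x / 2"
  have d: "d > 0" using x by (simp add: d_def)
  have re: "Re z \<ge> d" "norm z \<le> norm x + d" if "z \<in> cball x d" for z
  proof -
    have "norm (z - x) \<le> d" using that by (simp add: dist_norm norm_minus_commute)
    then show "Re z \<ge> d" "norm z \<le> norm x + d"
      using abs_Re_le_cmod[of "z - x"] norm_triangle_ineq2[of z x] by (auto simp: d_def)
  qed
  have lim: "(\<lambda>n. c * (norm x + d + 1)^2 / d * real (n + 1) powr (- d)) \<longlonglongrightarrow> 0"
    using d by (intro tendsto_mult_right_zero tendsto_neg_powr filterlim_compose[OF filterlim_real_sequentially filterlim_add_const_nat_at_top]) auto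
  have "uniform_limit (cball x d) F G sequentially"
  proof (rule uniform_limitI)
    fix e :: real assume "e > 0"
    from order_tendstoD(2)[OF lim this]
    show "\<forall>\<^sub>F n in sequentially. \<forall>z\<in>cball x d. dist (F n z) (G z) < e"
    proof eventually_elim
      case (elim n)
      show ?case
      proof
        fix z assume z: "z \<in> cball x d"
        have "norm (G z - F n z) \<le> c * (norm z + 1)^2 / Re z * real (n + 1) powr (- Re z)"
          by (rule assms(2)) (use re(1)[OF z] d in linarith)
        also have "\<dots> \<le> c * (norm x + d + 1)^2 / d * real (n + 1) powr (- d)"
          using re[OF z] d assms(3)
          by (intro mult_mono frac_le mult_left_mono power_mono powr_mono) auto
        finally show "dist (F n z) (G z) < e" using elim by (simp add: dist_norm norm_minus_commute)
      qed
    qed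
  qed
  moreover have "cball x d \<subseteq> {s. Re s > 0}" using re d by fastforce
  ultimately show "\<exists>d>0. cball x d \<subseteq> {s. Re s > 0} \<and> uniform_limit (cball x d) F G sequentially" using d by blast
qed

lemma nat_powr_holomorphic: "(\<lambda>s. a * of_nat n powr (-s)) holomorphic_on S"
  using DERIV_nat_powr[of a n] by (auto simp: holomorphic_on_def field_differentiable_def)

lemma bps_holomorphic:
  assumes "bps K f"
  shows "dser f holomorphic_on {s. Re s > 0}"
proof (rule holomorphic_from_tail[where c = K and F = "\<lambda>N s. \<Sum>n\<in>{1..N}. f n * of_nat n powr (-s)"])
  fix n s assume s: "Re s > 0"
  have "K * norm s \<le> K * (norm s + 1)^2"
    using bps_nonneg[OF assms] by (intro mult_left_mono) (auto simp: power2_eq_square algebra_simps)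
  then have "K * norm s / Re s * real (n + 1) powr (- Re s) \<le> K * (norm s + 1)^2 / Re s * real (n + 1) powr (- Re s)"
    using s by (intro mult_right_mono divide_right_mono) auto
  with bps_tail[OF assms s, of n]
  show "norm (dser f s - (\<Sum>n\<in>{1..n}. f n * of_nat n powr (-s))) \<le> K * (norm s + 1)^2 / Re s * real (n + 1) powr (- Re s)"
    by linarith
qed (use bps_nonneg[OF assms] in \<open>auto intro!: holomorphic_on_sum nat_powr_holomorphic\<close>)

section \<open>Growth slightly to the left of the line of real part one\<close>

lemma sum_powr_le:
  assumes "0 < d" "d < 1"
  shows "(\<Sum>n\<in>{1..N}. real n powr (d - 1)) \<le> real N powr d / d"
proof (induction N)
  case (Suc N)
  have "real (Suc N) powr (d - 1) \<le> (real (Suc N) powr d - real N powr d) / d"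
  proof (cases "N = 0")
    case False
    have "\<exists>z. real N < z \<and> z < real (Suc N) \<and> real (Suc N) powr d - real N powr d = (real (Suc N) - real N) * (d * z powr (d - 1))"
      by (rule MVT2) (use False in \<open>auto intro!: has_real_derivative_powr\<close>)
    then obtain z where z: "real N < z" "z < real (Suc N)" "real (Suc N) powr d - real N powr d = d * z powr (d - 1)" by auto
    have "real (Suc N) powr (d - 1) \<le> z powr (d - 1)"
      using z assms False by (intro powr_mono2') auto
    with z(3) assms show ?thesis by (simp add: field_simps)
  qed (use assms in \<open>simp add: field_simps\<close>)
  with Suc show ?case by (simp add: diff_divide_distrib)
qed simp

text \<open>Cut at \<open>N\<close> about \<open>X\<close>, which is modulus times height: the terms
  before the cut are bounded trivially, the tail by partial summation, and each part is of order
  \<open>X powr d\<close>. The factor 2 in the trivial bound is the one that the terms of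
  \<open>zg\<close> require.\<close>

lemma growth_split:
  assumes d: "0 < d" "d \<le> 1/2" and X: "X \<ge> 2" and \<sigma>: "1 - d \<le> \<sigma>"
    and a: "\<And>N. A \<le> (\<Sum>n\<in>{1..N}. 2 * real n powr (-\<sigma>)) + X / \<sigma> * real (N + 1) powr (-\<sigma>)"
  shows "A \<le> (4 / d + 8) * X powr d"
proof -
  define N where "N = nat \<lfloor>X\<rfloor>"
  have N: "real N \<le> X" "X \<le> real (N + 1)" "real (N + 1) \<le> 2 * X" using X by (auto simp: N_def) linarith+
  have "(\<Sum>n\<in>{1..N}. 2 * real n powr (-\<sigma>)) \<le> (\<Sum>n\<in>{1..N}. 2 * real n powr (d - 1))"
    using \<sigma> by (intro sum_mono mult_left_mono powr_mono) auto
  also have "\<dots> \<le> 2 * (real N powr d / d)"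
    unfolding sum_distrib_left[symmetric] by (intro mult_left_mono sum_powr_le) (use d in auto)
  also have "\<dots> \<le> 2 * (X powr d / d)" using N d by (intro mult_left_mono divide_right_mono powr_mono2) auto
  finally have 1: "(\<Sum>n\<in>{1..N}. 2 * real n powr (-\<sigma>)) \<le> 2 * (X powr d / d)" .
  have "X / \<sigma> * real (N + 1) powr (-\<sigma>) \<le> real (N + 1) / (1/2) * real (N + 1) powr (d - 1)"
    using N \<sigma> d X by (intro mult_mono frac_le powr_mono) auto
  also have "\<dots> = 2 * (real (N + 1) powr 1 * real (N + 1) powr (d - 1))" by simp
  also have "\<dots> = 2 * real (N + 1) powr d" by (simp only: powr_add[symmetric]) simp
  also have "\<dots> \<le> 2 * (2 * X) powr d" using N d by (intro mult_left_mono powr_mono2) auto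
  also have "(2 * X) powr d = 2 powr d * X powr d" using X by (simp add: powr_mult)
  also have "2 * (2 powr d * X powr d) \<le> 2 * (2 powr 1 * X powr d)" using d by (intro mult_left_mono mult_right_mono powr_mono) auto
  finally have 2: "X / \<sigma> * real (N + 1) powr (-\<sigma>) \<le> 4 * X powr d" by simp
  have "A \<le> 2 * (X powr d / d) + 4 * X powr d" using a[of N] 1 2 by linarith
  also have "\<dots> \<le> (4 / d + 8) * X powr d" using d by (simp add: field_simps)
  finally show ?thesis .
qed

lemma norm_le_Im: "norm s \<le> 2 * (\<bar>Im s\<bar> + 2)" if "0 \<le> Re s" "Re s \<le> 4"
  using cmod_le[of s] that abs_ge_zero[of "Im s"] by simp

lemma dser_growth:
  assumes "0 < d" "d \<le> 1/2"
  obtains C where "C > 0" "\<And>K f s. K \<ge> 1 \<Longrightarrow> bps K f \<Longrightarrow> (\<And>n. norm (f n) \<le> 1) \<Longrightarrow> 1 - d \<le> Re s \<Longrightarrow> Re s \<le> 4 \<Longrightarrow>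
     norm (dser f s) \<le> C * (K * (\<bar>Im s\<bar> + 2)) powr d"
proof (rule that[of "(4 / d + 8) * 2"])
  fix K f s assume K: "K \<ge> 1" "bps K f" "\<And>n. norm (f n :: complex) \<le> 1" and s: "1 - d \<le> Re s" "Re s \<le> 4"
  have s0: "Re s > 0" using s assms by linarith
  define X where "X = K * (2 * (\<bar>Im s\<bar> + 2))"
  have "1 * 2 \<le> K * (2 * (\<bar>Im s\<bar> + 2))" using K by (intro mult_mono) auto
  then have X: "X \<ge> 2" by (simp add: X_def)
  have "norm (dser f s) \<le> (4 / d + 8) * X powr d"
  proof (rule growth_split[OF assms X s(1)])
    fix N
    have "norm (dser f s) \<le> norm (\<Sum>n\<in>{1..N}. f n * of_nat n powr (-s)) + K * norm s / Re s * real (N + 1) powr (- Re s)"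
      using bps_tail[OF K(2) s0, of N] norm_triangle_ineq2[of "dser f s" "\<Sum>n\<in>{1..N}. f n * of_nat n powr (-s)"] by linarith
    also have "norm (\<Sum>n\<in>{1..N}. f n * of_nat n powr (-s)) \<le> (\<Sum>n\<in>{1..N}. 2 * real n powr (- Re s))"
    proof (rule order_trans[OF norm_sum], rule sum_mono)
      fix n show "norm (f n * of_nat n powr (-s)) \<le> 2 * real n powr (- Re s)"
        unfolding norm_mult norm_nat_powr uminus_complex.simps
        by (rule mult_right_mono) (use K(3)[of n] in auto)
    qed
    also have "K * norm s / Re s * real (N + 1) powr (- Re s) \<le> X / Re s * real (N + 1) powr (- Re s)"
      unfolding X_def using norm_le_Im[of s] s s0 K by (intro mult_right_mono divide_right_mono mult_left_mono) auto
    finally show "norm (dser f s) \<le> (\<Sum>n\<in>{1..N}. 2 * real n powr (- Re s)) + X / Re s * real (N + 1) powr (- Re s)" by simp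
  qed
  also have "X powr d = 2 powr d * (K * (\<bar>Im s\<bar> + 2)) powr d"
    using K by (simp add: X_def powr_mult[symmetric] mult_ac)
  also have "(4 / d + 8) * (2 powr d * (K * (\<bar>Im s\<bar> + 2)) powr d) \<le> (4 / d + 8) * (2 powr 1 * (K * (\<bar>Im s\<bar> + 2)) powr d)"
    using assms by (intro mult_left_mono mult_right_mono powr_mono) auto
  finally show "norm (dser f s) \<le> (4 / d + 8) * 2 * (K * (\<bar>Im s\<bar> + 2)) powr d" by (simp only: powr_one mult.assoc)
qed (use assms in \<open>auto simp: field_simps intro!: add_pos_pos\<close>)

text \<open>\<open>zg s = (s - 1) \<zeta>(s)\<close>, continued to \<open>Re s > 0\<close>.\<close>

definition zv :: "nat \<Rightarrow> complex \<Rightarrow> complex" where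
  "zv n s = (s - 1) * of_nat n powr (-s) + of_nat (n+1) powr (1 - s) - of_nat n powr (1 - s)"

definition zg :: "complex \<Rightarrow> complex" where
  "zg s = 1 + (\<Sum>n. zv (Suc n) s)"

text \<open>\<open>zv n s\<close> is the integral of
  \<open>(s - 1) * (n powr (-s) - u powr (-s))\<close> over \<open>u\<close> from \<open>n\<close>
  to \<open>n + 1\<close>. The first bound telescopes and controls tails; the second, trivial one
  serves the terms before the cut in \<open>zg_growth\<close>.\<close>

lemma norm_zv_le:
  assumes "Re s > 0" "n \<ge> 1"
  shows "norm (zv n s) \<le> norm (s - 1) * (norm s / Re s * (real n powr (- Re s) - real (n+1) powr (- Re s)))"
    and "norm (zv n s) \<le> norm (s - 1) * (2 * real n powr (- Re s))"
proof -
  define w where "w = (\<lambda>u. (s - 1) * of_real (u - real n) * of_nat n powr (-s) + complex_of_real u powr (1 - s))"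
  have d: "(w has_vector_derivative (s - 1) * (of_nat n powr (-s) - of_real u powr (-s))) (at u)" if "u > 0" for u
  proof -
    have 1: "((\<lambda>u. complex_of_real u powr (1 - s)) has_vector_derivative (1 - s) * of_real u powr (1 - s - 1)) (at u)"
      by (rule has_vector_derivative_real_field, rule has_field_derivative_powr)
         (use that in \<open>auto simp: complex_nonpos_Reals_iff\<close>)
    have 2: "((\<lambda>u. (s - 1) * of_real (u - real n) * of_nat n powr (-s)) has_vector_derivative (s - 1) * 1 * of_nat n powr (-s)) (at u)"
      by (auto intro!: derivative_eq_intros)
    from has_vector_derivative_add[OF 2 1] show ?thesis unfolding w_def by (simp add: algebra_simps)
  qed
  have cont: "continuous_on {real n..real (n+1)} w"
    using assms by (intro continuous_at_imp_continuous_on ballI has_vector_derivative_continuous[OF d]) auto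
  have eq: "zv n s = w (real (n+1)) - w (real n)" by (simp add: zv_def w_def)
  have key: "norm (zv n s) \<le> B" if B: "\<And>u. real n < u \<Longrightarrow> u < real (n+1) \<Longrightarrow> norm (s - 1) * norm (of_nat n powr (-s) - of_real u powr (-s)) \<le> B" for B
  proof -
    have "norm (w (real (n+1)) - w (real n)) \<le> B * real (n+1) - B * real n"
    proof (rule differentiable_bound_general[OF _ cont])
      show "(w has_vector_derivative (s - 1) * (of_nat n powr (-s) - of_real u powr (-s))) (at u)" if "real n < u" for u
        by (rule d) (use that in linarith)
      show "((\<lambda>u. B * u) has_vector_derivative B) (at u)" for u by (auto intro!: derivative_eq_intros)
    qed (use B in \<open>auto simp: norm_mult intro!: continuous_intros\<close>)
    then show ?thesis unfolding eq by (simp add: algebra_simps)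
  qed
  show "norm (zv n s) \<le> norm (s - 1) * (norm s / Re s * (real n powr (- Re s) - real (n+1) powr (- Re s)))"
  proof (rule key, rule mult_left_mono)
    fix u assume u: "real n < u" "u < real (n+1)"
    have "norm (of_nat n powr (-s) - of_real u powr (-s)) \<le> norm s / Re s * (real n powr (- Re s) - u powr (- Re s))"
      using norm_powr_diff_le[of "real n" u s] u assms by simp
    also have "\<dots> \<le> norm s / Re s * (real n powr (- Re s) - real (n+1) powr (- Re s))"
      using u assms by (intro mult_left_mono diff_left_mono powr_mono2') auto
    finally show "norm (of_nat n powr (-s) - of_real u powr (-s)) \<le> norm s / Re s * (real n powr (- Re s) - real (n+1) powr (- Re s))" .
  qed simp
  show "norm (zv n s) \<le> norm (s - 1) * (2 * real n powr (- Re s))"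
  proof (rule key, rule mult_left_mono)
    fix u assume u: "real n < u" "u < real (n+1)"
    have "norm (of_nat n powr (-s) - of_real u powr (-s)) \<le> norm (of_nat n powr (-s) :: complex) + norm (of_real u powr (-s) :: complex)"
      by (rule norm_triangle_ineq4)
    also have "norm (of_real u powr (-s) :: complex) = u powr (- Re s)" using u by (simp add: norm_powr_real_powr)
    also have "u powr (- Re s) \<le> real n powr (- Re s)" using u assms by (intro powr_mono2') auto
    finally show "norm (of_nat n powr (-s) - of_real u powr (-s)) \<le> 2 * real n powr (- Re s)" by simp
  qed simp
qed

lemma zg_tail:
  assumes "Re s > 0"
  shows "summable (\<lambda>n. zv (Suc n) s)"
    and "norm (zg s - (1 + (\<Sum>n<N. zv (Suc n) s))) \<le> norm (s - 1) * (norm s / Re s * real (N+1) powr (- Re s))"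
proof -
  let ?M = "\<lambda>n. norm (s - 1) * (norm s / Re s * (real (Suc n) powr (- Re s) - real (Suc (Suc n)) powr (- Re s)))"
  have lim: "(\<lambda>n. real (Suc (n + N)) powr (- Re s)) \<longlonglongrightarrow> 0" for N
    using assms by (intro tendsto_neg_powr filterlim_compose[OF filterlim_real_sequentially])
       (auto intro!: filterlim_at_top_mono[OF filterlim_ident] always_eventually)
  have tel: "(\<lambda>n. real (Suc (n + N)) powr (- Re s) - real (Suc (Suc (n + N))) powr (- Re s)) sums (real (Suc N) powr (- Re s))" for N
    using telescope_sums'[OF lim[of N]] by simp
  have sM: "(\<lambda>n. ?M (n + N)) sums (norm (s - 1) * (norm s / Re s * real (Suc N) powr (- Re s)))" for N
    by (intro sums_mult tel)
  have le: "norm (zv (Suc n) s) \<le> ?M n" for n using norm_zv_le(1)[of s "Suc n"] assms by simp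
  have s0: "summable ?M" using sM[of 0] by (simp add: sums_iff)
  show sv: "summable (\<lambda>n. zv (Suc n) s)" by (rule summable_comparison_test'[OF s0 le])
  have "zg s - (1 + (\<Sum>n<N. zv (Suc n) s)) = (\<Sum>n. zv (Suc (n + N)) s)"
    unfolding zg_def using suminf_minus_initial_segment[OF sv, of N] by simp
  also have "norm \<dots> \<le> (\<Sum>n. ?M (n + N))"
    by (rule norm_suminf_le[OF le]) (use sM[of N] in \<open>simp add: sums_iff\<close>)
  also have "\<dots> = norm (s - 1) * (norm s / Re s * real (Suc N) powr (- Re s))" using sM[of N] by (simp add: sums_iff)
  finally show "norm (zg s - (1 + (\<Sum>n<N. zv (Suc n) s))) \<le> norm (s - 1) * (norm s / Re s * real (N+1) powr (- Re s))" by simp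
qed

lemma zg_holomorphic: "zg holomorphic_on {s. Re s > 0}"
proof (rule holomorphic_from_tail[where c = 1 and F = "\<lambda>N s. 1 + (\<Sum>n<N. zv (Suc n) s)"])
  fix n s assume s: "Re s > 0"
  have "norm (s - 1) * norm s \<le> (norm s + 1) * (norm s + 1)"
    using norm_triangle_ineq4[of s 1] by (intro mult_mono) auto
  then have "norm (s - 1) * norm s / Re s * real (n+1) powr (- Re s) \<le> 1 * (norm s + 1)^2 / Re s * real (n+1) powr (- Re s)"
    using s by (intro mult_right_mono divide_right_mono) (auto simp: power2_eq_square)
  then show "norm (zg s - (1 + (\<Sum>n<n. zv (Suc n) s))) \<le> 1 * (norm s + 1)^2 / Re s * real (n+1) powr (- Re s)"
    using zg_tail(2)[OF s, of n] by simp
next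
  have h: "(\<lambda>s. of_nat (Suc m) powr (1 - s) :: complex) holomorphic_on {s. Re s > 0}" for m
    by (intro holomorphic_intros) (auto simp del: of_nat_Suc)
  have h2: "zv (Suc n) holomorphic_on {s. Re s > 0}" for n
    unfolding zv_def[abs_def] using nat_powr_holomorphic[of 1 "Suc n" "{s. Re s > 0}"] h[of n] h[of "Suc n"]
    by (intro holomorphic_on_diff holomorphic_on_add holomorphic_on_mult holomorphic_on_ident holomorphic_on_const) (simp_all del: of_nat_Suc)
  show "(\<lambda>s. 1 + (\<Sum>n<N. zv (Suc n) s)) holomorphic_on {s. Re s > 0}" for N
    by (intro holomorphic_intros h2)
qed simp

lemma zg_1 [simp]: "zg 1 = 1"
proof -
  have "complex_of_nat (Suc n) \<noteq> 0" for n using of_nat_neq_0 by blast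
  then have "zv (Suc n) 1 = 0" for n by (simp add: zv_def del: of_nat_Suc)
  then show ?thesis by (simp add: zg_def)
qed

text \<open>The differences of \<open>n powr (1 - s)\<close> telescope to -1, which cancels the
  leading 1 in \<open>zg\<close>.\<close>

lemma zg_eq:
  assumes "Re s > 1"
  shows "zg s = (s - 1) * dser (\<lambda>_. 1) s"
proof -
  have s1: "s \<noteq> 1" using assms by auto
  have tel: "(\<lambda>n. complex_of_nat (Suc (Suc n)) powr (1 - s) - of_nat (Suc n) powr (1 - s)) sums (0 - of_nat (Suc 0) powr (1 - s))"
  proof (rule telescope_sums)
    have "(\<lambda>n. real (Suc n) powr (1 - Re s)) \<longlonglongrightarrow> 0"
      using assms by (intro tendsto_neg_powr filterlim_compose[OF filterlim_real_sequentially]) (auto intro!: filterlim_Suc)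
    then show "(\<lambda>n. complex_of_nat (Suc n) powr (1 - s)) \<longlonglongrightarrow> 0"
      by (subst tendsto_norm_zero_iff[symmetric]) (simp only: norm_nat_powr minus_complex.simps one_complex.simps)
  qed
  have "(\<lambda>n. 1 * of_nat n powr (-s)) sums dser (\<lambda>_. 1) s" using slow_sums[OF slow_1 assms] .
  then have "(\<lambda>n. complex_of_nat (Suc n) powr (-s)) sums (dser (\<lambda>_. 1) s)"
    using sums_Suc_iff[of "\<lambda>n. complex_of_nat n powr (-s)"] by simp
  from sums_add[OF sums_mult[OF this, of "s - 1"] tel]
  have "(\<lambda>n. zv (Suc n) s) sums ((s - 1) * dser (\<lambda>_. 1) s - 1)"
    by (simp add: zv_def algebra_simps)
  then show ?thesis by (simp add: zg_def sums_iff)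
qed

lemma zg_growth:
  assumes "0 < d" "d \<le> 1/2"
  obtains C where "C > 0" "\<And>s. 1 - d \<le> Re s \<Longrightarrow> Re s \<le> 4 \<Longrightarrow> norm (zg s) \<le> 1 + C * norm (s - 1) * (\<bar>Im s\<bar> + 2) powr d"
proof (rule that[of "(4 / d + 8) * 2"])
  fix s assume s: "1 - d \<le> Re s" "Re s \<le> 4"
  have s0: "Re s > 0" using s assms by linarith
  show "norm (zg s) \<le> 1 + (4 / d + 8) * 2 * norm (s - 1) * (\<bar>Im s\<bar> + 2) powr d"
  proof (cases "s = 1")
    case False
    define X where "X = 2 * (\<bar>Im s\<bar> + 2)"
    have X: "X \<ge> 2" by (simp add: X_def)
    have "(norm (zg s) - 1) / norm (s - 1) \<le> (4 / d + 8) * X powr d"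
    proof (rule growth_split[OF assms X s(1)])
      fix N
      have "norm (zg s) \<le> norm (1 + (\<Sum>n<N. zv (Suc n) s)) + norm (s - 1) * (norm s / Re s * real (N+1) powr (- Re s))"
        using zg_tail(2)[OF s0, of N] norm_triangle_ineq2[of "zg s" "1 + (\<Sum>n<N. zv (Suc n) s)"] by linarith
      also have "norm (1 + (\<Sum>n<N. zv (Suc n) s)) \<le> 1 + (\<Sum>n<N. norm (s - 1) * (2 * real (Suc n) powr (- Re s)))"
        by (rule order_trans[OF norm_triangle_ineq]) (intro add_mono order_trans[OF norm_sum] sum_mono norm_zv_le(2) s0, auto)
      also have "(\<Sum>n<N. norm (s - 1) * (2 * real (Suc n) powr (- Re s))) = norm (s - 1) * (\<Sum>n\<in>{1..N}. 2 * real n powr (- Re s))"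
        by (simp add: sum_distrib_left sum.atLeast1_atMost_eq)
      also have "norm (s - 1) * (norm s / Re s * real (N+1) powr (- Re s)) \<le> norm (s - 1) * (X / Re s * real (N+1) powr (- Re s))"
        unfolding X_def using norm_le_Im[of s] s s0 by (intro mult_right_mono divide_right_mono mult_left_mono) auto
      finally have "norm (zg s) - 1 \<le> norm (s - 1) * ((\<Sum>n\<in>{1..N}. 2 * real n powr (- Re s)) + X / Re s * real (N+1) powr (- Re s))"
        by (simp add: algebra_simps)
      then show "(norm (zg s) - 1) / norm (s - 1) \<le> (\<Sum>n\<in>{1..N}. 2 * real n powr (- Re s)) + X / Re s * real (N+1) powr (- Re s)"
        using False by (simp add: divide_le_eq mult.commute)
    qed
    also have "X powr d = 2 powr d * (\<bar>Im s\<bar> + 2) powr d" unfolding X_def by (rule powr_mult)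
    also have "(4 / d + 8) * (2 powr d * (\<bar>Im s\<bar> + 2) powr d) \<le> (4 / d + 8) * (2 powr 1 * (\<bar>Im s\<bar> + 2) powr d)"
      using assms by (intro mult_left_mono mult_right_mono powr_mono) auto
    finally show ?thesis using False by (simp add: field_simps)
  qed simp
qed (use assms in \<open>auto simp: field_simps intro!: add_pos_pos\<close>)

section \<open>Dirichlet characters\<close>

text \<open>Encoded as arithmetic functions and not on the unit group: the same object is then a
  coefficient sequence of a Dirichlet series, and characters of different moduli can be multiplied
  pointwise.\<close>

definition dchar :: "nat \<Rightarrow> (nat \<Rightarrow> complex) \<Rightarrow> bool" where
  "dchar q \<psi> \<longleftrightarrow> (\<forall>m n. \<psi> (m * n) = \<psi> m * \<psi> n) \<and> (\<forall>n. \<psi> (n + q) = \<psi> n) \<and> (\<forall>n. \<psi> n = 0 \<longleftrightarrow> \<not> coprime n q)"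

definition chi0 :: "nat \<Rightarrow> nat \<Rightarrow> complex" where
  "chi0 q n = (if coprime n q then 1 else 0)"

lemma periodic_mod:
  assumes "\<And>n. f (n + q) = f n"
  shows "f (n mod q) = f (n::nat)"
proof -
  have "f (n + k * q) = f n" for n k
  proof (induction k)
    case (Suc k)
    have "f (n + Suc k * q) = f ((n + k * q) + q)" by (simp add: algebra_simps)
    then show ?case using assms Suc by simp
  qed simp
  from this[of "n mod q" "n div q"] show ?thesis by (simp add: mod_div_mult_eq)
qed

lemma periodic_cong:
  assumes "\<And>n. f (n + q) = f n" "[m = n] (mod q)"
  shows "f m = f (n::nat)"
  using periodic_mod[of f q m] periodic_mod[of f q n] assms by (simp add: Cong.cong_def)

lemma dchar_cong: "dchar q \<psi> \<Longrightarrow> [m = n] (mod q) \<Longrightarrow> \<psi> m = \<psi> n"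
  by (rule periodic_cong) (auto simp: dchar_def)

lemma dchar_mult: "dchar q \<psi> \<Longrightarrow> \<psi> (m * n) = \<psi> m * \<psi> n"
  by (simp add: dchar_def)

lemma dchar_eq_0_iff: "dchar q \<psi> \<Longrightarrow> \<psi> n = 0 \<longleftrightarrow> \<not> coprime n q"
  by (simp add: dchar_def)

lemma dchar_1: assumes "dchar q \<psi>" shows "\<psi> (Suc 0) = 1"
  using dchar_mult[OF assms, of 1 1] dchar_eq_0_iff[OF assms, of 1] by auto

lemma dchar_power: "dchar q \<psi> \<Longrightarrow> \<psi> (n ^ k) = \<psi> n ^ k"
  by (induction k) (auto simp: dchar_1 dchar_mult)

lemma dchar_pow_totient:
  assumes "dchar q \<psi>" "coprime n q"
  shows "\<psi> n ^ totient q = 1"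
proof -
  have "[n ^ totient q = 1] (mod q)" by (rule euler_theorem[OF assms(2)])
  from dchar_cong[OF assms(1) this] show ?thesis using dchar_1[OF assms(1)] dchar_power[OF assms(1)] by simp
qed

lemma dchar_norm:
  assumes "dchar q \<psi>" "coprime n q" "q > 0"
  shows "norm (\<psi> n) = 1"
proof -
  have "norm (\<psi> n) ^ totient q = 1" using dchar_pow_totient[OF assms(1,2)] by (metis norm_one norm_power)
  then show ?thesis using assms(3) power_eq_1_iff[of "norm (\<psi> n)" "totient q"] by (simp add: power_eq_1_iff)
qed

lemma dchar_norm_le: "dchar q \<psi> \<Longrightarrow> q > 0 \<Longrightarrow> norm (\<psi> n) \<le> 1"
  using dchar_norm[of q \<psi> n] dchar_eq_0_iff[of q \<psi> n] by (cases "coprime n q") auto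

lemma dchar_cmul: "dchar q \<psi> \<Longrightarrow> q > 0 \<Longrightarrow> cmul \<psi>"
  unfolding cmul_def One_nat_def using dchar_1[of q \<psi>] dchar_mult[of q \<psi>] dchar_norm_le[of q \<psi>] by blast

lemma coprime_add_self: "coprime (n + q) q \<longleftrightarrow> coprime n (q::nat)"
  unfolding coprime_iff_gcd_eq_1 gcd_add1 ..

lemma dchar_chi0: "dchar q (chi0 q)"
  by (auto simp: dchar_def chi0_def coprime_add_self)

lemma dchar_times: "dchar q \<psi> \<Longrightarrow> dchar q \<xi> \<Longrightarrow> dchar q (\<lambda>n. \<psi> n * \<xi> n)"
  by (auto simp: dchar_def)

lemma dchar_lift:
  assumes "dchar q \<psi>" "dchar r \<xi>"
  shows "dchar (q * r) (\<lambda>n. \<psi> n * \<xi> n)"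
proof -
  have "\<psi> (n + q * r) = \<psi> n" "\<xi> (n + q * r) = \<xi> n" for n
    using dchar_cong[OF assms(1), of "n + q * r" n] dchar_cong[OF assms(2), of "n + q * r" n]
    by (auto simp: Cong.cong_def)
  then show ?thesis using assms by (auto simp: dchar_def)
qed

lemma dchar_cnj: "dchar q \<psi> \<Longrightarrow> dchar q (\<lambda>n. cnj (\<psi> n))"
  by (auto simp: dchar_def)

lemma dchar_cnj_inverse:
  assumes "dchar q \<psi>" "coprime n q" "q > 0"
  shows "\<psi> n * cnj (\<psi> n) = 1"
  using dchar_norm[OF assms] by (simp add: complex_norm_square[symmetric])

lemma sum_shift_period:
  fixes f :: "nat \<Rightarrow> complex"
  assumes "\<And>n. f (n + q) = f n"
  shows "(\<Sum>n\<in>{M..<M+q}. f n) = (\<Sum>n<q. f n)"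
proof (induction M)
  case (Suc M)
  show ?case
  proof (cases "q = 0")
    case False
    have "(\<Sum>n\<in>{M..<M+q}. f n) = f M + (\<Sum>n\<in>{Suc M..<M+q}. f n)" using False by (simp add: sum.atLeast_Suc_lessThan)
    moreover have "(\<Sum>n\<in>{Suc M..<Suc M+q}. f n) = (\<Sum>n\<in>{Suc M..<M+q}. f n) + f (M + q)"
      using False by simp
    ultimately show ?thesis using Suc assms[of M] by simp
  qed simp
qed (simp add: atLeast0LessThan)

lemma dchar_sum_eq_0:
  assumes "dchar q \<psi>" "q > 0" "\<psi> \<noteq> chi0 q"
  shows "(\<Sum>n<q. \<psi> n) = 0"
proof -
  obtain a where a: "\<psi> a \<noteq> chi0 q a" using assms(3) by auto
  then have ca: "coprime a q" and a1: "\<psi> a \<noteq> 1" using dchar_eq_0_iff[OF assms(1), of a] by (auto simp: chi0_def split: if_splits)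
  have "(\<Sum>n<q. \<psi> n) = (\<Sum>n<q. \<psi> ((a * n) mod q))"
  proof (rule sum.reindex_bij_betw[symmetric])
    have inj: "inj_on (\<lambda>n. (a * n) mod q) {..<q}"
    proof (rule inj_onI)
      fix x y assume "x \<in> {..<q}" "y \<in> {..<q}" "(a * x) mod q = (a * y) mod q"
      then show "x = y" using cong_mult_lcancel_nat[OF ca, of x y] by (simp add: Cong.cong_def)
    qed
    moreover have "(\<lambda>n. (a * n) mod q) ` {..<q} = {..<q}"
      by (rule endo_inj_surj) (use inj assms(2) in auto)
    ultimately show "bij_betw (\<lambda>n. (a * n) mod q) {..<q} {..<q}" by (simp add: bij_betw_def)
  qed
  also have "\<dots> = (\<Sum>n<q. \<psi> a * \<psi> n)"
    using assms(1) by (intro sum.cong) (auto simp: dchar_mult[symmetric] intro!: dchar_cong simp: Cong.cong_def)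
  also have "\<dots> = \<psi> a * (\<Sum>n<q. \<psi> n)" by (simp add: sum_distrib_left)
  finally show ?thesis using a1 by (metis mult_cancel_right1)
qed

section \<open>Existence, number and orthogonality of characters\<close>

lemma finite_dchars: assumes "q > 0" shows "finite {\<psi>. dchar q \<psi>}"
proof -
  let ?R = "insert 0 {z::complex. z ^ totient q = 1}"
  have fin: "finite (PiE {..<q} (\<lambda>_. ?R))"
    using assms by (intro finite_PiE) (auto intro!: finite_roots_unity simp: Suc_le_eq)
  show ?thesis
  proof (rule inj_on_finite[OF _ _ fin])
    show "inj_on (\<lambda>\<psi>. restrict \<psi> {..<q}) {\<psi>. dchar q \<psi>}"
    proof (rule inj_onI, rule ext)
      fix \<psi> \<xi> :: "nat \<Rightarrow> complex" and n
      assume h: "\<psi> \<in> {\<psi>. dchar q \<psi>}" "\<xi> \<in> {\<psi>. dchar q \<psi>}" "restrict \<psi> {..<q} = restrict \<xi> {..<q}"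
      have "\<psi> n = \<psi> (n mod q)" "\<xi> n = \<xi> (n mod q)" using h by (auto intro!: dchar_cong simp: Cong.cong_def)
      moreover have "\<psi> (n mod q) = \<xi> (n mod q)" using fun_cong[OF h(3), of "n mod q"] assms by simp
      ultimately show "\<psi> n = \<xi> n" by simp
    qed
    show "(\<lambda>\<psi>. restrict \<psi> {..<q}) ` {\<psi>. dchar q \<psi>} \<subseteq> PiE {..<q} (\<lambda>_. ?R)"
    proof (rule image_subsetI)
      fix \<psi> :: "nat \<Rightarrow> complex" assume "\<psi> \<in> {\<psi>. dchar q \<psi>}"
      then have d: "dchar q \<psi>" by simp
      have "\<psi> n \<in> ?R" for n
        using dchar_pow_totient[OF d, of n] dchar_eq_0_iff[OF d, of n] by (cases "coprime n q") auto
      then show "restrict \<psi> {..<q} \<in> PiE {..<q} (\<lambda>_. ?R)" by (simp add: PiE_iff)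
    qed
  qed
qed

lemma sum_roots_unity:
  assumes "m > 0" "j < m"
  shows "(\<Sum>l<m. cis (- (2 * pi * real l / real m)) ^ j) = (if j = 0 then of_nat m else 0)"
proof (cases "j = 0")
  case False
  define z where "z = cis (- (2 * pi * real j / real m))"
  have e: "cis (- (2 * pi * real l / real m)) ^ j = z ^ l" for l
    unfolding z_def Complex.DeMoivre by (rule arg_cong[of _ _ cis]) simp
  have "z ^ m = cis (2 * pi * of_int (- int j))" unfolding z_def Complex.DeMoivre by (rule arg_cong[of _ _ cis]) (use assms in simp)
  also have "\<dots> = 1" by (rule cis_multiple_2pi) auto
  finally have zm: "z ^ m = 1" .
  have "z \<noteq> 1"
  proof
    assume "z = 1"
    then have "cos (2 * pi * real j / real m) = 1" by (simp add: z_def complex_eq_iff)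
    then obtain n :: int where "2 * pi * real j / real m = of_int n * 2 * pi"
      using cos_one_2pi_int by blast
    then have "real j = of_int n * real m" using assms by (simp add: field_simps)
    then have "int j = n * int m" by (metis (mono_tags) of_int_eq_iff of_int_mult of_int_of_nat_eq)
    then have "m dvd j" by (metis dvd_triv_right int_dvd_int_iff)
    then show False using assms False dvd_imp_le[of m j] by simp
  qed
  then have "(\<Sum>l<m. z ^ l) = 0" using zm by (simp add: sum_gp_strict)
  then show ?thesis using False e by simp
qed simp

text \<open>A nontrivial value of a character at a given point is produced by a joint eigenfunction of the
  multiplication operators on the units; \<open>eproj\<close> projects onto an eigenspace of one of them.\<close>

definition eig :: "nat \<Rightarrow> nat set \<Rightarrow> (nat \<Rightarrow> complex) \<Rightarrow> bool" where
  "eig q S f \<longleftrightarrow> (\<forall>x y. [x = y] (mod q) \<longrightarrow> f x = f y) \<and> (\<forall>x. f x \<noteq> 0 \<longrightarrow> coprime x q) \<and>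
     (\<exists>x. f x \<noteq> 0) \<and> (\<forall>g\<in>S. \<exists>\<omega>. \<forall>x. f (g * x) = \<omega> * f x)"

lemma eig_nz: "eig q S f \<Longrightarrow> \<exists>x. f x \<noteq> 0"
  and eig_cong: "eig q S f \<Longrightarrow> [x = y] (mod q) \<Longrightarrow> f x = f y"
  and eig_coprime: "eig q S f \<Longrightarrow> f x \<noteq> 0 \<Longrightarrow> coprime x q"
  unfolding eig_def by auto

lemma eig_ev: "eig q S f \<Longrightarrow> g \<in> S \<Longrightarrow> \<exists>\<omega>. \<forall>x. f (g * x) = \<omega> * f x"
  unfolding eig_def by (elim conjE) (erule bspec)

definition eproj :: "nat \<Rightarrow> nat \<Rightarrow> nat \<Rightarrow> (nat \<Rightarrow> complex) \<Rightarrow> nat \<Rightarrow> complex" where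
  "eproj q g l f x = (\<Sum>j<totient q. cis (- (2 * pi * real l / real (totient q))) ^ j * f (g ^ j * x))"

text \<open>Summing over all frequencies leaves only the exponent \<open>j = 0\<close>. Hence a
  nonzero function has a nonzero projection at some frequency.\<close>

lemma eproj_sum:
  assumes "q > 0"
  shows "(\<Sum>l<totient q. eproj q g l f x) = of_nat (totient q) * f x"
proof -
  let ?m = "totient q"
  have m: "?m > 0" using assms by simp
  have "(\<Sum>l<?m. eproj q g l f x) = (\<Sum>j<?m. (\<Sum>l<?m. cis (- (2 * pi * real l / real ?m)) ^ j) * f (g ^ j * x))"
    unfolding eproj_def by (subst sum.swap) (simp add: sum_distrib_right)
  also have "\<dots> = (\<Sum>j<?m. if j = 0 then of_nat ?m * f x else 0)"
    using m by (intro sum.cong refl) (subst sum_roots_unity, auto)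
  also have "\<dots> = of_nat ?m * f x" using m by simp
  finally show ?thesis .
qed

lemma eproj_eig:
  assumes "eig q S f" "coprime g q" "q > 0"
  shows "eproj q g l f (g * x) = cis (2 * pi * real l / real (totient q)) * eproj q g l f x"
    and "[x = y] (mod q) \<Longrightarrow> eproj q g l f x = eproj q g l f y"
    and "eproj q g l f x \<noteq> 0 \<Longrightarrow> coprime x q"
    and "\<forall>x. f (h * x) = \<omega> * f x \<Longrightarrow> eproj q g l f (h * x) = \<omega> * eproj q g l f x"
proof -
  let ?m = "totient q"
  let ?w = "cis (2 * pi * real l / real ?m)" and ?v = "cis (- (2 * pi * real l / real ?m))"
  have m: "?m > 0" using assms by simp
  have fc: "f x = f y" if "[x = y] (mod q)" for x y using assms(1) that by (auto simp: eig_def)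
  define T where "T = (\<lambda>j. ?v ^ j * f (g ^ j * x))"
  have wv: "?w * ?v = 1" by (simp add: cis_mult)
  have "?v ^ ?m = cis (2 * pi * of_int (- int l))" unfolding Complex.DeMoivre by (rule arg_cong[of _ _ cis]) (use m in simp)
  also have "\<dots> = 1" by (rule cis_multiple_2pi) auto
  finally have vm: "?v ^ ?m = 1" .
  have gm: "[g ^ ?m * x = 1 * x] (mod q)" by (intro cong_mult euler_theorem assms cong_refl)
  have TT: "T ?m = T 0" using vm fc[OF gm] by (simp add: T_def)
  have "eproj q g l f (g * x) = (\<Sum>j<?m. ?w * T (Suc j))"
    unfolding eproj_def
  proof (rule sum.cong)
    fix j
    have "?w * T (Suc j) = (?w * ?v) * (?v ^ j * f (g ^ j * (g * x)))" by (simp add: T_def mult_ac)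
    then show "?v ^ j * f (g ^ j * (g * x)) = ?w * T (Suc j)" using wv by simp
  qed simp
  also have "\<dots> = ?w * (\<Sum>j<?m. T (Suc j))" by (simp add: sum_distrib_left)
  also have "(\<Sum>j<?m. T (Suc j)) = (\<Sum>j<Suc ?m. T j) - T 0" by (subst sum.lessThan_Suc_shift) simp
  also have "\<dots> = (\<Sum>j<?m. T j)" using TT by simp
  finally show "eproj q g l f (g * x) = ?w * eproj q g l f x" by (simp add: eproj_def T_def)
  show "eproj q g l f x = eproj q g l f y" if "[x = y] (mod q)"
    unfolding eproj_def using fc[OF cong_scalar_left[OF that]] by simp
  show "coprime x q" if "eproj q g l f x \<noteq> 0"
  proof -
    from that obtain j where "f (g ^ j * x) \<noteq> 0" unfolding eproj_def by (metis (no_types, lifting) mult_eq_0_iff sum.neutral)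
    then show ?thesis using assms(1) by (auto simp: eig_def)
  qed
  show "eproj q g l f (h * x) = \<omega> * eproj q g l f x" if "\<forall>x. f (h * x) = \<omega> * f x"
  proof -
    have "f (g ^ j * (h * x)) = \<omega> * f (g ^ j * x)" for j using that by (metis mult.left_commute)
    then show ?thesis by (simp add: eproj_def sum_distrib_left mult_ac)
  qed
qed

text \<open>Start from the indicator of the class of 1. Some projection with frequency
  \<open>l\<close> different from 0 is nonzero, for otherwise the indicator would be invariant under
  multiplication by \<open>n\<close>; this prescribes an eigenvalue other than 1 at
  \<open>n\<close>. After refining to a joint eigenfunction \<open>f\<close> of all units, the
  eigenvalues \<open>f (g * x) / f x\<close> form the character.\<close>

lemma ex_dchar_neq_1:
  assumes "q > 0" "coprime n q" "\<not> [n = 1] (mod q)"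
  obtains \<psi> where "dchar q \<psi>" "\<psi> n \<noteq> 1"
proof -
  let ?m = "totient q"
  have m: "?m > 0" using assms by simp
  define \<delta> where "\<delta> = (\<lambda>x. if [x = 1] (mod q) then 1 else (0::complex))"
  have \<delta>: "eig q {} \<delta>"
    unfolding eig_def
  proof (intro conjI allI impI)
    show "\<delta> x = \<delta> y" if "[x = y] (mod q)" for x y
      unfolding \<delta>_def using that by (auto simp: Cong.cong_def)
    show "coprime x q" if "\<delta> x \<noteq> 0" for x
      using that cong_imp_coprime[of 1 x q] by (auto simp: \<delta>_def cong_sym_eq split: if_splits)
    show "\<exists>x. \<delta> x \<noteq> 0" by (auto simp: \<delta>_def intro!: exI[of _ 1])
  qed simp
  have "\<exists>l x. 0 < l \<and> l < ?m \<and> eproj q n l \<delta> x \<noteq> 0"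
  proof (rule ccontr)
    assume a: "\<not> (\<exists>l x. 0 < l \<and> l < ?m \<and> eproj q n l \<delta> x \<noteq> 0)"
    have e: "of_nat ?m * \<delta> x = eproj q n 0 \<delta> x" for x
    proof -
      have "of_nat ?m * \<delta> x = (\<Sum>l<?m. eproj q n l \<delta> x)" using eproj_sum[OF assms(1)] by simp
      also have "\<dots> = (\<Sum>l\<in>{0}. eproj q n l \<delta> x)"
        using a m by (intro sum.mono_neutral_right) auto
      finally show ?thesis by simp
    qed
    have "of_nat ?m * \<delta> (n * 1) = of_nat ?m * \<delta> 1"
      unfolding e using eproj_eig(1)[OF \<delta> assms(2,1), of 0 1] by simp
    then show False using m assms(3) by (simp add: \<delta>_def)
  qed
  then obtain l x where l: "0 < l" "l < ?m" "eproj q n l \<delta> x \<noteq> 0" by blast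
  define \<zeta> where "\<zeta> = cis (2 * pi * real l / real ?m)"
  have z1: "\<zeta> \<noteq> 1"
  proof
    assume "\<zeta> = 1"
    then have "cnj \<zeta> = 1" by simp
    then have "cis (- (2 * pi * real l / real ?m)) = 1" by (simp add: \<zeta>_def cis_cnj)
    moreover have "(\<Sum>k<?m. cis (- (2 * pi * real l / real ?m)) ^ k) = 0"
    proof -
      have "cis (- (2 * pi * real k / real ?m)) ^ l = cis (- (2 * pi * real l / real ?m)) ^ k" for k
        unfolding Complex.DeMoivre by (rule arg_cong[of _ _ cis]) simp
      then show ?thesis using sum_roots_unity[OF m l(2)] l(1) by simp
    qed
    ultimately show False using m by simp
  qed
  \<comment> \<open>The multiplication operators commute, so projecting for a further unit keeps the
    eigenvalues already obtained (\<open>eproj_eig(4)\<close>), and \<open>eproj_sum\<close>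
    supplies a frequency at which the projection is not zero.\<close>
  have ex: "\<exists>f. eig q (insert n S) f \<and> (\<forall>x. f (n * x) = \<zeta> * f x)" if "finite S" "\<And>g. g \<in> S \<Longrightarrow> coprime g q" for S
    using that
  proof (induction S rule: finite_induct)
    case empty
    have "eig q {n} (eproj q n l \<delta>)"
      using eproj_eig[OF \<delta> assms(2,1)] l(3) unfolding eig_def by blast
    then show ?case using eproj_eig(1)[OF \<delta> assms(2,1)] unfolding \<zeta>_def by blast
  next
    case (insert g S)
    have "\<exists>f. eig q (insert n S) f \<and> (\<forall>x. f (n * x) = \<zeta> * f x)" by (rule insert.IH) (use insert.prems in blast)
    then obtain f where f: "eig q (insert n S) f" "\<forall>x. f (n * x) = \<zeta> * f x" by (elim exE conjE)
    have g: "coprime g q" using insert by auto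
    obtain x where x: "f x \<noteq> 0" using eig_nz[OF f(1)] ..
    have "\<exists>k. eproj q g k f x \<noteq> 0"
    proof (rule ccontr)
      assume "\<not> ?thesis"
      then have "of_nat ?m * f x = 0" using eproj_sum[OF assms(1), of g f x] by simp
      then show False using x m by simp
    qed
    then obtain k where k: "eproj q g k f x \<noteq> 0" by blast
    have "\<exists>\<omega>. \<forall>x. eproj q g k f (h * x) = \<omega> * eproj q g k f x" if "h \<in> insert n (insert g S)" for h
    proof (cases "h = g")
      case True
      then show ?thesis using eproj_eig(1)[OF f(1) g assms(1), of k] by blast
    next
      case False
      then have "h \<in> insert n S" using that by auto
      from eig_ev[OF f(1) this] obtain \<omega> where w: "\<forall>x. f (h * x) = \<omega> * f x" ..
      show ?thesis by (intro exI[of _ \<omega>] allI eproj_eig(4)[OF f(1) g assms(1) w])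
    qed
    then have "eig q (insert n (insert g S)) (eproj q g k f)"
      unfolding eig_def using k eproj_eig(2,3)[OF f(1) g assms(1)] by (intro conjI allI impI ballI exI[of _ x])
    moreover have "\<forall>x. eproj q g k f (n * x) = \<zeta> * eproj q g k f x"
      by (intro allI eproj_eig(4)[OF f(1) g assms(1) f(2)])
    ultimately show ?case by blast
  qed
  have "\<exists>f. eig q (insert n {g. g < q \<and> coprime g q}) f \<and> (\<forall>x. f (n * x) = \<zeta> * f x)"
    by (rule ex) auto
  then obtain f where f: "eig q (insert n {g. g < q \<and> coprime g q}) f" "\<forall>x. f (n * x) = \<zeta> * f x"
    by (elim exE conjE)
  obtain x where x: "f x \<noteq> 0" using eig_nz[OF f(1)] ..
  have fc: "f x = f y" if "[x = y] (mod q)" for x y using eig_cong[OF f(1) that] .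
  have ev: "\<exists>\<omega>. \<omega> \<noteq> 0 \<and> (\<forall>x. f (g * x) = \<omega> * f x)" if g: "coprime g q" for g
  proof -
    have "coprime (g mod q) q" using g assms(1) by simp
    then have "g mod q \<in> insert n {g. g < q \<and> coprime g q}" using assms(1) by simp
    from eig_ev[OF f(1) this] obtain \<omega> where w: "\<forall>x. f ((g mod q) * x) = \<omega> * f x" ..
    have w': "f (g * x) = \<omega> * f x" for x
      using w fc[of "g * x" "(g mod q) * x"] by (simp add: Cong.cong_def mod_mult_left_eq)
    have pw: "f (g ^ k * x) = \<omega> ^ k * f x" for k x
    proof (induction k)
      case (Suc k)
      have "f (g ^ Suc k * x) = f (g * (g ^ k * x))" by (simp only: power_Suc mult.assoc)
      then show ?case unfolding w' Suc by simp
    qed simp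
    from pw[of ?m x] have "\<omega> ^ ?m * f x = f (g ^ ?m * x)" by simp
    also have "\<dots> = f (1 * x)" by (intro fc cong_mult euler_theorem g cong_refl)
    finally have "\<omega> ^ ?m = 1" using x by simp
    then have "\<omega> \<noteq> 0" using m by (cases "\<omega> = 0") (simp_all add: power_0_left)
    with w' show ?thesis by blast
  qed
  have f0: "f y = 0" if "\<not> coprime y q" for y using eig_coprime[OF f(1)] that by blast
  define \<psi> where "\<psi> = (\<lambda>g. f (g * x) / f x)"
  have "dchar q \<psi>"
    unfolding dchar_def
  proof (intro conjI allI)
    fix a b :: nat
    show "\<psi> (a * b) = \<psi> a * \<psi> b"
    proof (cases "coprime a q")
      case True
      then obtain \<omega> where "\<forall>x. f (a * x) = \<omega> * f x" using ev by blast
      then have "f (a * (b * x)) = \<omega> * f (b * x)" "f (a * x) = \<omega> * f x" by blast+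
      then show ?thesis unfolding \<psi>_def mult.assoc using x by simp
    next
      case False
      then have "\<not> coprime (a * x) q" "\<not> coprime (a * b * x) q" by auto
      then show ?thesis by (simp add: \<psi>_def f0)
    qed
    show "\<psi> (a + q) = \<psi> a" unfolding \<psi>_def using fc[of "(a + q) * x" "a * x"] by (simp add: Cong.cong_def algebra_simps)
    show "\<psi> a = 0 \<longleftrightarrow> \<not> coprime a q"
    proof (cases "coprime a q")
      case True
      from ev[OF True] obtain \<omega> where "\<omega> \<noteq> 0" "\<forall>x. f (a * x) = \<omega> * f x" by (elim exE conjE)
      then have "f (a * x) \<noteq> 0" using x by (metis mult_eq_0_iff)
      then show ?thesis using x True by (simp add: \<psi>_def)
    next
      case False
      then have "\<not> coprime (a * x) q" by auto
      then show ?thesis using False by (simp add: \<psi>_def f0)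
    qed
  qed
  moreover have "\<psi> n \<noteq> 1" unfolding \<psi>_def f(2)[rule_format] using x z1 by simp
  ultimately show ?thesis using that by blast
qed

lemma sum_dchars:
  assumes "q > 0" "coprime n q" "\<not> [n = 1] (mod q)"
  shows "(\<Sum>\<psi> | dchar q \<psi>. \<psi> n) = 0"
proof -
  obtain \<xi> where \<xi>: "dchar q \<xi>" "\<xi> n \<noteq> 1" using ex_dchar_neq_1[OF assms] .
  have inv: "\<xi> m * (cnj (\<xi> m) * \<psi> m) = \<psi> m" "cnj (\<xi> m) * (\<xi> m * \<psi> m) = \<psi> m" if d: "dchar q \<psi>" for \<psi> m
  proof -
    have "\<psi> m = 0 \<or> \<xi> m * cnj (\<xi> m) = 1"
      using dchar_cnj_inverse[OF \<xi>(1) _ assms(1), of m] dchar_eq_0_iff[OF d, of m] by blast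
    then have e: "(\<xi> m * cnj (\<xi> m)) * \<psi> m = \<psi> m" by (elim disjE) simp_all
    show "\<xi> m * (cnj (\<xi> m) * \<psi> m) = \<psi> m" using e by (simp only: mult.assoc)
    show "cnj (\<xi> m) * (\<xi> m * \<psi> m) = \<psi> m" using e by (simp only: mult_ac)
  qed
  have "(\<Sum>\<psi> | dchar q \<psi>. \<psi> n) = (\<Sum>\<psi> | dchar q \<psi>. \<xi> n * \<psi> n)"
  proof (rule sum.reindex_bij_witness[of _ "\<lambda>\<psi> m. \<xi> m * \<psi> m" "\<lambda>\<psi> m. cnj (\<xi> m) * \<psi> m"])
    fix \<psi> assume "\<psi> \<in> {\<psi>. dchar q \<psi>}"
    then have d: "dchar q \<psi>" by simp
    show "(\<lambda>m. \<xi> m * (cnj (\<xi> m) * \<psi> m)) = \<psi>" "(\<lambda>m. cnj (\<xi> m) * (\<xi> m * \<psi> m)) = \<psi>" by (rule ext, rule inv[OF d])+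
    show "(\<lambda>m. cnj (\<xi> m) * \<psi> m) \<in> {\<psi>. dchar q \<psi>}" "(\<lambda>m. \<xi> m * \<psi> m) \<in> {\<psi>. dchar q \<psi>}"
      using dchar_times[OF \<xi>(1) d] dchar_times[OF dchar_cnj[OF \<xi>(1)] d] by simp_all
    show "\<xi> n * (cnj (\<xi> n) * \<psi> n) = \<psi> n" using inv(1)[OF d] .
  qed
  also have "\<dots> = \<xi> n * (\<Sum>\<psi> | dchar q \<psi>. \<psi> n)" by (simp add: sum_distrib_left)
  finally show ?thesis using \<xi>(2) by (metis mult_cancel_right1)
qed

text \<open>The double sum of all values of all characters, evaluated in both orders: only
  \<open>chi0\<close> contributes in one, only the class of 1 in the other.\<close>

lemma card_dchars:
  assumes "q > 0"
  shows "card {\<psi>. dchar q \<psi>} = totient q"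
proof -
  let ?D = "{\<psi>. dchar q \<psi>}"
  have fin: "finite ?D" using finite_dchars[OF assms] .
  have tot: "(\<Sum>n<q. chi0 q n) = of_nat (totient q)"
  proof -
    have "(\<Sum>n<q. chi0 q n) = (\<Sum>n\<in>{n\<in>{..<q}. coprime n q}. 1)"
      unfolding chi0_def by (simp add: sum.If_cases Int_def)
    also have "\<dots> = of_nat (card {n\<in>{..<q}. coprime n q})" by simp
    also have "card {n\<in>{..<q}. coprime n q} = totient q"
    proof -
      have "bij_betw (\<lambda>n. n mod q) (totatives q) {n\<in>{..<q}. coprime n q}"
      proof (rule bij_betw_byWitness[where f' = "\<lambda>n. if n = 0 then q else n"])
        show "\<forall>a\<in>totatives q. (if a mod q = 0 then q else a mod q) = a"
          by (auto simp: totatives_def le_less)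
        show "\<forall>a'\<in>{n \<in> {..<q}. coprime n q}. (if a' = 0 then q else a') mod q = a'" by auto
        show "(\<lambda>n. n mod q) ` totatives q \<subseteq> {n \<in> {..<q}. coprime n q}" using assms by (auto simp: totatives_def)
        show "(\<lambda>n. if n = 0 then q else n) ` {n \<in> {..<q}. coprime n q} \<subseteq> totatives q" using assms by (auto simp: totatives_def)
      qed
      then show ?thesis by (simp add: totient_def bij_betw_same_card)
    qed
    finally show ?thesis .
  qed
  have "(\<Sum>\<psi>\<in>?D. \<Sum>n<q. \<psi> n) = (\<Sum>\<psi>\<in>?D. if \<psi> = chi0 q then of_nat (totient q) else 0)"
    using dchar_sum_eq_0[OF _ assms] tot by (intro sum.cong) auto
  also have "\<dots> = of_nat (totient q)" using fin dchar_chi0 by (simp add: sum.delta)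
  finally have 1: "(\<Sum>\<psi>\<in>?D. \<Sum>n<q. \<psi> n) = of_nat (totient q)" .
  have "(\<Sum>\<psi>\<in>?D. \<Sum>n<q. \<psi> n) = (\<Sum>n<q. \<Sum>\<psi>\<in>?D. \<psi> n)" by (rule sum.swap)
  also have "\<dots> = (\<Sum>n<q. if n = 1 mod q then of_nat (card ?D) else 0)"
  proof (rule sum.cong)
    fix n assume n: "n \<in> {..<q}"
    show "(\<Sum>\<psi>\<in>?D. \<psi> n) = (if n = 1 mod q then of_nat (card ?D) else 0)"
    proof (cases "n = 1 mod q")
      case True
      then have "\<psi> n = 1" if "dchar q \<psi>" for \<psi> using dchar_cong[OF that, of n 1] dchar_1[OF that] by (simp add: Cong.cong_def)
      then have "(\<Sum>\<psi>\<in>?D. \<psi> n) = (\<Sum>\<psi>\<in>?D. 1)" by (intro sum.cong) auto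
      then show ?thesis using True by simp
    next
      case False
      then have nc: "\<not> [n = 1] (mod q)" using n by (simp add: Cong.cong_def)
      show ?thesis
      proof (cases "coprime n q")
        case True
        then show ?thesis using sum_dchars[OF assms True nc] False by simp
      next
        case c: False
        then have "\<psi> n = 0" if "dchar q \<psi>" for \<psi> using dchar_eq_0_iff[OF that] by simp
        then have "(\<Sum>\<psi>\<in>?D. \<psi> n) = 0" by (intro sum.neutral) auto
        then show ?thesis using False by simp
      qed
    qed
  qed simp
  also have "\<dots> = of_nat (card ?D)" using assms by (simp add: sum.delta)
  finally show ?thesis using 1 by (metis of_nat_eq_iff)
qed

lemma dchar_orthogonality:
  assumes "q > 0" "coprime a q"
  shows "(\<Sum>\<psi> | dchar q \<psi>. cnj (\<psi> a) * \<psi> n) = (if [n = a] (mod q) then of_nat (totient q) else 0)"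
proof (cases "coprime n q")
  case False
  then have "\<not> [n = a] (mod q)" using assms(2) cong_imp_coprime[of a n q] by (auto simp: cong_sym_eq)
  moreover have "\<psi> n = 0" if "dchar q \<psi>" for \<psi> using dchar_eq_0_iff[OF that] False by simp
  then have "(\<Sum>\<psi> | dchar q \<psi>. cnj (\<psi> a) * \<psi> n) = 0" by (intro sum.neutral) auto
  ultimately show ?thesis by simp
next
  case True
  obtain b where b: "[a * b = 1] (mod q)" using cong_solve_coprime_nat[OF assms(2)] by auto
  have cb: "coprime b q" using b by (metis coprime_mult_left_iff cong_imp_coprime cong_sym coprime_1_left)
  have e: "cnj (\<psi> a) * \<psi> n = \<psi> (b * n)" if "dchar q \<psi>" for \<psi>
  proof -
    have "\<psi> a * \<psi> b = 1" using dchar_cong[OF that b] dchar_1[OF that] dchar_mult[OF that] by simp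
    moreover have "\<psi> a * cnj (\<psi> a) = 1" using dchar_cnj_inverse[OF that assms(2,1)] .
    moreover have "\<psi> a \<noteq> 0" using dchar_eq_0_iff[OF that] assms(2) by simp
    ultimately have "\<psi> b = cnj (\<psi> a)" by (metis mult_cancel_left)
    then show ?thesis using dchar_mult[OF that] by simp
  qed
  have iff: "[b * n = 1] (mod q) \<longleftrightarrow> [n = a] (mod q)"
  proof -
    have "[b * n = 1] (mod q) \<longleftrightarrow> [b * n = b * a] (mod q)"
      using b by (metis cong_sym cong_trans mult.commute)
    also have "\<dots> \<longleftrightarrow> [n = a] (mod q)" using cong_mult_lcancel_nat[OF cb] .
    finally show ?thesis .
  qed
  have "(\<Sum>\<psi> | dchar q \<psi>. cnj (\<psi> a) * \<psi> n) = (\<Sum>\<psi> | dchar q \<psi>. \<psi> (b * n))" using e by (intro sum.cong) auto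
  also have "\<dots> = (if [n = a] (mod q) then of_nat (totient q) else 0)"
  proof (cases "[n = a] (mod q)")
    case t: True
    then have "\<psi> (b * n) = 1" if "dchar q \<psi>" for \<psi> using dchar_cong[OF that, of "b * n" 1] dchar_1[OF that] iff t by simp
    then have "(\<Sum>\<psi> | dchar q \<psi>. \<psi> (b * n)) = (\<Sum>\<psi> | dchar q \<psi>. 1)" by (intro sum.cong) auto
    then show ?thesis using t card_dchars[OF assms(1)] by simp
  next
    case f: False
    then show ?thesis using sum_dchars[OF assms(1), of "b * n"] cb True iff by simp
  qed
  finally show ?thesis .
qed

section \<open>Bounded partial sums of characters\<close>

lemma periodic_bps:
  assumes per: "\<And>n. f (n + q) = (f n :: complex)" and z: "(\<Sum>n<q. f n) = 0" and b: "\<And>n. norm (f n) \<le> 1" and q: "q > 0"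
  shows "bps (real q) f"
  unfolding bps_def
proof (intro allI)
  fix M N :: nat
  show "norm (\<Sum>n\<in>{M<..N}. f n) \<le> real q"
  proof (induction "N - M" arbitrary: N rule: less_induct)
    case less
    show ?case
    proof (cases "N - M < q")
      case True
      have "norm (\<Sum>n\<in>{M<..N}. f n) \<le> (\<Sum>n\<in>{M<..N}. 1)" by (rule order_trans[OF norm_sum sum_mono[OF b]])
      then show ?thesis using True by simp
    next
      case False
      define N' where "N' = N - q"
      have N': "N = N' + q" "M \<le> N'" using False q by (auto simp: N'_def)
      have "{M<..N} = {M<..N'} \<union> {N' + 1..<N' + 1 + q}" using N' by auto
      then have "(\<Sum>n\<in>{M<..N}. f n) = (\<Sum>n\<in>{M<..N'}. f n) + (\<Sum>n\<in>{N' + 1..<N' + 1 + q}. f n)"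
        by (simp only:) (rule sum.union_disjoint, auto)
      also have "(\<Sum>n\<in>{N' + 1..<N' + 1 + q}. f n) = 0" using sum_shift_period[of f q "N' + 1"] per z by simp
      finally show ?thesis using less[of N'] N' q False by simp
    qed
  qed
qed

lemma dchar_bps:
  assumes "dchar q \<psi>" "q > 0" "\<psi> \<noteq> chi0 q"
  shows "bps (real q) \<psi>"
  using assms dchar_sum_eq_0[OF assms] dchar_norm_le[OF assms(1,2)]
  by (intro periodic_bps) (auto simp: dchar_def)

lemma sum_chi0: assumes "q > 0" shows "(\<Sum>n<q. chi0 q n) = of_nat (totient q)"
proof -
  have "(\<Sum>n<q. chi0 q n) = (\<Sum>n<q. \<Sum>\<psi> | dchar q \<psi>. if \<psi> = chi0 q then \<psi> n else 0)"
    using finite_dchars[OF assms] dchar_chi0 by (intro sum.cong) (auto simp: sum.delta)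
  also have "\<dots> = (\<Sum>\<psi> | dchar q \<psi>. \<Sum>n<q. if \<psi> = chi0 q then \<psi> n else 0)" by (rule sum.swap)
  also have "\<dots> = (\<Sum>\<psi> | dchar q \<psi>. \<Sum>n<q. \<psi> n)"
  proof (rule sum.cong)
    fix \<psi> assume "\<psi> \<in> {\<psi>. dchar q \<psi>}"
    then show "(\<Sum>n<q. if \<psi> = chi0 q then \<psi> n else 0) = (\<Sum>n<q. \<psi> n)"
      using dchar_sum_eq_0[OF _ assms, of \<psi>] by (cases "\<psi> = chi0 q") auto
  qed simp
  also have "\<dots> = (\<Sum>n<q. \<Sum>\<psi> | dchar q \<psi>. cnj (\<psi> 1) * \<psi> n)"
    by (subst sum.swap) (auto simp: dchar_1 intro!: sum.cong)
  also have "\<dots> = (\<Sum>n<q. if n = 1 mod q then of_nat (totient q) else 0)"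
    by (intro sum.cong refl, subst dchar_orthogonality) (use assms in \<open>auto simp: Cong.cong_def\<close>)
  also have "\<dots> = of_nat (totient q)" using assms by (simp add: sum.delta)
  finally show ?thesis .
qed

text \<open>The principal character minus its mean value. Its partial sums are bounded, so its
  series continues to \<open>Re s > 0\<close>, and the pole of the L-function of \<open>chi0\<close>
  is carried by a multiple of the zeta function alone.\<close>

definition chif :: "nat \<Rightarrow> nat \<Rightarrow> complex" where
  "chif q n = chi0 q n - of_real (real (totient q) / real q)"

lemma chif_bps: assumes "q > 0" shows "bps (real q) (chif q)" "norm (chif q n) \<le> 1"
proof -
  have t: "real (totient q) / real q \<le> 1" "real (totient q) / real q \<ge> 0" using assms totient_le[of q] by auto
  show n: "norm (chif q n) \<le> 1" for n
  proof -
    have "chif q n = of_real ((if coprime n q then 1 else 0) - real (totient q) / real q)" by (simp add: chif_def chi0_def)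
    then have "norm (chif q n) = \<bar>(if coprime n q then 1 else 0) - real (totient q) / real q\<bar>" by (metis norm_of_real)
    then show ?thesis using t by (auto split: if_splits)
  qed
  show "bps (real q) (chif q)"
  proof (rule periodic_bps[OF _ _ n assms])
    show "chif q (n + q) = chif q n" for n by (simp add: chif_def chi0_def coprime_add_self)
    show "(\<Sum>n<q. chif q n) = 0" using sum_chi0[OF assms] assms by (simp add: chif_def sum_subtractf)
  qed
qed

lemma dser_chi0:
  assumes "q > 0" "Re s > 1"
  shows "dser (chi0 q) s = of_real (real (totient q) / real q) * dser (\<lambda>_. 1) s + dser (chif q) s"
proof -
  have "chi0 q = (\<lambda>n. of_real (real (totient q) / real q) * 1 + chif q n)" by (auto simp: chif_def)
  moreover have "slow (chif q)" by (rule slow_bounded[of _ 1]) (use chif_bps(2)[OF assms(1)] in auto)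
  moreover have "slow (\<lambda>n. of_real (real (totient q) / real q) * 1)" by (rule slow_bounded[of _ "norm (complex_of_real (real (totient q) / real q))"]) auto
  ultimately show ?thesis using assms(2) dser_add[of "\<lambda>n. of_real (real (totient q) / real q) * 1" "chif q" s]
     dser_cmult[OF slow_1, of s "of_real (real (totient q) / real q)"] by simp
qed

lemma zg_near: "Re s > 0 \<Longrightarrow> norm (zg s - 1) \<le> norm (s - 1) * (norm s / Re s)"
  using zg_tail(2)[of s 0] by simp

lemma isCont_Re_pos: "f holomorphic_on {s. Re s > 0} \<Longrightarrow> Re z > 0 \<Longrightarrow> isCont f z"
  using holomorphic_on_imp_continuous_on[of f] continuous_on_interior[of "{s. Re s > 0}" f z]
  by (simp add: interior_open open_Re_gt)

lemma tendsto_right_1: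
  assumes "isCont f 1"
  shows "(\<lambda>n. f (of_real (1 + 1 / (real n + 1)))) \<longlonglongrightarrow> f (1::complex)"
proof (rule isCont_tendsto_compose[OF assms])
  have "(\<lambda>n. 1 + 1 / (real n + 1)) \<longlonglongrightarrow> 1 + 0"
    by (intro tendsto_intros LIMSEQ_inverse_real_of_nat[THEN tendsto_cong[THEN iffD1, rotated]]) (auto simp: divide_inverse add.commute)
  then have "(\<lambda>n. complex_of_real (1 + 1 / (real n + 1))) \<longlonglongrightarrow> of_real (1 + 0)" by (rule tendsto_of_real)
  then show "(\<lambda>n. complex_of_real (1 + 1 / (real n + 1))) \<longlonglongrightarrow> 1" by simp
qed

lemma nat_powr_of_real: "of_nat n powr (- of_real x) = complex_of_real (real n powr (- x))"
  using powr_of_real[of "real n" "-x"] by simp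

lemma Re_dser_real:
  assumes "slow a" "x > 1" "\<And>n. a n = of_real (r n)"
  shows "(\<lambda>n. r n * real n powr (-x)) sums Re (dser a (of_real x))" "Im (dser a (of_real x)) = 0"
proof -
  have e: "a n * of_nat n powr (- of_real x) = of_real (r n * real n powr (-x))" for n
    unfolding assms(3) nat_powr_of_real by simp
  have "(\<lambda>n. complex_of_real (r n * real n powr (-x))) sums dser a (of_real x)"
    using slow_sums[OF assms(1), of "of_real x"] assms(2) unfolding e by simp
  then show "(\<lambda>n. r n * real n powr (-x)) sums Re (dser a (of_real x))" "Im (dser a (of_real x)) = 0"
    using sums_Re[of _ "dser a (of_real x)"] sums_unique2[OF sums_zero, of "Im (dser a (of_real x))"] sums_Im[of _ "dser a (of_real x)"] by fastforce+
qed

section \<open>Siegel's theorem\<close>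

lemma higher_deriv_recip:
  assumes "s \<noteq> 1"
  shows "(deriv ^^ m) (\<lambda>s. l / (s - 1)) s = l * (-1) ^ m * fact m / (s - 1 :: complex) ^ (m + 1)"
  using assms
proof (induction m arbitrary: s)
  case (Suc m)
  have "eventually (\<lambda>z. z \<in> - {1}) (nhds s)" using Suc.prems by (intro eventually_nhds_in_open) auto
  then have "eventually (\<lambda>z. (deriv ^^ m) (\<lambda>s. l / (s - 1)) z = l * (-1) ^ m * fact m / (z - 1) ^ (m + 1)) (nhds s)"
    by eventually_elim (use Suc.IH in auto)
  then have "deriv ((deriv ^^ m) (\<lambda>s. l / (s - 1))) s = deriv (\<lambda>z. l * (-1) ^ m * fact m / (z - 1) ^ (m + 1)) s"
    by (rule deriv_cong_ev) simp
  also have "\<dots> = l * (-1) ^ Suc m * fact (Suc m) / (s - 1) ^ (Suc m + 1)"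
  proof (rule DERIV_imp_deriv)
    have d: "((\<lambda>z. (z - 1) ^ (m + 1)) has_field_derivative of_nat (m + 1) * (s - 1) ^ m) (at s)"
    proof -
      have "((\<lambda>z. z - 1) has_field_derivative 1) (at s)" by (auto intro!: derivative_eq_intros)
      from DERIV_power_Suc[OF this, of m] show ?thesis by simp
    qed
    have nz: "(s - 1) ^ (m + 1) \<noteq> 0" using Suc.prems by simp
    have alg: "(0 * w ^ (m + 1) - k * (d * w ^ m)) / (w ^ (m + 1) * w ^ (m + 1)) = - k * d / w ^ (Suc m + 1)" if "w \<noteq> 0" for w k d :: complex
    proof -
      have "w ^ (m + 1) * w ^ (m + 1) = w ^ m * w ^ (Suc m + 1)" by simp
      then show ?thesis using that by simp
    qed
    from DERIV_divide[OF DERIV_const d nz, of "l * (-1) ^ m * fact m"]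
    show "((\<lambda>z. l * (-1) ^ m * fact m / (z - 1) ^ (m + 1)) has_field_derivative l * (-1) ^ Suc m * fact (Suc m) / (s - 1) ^ (Suc m + 1)) (at s)"
      by (rule DERIV_cong) (subst alg, use Suc.prems in \<open>simp_all add: mult_ac\<close>)
  qed
  finally show ?case by simp
qed simp

text \<open>\<open>c\<close> will be \<open>1 + \<psi>\<close> or
  \<open>(1 + \<psi>) * (1 + \<xi>)\<close> for real characters, which explains the bound 4.\<close>

locale nonneg_log =
  fixes c :: "nat \<Rightarrow> real"
  assumes c0: "c n \<ge> 0" and c4: "c n \<le> 4"
begin

text \<open>Estermann's argument expands \<open>FF\<close> about the point \<open>2\<close>, where all Taylor coefficients of
  \<open>FF (2 - z)\<close> are nonnegative.\<close>

definition "PP = dser (\<lambda>n. of_real (kap n) * of_real (c n))"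
definition "FF s = exp (PP s)"
definition "BB = dser (\<lambda>n. mangoldt n * of_real (c n))"

lemma slow_c: "slow (\<lambda>n. of_real (c n))"
  by (rule slow_bounded[of _ 4]) (use c0 c4 in auto)

lemma FF_deriv: assumes "Re s > 1" shows "(FF has_field_derivative - (FF s * BB s)) (at s)"
proof -
  have "(PP has_field_derivative - BB s) (at s)" unfolding PP_def BB_def by (rule dser_kap_deriv[OF slow_c assms])
  from DERIV_chain2[OF DERIV_exp this] show ?thesis unfolding FF_def[abs_def] by (simp add: FF_def)
qed

lemma FF_hol: "FF holomorphic_on {s. Re s > 1}"
  using FF_deriv by (auto simp: holomorphic_on_def field_differentiable_def intro: has_field_derivative_at_within)

lemma BB_hol: "BB holomorphic_on {s. Re s > 1}"
  unfolding BB_def by (intro dser_holomorphic slow_mangoldt slow_c)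

definition "al m = (-1) ^ m * (deriv ^^ m) FF 2"
definition "be m = (\<Sum>n. ln (real n) ^ m * mangoldt n * c n * real n powr (-2))"

lemma be_sums: "(\<lambda>n. ln (real n) ^ m * mangoldt n * c n * real n powr (-2)) sums be m"
   and be_deriv: "(-1) ^ m * (deriv ^^ m) BB 2 = of_real (be m)"
proof -
  let ?r = "\<lambda>n. (- ln (real n)) ^ m * mangoldt n * c n"
  have sl: "slow (\<lambda>n. (- of_real (ln (real n))) ^ m * (mangoldt n * of_real (c n)))"
    by (rule slow_mono[OF slow_ln_power[OF slow_mangoldt[OF slow_c], of m], where C = 1]) (auto simp: norm_mult norm_power)
  have e: "(\<lambda>n. (- of_real (ln (real n))) ^ m * (mangoldt n * of_real (c n))) = (\<lambda>n. complex_of_real (?r n))" by (auto simp: mult_ac)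
  have d: "(deriv ^^ m) BB 2 = dser (\<lambda>n. (- of_real (ln (real n))) ^ m * (mangoldt n * of_real (c n))) (of_real 2)"
    unfolding BB_def using dser_higher_deriv[OF slow_mangoldt[OF slow_c], of 2 m] by simp
  have r: "(\<lambda>n. ?r n * real n powr (-2)) sums Re ((deriv ^^ m) BB 2)" "Im ((deriv ^^ m) BB 2) = 0"
    unfolding d by (rule Re_dser_real(1)[OF sl _ fun_cong[OF e]], simp) (rule Re_dser_real(2)[OF sl _ fun_cong[OF e]], simp)
  have "(\<lambda>n. ln (real n) ^ m * mangoldt n * c n * real n powr (-2)) sums ((-1) ^ m * Re ((deriv ^^ m) BB 2))"
  proof -
    have pw: "(-1) ^ m * (- ln (real n)) ^ m = ln (real n) ^ m" for n by (simp add: power_mult_distrib[symmetric])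
    have "(-1) ^ m * ((- ln (real n)) ^ m * mangoldt n * c n * real n powr (-2)) = ln (real n) ^ m * mangoldt n * c n * real n powr (-2)" for n
      by (simp only: mult.assoc[symmetric] pw)
    then show ?thesis using sums_mult[OF r(1), of "(-1) ^ m"] by (simp only:)
  qed
  then show s: "(\<lambda>n. ln (real n) ^ m * mangoldt n * c n * real n powr (-2)) sums be m" and "(-1) ^ m * (deriv ^^ m) BB 2 = of_real (be m)"
    using r(2) by (auto simp: be_def sums_iff complex_eq_iff Re_power_real minus_one_power_iff)
qed

lemma be_nonneg: "be m \<ge> 0"
proof (rule sums_le[OF _ sums_zero be_sums])
  fix n show "0 \<le> ln (real n) ^ m * mangoldt n * c n * real n powr (-2)"
    using c0 mangoldt_nonneg by (cases "n = 0") auto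
qed

text \<open>Leibniz' rule applied to \<open>FF' = - FF * BB\<close>. Since the \<open>be\<close> are
  visibly nonnegative, this recursion carries nonnegativity to the \<open>al\<close>.\<close>

lemma al_Suc: "al (Suc m) = (\<Sum>i=0..m. of_nat (m choose i) * al i * of_real (be (m - i)))"
proof -
  have o: "open {s. Re s > 1}" by (rule open_Re_gt)
  have "(deriv ^^ Suc m) FF 2 = (deriv ^^ m) (deriv FF) 2" by (simp add: funpow_swap1)
  also have "\<dots> = (deriv ^^ m) (\<lambda>s. - (FF s * BB s)) 2"
    by (rule higher_deriv_transform_within_open[OF _ _ o])
       (use FF_deriv DERIV_imp_deriv FF_hol BB_hol o in \<open>auto intro!: holomorphic_intros holomorphic_deriv\<close>)
  also have "\<dots> = - (deriv ^^ m) (\<lambda>s. FF s * BB s) 2"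
    by (rule higher_deriv_uminus[OF _ o]) (use FF_hol BB_hol in \<open>auto intro!: holomorphic_intros\<close>)
  also have "(deriv ^^ m) (\<lambda>s. FF s * BB s) 2 = (\<Sum>i=0..m. of_nat (m choose i) * (deriv ^^ i) FF 2 * (deriv ^^ (m - i)) BB 2)"
    by (rule higher_deriv_mult[OF FF_hol BB_hol o]) simp
  finally have "al (Suc m) = (\<Sum>i=0..m. (-1) ^ m * (of_nat (m choose i) * (deriv ^^ i) FF 2 * (deriv ^^ (m - i)) BB 2))"
    by (simp add: al_def sum_distrib_left sum_negf)
  also have "\<dots> = (\<Sum>i=0..m. of_nat (m choose i) * al i * of_real (be (m - i)))"
  proof (rule sum.cong)
    fix i assume "i \<in> {0..m}"
    then have "(-1::complex) ^ m = (-1) ^ i * (-1) ^ (m - i)" by (simp add: power_add[symmetric])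
    then show "(-1) ^ m * (of_nat (m choose i) * (deriv ^^ i) FF 2 * (deriv ^^ (m - i)) BB 2) = of_nat (m choose i) * al i * of_real (be (m - i))"
      by (simp add: al_def be_deriv[symmetric] mult_ac)
  qed simp
  finally show ?thesis .
qed

lemma PP_real: "x > 1 \<Longrightarrow> Im (PP (of_real x)) = 0" "x > 1 \<Longrightarrow> Re (PP (of_real x)) \<ge> 0"
  and PP_sums: "x > 1 \<Longrightarrow> (\<lambda>n. kap n * c n * real n powr (-x)) sums Re (PP (of_real x))"
proof -
  assume x: "x > 1"
  note r = Re_dser_real[OF slow_kap[OF slow_c] x, of "\<lambda>n. kap n * c n"]
  show "Im (PP (of_real x)) = 0" unfolding PP_def using r by auto
  show s: "(\<lambda>n. kap n * c n * real n powr (-x)) sums Re (PP (of_real x))"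
    unfolding PP_def using r by auto
  have "0 \<le> kap n * c n * real n powr (-x)" for n by (intro mult_nonneg_nonneg c0 kap_nonneg powr_ge_zero)
  from sums_le[OF this sums_zero s] show "Re (PP (of_real x)) \<ge> 0" .
qed

lemma al_real: "al m = of_real (Re (al m)) \<and> Re (al m) \<ge> 0"
proof (induction m rule: less_induct)
  case (less m)
  show ?case
  proof (cases m)
    case 0
    have "al 0 = of_real (exp (Re (PP 2)))"
      using PP_real(1)[of 2] by (simp add: al_def FF_def exp_of_real[symmetric] complex_is_Real_iff[symmetric] of_real_Re complex_eq_iff[of "PP 2"])
    then show ?thesis using 0 by simp
  next
    case (Suc k)
    have "al m = (\<Sum>i=0..k. of_nat (k choose i) * of_real (Re (al i)) * of_real (be (k - i)))"
      unfolding Suc al_Suc using less Suc by (intro sum.cong) auto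
    also have "\<dots> = of_real (\<Sum>i=0..k. of_nat (k choose i) * Re (al i) * be (k - i))" by simp
    finally have e: "al m = of_real (\<Sum>i=0..k. of_nat (k choose i) * Re (al i) * be (k - i))" .
    moreover have "(\<Sum>i=0..k. of_nat (k choose i) * Re (al i) * be (k - i)) \<ge> 0"
      using less Suc be_nonneg by (intro sum_nonneg mult_nonneg_nonneg) auto
    ultimately show ?thesis by simp
  qed
qed

lemma al_0: "Re (al 0) \<ge> 1"
proof -
  have "al 0 = exp (PP 2)" by (simp add: al_def FF_def)
  moreover have "Im (PP 2) = 0" "Re (PP 2) \<ge> 0" using PP_real[of 2] by auto
  ultimately show ?thesis by (simp add: Re_exp)
qed

text \<open>Only the term \<open>i = 0\<close> of the recursion is kept, with
  \<open>al 0 \<ge> 1\<close>. It transfers bounds for the Taylor coefficients of the product back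
  to those of its logarithm.\<close>

lemma al_ge_be: "Re (al (Suc m)) \<ge> be m"
proof -
  have "Re (al (Suc m)) = (\<Sum>i=0..m. real (m choose i) * Re (al i) * be (m - i))"
    unfolding al_Suc Re_sum
  proof (rule sum.cong)
    fix i
    have "of_nat (m choose i) * al i * of_real (be (m - i)) = of_real (real (m choose i) * Re (al i) * be (m - i))"
      using al_real[of i] by (metis of_real_mult of_real_of_nat_eq)
    then show "Re (of_nat (m choose i) * al i * of_real (be (m - i))) = real (m choose i) * Re (al i) * be (m - i)" by simp
  qed simp
  also have "\<dots> \<ge> (\<Sum>i\<in>{0}. real (m choose i) * Re (al i) * be (m - i))"
    using al_real be_nonneg by (intro sum_mono2) auto
  moreover have "1 * be m \<le> Re (al 0) * be m" by (intro mult_right_mono al_0 be_nonneg)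
  ultimately show ?thesis by simp
qed

text \<open>With the pole removed, \<open>FF s - l / (s - 1)\<close> is holomorphic on the disc of
  radius 7/4 about 2, which reaches past 1 and stays in \<open>Re s > 0\<close>. Cauchy's estimate
  makes its Taylor coefficients decay like \<open>(4/7) ^ m\<close>; the factor 8/3 is
  \<open>2 / (3/4)\<close>, as \<open>norm (s - 1) \<ge> 3/4\<close> on the circle.\<close>

lemma estermann_coeffs:
  assumes hol: "E holomorphic_on {s. Re s > 0}" and eq: "\<And>s. Re s > 1 \<Longrightarrow> E s = (s - 1) * FF s"
    and M0: "\<And>s. norm (s - 2) \<le> 7/4 \<Longrightarrow> norm (E s) \<le> M0"
  defines "l \<equiv> Re (E 1)"
  shows "E 1 = of_real l" "l \<ge> 0"
    and "\<bar>Re (al m) / fact m - l\<bar> \<le> 8/3 * M0 * (4/7) ^ m"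
    and "\<bar>x - 2\<bar> < 7/4 \<Longrightarrow> x \<noteq> 1 \<Longrightarrow> (\<lambda>m. (Re (al m) / fact m - l) * (2 - x) ^ m) sums (Re ((E (of_real x) - E 1) / (of_real x - 1)))"
proof -
  have lim: "(\<lambda>n. E (of_real (1 + 1 / (real n + 1)))) \<longlonglongrightarrow> E 1"
    by (rule tendsto_right_1[OF isCont_Re_pos[OF hol]]) simp
  have pos: "E (of_real (1 + 1 / (real n + 1))) = of_real (1 / (real n + 1) * exp (Re (PP (of_real (1 + 1 / (real n + 1))))))" for n
  proof -
    let ?x = "1 + 1 / (real n + 1)"
    have x: "?x > 1" by simp
    have "PP (of_real ?x) = of_real (Re (PP (of_real ?x)))" using PP_real(1)[OF x] by (simp add: complex_eq_iff)
    then have "FF (of_real ?x) = of_real (exp (Re (PP (of_real ?x))))" unfolding FF_def by (metis exp_of_real)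
    then show ?thesis using eq[of "of_real ?x"] x by simp
  qed
  have "(\<lambda>n. Im (E (of_real (1 + 1 / (real n + 1))))) \<longlonglongrightarrow> Im (E 1)" by (intro tendsto_intros lim)
  then have "Im (E 1) = 0" unfolding pos by (simp add: LIMSEQ_const_iff)
  then show l1: "E 1 = of_real l" by (simp add: l_def complex_eq_iff)
  have "(\<lambda>n. Re (E (of_real (1 + 1 / (real n + 1))))) \<longlonglongrightarrow> Re (E 1)" by (intro tendsto_intros lim)
  then show l0: "l \<ge> 0" unfolding pos l_def by (rule LIMSEQ_le_const) (auto intro!: exI[of _ 0])
  define G where "G = (\<lambda>s. if s = 1 then deriv E 1 else (E s - E 1) / (s - 1))"
  have one: "(1::complex) \<in> interior {s. Re s > 0}" by (simp add: interior_open open_Re_gt)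
  have holG: "G holomorphic_on {s. Re s > 0}" unfolding G_def by (rule pole_lemma[OF hol one])
  have sub: "cball (2::complex) (7/4) \<subseteq> {s. Re s > 0}"
  proof
    fix z :: complex assume "z \<in> cball 2 (7/4)"
    then have "\<bar>Re (z - 2)\<bar> \<le> 7/4" using abs_Re_le_cmod[of "z - 2"] by (simp add: dist_norm norm_minus_commute)
    then have "- (7/4) \<le> Re (z - 2)" by linarith
    then show "z \<in> {s. Re s > 0}" by simp
  qed
  have M00: "M0 \<ge> 0" using M0[of 2] norm_ge_zero order_trans by (metis diff_self norm_zero divide_nonneg_nonneg zero_le_numeral)
  have Gb: "norm (G s) \<le> 8/3 * M0" if "norm (2 - s) = 7/4" for s
  proof -
    have s2: "norm (s - 2) = 7/4" using that by (simp add: norm_minus_commute)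
    have "norm (s - 1) \<ge> 3/4" using norm_triangle_ineq2[of "s - 2" "-1"] s2 by simp
    moreover have "norm (E s - E 1) \<le> 2 * M0" using norm_triangle_ineq4[of "E s" "E 1"] M0[of s] M0[of 1] s2 by simp
    ultimately have "norm (E s - E 1) / norm (s - 1) \<le> 2 * M0 / (3/4)" using M00 by (intro frac_le) auto
    moreover have "s \<noteq> 1" using s2 by auto
    ultimately show ?thesis by (simp add: G_def norm_divide)
  qed
  have derG: "(deriv ^^ m) G 2 = (-1) ^ m * of_real (Re (al m) - l * fact m)" for m
  proof -
    have "(deriv ^^ m) G 2 = (deriv ^^ m) (\<lambda>s. FF s - of_real l / (s - 1)) 2"
    proof (rule higher_deriv_transform_within_open[OF _ _ open_Re_gt[of 1]])
      show "G holomorphic_on {s. Re s > 1}" by (rule holomorphic_on_subset[OF holG]) auto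
      show "(\<lambda>s. FF s - of_real l / (s - 1)) holomorphic_on {s. Re s > 1}" using FF_hol by (intro holomorphic_intros) auto
      fix z assume "z \<in> {s. Re s > 1}"
      then have "z \<noteq> 1" "Re z > 1" by auto
      then show "G z = FF z - of_real l / (z - 1)" using eq[of z] l1 by (simp add: G_def diff_divide_distrib)
    qed simp
    also have "\<dots> = (deriv ^^ m) FF 2 - (deriv ^^ m) (\<lambda>s. of_real l / (s - 1)) 2"
      by (rule higher_deriv_diff[OF FF_hol _ open_Re_gt[of 1]]) (auto intro!: holomorphic_intros)
    also have "(deriv ^^ m) (\<lambda>s. complex_of_real l / (s - 1)) 2 = (-1) ^ m * of_real (l * fact m)"
      by (subst higher_deriv_recip) (auto simp: mult_ac)
    also have "(deriv ^^ m) FF 2 = (-1) ^ m * al m" by (simp add: al_def mult.assoc[symmetric] power_mult_distrib[symmetric])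
    also have "al m = of_real (Re (al m))" using al_real by blast
    finally show ?thesis by (simp add: algebra_simps)
  qed
  have holb: "G holomorphic_on ball 2 (7/4)" using holG sub by (meson ball_subset_cball holomorphic_on_subset)
  have "norm ((deriv ^^ m) G 2) \<le> fact m * (8/3 * M0) / (7/4) ^ m"
    by (rule Cauchy_inequality[OF holb]) (use holomorphic_on_imp_continuous_on[OF holomorphic_on_subset[OF holG sub]] Gb in auto)
  also have "norm ((deriv ^^ m) G 2) = \<bar>Re (al m) - l * fact m\<bar>" unfolding derG norm_mult norm_power norm_of_real by simp
  also have "\<bar>Re (al m) - l * fact m\<bar> = fact m * \<bar>Re (al m) / fact m - l\<bar>"
  proof -
    have e1: "Re (al m) - l * fact m = fact m * (Re (al m) / fact m - l)" by (simp add: algebra_simps)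
    show ?thesis unfolding e1 abs_mult by simp
  qed
  finally show "\<bar>Re (al m) / fact m - l\<bar> \<le> 8/3 * M0 * (4/7) ^ m" by (simp add: field_simps power_divide)
  assume x: "\<bar>x - 2\<bar> < 7/4" "x \<noteq> 1"
  have "of_real x \<in> ball (2::complex) (7/4)"
  proof -
    have "norm (of_real (x - 2) :: complex) < 7/4" using x unfolding norm_of_real by simp
    then show ?thesis by (simp add: dist_norm norm_minus_commute)
  qed
  from holomorphic_power_series[OF holb this]
  have "(\<lambda>m. (deriv ^^ m) G 2 / fact m * (of_real x - 2) ^ m) sums G (of_real x)" .
  moreover have "(deriv ^^ m) G 2 / fact m * (of_real x - 2) ^ m = of_real ((Re (al m) / fact m - l) * (2 - x) ^ m)" for m
  proof -
    have "(of_real x - 2 :: complex) ^ m = (-1) ^ m * of_real ((2 - x) ^ m)"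
    proof -
      have "(of_real x - 2 :: complex) = -1 * of_real (2 - x)" by simp
      then show ?thesis by (simp only: power_mult_distrib of_real_power)
    qed
    then show ?thesis unfolding derG by (simp add: power_mult_distrib[symmetric] field_simps)
  qed
  ultimately have "(\<lambda>m. complex_of_real ((Re (al m) / fact m - l) * (2 - x) ^ m)) sums G (of_real x)" by simp
  from sums_Re[OF this] have "(\<lambda>m. (Re (al m) / fact m - l) * (2 - x) ^ m) sums Re (G (of_real x))"
    by (simp only: Re_complex_of_real)
  moreover have "G (of_real x) = (E (of_real x) - E 1) / (of_real x - 1)" using x(2) by (simp add: G_def)
  ultimately show "(\<lambda>m. (Re (al m) / fact m - l) * (2 - x) ^ m) sums (Re ((E (of_real x) - E 1) / (of_real x - 1)))"
    by (simp only:)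
qed

text \<open>Expanded at \<open>x\<close>, the first \<open>m0\<close> terms are at least
  \<open>- l * u ^ m\<close>, with an extra 1 at \<open>m = 0\<close>, and the rest is small. As
  \<open>E\<close> is not negative at \<open>x\<close>, the value of the series is at most
  \<open>l / (1 - x)\<close>; so \<open>l * u ^ m0\<close> cannot be much smaller than
  \<open>1 - x\<close>.\<close>

lemma estermann:
  assumes hol: "E holomorphic_on {s. Re s > 0}" and eq: "\<And>s. Re s > 1 \<Longrightarrow> E s = (s - 1) * FF s"
    and M0: "\<And>s. norm (s - 2) \<le> 7/4 \<Longrightarrow> norm (E s) \<le> M0" and M1: "M0 \<ge> 1"
    and x: "7/8 \<le> x" "x < 1" and E0: "Re (E (of_real x)) \<ge> 0"
  shows "Re (E 1) \<ge> (1 - x) / 6 * (16 * M0) powr (-3 * (1 - x))"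
proof -
  define l where "l = Re (E 1)"
  note co = estermann_coeffs[OF hol eq M0, folded l_def]
  define u where "u = 2 - x"
  have u: "1 < u" "u \<le> 9/8" using x by (auto simp: u_def)
  \<comment> \<open>Since \<open>ln (14/9) \<ge> 1/3\<close>, this many terms give
    \<open>(9/14) ^ m0 \<le> 1 / (16 * M0)\<close> and bring the geometric tail below 1/2. The ratio
    9/14 is 4/7 from Cauchy's estimate times the bound 9/8 for \<open>u\<close>.\<close>
  define m0 where "m0 = nat \<lceil>3 * ln (16 * M0)\<rceil>"
  have l16: "ln (16 * M0) > 0" using M1 by simp
  have m0: "3 * ln (16 * M0) \<le> real m0" "real m0 \<le> 3 * ln (16 * M0) + 1" using l16 by (auto simp: m0_def)
  have "m0 > 0" using m0 l16 by (cases m0) auto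
  have p: "(9/14::real) ^ m0 \<le> 1 / (16 * M0)"
  proof -
    have "exp 1 \<le> (14/9::real) ^ 3" using exp_le by (simp add: power3_eq_cube)
    then have "ln (exp 1) \<le> ln ((14/9::real) ^ 3)" by (subst ln_le_cancel_iff) auto
    then have "1/3 \<le> ln (14/9::real)" by (simp add: ln_realpow)
    moreover have "ln (9/14::real) = - ln (14/9)" by (simp add: ln_div)
    ultimately have l9: "ln (9/14::real) \<le> -1/3" by simp
    have "(9/14::real) ^ m0 = exp (real m0 * ln (9/14))" by (simp add: exp_of_nat_mult)
    also have "\<dots> \<le> exp (real m0 * (-1/3))" using l9 by (intro exp_mono mult_left_mono) auto
    also have "\<dots> \<le> exp (- ln (16 * M0))" using m0 by simp
    also have "\<dots> = 1 / (16 * M0)" using M1 by (simp add: exp_minus field_simps)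
    finally show ?thesis .
  qed
  \<comment> \<open>A minorant of the terms of the Taylor series: nonnegativity of the coefficients
    is used before \<open>m0\<close>, Cauchy's estimate from \<open>m0\<close> on.\<close>
  define t where "t = (\<lambda>m. (if m = 0 then 1 else 0) - (if m < m0 then l * u ^ m else 0) - (if m < m0 then 0 else 8/3 * M0 * (9/14) ^ m))"
  have tle: "t m \<le> (Re (al m) / fact m - l) * u ^ m" for m
  proof (cases "m < m0")
    case True
    have "(if m = 0 then 1 else 0) \<le> Re (al m) / fact m * u ^ m"
      using al_0 al_real[of m] u by (cases "m = 0") auto
    then show ?thesis using True by (simp add: t_def algebra_simps)
  next
    case False
    have "\<bar>(Re (al m) / fact m - l) * u ^ m\<bar> \<le> 8/3 * M0 * (4/7) ^ m * (9/8) ^ m"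
      unfolding abs_mult using co(3)[of m] u M1 by (intro mult_mono) (auto simp: power_mono)
    also have "\<dots> = 8/3 * M0 * (9/14) ^ m" by (simp add: power_mult_distrib[symmetric] mult.assoc)
    finally show ?thesis using False \<open>m0 > 0\<close> by (auto simp: t_def)
  qed
  have ts: "t sums (1 - (\<Sum>m<m0. l * u ^ m) - 8/3 * M0 * ((9/14) ^ m0 * (14/5)))"
  proof -
    have 1: "(\<lambda>m. if m = 0 then 1 else (0::real)) sums 1" using sums_single[of 0 "\<lambda>_. 1::real"] by simp
    have 2: "(\<lambda>m. if m < m0 then l * u ^ m else 0) sums (\<Sum>m<m0. l * u ^ m)"
      using sums_If_finite[of "\<lambda>m. m < m0" "\<lambda>m. l * u ^ m"] by (simp add: lessThan_def)
    have "(\<lambda>m. (9/14::real) ^ m0 * (9/14) ^ m) sums ((9/14) ^ m0 * (1 / (1 - 9/14)))" by (intro sums_mult geometric_sums) simp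
    then have "(\<lambda>m. if m + m0 < m0 then 0 else (9/14::real) ^ (m + m0)) sums ((9/14) ^ m0 * (14/5))" by (simp add: power_add mult.commute)
    then have "(\<lambda>m. if m < m0 then 0 else (9/14::real) ^ m) sums ((9/14) ^ m0 * (14/5))"
      by (subst (asm) sums_iff_shift[where f = "\<lambda>m. if m < m0 then 0 else (9/14::real) ^ m"]) simp
    from sums_mult[OF this, of "8/3 * M0"] have 3: "(\<lambda>m. if m < m0 then 0 else 8/3 * M0 * (9/14) ^ m) sums (8/3 * M0 * ((9/14) ^ m0 * (14/5)))"
      by (simp add: if_distrib cong: if_cong)
    show ?thesis unfolding t_def by (intro sums_diff 1 2 3)
  qed
  have "1 - (\<Sum>m<m0. l * u ^ m) - 8/3 * M0 * ((9/14) ^ m0 * (14/5)) \<le> Re ((E (of_real x) - E 1) / (of_real x - 1))"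
    by (rule sums_le[OF tle ts]) (use co(4)[of x] x in \<open>simp add: u_def\<close>)
  moreover have "8/3 * M0 * ((9/14) ^ m0 * (14/5)) \<le> 8/3 * M0 * (1 / (16 * M0) * (14/5))" using p M1 by (intro mult_left_mono mult_right_mono) auto
  moreover have "8/3 * M0 * (1 / (16 * M0) * (14/5)) \<le> 1/2" using M1 by simp
  moreover have "(\<Sum>m<m0. l * u ^ m) = l * (u ^ m0 - 1) / (1 - x)"
    using u by (simp add: sum_distrib_left[symmetric] geometric_sum u_def)
  moreover have "Re ((E (of_real x) - E 1) / (of_real x - 1)) = (Re (E (of_real x)) - l) / (x - 1)"
  proof -
    have "(E (of_real x) - E 1) / (of_real x - 1) = (E (of_real x) - E 1) / of_real (x - 1)" by simp
    then show ?thesis unfolding l_def by (simp only: Re_divide_of_real minus_complex.simps)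
  qed
  moreover have "(Re (E (of_real x)) - l) / (x - 1) \<le> l / (1 - x)"
  proof -
    have "(Re (E (of_real x)) - l) / (x - 1) = (l - Re (E (of_real x))) / (1 - x)" by (metis minus_diff_eq minus_divide_divide)
    also have "\<dots> \<le> l / (1 - x)" using E0 x by (intro divide_right_mono) auto
    finally show ?thesis .
  qed
  ultimately have "1/2 \<le> l * (u ^ m0 - 1) / (1 - x) + l / (1 - x)" by linarith
  also have "\<dots> = l * u ^ m0 / (1 - x)" by (simp add: add_divide_distrib[symmetric] algebra_simps)
  finally have "(1 - x) / 2 \<le> l * u ^ m0" using x by (simp add: field_simps)
  moreover have "u ^ m0 \<le> 3 * (16 * M0) powr (3 * (1 - x))"
  proof -
    have "u \<le> exp (1 - x)" using exp_ge_add_one_self[of "1 - x"] by (simp add: u_def)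
    then have "u ^ m0 \<le> exp (1 - x) ^ m0" using u by (intro power_mono) auto
    also have "\<dots> = exp ((1 - x) * real m0)" by (simp add: exp_of_nat2_mult)
    also have "\<dots> \<le> exp ((1 - x) * (3 * ln (16 * M0) + 1))" using m0 x by (intro exp_mono mult_left_mono) auto
    also have "\<dots> = exp (3 * (1 - x) * ln (16 * M0)) * exp (1 - x)" by (simp add: exp_add[symmetric] algebra_simps)
    also have "\<dots> \<le> exp (3 * (1 - x) * ln (16 * M0)) * 3"
    proof (rule mult_left_mono)
      have "exp (1 - x) \<le> exp 1" using x by simp
      then show "exp (1 - x) \<le> 3" using exp_le by linarith
    qed simp
    finally show ?thesis using M1 by (simp add: powr_def mult_ac)
  qed
  ultimately have "(1 - x) / 2 \<le> l * (3 * (16 * M0) powr (3 * (1 - x)))"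
    using co(2) by (meson mult_left_mono order_trans)
  then have "(1 - x) / 6 / (16 * M0) powr (3 * (1 - x)) \<le> l" using M1 by (simp add: field_simps)
  moreover have "(16 * M0) powr (-3 * (1 - x)) = 1 / (16 * M0) powr (3 * (1 - x))"
    using powr_minus_divide[of "16 * M0" "3 * (1 - x)"] by simp
  ultimately show ?thesis unfolding l_def by simp
qed

text \<open>Without a pole the coefficients themselves decay like \<open>(4/7) ^ m\<close>, and
  \<open>al_ge_be\<close> hands this to the logarithm. Moving the exponent from 2 down to 1/2
  multiplies the \<open>m\<close>-th coefficient by \<open>(3/2) ^ m\<close>, and
  \<open>(3/2) * (4/7) = 6/7\<close> is still below 1.\<close>

lemma vanishing_bound:
  assumes hol: "E holomorphic_on {s. Re s > 0}" and eq: "\<And>s. Re s > 1 \<Longrightarrow> E s = (s - 1) * FF s"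
    and M0: "\<And>s. norm (s - 2) \<le> 7/4 \<Longrightarrow> norm (E s) \<le> M0" and z: "E 1 = 0"
  shows "\<exists>K. \<forall>N. (\<Sum>n\<in>{1..N}. kap n * c n * real n powr (-(1/2))) \<le> K"
proof -
  note co = estermann_coeffs[OF hol eq M0]
  have alb: "Re (al m) / fact m \<le> 8/3 * M0 * (4/7) ^ m" for m using abs_le_D1[OF co(3)[of m]] z by simp
  have M00: "M0 \<ge> 0" using M0[of 2] norm_ge_zero order_trans by (metis diff_self norm_zero divide_nonneg_nonneg zero_le_numeral)
  have fin: "(\<Sum>n\<in>{1..N}. kap n * c n * real n powr (-2) * (ln (real n) ^ m / fact m)) \<le> 8/3 * M0 * (4/7) ^ m" if m: "m \<ge> 1" for m N
  proof -
    obtain k where k: "m = Suc k" using m by (cases m) auto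
    have e: "kap n * c n * real n powr (-2) * ln (real n) ^ m = ln (real n) ^ k * mangoldt n * c n * real n powr (-2)" for n
      using ln_kap[of n] unfolding k by (simp add: mult_ac)
    have "(\<Sum>n\<in>{1..N}. kap n * c n * real n powr (-2) * (ln (real n) ^ m / fact m)) = (\<Sum>n\<in>{1..N}. ln (real n) ^ k * mangoldt n * c n * real n powr (-2)) / fact m"
      unfolding e[symmetric] by (simp add: sum_divide_distrib)
    also have "\<dots> \<le> be k / fact m"
    proof (rule divide_right_mono)
      have "0 \<le> ln (real n) ^ k * mangoldt n * c n * real n powr (-2)" for n
        using c0 mangoldt_nonneg by (cases "n = 0") auto
      then show "(\<Sum>n\<in>{1..N}. ln (real n) ^ k * mangoldt n * c n * real n powr (-2)) \<le> be k"
        using sum_le_suminf[OF sums_summable[OF be_sums[of k]], of "{1..N}"] sums_unique[OF be_sums[of k]] by simp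
    qed simp
    also have "\<dots> \<le> Re (al m) / fact m" unfolding k by (intro divide_right_mono al_ge_be) auto
    also have "\<dots> \<le> 8/3 * M0 * (4/7) ^ m" by (rule alb)
    finally show ?thesis .
  qed
  define K0 where "K0 = Re (PP (of_real 2))"
  have k0: "(\<Sum>n\<in>{1..N}. kap n * c n * real n powr (-2)) \<le> K0" for N
    using sum_le_suminf[OF sums_summable[OF PP_sums[of 2]], of "{1..N}"] sums_unique[OF PP_sums[of 2]] c0 kap_nonneg by (auto simp: K0_def)
  have "(\<Sum>n\<in>{1..N}. kap n * c n * real n powr (-(1/2))) \<le> K0 + 8/3 * M0 * 7" for N
  proof -
    have ex: "(\<lambda>m. (3/2 * ln (real n)) ^ m / fact m) sums real n powr (3/2)" if "n \<ge> 1" for n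
    proof -
      have "real n powr (3/2) = exp (3/2 * ln (real n))" using that by (simp add: powr_def)
      then show ?thesis using exp_converges[of "3/2 * ln (real n)"] by (simp only: real_scaleR_def divide_inverse mult.commute)
    qed
    have s: "(\<lambda>m. \<Sum>n\<in>{1..N}. kap n * c n * real n powr (-2) * ((3/2 * ln (real n)) ^ m / fact m)) sums (\<Sum>n\<in>{1..N}. kap n * c n * real n powr (-2) * real n powr (3/2))"
      by (intro sums_sum sums_mult ex) auto
    have g: "(\<lambda>m. (if m = 0 then K0 else 0) + 8/3 * M0 * (6/7) ^ m) sums (K0 + 8/3 * M0 * (1 / (1 - 6/7)))"
      by (intro sums_add sums_mult geometric_sums) (use sums_single[of 0 "\<lambda>_. K0"] in auto)
    have "(\<Sum>n\<in>{1..N}. kap n * c n * real n powr (-2) * real n powr (3/2)) \<le> K0 + 8/3 * M0 * (1 / (1 - 6/7))"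
    proof (rule sums_le[OF _ s g])
      fix m
      show "(\<Sum>n\<in>{1..N}. kap n * c n * real n powr (-2) * ((3/2 * ln (real n)) ^ m / fact m)) \<le> (if m = 0 then K0 else 0) + 8/3 * M0 * (6/7) ^ m"
      proof (cases "m = 0")
        case True
        then show ?thesis using k0[of N] M00 by simp
      next
        case False
        have "(\<Sum>n\<in>{1..N}. kap n * c n * real n powr (-2) * ((3/2 * ln (real n)) ^ m / fact m)) = (3/2) ^ m * (\<Sum>n\<in>{1..N}. kap n * c n * real n powr (-2) * (ln (real n) ^ m / fact m))"
          unfolding sum_distrib_left by (intro sum.cong) (auto simp: power_mult_distrib power_divide)
        also have "\<dots> \<le> (3/2) ^ m * (8/3 * M0 * (4/7) ^ m)" using fin[of m N] False by (intro mult_left_mono) auto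
        also have "\<dots> = 8/3 * M0 * ((3/2) ^ m * (4/7) ^ m)" by simp
        also have "(3/2) ^ m * (4/7::real) ^ m = (6/7) ^ m" by (simp add: power_mult_distrib[symmetric])
        finally show ?thesis using False by simp
      qed
    qed
    moreover have "kap n * c n * real n powr (-2) * real n powr (3/2) = kap n * c n * real n powr (-(1/2))" for n
      by (simp add: mult.assoc powr_add[symmetric])
    ultimately show ?thesis by simp
  qed
  then show ?thesis by blast
qed

end

text \<open>The \<open>i\<close>-th smallest element is at least \<open>i + 1\<close>, and the
  product over the extremal set telescopes.\<close>

lemma prod_one_minus_inverse_ge:
  assumes "finite S" "\<And>p. p \<in> S \<Longrightarrow> (2::nat) \<le> p"
  shows "1 / (real (card S) + 1) \<le> (\<Prod>p\<in>S. 1 - 1 / real p)"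
  using assms
proof (induction "card S" arbitrary: S)
  case (Suc k)
  have ne: "S \<noteq> {}" using Suc.hyps(2) by auto
  define m where "m = Max S"
  have m: "m \<in> S" using ne Suc.prems by (simp add: m_def)
  have sub: "S \<subseteq> {2..m}" using Suc.prems by (auto simp: m_def)
  have "Suc k \<le> card {2..m}" unfolding Suc.hyps(2) using sub by (intro card_mono) auto
  then have mk: "m \<ge> k + 2" by simp
  have "1 / (real k + 1) \<le> (\<Prod>p\<in>S - {m}. 1 - 1 / real p)"
  proof -
    have ck: "k = card (S - {m})" using Suc.hyps(2) m Suc.prems by simp
    have "1 / (real (card (S - {m})) + 1) \<le> (\<Prod>p\<in>S - {m}. 1 - 1 / real p)"
      by (rule Suc.hyps(1)[OF ck]) (use Suc.prems in auto)
    then show ?thesis unfolding ck[symmetric] .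
  qed
  moreover have "0 \<le> 1 - 1 / real p" if "p \<in> S" for p using Suc.prems(2)[OF that] by simp
  moreover have "1 - 1 / (real k + 2) \<le> 1 - 1 / real m" using mk by (intro diff_left_mono divide_left_mono) auto
  ultimately have "(1 / (real k + 1)) * (1 - 1 / (real k + 2)) \<le> (\<Prod>p\<in>S - {m}. 1 - 1 / real p) * (1 - 1 / real m)"
    by (intro mult_mono) (auto intro!: prod_nonneg)
  also have "\<dots> = (\<Prod>p\<in>S. 1 - 1 / real p)" using Suc.prems m by (subst prod.remove[of S m]) (auto simp: mult.commute)
  also have "(1 / (real k + 1)) * (1 - 1 / (real k + 2)) = 1 / (real (card S) + 1)" using Suc.hyps(2)[symmetric] by (simp add: divide_simps add.commute)
  finally show ?case .
qed simp

text \<open>A number \<open>n\<close> has at most \<open>log 2 n\<close> prime factors.\<close>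

lemma totient_lower:
  assumes "n > 0"
  shows "real n \<le> real (totient n) * (1 + log 2 (real n))"
proof -
  define S where "S = prime_factors n"
  have S: "finite S" "\<And>p. p \<in> S \<Longrightarrow> 2 \<le> p" using prime_ge_2_nat by (auto simp: S_def)
  have "2 ^ card S = (\<Prod>p\<in>S. 2::nat)" by simp
  also have "\<dots> \<le> (\<Prod>p\<in>S. p)" using S by (intro prod_mono) auto
  also have "\<dots> \<le> n"
  proof (rule dvd_imp_le[OF _ assms])
    show "(\<Prod>p\<in>S. p) dvd n"
    proof -
      have "(\<Prod>p\<in>S. p) dvd (\<Prod>p\<in>S. p ^ multiplicity p n)"
        unfolding S_def by (intro prod_dvd_prod dvd_power) (auto simp: prime_factors_multiplicity)
      then show ?thesis using assms by (simp add: S_def prod_prime_factors)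
    qed
  qed
  finally have "2 ^ card S \<le> n" .
  then have "(2::real) ^ card S \<le> real n" by (metis of_nat_le_iff of_nat_numeral of_nat_power)
  then have c: "real (card S) \<le> log 2 (real n)" using assms by (simp add: le_log_iff powr_realpow)
  have "1 / (1 + log 2 (real n)) \<le> 1 / (real (card S) + 1)" using c by (intro divide_left_mono) (auto intro!: mult_pos_pos add_pos_nonneg)
  also have "\<dots> \<le> (\<Prod>p\<in>S. 1 - 1 / real p)" by (rule prod_one_minus_inverse_ge[OF S])
  finally have "real n * (1 / (1 + log 2 (real n))) \<le> real n * (\<Prod>p\<in>S. 1 - 1 / real p)" by (rule mult_left_mono) simp
  also have "\<dots> = real (totient n)" unfolding S_def by (rule totient_formula2[symmetric])
  finally show ?thesis using c by (simp add: field_simps add_pos_nonneg)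
qed

lemma totient_ratio_lower:
  assumes "e > 0"
  obtains c where "c > 0" "\<And>n. n > 0 \<Longrightarrow> c * real n powr (-e) \<le> real (totient n) / real n"
proof -
  define c where "c = 1 / (1 + 2 / e)"
  have c0: "c > 0" using assms by (auto simp: c_def intro!: divide_pos_pos add_pos_pos)
  show ?thesis
  proof (rule that[OF c0])
    fix n :: nat assume n: "n > 0"
    have "log 2 (real n) = ln (real n) / ln 2" by (simp add: log_def)
    also have "\<dots> \<le> ln (real n) / (1/2)" using n ln2_ge_two_thirds by (intro divide_left_mono) auto
    also have "\<dots> \<le> 2 * (real n powr e / e)" using ln_powr_bound[of "real n" e] n assms by simp
    finally have "1 + log 2 (real n) \<le> 1 * real n powr e + 2 / e * real n powr e" using n assms ge_one_powr_ge_zero[of "real n" e] by simp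
    also have "\<dots> = real n powr e / c" by (simp add: c_def algebra_simps)
    finally have "real n \<le> real (totient n) * (real n powr e / c)"
      using totient_lower[OF n] by (meson mult_left_mono of_nat_0_le_iff order_trans)
    then have "c * real n \<le> real (totient n) * real n powr e" using c0 by (simp add: field_simps)
    then show "c * real n powr (-e) \<le> real (totient n) / real n" using n by (simp add: powr_minus field_simps)
  qed
qed

section \<open>Real characters and the value of their L-functions at 1\<close>

definition rchar :: "nat \<Rightarrow> (nat \<Rightarrow> complex) \<Rightarrow> bool" where
  "rchar q \<psi> \<longleftrightarrow> q > 0 \<and> dchar q \<psi> \<and> \<psi> \<noteq> chi0 q \<and> (\<forall>n. \<psi> n ^ 2 = chi0 q n)"

lemma rchar_real:
  assumes "rchar q \<psi>"
  shows "\<psi> n = of_real (Re (\<psi> n))" "Re (\<psi> n) \<in> {-1, 0, 1}"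
proof -
  have "\<psi> n ^ 2 = 1 \<or> \<psi> n ^ 2 = 0" using assms by (auto simp: rchar_def chi0_def)
  then have "\<psi> n = 1 \<or> \<psi> n = -1 \<or> \<psi> n = 0" by (auto simp: power2_eq_1_iff)
  then show "\<psi> n = of_real (Re (\<psi> n))" "Re (\<psi> n) \<in> {-1, 0, 1}" by auto
qed

lemma bps_dser_real:
  assumes "bps K f" "x > 0" "\<And>n. f n = of_real (r n)"
  shows "Im (dser f (of_real x)) = 0"
proof -
  have "(\<lambda>n. f n * of_nat n powr (- of_real x)) sums dser f (of_real x)"
    unfolding dser_def by (rule summable_sums[OF bps_summable[OF assms(1)]]) (use assms in simp)
  from sums_Im[OF this] have "(\<lambda>n. 0) sums Im (dser f (of_real x))" unfolding assms(3) nat_powr_of_real by simp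
  then show ?thesis using sums_unique2 sums_zero by blast
qed

context
  fixes q \<psi> assumes r: "rchar q \<psi>"
begin

lemma rchar_bps: "bps (real q) \<psi>" and rchar_cmul: "cmul \<psi>"
  using r dchar_bps dchar_cmul by (auto simp: rchar_def)

lemma rchar_L_real: "x > 0 \<Longrightarrow> Im (dser \<psi> (of_real x)) = 0"
  by (rule bps_dser_real[OF rchar_bps _ rchar_real(1)[OF r]])

lemma rchar_L_hol: "dser \<psi> holomorphic_on {s. Re s > 0}"
  by (rule bps_holomorphic[OF rchar_bps])

lemma rchar_L_bound: "norm (s - 2) \<le> 7/4 \<Longrightarrow> norm (dser \<psi> s) \<le> 15 * real q"
proof -
  assume s: "norm (s - 2) \<le> 7/4"
  have "- (7/4) \<le> Re (s - 2)" using abs_Re_le_cmod[of "s - 2"] s by linarith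
  then have re: "Re s \<ge> 1/4" by simp
  have "norm s \<le> 15/4" using norm_triangle_ineq2[of s 2] s by simp
  then have "real q * norm s / Re s \<le> real q * (15/4) / (1/4)" using re by (intro frac_le mult_left_mono) auto
  then show ?thesis using dser_bps_bound[OF rchar_bps, of s] re by simp
qed

lemma rchar_L_pos: "x > 1 \<Longrightarrow> Re (dser \<psi> (of_real x)) > 0"
proof -
  assume x: "x > 1"
  have "dser \<psi> (of_real x) = exp (dser (\<lambda>n. of_real (kap n) * \<psi> n) (of_real x))"
    using dser_eq_exp[OF rchar_cmul, of "of_real x"] x by simp
  moreover have "Im (dser (\<lambda>n. of_real (kap n) * \<psi> n) (of_real x)) = 0"
    by (rule Re_dser_real(2)[OF slow_kap[OF cmul_slow[OF rchar_cmul]] x, of "\<lambda>n. kap n * Re (\<psi> n)"])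
       (use rchar_real(1)[OF r] in \<open>simp add: complex_eq_iff\<close>)
  ultimately show ?thesis by (simp add: Re_exp)
qed

end

lemma zg_bound_disc: obtains Z where "Z \<ge> 1" "\<And>s. norm (s - 2) \<le> 7/4 \<Longrightarrow> norm (zg s) \<le> Z"
proof -
  have re: "Re s \<ge> 1/4" "norm s \<le> 15/4" "norm (s - 1) \<le> 11/4" if s: "norm (s - 2) \<le> 7/4" for s
  proof -
    have "- (7/4) \<le> Re (s - 2)" using abs_Re_le_cmod[of "s - 2"] s by linarith
    then show "Re s \<ge> 1/4" by simp
    show "norm s \<le> 15/4" using norm_triangle_ineq2[of s 2] s by simp
    show "norm (s - 1) \<le> 11/4" using norm_triangle_ineq[of "s - 2" 1] s by simp
  qed
  show ?thesis
  proof (rule that[of 100])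
    fix s :: complex assume s: "norm (s - 2) \<le> 7/4"
    have "norm (zg s - 1) \<le> norm (s - 1) * (norm s / Re s)" using zg_near[of s] re[OF s] by simp
    also have "\<dots> \<le> 11/4 * ((15/4) / (1/4))" using re[OF s] by (intro mult_mono frac_le) auto
    finally show "norm (zg s) \<le> 100" using norm_triangle_ineq2[of "zg s" 1] by simp
  qed simp
qed

lemma zg_real_pos:
  assumes "7/8 \<le> x" "x \<le> 1"
  shows "Im (zg (of_real x)) = 0" "Re (zg (of_real x)) > 0"
proof -
  have "norm (complex_of_real x - 1) = 1 - x" using assms norm_of_real[of "x - 1", where 'a = complex] by simp
  then have "norm (zg (of_real x) - 1) \<le> 1 - x" using zg_near[of "of_real x"] assms by simp
  then have "\<bar>Re (zg (of_real x) - 1)\<bar> \<le> 1 - x" using abs_Re_le_cmod order_trans by blast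
  then show "Re (zg (of_real x)) > 0" using assms by simp
  have "zv (Suc n) (of_real x) = of_real ((x - 1) * real (Suc n) powr (-x) + real (Suc n + 1) powr (1 - x) - real (Suc n) powr (1 - x))" for n
  proof -
    have "of_nat k powr (1 - of_real x) = complex_of_real (real k powr (1 - x))" for k
      using powr_of_real[of "real k" "1 - x"] by simp
    then show ?thesis unfolding zv_def nat_powr_of_real by (simp del: of_nat_Suc)
  qed
  then have "Im (zv (Suc n) (of_real x)) = 0" for n by (metis Im_complex_of_real)
  moreover have "(\<lambda>n. Im (zv (Suc n) (of_real x))) sums Im (\<Sum>n. zv (Suc n) (of_real x))"
    by (intro sums_Im summable_sums zg_tail(1)) (use assms in simp)
  ultimately have "(\<lambda>n. 0) sums Im (\<Sum>n. zv (Suc n) (of_real x))" by simp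
  then have "Im (\<Sum>n. zv (Suc n) (of_real x)) = 0" using sums_unique2 sums_zero by blast
  then show "Im (zg (of_real x)) = 0" by (simp add: zg_def)
qed

lemma two_fold:
  assumes r: "rchar q \<psi>"
  defines "c \<equiv> \<lambda>n. 1 + Re (\<psi> n)"
  shows "nonneg_log c" "Re s > 1 \<Longrightarrow> zg s * dser \<psi> s = (s - 1) * nonneg_log.FF c s"
proof -
  show nl: "nonneg_log c"
  proof
    fix n
    show "0 \<le> c n" "c n \<le> 4" using rchar_real(2)[OF r, of n] by (auto simp: c_def)
  qed
  assume s: "Re s > 1"
  have "(\<lambda>n. of_real (kap n) * complex_of_real (c n)) = (\<lambda>n. of_real (kap n) * 1 + of_real (kap n) * \<psi> n)"
    using rchar_real(1)[OF r] by (auto simp: c_def complex_eq_iff algebra_simps)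
  then have "nonneg_log.PP c s = dser (\<lambda>n. of_real (kap n) * 1) s + dser (\<lambda>n. of_real (kap n) * \<psi> n) s"
    unfolding nonneg_log.PP_def[OF nl] using dser_add[OF slow_kap[OF slow_1] slow_kap[OF cmul_slow[OF rchar_cmul[OF r]]] s] by simp
  then show "zg s * dser \<psi> s = (s - 1) * nonneg_log.FF c s"
    unfolding nonneg_log.FF_def[OF nl] zg_eq[OF s] dser_eq_exp[OF cmul_one s] dser_eq_exp[OF rchar_cmul[OF r] s]
    by (simp add: exp_add)
qed

text \<open>The identity \<open>1 + \<psi> + \<xi> + \<psi> \<xi> = (1 + \<psi>) (1 + \<xi>)\<close>
  makes the coefficients of the logarithm nonnegative; this is why the character
  \<open>\<psi> \<xi>\<close> must join the product.\<close>

lemma four_fold: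
  assumes r: "rchar q \<psi>" "rchar p \<xi>" and r12: "rchar (q * p) (\<lambda>n. \<psi> n * \<xi> n)"
  defines "c \<equiv> \<lambda>n. (1 + Re (\<psi> n)) * (1 + Re (\<xi> n))"
  shows "nonneg_log c" "Re s > 1 \<Longrightarrow> zg s * dser \<psi> s * dser \<xi> s * dser (\<lambda>n. \<psi> n * \<xi> n) s = (s - 1) * nonneg_log.FF c s"
proof -
  show nl: "nonneg_log c"
  proof
    fix n
    show "0 \<le> c n" "c n \<le> 4" using rchar_real(2)[OF r(1), of n] rchar_real(2)[OF r(2), of n] by (auto simp: c_def)
  qed
  assume s: "Re s > 1"
  note sl = slow_kap[OF slow_1] slow_kap[OF cmul_slow[OF rchar_cmul[OF r(1)]]] slow_kap[OF cmul_slow[OF rchar_cmul[OF r(2)]]] slow_kap[OF cmul_slow[OF rchar_cmul[OF r12]]]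
  have "(\<lambda>n. of_real (kap n) * complex_of_real (c n)) =
     (\<lambda>n. of_real (kap n) * 1 + of_real (kap n) * \<psi> n + of_real (kap n) * \<xi> n + of_real (kap n) * (\<psi> n * \<xi> n))"
  proof
    fix n
    have "complex_of_real (c n) = (1 + \<psi> n) * (1 + \<xi> n)"
      by (subst rchar_real(1)[OF r(1)], subst rchar_real(1)[OF r(2)]) (simp add: c_def)
    then show "of_real (kap n) * complex_of_real (c n) = of_real (kap n) * 1 + of_real (kap n) * \<psi> n + of_real (kap n) * \<xi> n + of_real (kap n) * (\<psi> n * \<xi> n)"
      by (simp add: algebra_simps)
  qed
  then have "nonneg_log.PP c s = dser (\<lambda>n. of_real (kap n) * 1) s + dser (\<lambda>n. of_real (kap n) * \<psi> n) s + dser (\<lambda>n. of_real (kap n) * \<xi> n) s + dser (\<lambda>n. of_real (kap n) * (\<psi> n * \<xi> n)) s"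
    unfolding nonneg_log.PP_def[OF nl] using dser_add[OF slow_add[OF slow_add[OF sl(1,2)] sl(3)] sl(4) s]
      dser_add[OF slow_add[OF sl(1,2)] sl(3) s] dser_add[OF sl(1,2) s] by simp
  then show "zg s * dser \<psi> s * dser \<xi> s * dser (\<lambda>n. \<psi> n * \<xi> n) s = (s - 1) * nonneg_log.FF c s"
    unfolding nonneg_log.FF_def[OF nl] zg_eq[OF s] dser_eq_exp[OF cmul_one s] dser_eq_exp[OF rchar_cmul[OF r(1)] s]
      dser_eq_exp[OF rchar_cmul[OF r(2)] s] dser_eq_exp[OF rchar_cmul[OF r12] s]
    by (simp add: exp_add)
qed

text \<open>The residue at 1 of the L-function of the principal character, taken along a sequence
  from the right.\<close>

lemma chi0_lim:
  assumes "q > 0"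
  shows "(\<lambda>n. of_real (1 / (real n + 1)) * dser (chi0 q) (of_real (1 + 1 / (real n + 1)))) \<longlonglongrightarrow> of_real (real (totient q) / real q)"
proof -
  define x where "x = (\<lambda>n. 1 + 1 / (real n + 1))"
  define f where "f = (\<lambda>s. of_real (real (totient q) / real q) * zg s + (s - 1) * dser (chif q) s)"
  have "(\<lambda>n. f (of_real (x n))) \<longlonglongrightarrow> f 1" unfolding x_def
    by (rule tendsto_right_1, rule isCont_Re_pos)
       (auto simp: f_def intro!: holomorphic_intros zg_holomorphic bps_holomorphic[OF chif_bps(1)[OF assms]])
  moreover have "f (of_real (x n)) = of_real (1 / (real n + 1)) * dser (chi0 q) (of_real (x n))" for n
  proof -
    have s: "Re (complex_of_real (x n)) > 1" by (simp add: x_def)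
    show ?thesis unfolding f_def zg_eq[OF s] dser_chi0[OF assms s] by (simp add: x_def algebra_simps)
  qed
  ultimately show ?thesis by (simp add: f_def x_def)
qed

lemma rchar_L1_nonneg: "rchar q \<psi> \<Longrightarrow> Re (dser \<psi> 1) \<ge> 0"
proof -
  assume r: "rchar q \<psi>"
  have "(\<lambda>n. Re (dser \<psi> (of_real (1 + 1 / (real n + 1))))) \<longlonglongrightarrow> Re (dser \<psi> 1)"
    by (intro tendsto_Re tendsto_right_1 isCont_Re_pos[OF rchar_L_hol[OF r]]) simp
  moreover have "0 \<le> Re (dser \<psi> (of_real (1 + 1 / (real n + 1))))" for n
    by (intro less_imp_le rchar_L_pos[OF r]) simp
  ultimately show ?thesis by (intro LIMSEQ_le_const) blast+
qed

text \<open>A square is a prime power exactly when its root is, with doubled exponent. It ties the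
  series at exponent 1/2, restricted to squares, to the series at exponent 1.\<close>

lemma kap_square: "kap (k ^ 2) = kap k / 2"
proof (cases "k = 0")
  case False
  have "mangoldt (k ^ 2) = (mangoldt k :: real)"
  proof (cases "primepow k")
    case True
    then obtain p n where p: "prime p" "n > 0" "k = p ^ n" by (auto simp: primepow_def)
    then have "k ^ 2 = p ^ (n * 2)" by (simp add: power_mult)
    then show ?thesis using p by (simp add: mangoldt_primepow)
  next
    case f: False
    then have "\<not> primepow (k ^ 2)" using primepow_power_iff_nat[of k 2] False by simp
    then show ?thesis using f by (simp add: mangoldt_def)
  qed
  then show ?thesis using False by (simp add: kap_def ln_realpow)
qed (simp add: kap_def)

text \<open>If the value at 1 were zero, \<open>vanishing_bound\<close> would bound the logarithmic
  series at exponent 1/2. Its squares alone, where the character equals \<open>chi0\<close>, give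
  the logarithm of the principal L-function at exponent 1. That would stay bounded near 1, against
  the pole found in \<open>chi0_lim\<close>.\<close>

lemma rchar_L1_pos:
  assumes r: "rchar q \<psi>" shows "Re (dser \<psi> 1) > 0"
proof (rule ccontr)
  assume "\<not> ?thesis"
  then have "Re (dser \<psi> 1) = 0" using rchar_L1_nonneg[OF r] by simp
  then have L0: "dser \<psi> 1 = 0" using rchar_L_real[OF r, of 1] by (simp add: complex_eq_iff)
  have q: "q > 0" using r by (simp add: rchar_def)
  define c where "c = (\<lambda>n. 1 + Re (\<psi> n))"
  interpret nonneg_log c unfolding c_def by (rule two_fold(1)[OF r])
  obtain Z where Z: "Z \<ge> 1" "\<And>s. norm (s - 2) \<le> 7/4 \<Longrightarrow> norm (zg s) \<le> Z" by (rule zg_bound_disc) blast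
  have "\<exists>K. \<forall>N. (\<Sum>n\<in>{1..N}. kap n * c n * real n powr (-(1/2))) \<le> K"
  proof (rule vanishing_bound[of "\<lambda>s. zg s * dser \<psi> s" "Z * (15 * real q)"])
    show "(\<lambda>s. zg s * dser \<psi> s) holomorphic_on {s. Re s > 0}"
      by (intro holomorphic_intros zg_holomorphic rchar_L_hol[OF r])
    show "zg s * dser \<psi> s = (s - 1) * FF s" if "Re s > 1" for s
      using two_fold(2)[OF r that] by (simp add: c_def)
    show "norm (zg s * dser \<psi> s) \<le> Z * (15 * real q)" if "norm (s - 2) \<le> 7/4" for s
      unfolding norm_mult using Z rchar_L_bound[OF r that] that by (intro mult_mono) auto
  qed (use L0 in simp)
  then obtain K where K: "\<And>N. (\<Sum>n\<in>{1..N}. kap n * c n * real n powr (-(1/2))) \<le> K" by blast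
  have sq: "(\<Sum>k\<in>{1..N}. kap k * Re (chi0 q k) * real k powr (-1)) \<le> K" for N
  proof -
    have "(\<Sum>k\<in>{1..N}. kap k * Re (chi0 q k) * real k powr (-1)) \<le> (\<Sum>k\<in>{1..N}. kap (k^2) * c (k^2) * real (k^2) powr (-(1/2)))"
    proof (rule sum_mono)
      fix k assume k: "k \<in> {1..N}"
      have "\<psi> (k^2) = chi0 q k"
      proof -
        have "\<psi> (k * k) = \<psi> k * \<psi> k" using r by (auto simp: rchar_def dchar_def)
        then show ?thesis using r by (simp add: rchar_def power2_eq_square)
      qed
      moreover have "real (k^2) powr (-(1/2)) = real k powr (-1)" using k by (simp add: powr_minus powr_half_sqrt)
      moreover have "Re (chi0 q k) \<le> 1/2 * (1 + Re (chi0 q k))" by (simp add: chi0_def)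
      then have "kap k * Re (chi0 q k) * real k powr (-1) \<le> kap k * (1/2 * (1 + Re (chi0 q k))) * real k powr (-1)"
        by (intro mult_right_mono mult_left_mono kap_nonneg) auto
      ultimately show "kap k * Re (chi0 q k) * real k powr (-1) \<le> kap (k^2) * c (k^2) * real (k^2) powr (-(1/2))"
        by (simp add: c_def kap_square)
    qed
    also have "\<dots> = (\<Sum>n\<in>(\<lambda>k. k^2) ` {1..N}. kap n * c n * real n powr (-(1/2)))"
      by (subst sum.reindex) (auto simp: inj_on_def power2_eq_iff)
    also have "\<dots> \<le> (\<Sum>n\<in>{1..N^2}. kap n * c n * real n powr (-(1/2)))"
      using c0 kap_nonneg by (intro sum_mono2) (auto simp: power_mono)
    also have "\<dots> \<le> K" by (rule K)
    finally show ?thesis .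
  qed
  have cm0: "cmul (chi0 q)" using dchar_cmul[OF dchar_chi0 q] .
  have bnd: "norm (dser (chi0 q) (of_real x)) \<le> exp K" if x: "x > 1" for x
  proof -
    have e: "of_real (kap n) * chi0 q n = complex_of_real (kap n * Re (chi0 q n))" for n by (simp add: chi0_def)
    have s: "(\<lambda>n. kap n * Re (chi0 q n) * real n powr (-x)) sums Re (dser (\<lambda>n. of_real (kap n) * chi0 q n) (of_real x))"
      by (rule Re_dser_real(1)[OF slow_kap[OF cmul_slow[OF cm0]] x e])
    have "Re (dser (\<lambda>n. of_real (kap n) * chi0 q n) (of_real x)) \<le> K"
    proof (rule LIMSEQ_le_const2)
      show "(\<lambda>N. \<Sum>n<N. kap n * Re (chi0 q n) * real n powr (-x)) \<longlonglongrightarrow> Re (dser (\<lambda>n. of_real (kap n) * chi0 q n) (of_real x))"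
        using s by (simp add: sums_def)
      have "(\<Sum>n<N. kap n * Re (chi0 q n) * real n powr (-x)) \<le> K" for N
      proof -
        have "(\<Sum>n<N. kap n * Re (chi0 q n) * real n powr (-x)) \<le> (\<Sum>n\<in>{0..N}. kap n * Re (chi0 q n) * real n powr (-x))"
          using kap_nonneg by (intro sum_mono2) (auto simp: chi0_def)
        also have "\<dots> = (\<Sum>n\<in>{1..N}. kap n * Re (chi0 q n) * real n powr (-x))"
          by (subst sum.atLeast_Suc_atMost) auto
        also have "\<dots> \<le> (\<Sum>n\<in>{1..N}. kap n * Re (chi0 q n) * real n powr (-1))"
          using kap_nonneg x by (intro sum_mono mult_left_mono powr_mono mult_nonneg_nonneg) (auto simp: chi0_def)
        also have "\<dots> \<le> K" by (rule sq)
        finally show ?thesis .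
      qed
      then show "\<exists>N. \<forall>n\<ge>N. (\<Sum>n<n. kap n * Re (chi0 q n) * real n powr (-x)) \<le> K" by blast
    qed
    then show ?thesis using dser_eq_exp[OF cm0, of "of_real x"] x by simp
  qed
  have "(\<lambda>n. norm (of_real (1 / (real n + 1)) * dser (chi0 q) (of_real (1 + 1 / (real n + 1))))) \<longlonglongrightarrow> norm (complex_of_real (real (totient q) / real q))"
    by (intro tendsto_norm chi0_lim[OF q])
  moreover have "(\<lambda>n. norm (of_real (1 / (real n + 1)) * dser (chi0 q) (of_real (1 + 1 / (real n + 1))))) \<longlonglongrightarrow> 0"
  proof (rule tendsto_sandwich[of "\<lambda>_. 0" _ _ "\<lambda>n. 1 / (real n + 1) * exp K"])
    have "(\<lambda>n. inverse (real (Suc n)) * exp K) \<longlonglongrightarrow> 0 * exp K" by (intro tendsto_mult LIMSEQ_inverse_real_of_nat tendsto_const)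
    then show "(\<lambda>n. 1 / (real n + 1) * exp K) \<longlonglongrightarrow> 0" by (simp add: divide_inverse add.commute)
    have "norm (of_real (1 / (real n + 1)) * dser (chi0 q) (of_real (1 + 1 / (real n + 1)))) \<le> 1 / (real n + 1) * exp K" for n
    proof -
      have "norm (complex_of_real (1 / (real n + 1))) = 1 / (real n + 1)" unfolding norm_of_real by simp
      then show ?thesis unfolding norm_mult using bnd[of "1 + 1 / (real n + 1)"] by (simp only:) (intro mult_left_mono, auto)
    qed
    then show "eventually (\<lambda>n. norm (of_real (1 / (real n + 1)) * dser (chi0 q) (of_real (1 + 1 / (real n + 1)))) \<le> 1 / (real n + 1) * exp K) sequentially" by simp
  qed auto
  ultimately have "norm (complex_of_real (real (totient q) / real q)) = 0" using LIMSEQ_unique by blast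
  then show False using q by simp
qed

text \<open>When the product is principal, the two characters agree at every \<open>n\<close> prime
  to \<open>q * p\<close>, so \<open>\<psi> + chi0 \<le> \<xi> + 1\<close> holds at every
  \<open>n\<close>. Comparing logarithms on the real axis right of 1, multiplying by
  \<open>s - 1\<close> and letting \<open>s\<close> tend to 1 gives the claim.\<close>

lemma equivalent_lower:
  assumes r: "rchar q \<psi>" "rchar p \<xi>" and e: "(\<lambda>n. \<psi> n * \<xi> n) = chi0 (q * p)"
  shows "Re (dser \<xi> 1) \<ge> Re (dser \<psi> 1) * (real (totient (q * p)) / real (q * p))"
proof -
  define Q where "Q = q * p"
  have Q: "Q > 0" using r by (auto simp: Q_def rchar_def)
  define x where "x = (\<lambda>n. 1 + 1 / (real n + 1))"
  have cm0: "cmul (chi0 Q)" using dchar_cmul[OF dchar_chi0 Q] .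
  have lex: "\<exists>a b u v. (dser \<psi> (of_real y) = of_real (exp a) \<and> dser \<xi> (of_real y) = of_real (exp b) \<and> dser (\<lambda>_. 1) (of_real y) = of_real (exp u) \<and> dser (chi0 Q) (of_real y) = of_real (exp v) \<and> a + v \<le> b + u)" if y: "y > 1" for y
  proof -
    have R: "\<exists>a. (\<lambda>n. kap n * Re (f n) * real n powr (-y)) sums a \<and> dser f (of_real y) = of_real (exp a)" if f: "cmul f" "\<And>n. f n = of_real (Re (f n))" for f
    proof -
      have e: "of_real (kap n) * f n = complex_of_real (kap n * Re (f n))" for n by (subst f(2)) simp
      note R = Re_dser_real[OF slow_kap[OF cmul_slow[OF f(1)]] y, of "\<lambda>n. kap n * Re (f n)", OF e]
      have "dser (\<lambda>n. of_real (kap n) * f n) (of_real y) = of_real (Re (dser (\<lambda>n. of_real (kap n) * f n) (of_real y)))"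
        using R(2) by (simp add: complex_eq_iff)
      then have "dser f (of_real y) = of_real (exp (Re (dser (\<lambda>n. of_real (kap n) * f n) (of_real y))))"
        using dser_eq_exp[OF f(1), of "of_real y"] y by (metis Re_complex_of_real exp_of_real)
      then show ?thesis using R(1) by blast
    qed
    obtain a where a: "(\<lambda>n. kap n * Re (\<psi> n) * real n powr (-y)) sums a" "dser \<psi> (of_real y) = of_real (exp a)" using R[OF rchar_cmul[OF r(1)] rchar_real(1)[OF r(1)]] by blast
    obtain b where b: "(\<lambda>n. kap n * Re (\<xi> n) * real n powr (-y)) sums b" "dser \<xi> (of_real y) = of_real (exp b)" using R[OF rchar_cmul[OF r(2)] rchar_real(1)[OF r(2)]] by blast
    obtain u where u: "(\<lambda>n. kap n * Re 1 * real n powr (-y)) sums u" "dser (\<lambda>_. 1) (of_real y) = of_real (exp u)" using R[OF cmul_one] by auto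
    obtain v where v: "(\<lambda>n. kap n * Re (chi0 Q n) * real n powr (-y)) sums v" "dser (chi0 Q) (of_real y) = of_real (exp v)" using R[OF cm0] by (auto simp: chi0_def)
    have "a + v \<le> b + u"
    proof (rule sums_le[OF _ sums_add[OF a(1) v(1)] sums_add[OF b(1) u(1)]])
      fix n
      have "Re (\<psi> n) + Re (chi0 Q n) \<le> Re (\<xi> n) + Re 1"
      proof (cases "coprime n Q")
        case True
        then have "\<psi> n * \<xi> n = 1" using fun_cong[OF e, of n] by (simp add: chi0_def Q_def)
        then have "Re (\<psi> n) * Re (\<xi> n) = 1" by (subst (asm) rchar_real(1)[OF r(1)], subst (asm) rchar_real(1)[OF r(2)]) (simp add: complex_eq_iff)
        then have "Re (\<psi> n) = Re (\<xi> n)" using rchar_real(2)[OF r(1), of n] rchar_real(2)[OF r(2), of n] by auto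
        then show ?thesis using True by (simp add: chi0_def)
      next
        case False
        then have "\<psi> n * \<xi> n = 0" using fun_cong[OF e, of n] by (simp add: chi0_def Q_def)
        then have "Re (\<psi> n) = 0 \<or> Re (\<xi> n) = 0" by auto
        then show ?thesis using False rchar_real(2)[OF r(1), of n] rchar_real(2)[OF r(2), of n] by (auto simp: chi0_def)
      qed
      then have "kap n * real n powr (-y) * (Re (\<psi> n) + Re (chi0 Q n)) \<le> kap n * real n powr (-y) * (Re (\<xi> n) + Re 1)"
        using kap_nonneg by (intro mult_left_mono) auto
      then show "kap n * Re (\<psi> n) * real n powr - y + kap n * Re (chi0 Q n) * real n powr - y \<le> kap n * Re (\<xi> n) * real n powr - y + kap n * Re 1 * real n powr - y"
        by (simp add: algebra_simps)
    qed
    then show ?thesis using a b u v by blast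
  qed
  have ineq: "Re (dser \<psi> (of_real (x n))) * Re (of_real (1 / (real n + 1)) * dser (chi0 Q) (of_real (x n))) \<le> Re (dser \<xi> (of_real (x n))) * Re (zg (of_real (x n)))" for n
  proof -
    have xn: "x n > 1" by (simp add: x_def)
    obtain a b u v where h: "dser \<psi> (of_real (x n)) = of_real (exp a)" "dser \<xi> (of_real (x n)) = of_real (exp b)"
      "dser (\<lambda>_. 1) (of_real (x n)) = of_real (exp u)" "dser (chi0 Q) (of_real (x n)) = of_real (exp v)" "a + v \<le> b + u"
      using lex[OF xn] by blast
    have z: "zg (of_real (x n)) = of_real (1 / (real n + 1) * exp u)" using zg_eq[of "of_real (x n)"] xn h(3) by (simp add: x_def)
    have "exp a * exp v \<le> exp b * exp u" using h(5) by (simp flip: exp_add)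
    then have "exp a * exp v / (real n + 1) \<le> exp b * exp u / (real n + 1)" by (rule divide_right_mono) simp
    then show ?thesis unfolding z h by simp
  qed
  have "Re (dser \<psi> 1) * Re (of_real (real (totient Q) / real Q)) \<le> Re (dser \<xi> 1) * Re (zg 1)"
  proof (rule LIMSEQ_le)
    show "(\<lambda>n. Re (dser \<psi> (of_real (x n))) * Re (of_real (1 / (real n + 1)) * dser (chi0 Q) (of_real (x n)))) \<longlonglongrightarrow> Re (dser \<psi> 1) * Re (of_real (real (totient Q) / real Q))"
      unfolding x_def by (intro tendsto_mult tendsto_Re tendsto_right_1 chi0_lim[OF Q] isCont_Re_pos[OF rchar_L_hol[OF r(1)]]) simp
    show "(\<lambda>n. Re (dser \<xi> (of_real (x n))) * Re (zg (of_real (x n)))) \<longlonglongrightarrow> Re (dser \<xi> 1) * Re (zg 1)"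
      unfolding x_def by (intro tendsto_mult tendsto_Re tendsto_right_1 isCont_Re_pos[OF zg_holomorphic] isCont_Re_pos[OF rchar_L_hol[OF r(2)]]) simp_all
    show "\<exists>N. \<forall>n\<ge>N. Re (dser \<psi> (of_real (x n))) * Re (of_real (1 / (real n + 1)) * dser (chi0 Q) (of_real (x n))) \<le> Re (dser \<xi> (of_real (x n))) * Re (zg (of_real (x n)))"
      using ineq by blast
  qed
  then show ?thesis by (simp add: Q_def)
qed

text \<open>Either no real character has a negative value at \<open>x0\<close>, and
  \<open>estermann\<close> applies to zeta times L at \<open>x0\<close>; or one such character is
  fixed as \<open>\<psi>1\<close>, and \<open>estermann\<close> applies to the four-fold product at
  a real zero \<open>b\<close> of its L-function. The final constant depends on
  \<open>\<psi>1\<close>, which is legitimate because it is chosen once for each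
  \<open>e\<close>.\<close>

theorem siegel:
  assumes "e > 0"
  obtains c where "c > 0" "\<And>q \<psi>. rchar q \<psi> \<Longrightarrow> Re (dser \<psi> 1) \<ge> c * real q powr (-e)"
proof -
  \<comment> \<open>The lower bound for the four-fold product costs
    \<open>q powr (6 * \<epsilon>)\<close>, from \<open>(q^2) powr (3 * (1 - b))\<close>; the upper
    bound for the L-value of \<open>\<psi>1 \<psi>\<close> at 1 costs one more
    \<open>\<epsilon>\<close>. The cap 1/8 keeps \<open>x0\<close> in the range of
    \<open>estermann\<close>.\<close>
  define \<epsilon> where "\<epsilon> = min (1/8) (e / 7)"
  have \<epsilon>: "0 < \<epsilon>" "\<epsilon> \<le> 1/8" "7 * \<epsilon> \<le> e" using assms by (auto simp: \<epsilon>_def)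
  define x0 where "x0 = 1 - \<epsilon>"
  have x0: "7/8 \<le> x0" "x0 < 1" using \<epsilon> by (auto simp: x0_def)
  obtain Z where Z: "Z \<ge> 1" "\<And>s. norm (s - 2) \<le> 7/4 \<Longrightarrow> norm (zg s) \<le> Z" by (rule zg_bound_disc) blast
  have mono: "real q powr (-a) \<ge> real q powr (-e)" if "q > 0" "a \<le> e" for q :: nat and a using that by (intro powr_mono) auto
  define c1 where "c1 = \<epsilon> / 6 * (16 * (Z * 15)) powr (-3 * \<epsilon>)"
  have c1: "c1 > 0" using \<epsilon> Z by (simp add: c1_def)
  have A: "Re (dser \<psi> 1) \<ge> c1 * real q powr (-e)" if r: "rchar q \<psi>" and L: "Re (dser \<psi> (of_real x0)) \<ge> 0" for q \<psi>
  proof -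
    have q: "q \<ge> 1" using r by (simp add: rchar_def Suc_le_eq)
    define c where "c = (\<lambda>n. 1 + Re (\<psi> n))"
    interpret nonneg_log c unfolding c_def by (rule two_fold(1)[OF r])
    have "Re (zg 1 * dser \<psi> 1) \<ge> (1 - x0) / 6 * (16 * (Z * (15 * real q))) powr (-3 * (1 - x0))"
    proof (rule estermann[of "\<lambda>s. zg s * dser \<psi> s"])
      show "(\<lambda>s. zg s * dser \<psi> s) holomorphic_on {s. Re s > 0}"
        by (intro holomorphic_intros zg_holomorphic rchar_L_hol[OF r])
      show "zg s * dser \<psi> s = (s - 1) * FF s" if "Re s > 1" for s
        using two_fold(2)[OF r that] by (simp add: c_def)
      show "norm (zg s * dser \<psi> s) \<le> Z * (15 * real q)" if "norm (s - 2) \<le> 7/4" for s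
        unfolding norm_mult using Z rchar_L_bound[OF r that] that by (intro mult_mono) auto
      have "1 * 1 \<le> Z * (15 * real q)" using Z q by (intro mult_mono) auto
      then show "1 \<le> Z * (15 * real q)" by simp
      show "0 \<le> Re (zg (of_real x0) * dser \<psi> (of_real x0))"
        using zg_real_pos[of x0] x0 L by simp
    qed (use x0 in auto)
    also have "(16 * (Z * (15 * real q))) powr (-3 * (1 - x0)) = (16 * (Z * 15)) powr (-3 * \<epsilon>) * real q powr (-3 * \<epsilon>)"
      unfolding x0_def by (simp add: powr_mult[symmetric] mult_ac)
    finally have "c1 * real q powr (-(3 * \<epsilon>)) \<le> Re (dser \<psi> 1)" by (simp add: c1_def x0_def mult.assoc)
    moreover have "c1 * real q powr (-e) \<le> c1 * real q powr (-(3 * \<epsilon>))" using c1 q \<epsilon> by (intro mult_left_mono mono) auto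
    ultimately show ?thesis by linarith
  qed
  show ?thesis
  proof (cases "\<exists>q \<psi>. rchar q \<psi> \<and> Re (dser \<psi> (of_real x0)) < 0")
    case False
    then show ?thesis using A by (intro that[OF c1]) (meson not_le)
  next
    case True
    then obtain q1 \<psi>1 where r1: "rchar q1 \<psi>1" "Re (dser \<psi>1 (of_real x0)) < 0" by blast
    have q1: "q1 \<ge> 1" using r1 by (simp add: rchar_def Suc_le_eq)
    \<comment> \<open>At a zero of one factor the four-fold product vanishes whatever the other
      factors are, so the sign condition of \<open>estermann\<close> holds for every
      \<open>\<psi>\<close>.\<close>
    have "\<exists>b\<ge>x0. b \<le> 1 \<and> Re (dser \<psi>1 (of_real b)) = 0"
    proof (rule IVT')
      show "Re (dser \<psi>1 (of_real x0)) \<le> 0" "0 \<le> Re (dser \<psi>1 (of_real 1))" using r1 rchar_L1_nonneg by auto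
      show "continuous_on {x0..1} (\<lambda>x. Re (dser \<psi>1 (of_real x)))"
      proof (intro continuous_at_imp_continuous_on ballI)
        fix x assume "x \<in> {x0..1}"
        then have "isCont (dser \<psi>1) (of_real x)" using x0 by (intro isCont_Re_pos[OF rchar_L_hol[OF r1(1)]]) auto
        then show "isCont (\<lambda>x. Re (dser \<psi>1 (of_real x))) x"
          by (rule isCont_Re[OF isCont_o2[where f = complex_of_real, rotated]]) (rule continuous_of_real[OF continuous_ident])
      qed
    qed (use x0 in auto)
    then obtain b where b: "x0 \<le> b" "b \<le> 1" "Re (dser \<psi>1 (of_real b)) = 0" by blast
    have b1: "b < 1" using b rchar_L1_pos[OF r1(1)] by (cases "b = 1") auto
    have Lb: "dser \<psi>1 (of_real b) = 0" using b x0 rchar_L_real[OF r1(1), of b] by (simp add: complex_eq_iff)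
    define L1 where "L1 = Re (dser \<psi>1 1)"
    have L1: "L1 > 0" using rchar_L1_pos[OF r1(1)] by (simp add: L1_def)
    have e2: "\<epsilon> \<le> 1/2" using \<epsilon> by simp
    obtain G where G: "G > 0" "\<And>K f s. K \<ge> 1 \<Longrightarrow> bps K f \<Longrightarrow> (\<And>n. norm (f n) \<le> 1) \<Longrightarrow> 1 - \<epsilon> \<le> Re s \<Longrightarrow> Re s \<le> 4 \<Longrightarrow> norm (dser f s) \<le> G * (K * (\<bar>Im s\<bar> + 2)) powr \<epsilon>"
      by (rule dser_growth[OF \<epsilon>(1) e2]) blast
    obtain t where t: "t > 0" "\<And>n. n > 0 \<Longrightarrow> t * real n powr (-e) \<le> real (totient n) / real n"
      using totient_ratio_lower[OF assms] by blast
    define cB where "cB = L1 * t * real q1 powr (-e)"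
    have cB: "cB > 0" using L1 t q1 by (simp add: cB_def)
    define K0 where "K0 = 16 * (Z * 15 ^ 3 * real q1 ^ 2)"
    have K0: "K0 > 0" using Z q1 by (simp add: K0_def)
    define cC where "cC = ((1 - b) / 6 * min 1 (K0 powr (-3 * \<epsilon>))) / (L1 * (G * (2 * real q1) powr \<epsilon>))"
    have den: "L1 * (G * (2 * real q1) powr \<epsilon>) > 0" using L1 G q1 by simp
    have cC: "cC > 0" unfolding cC_def using den b1 K0 by (intro divide_pos_pos) auto
    define cc where "cc = min c1 (min cB cC)"
    have cc: "cc > 0" using c1 cB cC by (simp add: cc_def)
    show ?thesis
    proof (rule that[OF cc])
      fix q \<psi> assume r: "rchar q \<psi>"
      have q: "q \<ge> 1" using r by (simp add: rchar_def Suc_le_eq)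
      have pe: "real q powr (-e) \<ge> 0" by simp
      have d12: "dchar (q1 * q) (\<lambda>n. \<psi>1 n * \<psi> n)" using dchar_lift r1 r by (auto simp: rchar_def)
      show "cc * real q powr (-e) \<le> Re (dser \<psi> 1)"
      \<comment> \<open>A principal product would bring in a second pole at 1; in that case the two
        values at 1 are compared directly.\<close>
      proof (cases "(\<lambda>n. \<psi>1 n * \<psi> n) = chi0 (q1 * q)")
        case True
        have "cc * real q powr (-e) \<le> cB * real q powr (-e)" using pe by (intro mult_right_mono) (auto simp: cc_def)
        also have "\<dots> = L1 * (t * real (q1 * q) powr (-e))" by (simp add: cB_def powr_mult)
        also have "\<dots> \<le> L1 * (real (totient (q1 * q)) / real (q1 * q))" using t(2)[of "q1 * q"] q1 q L1 by (intro mult_left_mono) auto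
        also have "\<dots> \<le> Re (dser \<psi> 1)" unfolding L1_def by (rule equivalent_lower[OF r1(1) r True])
        finally show ?thesis .
      next
        case False
        have r12: "rchar (q1 * q) (\<lambda>n. \<psi>1 n * \<psi> n)"
          using r1 r d12 False by (auto simp: rchar_def chi0_def power_mult_distrib)
        define c where "c = (\<lambda>n. (1 + Re (\<psi>1 n)) * (1 + Re (\<psi> n)))"
        interpret nonneg_log c unfolding c_def by (rule four_fold(1)[OF r1(1) r r12])
        define E where "E = (\<lambda>s. zg s * dser \<psi>1 s * dser \<psi> s * dser (\<lambda>n. \<psi>1 n * \<psi> n) s)"
        define M where "M = Z * (15 * real q1) * (15 * real q) * (15 * real (q1 * q))"
        have "Re (E 1) \<ge> (1 - b) / 6 * (16 * M) powr (-3 * (1 - b))"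
        proof (rule estermann[of E])
          show "E holomorphic_on {s. Re s > 0}" unfolding E_def
            by (intro holomorphic_intros zg_holomorphic rchar_L_hol[OF r] rchar_L_hol[OF r1(1)] rchar_L_hol[OF r12])
          show "E s = (s - 1) * FF s" if "Re s > 1" for s
            using four_fold(2)[OF r1(1) r r12 that] by (simp add: c_def E_def)
          show "norm (E s) \<le> M" if "norm (s - 2) \<le> 7/4" for s
            unfolding E_def M_def norm_mult using Z rchar_L_bound[OF r that] rchar_L_bound[OF r1(1) that] rchar_L_bound[OF r12 that] that
            by (intro mult_mono) auto
          have "1 \<le> real (q1 * q)" using q q1 by (simp add: Suc_le_eq del: of_nat_mult)
          then have qq: "1 \<le> 15 * real (q1 * q)" by linarith
          have "1 * 1 * 1 * 1 \<le> M" unfolding M_def using Z q q1 by (intro mult_mono qq) auto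
          then show "1 \<le> M" by simp
          show "0 \<le> Re (E (of_real b))" unfolding E_def Lb by simp
        qed (use x0 b b1 in auto)
        moreover have "16 * M = K0 * real q ^ 2" by (simp add: M_def K0_def power2_eq_square power3_eq_cube)
        ultimately have E1: "(1 - b) / 6 * (K0 * real q ^ 2) powr (-3 * (1 - b)) \<le> Re (E 1)" by simp
        have b3: "-3 * \<epsilon> \<le> -3 * (1 - b)" "-3 * (1 - b) \<le> 0" using b by (auto simp: x0_def)
        have "min 1 (K0 powr (-3 * \<epsilon>)) * real q powr (-6 * \<epsilon>) \<le> (K0 * real q ^ 2) powr (-3 * (1 - b))"
        proof -
          have "min 1 (K0 powr (-3 * \<epsilon>)) \<le> K0 powr (-3 * (1 - b))"
          proof (cases "K0 \<ge> 1")
            case True then show ?thesis using b3 by (intro order_trans[OF min.cobounded2] powr_mono) auto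
          next
            case f: False
            have "K0 powr 0 \<le> K0 powr (-3 * (1 - b))" using f K0 b3 by (intro powr_mono') auto
            then show ?thesis using K0 by (intro order_trans[OF min.cobounded1]) simp
          qed
          moreover have "real q powr (-6 * \<epsilon>) \<le> (real q ^ 2) powr (-3 * (1 - b))"
          proof -
            have "(real q ^ 2) powr (-3 * (1 - b)) = real q powr (-6 * (1 - b))"
            proof -
              have "(real q) ^ 2 = real q powr 2" using q by (simp add: powr_numeral)
              then have "(real q ^ 2) powr (-3 * (1 - b)) = real q powr (2 * (-3 * (1 - b)))" by (simp only: powr_powr)
              then show ?thesis by simp
            qed
            then show ?thesis using q b by (simp add: x0_def powr_mono)
          qed
          ultimately have "min 1 (K0 powr (-3 * \<epsilon>)) * real q powr (-6 * \<epsilon>) \<le> K0 powr (-3 * (1 - b)) * (real q ^ 2) powr (-3 * (1 - b))"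
            by (intro mult_mono) auto
          then show ?thesis by (simp add: powr_mult)
        qed
        then have "(1 - b) / 6 * (min 1 (K0 powr (-3 * \<epsilon>)) * real q powr (-6 * \<epsilon>)) \<le> (1 - b) / 6 * (K0 * real q ^ 2) powr (-3 * (1 - b))"
          using b1 by (intro mult_left_mono) auto
        then have lowE: "(1 - b) / 6 * (min 1 (K0 powr (-3 * \<epsilon>)) * real q powr (-6 * \<epsilon>)) \<le> Re (E 1)" using E1 by linarith
        have real3: "dser f 1 = of_real (Re (dser f 1))" if "rchar n f" for f n using rchar_L_real[OF that, of 1] by (simp add: complex_eq_iff)
        have "Re (E 1) = L1 * Re (dser \<psi> 1) * Re (dser (\<lambda>n. \<psi>1 n * \<psi> n) 1)"
          unfolding E_def L1_def by (subst real3[OF r1(1)], subst real3[OF r], subst real3[OF r12]) simp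
        also have "\<dots> \<le> L1 * Re (dser \<psi> 1) * (G * (2 * real q1) powr \<epsilon> * real q powr \<epsilon>)"
        proof (rule mult_left_mono)
          have "norm (dser (\<lambda>n. \<psi>1 n * \<psi> n) 1) \<le> G * (real (q1 * q) * (\<bar>Im 1\<bar> + 2)) powr \<epsilon>"
          proof (rule G(2))
            have "1 * 1 \<le> q1 * q" using q1 q by (intro mult_mono) auto
            then show "1 \<le> real (q1 * q)" by (simp del: of_nat_mult)
            show "bps (real (q1 * q)) (\<lambda>n. \<psi>1 n * \<psi> n)" by (rule rchar_bps[OF r12])
            show "norm (\<psi>1 n * \<psi> n) \<le> 1" for n using rchar_cmul[OF r12] by (simp add: cmul_def)
          qed (use \<epsilon> in auto)
          also have "\<dots> = G * (2 * real q1) powr \<epsilon> * real q powr \<epsilon>" by (simp add: powr_mult mult_ac)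
          finally show "Re (dser (\<lambda>n. \<psi>1 n * \<psi> n) 1) \<le> G * (2 * real q1) powr \<epsilon> * real q powr \<epsilon>"
            using complex_Re_le_cmod order_trans by blast
        qed (use L1 rchar_L1_nonneg[OF r] in auto)
        finally have "(1 - b) / 6 * (min 1 (K0 powr (-3 * \<epsilon>)) * real q powr (-6 * \<epsilon>)) \<le> (L1 * (G * (2 * real q1) powr \<epsilon>)) * (Re (dser \<psi> 1) * real q powr \<epsilon>)"
          using lowE by (simp add: mult_ac)
        then have "cC * real q powr (-6 * \<epsilon>) \<le> Re (dser \<psi> 1) * real q powr \<epsilon>"
          unfolding cC_def using den by (simp add: field_simps)
        then have "cC * real q powr (-6 * \<epsilon>) * real q powr (-\<epsilon>) \<le> Re (dser \<psi> 1) * real q powr \<epsilon> * real q powr (-\<epsilon>)"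
          by (rule mult_right_mono) simp
        then have "cC * real q powr (-(7 * \<epsilon>)) \<le> Re (dser \<psi> 1)"
          using q by (simp add: mult.assoc powr_add[symmetric])
        moreover have "cc * real q powr (-e) \<le> cC * real q powr (-(7 * \<epsilon>))"
          using mono[of q "7 * \<epsilon>"] q \<epsilon> cC by (intro mult_mono) (auto simp: cc_def)
        ultimately show ?thesis by linarith
      qed
    qed
  qed
qed

section \<open>Logarithmic derivatives near the line of real part one\<close>

text \<open>The L-function is bounded on \<open>box\<close>; \<open>ibox\<close> is shrunk so that
  discs of radius \<open>d / 2\<close> about its points stay in \<open>box\<close>, and Cauchy's
  estimate bounds the derivative there. The right edge leaves room for the 3-4-1 argument up to real
  part 2.\<close>

definition box :: "real \<Rightarrow> real \<Rightarrow> complex set" where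
  "box d t = {z. 1 - d \<le> Re z \<and> Re z \<le> 4 \<and> \<bar>Im z - t\<bar> \<le> 1/2}"

definition ibox :: "real \<Rightarrow> real \<Rightarrow> complex set" where
  "ibox d t = {z. 1 - d/2 \<le> Re z \<and> Re z \<le> 3 \<and> \<bar>Im z - t\<bar> \<le> 1/4}"

lemma convex_ibox: "convex (ibox d t)"
proof -
  have "ibox d t = {z. 1 - d/2 \<le> Re z} \<inter> {z. Re z \<le> 3} \<inter> {z. t - 1/4 \<le> Im z} \<inter> {z. Im z \<le> t + 1/4}"
  proof (rule Set.set_eqI)
    fix z show "z \<in> ibox d t \<longleftrightarrow> z \<in> {z. 1 - d/2 \<le> Re z} \<inter> {z. Re z \<le> 3} \<inter> {z. t - 1/4 \<le> Im z} \<inter> {z. Im z \<le> t + 1/4}"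
      using abs_le_iff[of "Im z - t" "1/4"] by (auto simp: ibox_def)
  qed
  then show ?thesis
    by (simp only:) (intro convex_Int convex_halfspace_Re_ge convex_halfspace_Re_le convex_halfspace_Im_ge convex_halfspace_Im_le)
qed

lemma cball_subset_box: assumes "z \<in> ibox d t" "0 < d" "d \<le> 1/2" shows "cball z (d/2) \<subseteq> box d t"
proof
  fix w assume "w \<in> cball z (d/2)"
  then have "norm (w - z) \<le> d/2" by (simp add: dist_norm norm_minus_commute)
  then have "\<bar>Re (w - z)\<bar> \<le> d/2" "\<bar>Im (w - z)\<bar> \<le> d/2" using abs_Re_le_cmod abs_Im_le_cmod order_trans by blast+
  then show "w \<in> box d t" using assms
    unfolding box_def ibox_def mem_Collect_eq abs_le_iff minus_complex.simps by (intro conjI; linarith)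
qed

text \<open>Serves both the L-functions of nonprincipal characters and the zeta function away from
  its pole. \<open>D\<close> bounds the derivative on \<open>ibox\<close> and is the Lipschitz
  constant there.\<close>

locale boxed =
  fixes L :: "complex \<Rightarrow> complex" and U d t B
  assumes hol: "L holomorphic_on U" and op: "open U" and sub: "box d t \<subseteq> U"
    and d: "0 < d" "d \<le> 1/2" and B: "B \<ge> 1" and LB: "\<And>z. z \<in> box d t \<Longrightarrow> norm (L z) \<le> B"
begin

definition "D = 2 * B / d"

lemma D1: "D \<ge> 4"
proof -
  have "2 * 1 / (1/2) \<le> 2 * B / d" using d B by (intro frac_le) auto
  then show ?thesis by (simp add: D_def)
qed

lemma ibox_U: "ibox d t \<subseteq> U"
  using cball_subset_box[OF _ d] sub d by (meson centre_in_cball half_gt_zero less_imp_le subset_iff)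

lemma deriv_bound: assumes "z \<in> ibox d t" shows "norm (deriv L z) \<le> D"
proof -
  have c: "cball z (d/2) \<subseteq> box d t" by (rule cball_subset_box[OF assms d])
  have "norm ((deriv ^^ 1) L z) \<le> fact 1 * B / (d/2) ^ 1"
  proof (rule Cauchy_inequality)
    show "L holomorphic_on ball z (d/2)" using c sub by (intro holomorphic_on_subset[OF hol]) (meson ball_subset_cball order_trans)
    show "continuous_on (cball z (d/2)) L" using c sub by (intro holomorphic_on_imp_continuous_on holomorphic_on_subset[OF hol]) auto
    show "0 < d/2" using d by simp
    fix x assume "norm (z - x) = d/2"
    then show "norm (L x) \<le> B" using c by (intro LB) (auto simp: dist_norm)
  qed
  then show ?thesis by (simp add: D_def mult.commute)
qed

lemma lipschitz: assumes "z \<in> ibox d t" "w \<in> ibox d t" shows "norm (L z - L w) \<le> D * norm (z - w)"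
proof (rule field_differentiable_bound[OF convex_ibox[of d t]])
  fix x assume x: "x \<in> ibox d t"
  then have "x \<in> U" using ibox_U by auto
  then have "(L has_field_derivative deriv L x) (at x)" using hol op holomorphic_derivI by blast
  then show "(L has_field_derivative deriv L x) (at x within ibox d t)" by (rule has_field_derivative_at_within)
  show "norm (deriv L x) \<le> D" by (rule deriv_bound[OF x])
qed (use assms in auto)

text \<open>Within distance \<open>m / (2 * D)\<close> of the point the function keeps at least half
  of its lower bound \<open>m\<close>. On this disc the logarithmic derivative is therefore
  holomorphic and at most \<open>2 * D / m\<close>, and Cauchy's estimate bounds its derivatives at
  the centre.\<close>

lemma log_deriv_bound:
  assumes f: "cmul f" and Lf: "\<And>s. Re s > 1 \<Longrightarrow> L s = dser f s" and c: "1 < c" "c \<le> 2"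
    and m: "0 < m" "m \<le> 1" "m \<le> norm (L (Complex c t))"
  shows "norm (dser (\<lambda>n. of_real (ln (real n)) ^ k * (mangoldt n * f n)) (Complex c t)) \<le> fact k * (2 * D / m) ^ (k + 1)"
proof -
  define s where "s = Complex c t"
  define r where "r = m / (2 * D)"
  have r: "0 < r" using m D1 by (simp add: r_def)
  have rd: "r \<le> d/2"
  proof -
    have "m / (2 * D) \<le> 1 / (2 * D)" using m D1 by (intro divide_right_mono) auto
    also have "\<dots> = d / (4 * B)" using d by (simp add: D_def)
    also have "\<dots> \<le> d / 2" using d B by (intro divide_left_mono) auto
    finally show ?thesis by (simp add: r_def)
  qed
  have ib: "cball s r \<subseteq> ibox d t"
  proof
    fix w assume "w \<in> cball s r"
    then have "norm (w - s) \<le> d/2" using rd by (simp add: dist_norm norm_minus_commute)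
    then have "\<bar>Re (w - s)\<bar> \<le> d/2" "\<bar>Im (w - s)\<bar> \<le> d/2" using abs_Re_le_cmod abs_Im_le_cmod order_trans by blast+
    then show "w \<in> ibox d t" using c d
      unfolding ibox_def mem_Collect_eq abs_le_iff minus_complex.simps s_def complex.sel by (intro conjI; linarith)
  qed
  have sib: "s \<in> ibox d t" using ib r by auto
  have low: "norm (L w) \<ge> m / 2" if "w \<in> cball s r" for w
  proof -
    have "norm (L s - L w) \<le> D * norm (s - w)" by (rule lipschitz) (use sib ib that in auto)
    also have "\<dots> \<le> D * r" using that D1 by (intro mult_left_mono) (auto simp: dist_norm)
    also have "\<dots> = m / 2" using D1 by (simp add: r_def)
    finally show ?thesis using m(3) norm_triangle_ineq2[of "L s" "L w"] by (simp add: s_def)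
  qed
  define A where "A = (\<lambda>w. - deriv L w / L w)"
  have holA: "A holomorphic_on ball s r"
  proof -
    have sU: "ball s r \<subseteq> U" using ib ibox_U by (meson ball_subset_cball order_trans)
    have "L holomorphic_on ball s r" "deriv L holomorphic_on ball s r"
      using holomorphic_on_subset[OF hol sU] holomorphic_deriv by auto
    moreover have "L w \<noteq> 0" if "w \<in> ball s r" for w using low[of w] that m by auto
    ultimately show ?thesis unfolding A_def by (intro holomorphic_intros) auto
  qed
  have contA: "continuous_on (cball s r) A"
  proof -
    have sU: "cball s r \<subseteq> U" using ib ibox_U by blast
    have "continuous_on (cball s r) L" "continuous_on (cball s r) (deriv L)"
      using holomorphic_on_imp_continuous_on[OF holomorphic_on_subset[OF hol sU]]
        holomorphic_on_imp_continuous_on[OF holomorphic_on_subset[OF holomorphic_deriv[OF hol op] sU]] by auto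
    moreover have "L w \<noteq> 0" if "w \<in> cball s r" for w using low[OF that] m by auto
    ultimately show ?thesis unfolding A_def by (intro continuous_intros) auto
  qed
  have "norm ((deriv ^^ k) A s) \<le> fact k * (2 * D / m) / r ^ k"
  proof (rule Cauchy_inequality[OF holA contA r])
    fix x assume "norm (s - x) = r"
    then have x: "x \<in> cball s r" by (simp add: dist_norm)
    have "norm (A x) = norm (deriv L x) / norm (L x)" by (simp add: A_def norm_divide)
    also have "\<dots> \<le> D / (m / 2)" using low[OF x] deriv_bound[of x] ib x m D1 by (intro frac_le) auto
    finally show "norm (A x) \<le> 2 * D / m" by (simp add: field_simps)
  qed
  also have "fact k * (2 * D / m) / r ^ k = fact k * (2 * D / m) ^ (k + 1)"
    using m D1 by (simp add: r_def power_divide field_simps)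
  \<comment> \<open>The disc may reach across the line of real part one, so the Dirichlet series is
    compared only on the part of the disc to the right of it; derivatives at \<open>s\<close> see no
    more.\<close>
  also have "(deriv ^^ k) A s = (deriv ^^ k) (dser (\<lambda>n. mangoldt n * f n)) s"
  proof (rule higher_deriv_transform_within_open[where S = "ball s r \<inter> {s. Re s > 1}"])
    show "open (ball s r \<inter> {s. Re s > 1})" by (intro open_Int open_ball open_Re_gt)
    show "A holomorphic_on ball s r \<inter> {s. Re s > 1}" using holA holomorphic_on_subset by blast
    show "dser (\<lambda>n. mangoldt n * f n) holomorphic_on ball s r \<inter> {s. Re s > 1}"
      by (rule holomorphic_on_subset[OF dser_holomorphic[OF slow_mangoldt[OF cmul_slow[OF f]]]]) simp
    show "s \<in> ball s r \<inter> {s. Re s > 1}" using r c by (simp add: s_def)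
    fix w assume "w \<in> ball s r \<inter> {s. Re s > 1}"
    then have w: "Re w > 1" by simp
    have "eventually (\<lambda>z. z \<in> {s. Re s > 1}) (nhds w)" using w by (intro eventually_nhds_in_open open_Re_gt) auto
    then have "eventually (\<lambda>z. L z = dser f z) (nhds w)" by eventually_elim (use Lf in auto)
    then have "deriv L w = deriv (dser f) w" by (rule deriv_cong_ev) simp
    also have "\<dots> = - (dser (\<lambda>n. mangoldt n * f n) w * dser f w)" by (rule DERIV_imp_deriv[OF dser_deriv_mangoldt[OF f w]])
    finally show "A w = dser (\<lambda>n. mangoldt n * f n) w" using Lf[OF w] dser_nonzero[OF f w] by (simp add: A_def)
  qed
  also have "\<dots> = dser (\<lambda>n. (- of_real (ln (real n))) ^ k * (mangoldt n * f n)) s"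
    by (rule dser_higher_deriv[OF slow_mangoldt[OF cmul_slow[OF f]]]) (use c in \<open>simp add: s_def\<close>)
  also have "\<dots> = (-1) ^ k * dser (\<lambda>n. of_real (ln (real n)) ^ k * (mangoldt n * f n)) s"
  proof -
    have "(\<lambda>n. (- complex_of_real (ln (real n))) ^ k * (mangoldt n * f n)) = (\<lambda>n. (-1) ^ k * (of_real (ln (real n)) ^ k * (mangoldt n * f n)))"
      by (auto simp: power_minus[of "of_real (ln _)"])
    then show ?thesis using dser_cmult[OF slow_ln_power[OF slow_mangoldt[OF cmul_slow[OF f]]], of s "(-1) ^ k" k] c by (simp add: s_def)
  qed
  finally show ?thesis by (simp add: s_def norm_mult norm_power)
qed

text \<open>The cube of zeta makes the 3-4-1 inequality degenerate as the real part tends to 1. It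
  is therefore applied at distance at least \<open>\<rho>\<close> from 1, and the Lipschitz bound
  carries the result back to \<open>c\<close> at a loss of at most
  \<open>D * \<rho>\<close>.\<close>

lemma lower_bound_341:
  assumes f: "cmul f" and Lf: "\<And>s. Re s > 1 \<Longrightarrow> L s = dser f s" and c: "1 < c" "c \<le> 2"
    and W: "W \<ge> 1" "\<And>x. c \<le> x \<Longrightarrow> x \<le> 2 \<Longrightarrow> norm (dser (\<lambda>n. f n ^ 2) (Complex x (2 * t))) \<le> W"
  shows "1 / (128 * W * D ^ 3) \<le> norm (L (Complex c t))"
proof -
  \<comment> \<open>Solves \<open>(2 * D * \<rho>) ^ 4 = \<rho> ^ 3 / (8 * W)\<close>: the lower
    bound obtained at \<open>x\<close> is then twice the loss on the way back.\<close>
  define \<rho> where "\<rho> = 1 / (128 * W * D ^ 4)"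
  have D0: "D > 0" using D1 by simp
  have \<rho>0: "\<rho> > 0" using W D0 by (simp add: \<rho>_def)
  have "1 * 1 * 1 \<le> 128 * W * D ^ 4" using W D1 by (intro mult_mono one_le_power) auto
  then have \<rho>1: "\<rho> \<le> 1" using W D0 by (simp add: \<rho>_def divide_le_eq)
  define x where "x = max c (1 + \<rho>)"
  have x: "c \<le> x" "x \<le> 2" "1 + \<rho> \<le> x" "x - c \<le> \<rho>" "x > 1" using c \<rho>0 \<rho>1 by (auto simp: x_def)
  have z2: "norm (dser (\<lambda>_. 1) (of_real x)) \<le> 2 / (x - 1)"
  proof -
    have "norm (zg (of_real x) - 1) \<le> norm (complex_of_real x - 1) * (norm (complex_of_real x) / x)" using zg_near[of "of_real x"] x by simp
    also have "\<dots> = x - 1" using x norm_of_real[of "x - 1", where 'a = complex] by simp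
    finally have "norm (zg (of_real x)) \<le> 2" using norm_triangle_ineq2[of "zg (of_real x)" 1] x by simp
    moreover have "zg (of_real x) = of_real (x - 1) * dser (\<lambda>_. 1) (of_real x)" using zg_eq[of "of_real x"] x by simp
    ultimately have "\<bar>x - 1\<bar> * norm (dser (\<lambda>_. 1) (of_real x)) \<le> 2" by (simp only: norm_mult norm_of_real)
    then show ?thesis using x by (simp add: field_simps)
  qed
  define l where "l = norm (dser f (Complex x t))"
  have "1 \<le> norm (dser (\<lambda>_. 1) (of_real x)) ^ 3 * l ^ 4 * norm (dser (\<lambda>n. f n ^ 2) (Complex x (2 * t)))"
    unfolding l_def by (rule three_four_one[OF f x(5)])
  also have "\<dots> \<le> (2 / (x - 1)) ^ 3 * l ^ 4 * W"
    using z2 W(2)[OF x(1,2)] W(1) x by (intro mult_mono power_mono) (auto simp: l_def)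
  also have "\<dots> \<le> (2 / \<rho>) ^ 3 * l ^ 4 * W"
    using x \<rho>0 W by (intro mult_right_mono power_mono divide_left_mono) auto
  finally have "\<rho> ^ 3 \<le> 8 * W * l ^ 4" using \<rho>0 by (simp add: power_divide field_simps)
  then have "\<rho> ^ 3 / (8 * W) \<le> l ^ 4" using W by (simp add: field_simps)
  moreover have "(2 * D * \<rho>) ^ 4 = \<rho> ^ 3 / (8 * W)"
  proof -
    have "(2 * D * \<rho>) ^ 4 = \<rho> ^ 3 * (16 * D ^ 4 * \<rho>)" by (simp add: power_mult_distrib power4_eq_xxxx power3_eq_cube)
    also have "16 * D ^ 4 * \<rho> = 1 / (8 * W)" using D0 W by (simp add: \<rho>_def)
    finally show ?thesis by simp
  qed
  ultimately have "(2 * D * \<rho>) ^ 4 \<le> l ^ 4" by simp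
  then have l2: "2 * D * \<rho> \<le> l" by (rule power_le_imp_le_base[of _ 3, simplified]) (simp_all add: l_def)
  have "norm (L (Complex x t) - L (Complex c t)) \<le> D * norm (Complex x t - Complex c t)"
    by (rule lipschitz) (use x c d in \<open>auto simp: ibox_def\<close>)
  also have "norm (Complex x t - Complex c t) = \<bar>x - c\<bar>" by (simp add: cmod_def)
  also have "D * \<bar>x - c\<bar> \<le> D * \<rho>" using x D0 by (intro mult_left_mono) auto
  finally have "norm (L (Complex x t)) - D * \<rho> \<le> norm (L (Complex c t))"
    using norm_triangle_ineq2[of "L (Complex x t)" "L (Complex c t)"] by linarith
  moreover have "norm (L (Complex x t)) = l" using Lf[of "Complex x t"] x by (simp add: l_def)
  ultimately have "D * \<rho> \<le> norm (L (Complex c t))" using l2 by linarith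
  moreover have "D * \<rho> = 1 / (128 * W * D ^ 3)" using D0 by (simp add: \<rho>_def power4_eq_xxxx power3_eq_cube)
  ultimately show ?thesis by simp
qed

end

lemma box_Im:
  assumes "z \<in> box d t"
  shows "\<bar>Im z\<bar> \<le> \<bar>t\<bar> + 1/2" "\<bar>t\<bar> - 1/2 \<le> \<bar>Im z\<bar>"
  using assms abs_triangle_ineq2[of "Im z" t] abs_triangle_ineq2[of t "Im z"] abs_minus_commute[of t "Im z"]
  unfolding box_def mem_Collect_eq by linarith+

lemma Im_shift_powr_le:
  fixes q u t d :: real
  assumes "0 < d" "d \<le> 1/2" "q \<ge> 1" "\<bar>u\<bar> \<le> 2 * \<bar>t\<bar> + 2"
  shows "(q * (\<bar>u\<bar> + 2)) powr d \<le> 2 * (q * (\<bar>t\<bar> + 2)) powr d"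
proof -
  have "(q * (\<bar>u\<bar> + 2)) powr d \<le> (2 * (q * (\<bar>t\<bar> + 2))) powr d"
  proof (rule powr_mono2)
    have "q * (\<bar>u\<bar> + 2) \<le> q * (2 * (\<bar>t\<bar> + 2))" using assms by (intro mult_left_mono) auto
    then show "q * (\<bar>u\<bar> + 2) \<le> 2 * (q * (\<bar>t\<bar> + 2))" by (simp only: mult.left_commute)
  qed (use assms in auto)
  also have "\<dots> = 2 powr d * (q * (\<bar>t\<bar> + 2)) powr d" by (rule powr_mult)
  also have "\<dots> \<le> 2 powr 1 * (q * (\<bar>t\<bar> + 2)) powr d" using assms by (intro mult_right_mono powr_mono) auto
  finally show ?thesis by simp
qed

text \<open>The 3-4-1 inequality gives the lower bound unless \<open>\<psi>^2\<close> is principal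
  and \<open>1 + 2 i t\<close> is close to the pole of its L-function. That leaves real characters
  near \<open>s = 1\<close>, where Siegel's bound at 1 is carried to \<open>s\<close> by the
  Lipschitz estimate.\<close>

theorem log_deriv_char:
  obtains C where "C > 0" "\<And>q \<psi> c t. q > 0 \<Longrightarrow> dchar q \<psi> \<Longrightarrow> \<psi> \<noteq> chi0 q \<Longrightarrow> 1 < c \<Longrightarrow> c \<le> 2 \<Longrightarrow>
     norm (dser (\<lambda>n. of_real (ln (real n)) ^ k * (mangoldt n * \<psi> n)) (Complex c t)) \<le> C * sqrt (real q) * (\<bar>t\<bar> + 2) powr (1/2)"
proof -
  \<comment> \<open>Everything is measured in \<open>T = (q (|t| + 2)) powr d\<close>: the
    derivative bound \<open>D\<close> is of order \<open>T\<close>, the lower bound of order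
    \<open>T ^ (-5)\<close>, so the result is of order \<open>T ^ (6 * (k + 1))\<close>. This
    \<open>d\<close> turns that into the exponent 1/2.\<close>
  define d where "d = 1 / (12 * (real k + 1))"
  have d: "0 < d" "d \<le> 1/2" by (auto simp: d_def field_simps)
  have dk: "d * (6 * (real k + 1)) = 1/2" by (simp add: d_def field_simps)
  obtain G where G: "G > 0" "\<And>K f s. K \<ge> 1 \<Longrightarrow> bps K f \<Longrightarrow> (\<And>n. norm (f n) \<le> 1) \<Longrightarrow> 1 - d \<le> Re s \<Longrightarrow> Re s \<le> 4 \<Longrightarrow> norm (dser f s) \<le> G * (K * (\<bar>Im s\<bar> + 2)) powr d"
    by (rule dser_growth[OF d]) blast
  obtain Z where Z: "Z > 0" "\<And>s. 1 - d \<le> Re s \<Longrightarrow> Re s \<le> 4 \<Longrightarrow> norm (zg s) \<le> 1 + Z * norm (s - 1) * (\<bar>Im s\<bar> + 2) powr d"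
    by (rule zg_growth[OF d]) blast
  obtain cS0 where cS0: "cS0 > 0" "\<And>q \<psi>. rchar q \<psi> \<Longrightarrow> Re (dser \<psi> 1) \<ge> cS0 * real q powr (-d)"
    by (rule siegel[OF d(1)]) blast
  define cS where "cS = min 1 cS0"
  have cS: "0 < cS" "cS \<le> 1" using cS0 by (auto simp: cS_def)
  have sieg: "Re (dser \<psi> 1) \<ge> cS * real q powr (-d)" if "rchar q \<psi>" for q \<psi>
  proof -
    have "cS * real q powr (-d) \<le> cS0 * real q powr (-d)" by (intro mult_right_mono) (auto simp: cS_def)
    with cS0(2)[OF that] show ?thesis by linarith
  qed
  define D1 where "D1 = 2 * (2 * G + 1) / d"
  define W1 where "W1 = 2 * D1 / cS + 2 * Z + 2 * G + 1"
  define c0 where "c0 = min (1 / (128 * W1 * D1 ^ 3)) (cS / 2)"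
  have D1p: "D1 > 0" using G d by (auto simp: D1_def intro!: divide_pos_pos)
  have W1: "W1 \<ge> 1" "W1 \<ge> 2 * G + 1" using D1p cS Z G by (auto simp: W1_def)
  have c0: "0 < c0" using D1p W1 cS by (auto simp: c0_def)
  define C where "C = fact k * (2 * D1 / c0) ^ (k + 1)"
  have C: "C > 0" using D1p c0 by (simp add: C_def)
  show ?thesis
  proof (rule that[OF C])
    fix q \<psi> and c t :: real assume q: "q > (0::nat)" and ch: "dchar q \<psi>" "\<psi> \<noteq> chi0 q" and c: "1 < c" "c \<le> 2"
    define \<tau> where "\<tau> = real q * (\<bar>t\<bar> + 2)"
    define T where "T = \<tau> powr d"
    have q1: "real q \<ge> 1" using q by simp
    have \<tau>q: "\<tau> \<ge> real q" "\<tau> \<ge> 1"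
    proof -
      have "real q * 1 \<le> real q * (\<bar>t\<bar> + 2)" by (intro mult_left_mono) auto
      then show "\<tau> \<ge> real q" by (simp add: \<tau>_def)
      then show "\<tau> \<ge> 1" using q1 by linarith
    qed
    have T1: "T \<ge> 1" unfolding T_def using \<tau>q d by (intro ge_one_powr_ge_zero) auto
    have Tb: "(real q * (\<bar>u\<bar> + 2)) powr d \<le> 2 * T" if "\<bar>u\<bar> \<le> 2 * \<bar>t\<bar> + 2" for u
      unfolding T_def \<tau>_def by (rule Im_shift_powr_le[OF d q1 that])
    have Tb1: "(\<bar>u\<bar> + 2) powr d \<le> 2 * T" if "\<bar>u\<bar> \<le> 2 * \<bar>t\<bar> + 2" for u
    proof -
      have "(1 * (\<bar>u\<bar> + 2)) powr d \<le> (real q * (\<bar>u\<bar> + 2)) powr d" using q1 d by (intro powr_mono2 mult_right_mono) auto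
      with Tb[OF that] show ?thesis by simp
    qed
    have cm: "cmul \<psi>" by (rule dchar_cmul[OF ch(1) q])
    have n1: "norm (\<psi> n) \<le> 1" for n using cm by (simp add: cmul_def)
    have bp: "bps (real q) \<psi>" by (rule dchar_bps[OF ch(1) q ch(2)])
    have bsub: "box d t \<subseteq> {s. Re s > 0}" using d by (auto simp: box_def)
    have bT: "1 \<le> (2 * G + 1) * T"
    proof -
      have "1 * 1 \<le> (2 * G + 1) * T" using G T1 by (intro mult_mono) auto
      then show ?thesis by simp
    qed
    have bLB: "norm (dser \<psi> z) \<le> (2 * G + 1) * T" if z: "z \<in> box d t" for z
    proof -
      have im: "\<bar>Im z\<bar> \<le> 2 * \<bar>t\<bar> + 2" using box_Im[OF z] by linarith
      have "norm (dser \<psi> z) \<le> G * (real q * (\<bar>Im z\<bar> + 2)) powr d" by (rule G(2)[OF q1 bp n1]) (use z in \<open>auto simp: box_def\<close>)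
      also have "\<dots> \<le> G * (2 * T)" using G Tb[OF im] by (intro mult_left_mono) auto
      also have "\<dots> \<le> (2 * G + 1) * T" using T1 by (simp add: algebra_simps)
      finally show ?thesis .
    qed
    interpret boxed "dser \<psi>" "{s. Re s > 0}" d t "(2 * G + 1) * T"
      by (unfold_locales) (use bps_holomorphic[OF bp] open_Re_gt bsub d bT bLB in auto)
    have DD: "D = D1 * T" by (simp add: D_def D1_def)
    define s where "s = Complex c t"
    \<comment> \<open>The exponent 5 is 2 + 3: \<open>lower_bound_341\<close> yields
      \<open>1 / (W * D ^ 3)\<close> with \<open>W\<close> of order \<open>T ^ 2\<close>.\<close>
    define m where "m = c0 / T ^ 5"
    have m0: "0 < m" using c0 T1 by (simp add: m_def)
    have "m \<le> c0 / 1" unfolding m_def using c0 T1 by (intro divide_left_mono one_le_power) auto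
    also have "c0 \<le> 1/2" using cS by (auto simp: c0_def)
    finally have m1: "m \<le> 1" by simp
    have mW: "m \<le> norm (dser \<psi> s)"
      if W: "\<And>x. c \<le> x \<Longrightarrow> x \<le> 2 \<Longrightarrow> norm (dser (\<lambda>n. \<psi> n ^ 2) (Complex x (2 * t))) \<le> W1 * T ^ 2"
    proof -
      have W0: "1 \<le> W1 * T ^ 2"
      proof -
        have "1 * 1 \<le> W1 * T ^ 2" using W1 T1 by (intro mult_mono one_le_power) auto
        then show ?thesis by simp
      qed
      have "m \<le> 1 / (128 * W1 * D1 ^ 3) / T ^ 5" unfolding m_def using T1 by (intro divide_right_mono) (auto simp: c0_def)
      also have "\<dots> = 1 / (128 * (W1 * T ^ 2) * D ^ 3)" unfolding DD by (simp add: power_mult_distrib power_add[symmetric] mult_ac)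
      also have "\<dots> \<le> norm (dser \<psi> s)" unfolding s_def by (rule lower_bound_341[OF cm refl c W0 W])
      finally show ?thesis .
    qed
    have TT: "T \<le> T ^ 2" using T1 by (simp add: power2_eq_square)
    have mm: "m \<le> norm (dser \<psi> s)"
    proof (cases "(\<lambda>n. \<psi> n ^ 2) = chi0 q")
      case False
      show ?thesis
      proof (rule mW)
        fix x assume x: "c \<le> x" "x \<le> 2"
        have d2: "dchar q (\<lambda>n. \<psi> n ^ 2)" using dchar_times[OF ch(1) ch(1)] by (simp add: power2_eq_square)
        have "norm (dser (\<lambda>n. \<psi> n ^ 2) (Complex x (2 * t))) \<le> G * (real q * (\<bar>Im (Complex x (2 * t))\<bar> + 2)) powr d"
          by (rule G(2)[OF q1 dchar_bps[OF d2 q False]]) (use x c d dchar_norm_le[OF d2 q] in auto)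
        also have "\<dots> \<le> G * (2 * T)" using G by (intro mult_left_mono Tb) auto
        also have "\<dots> \<le> W1 * T" using W1 T1 by (simp add: mult_right_mono)
        also have "\<dots> \<le> W1 * T ^ 2" using W1 TT by (intro mult_left_mono) auto
        finally show "norm (dser (\<lambda>n. \<psi> n ^ 2) (Complex x (2 * t))) \<le> W1 * T ^ 2" .
      qed
    next
      case True
      then have r: "rchar q \<psi>" using q ch by (auto simp: rchar_def fun_eq_iff)
      have qT: "real q powr d \<le> T" unfolding T_def using \<tau>q d by (intro powr_mono2) auto
      \<comment> \<open>Within this radius of 1 the Lipschitz estimate can destroy at most half of
        Siegel's bound; outside it the pole contributes at most \<open>1 / \<delta>\<close>, which
        is of order \<open>T ^ 2\<close>.\<close>
      define \<delta> where "\<delta> = cS * real q powr (-d) / (2 * D)"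
      have D4: "D \<ge> 4" by (rule D1)
      have \<delta>0: "\<delta> > 0" using cS q D4 by (simp add: \<delta>_def)
      have "real q powr (-d) \<le> real q powr 0" using q1 d by (intro powr_mono) auto
      then have "real q powr (-d) \<le> 1" using q by simp
      then have "cS * real q powr (-d) \<le> 1 * 1" using cS by (intro mult_mono) auto
      then have "\<delta> \<le> 1 / (2 * D)" unfolding \<delta>_def using D4 by (intro divide_right_mono) auto
      also have "\<dots> \<le> 1 / (2 * 4)" using D4 by (intro divide_left_mono) auto
      finally have \<delta>1: "\<delta> \<le> 1/8" by simp
      show ?thesis
      proof (cases "norm (s - 1) \<le> \<delta>")
        case near: True
        have "\<bar>Im (s - 1)\<bar> \<le> 1/8" using near \<delta>1 abs_Im_le_cmod[of "s - 1"] by linarith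
        then have t: "\<bar>t\<bar> \<le> 1/8" by (simp add: s_def)
        have "norm (dser \<psi> 1 - dser \<psi> s) \<le> D * norm (1 - s)"
          by (rule lipschitz) (use t c d in \<open>auto simp: ibox_def s_def\<close>)
        also have "\<dots> \<le> D * \<delta>" using near D4 by (intro mult_left_mono) (auto simp: norm_minus_commute)
        also have "\<dots> = cS * real q powr (-d) / 2" using D4 by (simp add: \<delta>_def)
        finally have "norm (dser \<psi> 1) - cS * real q powr (-d) / 2 \<le> norm (dser \<psi> s)"
          using norm_triangle_ineq2[of "dser \<psi> 1" "dser \<psi> s"] by linarith
        moreover have "cS * real q powr (-d) \<le> norm (dser \<psi> 1)" using sieg[OF r] complex_Re_le_cmod order_trans by blast
        ultimately have "cS / 2 * real q powr (-d) \<le> norm (dser \<psi> s)" by simp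
        moreover have "m \<le> cS / 2 * real q powr (-d)"
        proof -
          have "1 / T ^ 5 \<le> 1 / T" using T1 self_le_power[of T 5] by (intro divide_left_mono) auto
          also have "\<dots> \<le> 1 / real q powr d" using qT q T1 by (intro divide_left_mono mult_pos_pos) auto
          finally have "c0 * (1 / T ^ 5) \<le> cS / 2 * (1 / real q powr d)" using c0 cS T1 by (intro mult_mono) (auto simp: c0_def)
          then show ?thesis by (simp add: m_def powr_minus_divide)
        qed
        ultimately show ?thesis by linarith
      next
        case far: False
        show ?thesis
        proof (rule mW)
          fix x assume x: "c \<le> x" "x \<le> 2"
          define z where "z = Complex x (2 * t)"
          have z1: "Re z > 1" using x c by (simp add: z_def)
          have im: "\<bar>Im z\<bar> \<le> 2 * \<bar>t\<bar> + 2" by (simp add: z_def)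
          have zs: "norm (z - 1) \<ge> norm (s - 1)"
          proof -
            have "(c - 1)\<^sup>2 \<le> (x - 1)\<^sup>2" using x c by (intro power_mono) auto
            moreover have "t\<^sup>2 \<le> (2 * t)\<^sup>2" by (simp add: power_mult_distrib)
            ultimately have "sqrt ((c - 1)\<^sup>2 + t\<^sup>2) \<le> sqrt ((x - 1)\<^sup>2 + (2 * t)\<^sup>2)" by (intro real_sqrt_le_mono add_mono)
            then show ?thesis by (simp add: z_def s_def cmod_def)
          qed
          then have zd: "norm (z - 1) > \<delta>" using far by linarith
          then have zn: "z \<noteq> 1" using \<delta>0 by auto
          have "norm (dser (\<lambda>_. 1) z) = norm (zg z) / norm (z - 1)"
            using zg_eq[OF z1] zn by (simp add: norm_mult)
          also have "\<dots> \<le> (1 + Z * norm (z - 1) * (\<bar>Im z\<bar> + 2) powr d) / norm (z - 1)"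
            using Z(2)[of z] z1 d x by (intro divide_right_mono) (auto simp: z_def)
          also have "\<dots> = 1 / norm (z - 1) + Z * (\<bar>Im z\<bar> + 2) powr d" using zn by (simp add: add_divide_distrib)
          also have "\<dots> \<le> 1 / \<delta> + Z * (2 * T)"
            using zd zn \<delta>0 Z Tb1[OF im] by (intro add_mono mult_left_mono divide_left_mono mult_pos_pos) auto
          finally have z2: "norm (dser (\<lambda>_. 1) z) \<le> 1 / \<delta> + Z * (2 * T)" .
          have "1 / \<delta> = 2 * D1 / cS * (T * real q powr d)" unfolding \<delta>_def DD using q by (simp add: powr_minus field_simps)
          also have "\<dots> \<le> 2 * D1 / cS * (T * T)" using qT T1 D1p cS by (intro mult_left_mono) auto
          finally have i\<delta>: "1 / \<delta> \<le> 2 * D1 / cS * T ^ 2" by (simp add: power2_eq_square)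
          have z3: "norm (dser (chif q) z) \<le> G * (2 * T)"
          proof -
            have "norm (dser (chif q) z) \<le> G * (real q * (\<bar>Im z\<bar> + 2)) powr d"
              by (rule G(2)[OF q1 chif_bps(1)[OF q]]) (use chif_bps(2)[OF q] z1 x d in \<open>auto simp: z_def\<close>)
            also have "\<dots> \<le> G * (2 * T)" using G Tb[OF im] by (intro mult_left_mono) auto
            finally show ?thesis .
          qed
          have z4: "norm (of_real (real (totient q) / real q) * dser (\<lambda>_. 1) z) \<le> 1 * norm (dser (\<lambda>_. 1) z)"
            unfolding norm_mult norm_of_real using totient_le[of q] q by (intro mult_right_mono) auto
          have "norm (dser (chi0 q) z) \<le> norm (of_real (real (totient q) / real q) * dser (\<lambda>_. 1) z) + norm (dser (chif q) z)"
            unfolding dser_chi0[OF q z1] by (rule norm_triangle_ineq)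
          also have "\<dots> \<le> 2 * D1 / cS * T ^ 2 + (2 * Z + 2 * G) * T"
            using z2 z3 z4 i\<delta> by (simp add: algebra_simps)
          also have "\<dots> \<le> 2 * D1 / cS * T ^ 2 + (2 * Z + 2 * G) * T ^ 2" using Z G TT by (intro add_left_mono mult_left_mono) auto
          also have "\<dots> \<le> W1 * T ^ 2" by (simp add: W1_def algebra_simps)
          finally show "norm (dser (\<lambda>n. \<psi> n ^ 2) (Complex x (2 * t))) \<le> W1 * T ^ 2" unfolding True z_def .
        qed
      qed
    qed
    have "norm (dser (\<lambda>n. of_real (ln (real n)) ^ k * (mangoldt n * \<psi> n)) (Complex c t)) \<le> fact k * (2 * D / m) ^ (k + 1)"
      by (rule log_deriv_bound[OF cm refl c m0 m1]) (use mm in \<open>simp add: s_def\<close>)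
    also have "2 * D / m = 2 * D1 / c0 * T ^ 6" using T1 by (simp add: DD m_def eval_nat_numeral)
    also have "fact k * (2 * D1 / c0 * T ^ 6) ^ (k + 1) = C * (T ^ 6) ^ (k + 1)" by (simp only: C_def power_mult_distrib[of "2 * D1 / c0" "T ^ 6"] mult.assoc)
    also have "(T ^ 6) ^ (k + 1) = \<tau> powr (1/2)"
    proof -
      have "(T ^ 6) ^ (k + 1) = T ^ (6 * (k + 1))" by (simp only: power_mult)
      also have "\<dots> = T powr (6 * (real k + 1))" using T1 by (subst powr_realpow[symmetric]) (auto simp: algebra_simps)
      also have "\<dots> = \<tau> powr (1/2)" unfolding T_def powr_powr dk ..
      finally show ?thesis .
    qed
    also have "\<tau> powr (1/2) = sqrt (real q) * (\<bar>t\<bar> + 2) powr (1/2)"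
      unfolding \<tau>_def by (subst powr_mult) (simp add: powr_half_sqrt)
    finally show "norm (dser (\<lambda>n. of_real (ln (real n)) ^ k * (mangoldt n * \<psi> n)) (Complex c t)) \<le> C * sqrt (real q) * (\<bar>t\<bar> + 2) powr (1/2)"
      by (simp add: mult.assoc)
  qed
qed

text \<open>A box of half height 1/2 about such a \<open>t\<close> avoids the pole, so the
  logarithmic derivative and zeta itself can be bounded separately. Subtracting 1 from the
  coefficients matters only near the pole.\<close>

lemma log_deriv_zeta_large:
  obtains C where "C > 0" "\<And>c t. 1 < c \<Longrightarrow> c \<le> 2 \<Longrightarrow> \<bar>t\<bar> \<ge> 3/4 \<Longrightarrow>
     norm (dser (\<lambda>n. of_real (ln (real n)) ^ k * (mangoldt n - 1)) (Complex c t)) \<le> C * (\<bar>t\<bar> + 2) powr (1/2)"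
proof -
  define d where "d = 1 / (12 * (real k + 1))"
  have d: "0 < d" "d \<le> 1/2" by (auto simp: d_def field_simps)
  have dk: "d * (6 * (real k + 1)) = 1/2" by (simp add: d_def field_simps)
  obtain Z where Z: "Z > 0" "\<And>s. 1 - d \<le> Re s \<Longrightarrow> Re s \<le> 4 \<Longrightarrow> norm (zg s) \<le> 1 + Z * norm (s - 1) * (\<bar>Im s\<bar> + 2) powr d"
    by (rule zg_growth[OF d]) blast
  define B1 where "B1 = 4 + 2 * Z"
  define D1 where "D1 = 2 * B1 / d"
  define c0 where "c0 = min 1 (1 / (128 * B1 * D1 ^ 3))"
  have B1: "B1 \<ge> 1" using Z by (simp add: B1_def)
  have D1p: "D1 > 0" using B1 d by (auto simp: D1_def intro!: divide_pos_pos)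
  have c0: "0 < c0" using D1p B1 by (auto simp: c0_def)
  define C1 where "C1 = fact k * (2 * D1 / c0) ^ (k + 1)"
  define C2 where "C2 = fact k * B1 / (d/2) ^ k"
  have C: "C1 > 0" "C2 > 0" using D1p c0 B1 d by (auto simp: C1_def C2_def)
  show ?thesis
  proof (rule that[of "C1 + C2"])
    fix c t :: real assume c: "1 < c" "c \<le> 2" and t: "\<bar>t\<bar> \<ge> 3/4"
    define \<tau> where "\<tau> = \<bar>t\<bar> + 2"
    define T where "T = \<tau> powr d"
    have T1: "T \<ge> 1" unfolding T_def \<tau>_def using d by (intro ge_one_powr_ge_zero) auto
    have Tb: "(\<bar>u\<bar> + 2) powr d \<le> 2 * T" if "\<bar>u\<bar> \<le> 2 * \<bar>t\<bar> + 2" for u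
      using Im_shift_powr_le[OF d, of 1 u t] that by (simp add: T_def \<tau>_def)
    define L where "L = (\<lambda>s. zg s / (s - 1))"
    have Lf: "L s = dser (\<lambda>_. 1) s" if "Re s > 1" for s
    proof -
      have "s \<noteq> 1" using that by auto
      then show ?thesis using zg_eq[OF that] by (simp add: L_def)
    qed
    have Lb: "norm (L z) \<le> B1 * T" if z: "1 - d \<le> Re z" "Re z \<le> 4" "\<bar>Im z\<bar> \<ge> 1/4" "\<bar>Im z\<bar> \<le> 2 * \<bar>t\<bar> + 2" for z
    proof -
      have z4: "norm (z - 1) \<ge> 1/4" using abs_Im_le_cmod[of "z - 1"] z(3) by simp
      have z1: "z \<noteq> 1" using z4 by auto
      have "norm (L z) \<le> (1 + Z * norm (z - 1) * (\<bar>Im z\<bar> + 2) powr d) / norm (z - 1)"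
        unfolding L_def norm_divide using Z(2)[of z] z by (intro divide_right_mono) auto
      also have "\<dots> = 1 / norm (z - 1) + Z * (\<bar>Im z\<bar> + 2) powr d" using z1 by (simp add: add_divide_distrib)
      also have "\<dots> \<le> 1 / (1/4) + Z * (2 * T)" using z4 Z Tb[OF z(4)] by (intro add_mono mult_left_mono divide_left_mono) auto
      also have "\<dots> \<le> B1 * T" using T1 by (simp add: B1_def algebra_simps)
      finally show ?thesis .
    qed
    have BT: "1 \<le> B1 * T"
    proof -
      have "1 * 1 \<le> B1 * T" using B1 T1 by (intro mult_mono) auto
      then show ?thesis by simp
    qed
    have bsub: "box d t \<subseteq> {s. Re s > 0} - {1}"
    proof
      fix z assume z: "z \<in> box d t"
      have "Im z \<noteq> 0" using box_Im(2)[OF z] t by auto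
      then show "z \<in> {s. Re s > 0} - {1}" using z d by (auto simp: box_def)
    qed
    have holL: "L holomorphic_on {s. Re s > 0} - {1}"
      unfolding L_def by (intro holomorphic_intros holomorphic_on_subset[OF zg_holomorphic]) auto
    interpret boxed L "{s. Re s > 0} - {1}" d t "B1 * T"
    proof
      show "open ({s. Re s > 0} - {1})" by (intro open_delete open_Re_gt)
      show "norm (L z) \<le> B1 * T" if z: "z \<in> box d t" for z
      proof (rule Lb)
        show "1 - d \<le> Re z" "Re z \<le> 4" using z by (auto simp: box_def)
        show "1/4 \<le> \<bar>Im z\<bar>" "\<bar>Im z\<bar> \<le> 2 * \<bar>t\<bar> + 2" using box_Im[OF z] t by linarith+
      qed
    qed (use holL bsub d BT in auto)
    have DD: "D = D1 * T" by (simp add: D_def D1_def)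
    define m where "m = c0 / T ^ 5"
    have m0: "0 < m" using c0 T1 by (simp add: m_def)
    have "m \<le> c0 / 1" unfolding m_def using c0 T1 by (intro divide_left_mono one_le_power) auto
    also have "c0 \<le> 1" by (simp add: c0_def)
    finally have m1: "m \<le> 1" by simp
    have "m \<le> 1 / (128 * B1 * D1 ^ 3) / T ^ 5" unfolding m_def using T1 by (intro divide_right_mono) (auto simp: c0_def)
    also have "\<dots> \<le> 1 / (128 * B1 * D1 ^ 3) / T ^ 4" using T1 D1p B1 by (intro divide_left_mono power_increasing) auto
    also have "\<dots> = 1 / (128 * (B1 * T) * D ^ 3)" unfolding DD by (simp add: power_mult_distrib eval_nat_numeral mult_ac)
    also have "\<dots> \<le> norm (L (Complex c t))"
    proof (rule lower_bound_341[OF cmul_one Lf c BT])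
      fix x assume x: "c \<le> x" "x \<le> 2"
      have "norm (dser (\<lambda>_. 1) (Complex x (2 * t))) \<le> B1 * T"
        using Lb[of "Complex x (2 * t)"] Lf[of "Complex x (2 * t)"] x c d t by simp
      then show "norm (dser (\<lambda>n. 1 ^ 2) (Complex x (2 * t))) \<le> B1 * T" by simp
    qed auto
    finally have mm: "m \<le> norm (L (Complex c t))" .
    have "norm (dser (\<lambda>n. of_real (ln (real n)) ^ k * (mangoldt n * 1)) (Complex c t)) \<le> fact k * (2 * D / m) ^ (k + 1)"
      by (rule log_deriv_bound[OF cmul_one Lf c m0 m1 mm])
    also have "2 * D / m = 2 * D1 / c0 * T ^ 6" using T1 by (simp add: DD m_def eval_nat_numeral)
    also have "fact k * (2 * D1 / c0 * T ^ 6) ^ (k + 1) = C1 * (T ^ 6) ^ (k + 1)" by (simp only: C1_def power_mult_distrib[of "2 * D1 / c0" "T ^ 6"] mult.assoc)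
    also have T6: "(T ^ 6) ^ (k + 1) = \<tau> powr (1/2)"
    proof -
      have "(T ^ 6) ^ (k + 1) = T ^ (6 * (k + 1))" by (simp only: power_mult)
      also have "\<dots> = T powr (6 * (real k + 1))" using T1 by (subst powr_realpow[symmetric]) (auto simp: algebra_simps)
      also have "\<dots> = \<tau> powr (1/2)" unfolding T_def powr_powr dk ..
      finally show ?thesis .
    qed
    finally have p1: "norm (dser (\<lambda>n. of_real (ln (real n)) ^ k * mangoldt n) (Complex c t)) \<le> C1 * \<tau> powr (1/2)" by simp
    have sib: "Complex c t \<in> ibox d t" using c d by (auto simp: ibox_def)
    have cb: "cball (Complex c t) (d/2) \<subseteq> box d t" by (rule cball_subset_box[OF sib d])
    have "norm ((deriv ^^ k) L (Complex c t)) \<le> fact k * (B1 * T) / (d/2) ^ k"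
    proof (rule Cauchy_inequality)
      show "L holomorphic_on ball (Complex c t) (d/2)" using cb bsub by (intro holomorphic_on_subset[OF holL]) (meson ball_subset_cball order_trans)
      show "continuous_on (cball (Complex c t) (d/2)) L" using cb bsub by (intro holomorphic_on_imp_continuous_on holomorphic_on_subset[OF holL]) auto
      show "0 < d/2" using d by simp
      fix x assume "norm (Complex c t - x) = d/2"
      then show "norm (L x) \<le> B1 * T" using cb by (intro LB) (auto simp: dist_norm)
    qed
    also have "(deriv ^^ k) L (Complex c t) = (deriv ^^ k) (dser (\<lambda>_. 1)) (Complex c t)"
      by (rule higher_deriv_transform_within_open[OF _ _ open_Re_gt[of 1]])
         (use c Lf dser_holomorphic[OF slow_1] in \<open>auto intro!: holomorphic_on_subset[OF holL]\<close>)
    also have "\<dots> = dser (\<lambda>n. (- of_real (ln (real n))) ^ k * 1) (Complex c t)"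
      by (rule dser_higher_deriv[OF slow_1]) (use c in simp)
    also have "\<dots> = (-1) ^ k * dser (\<lambda>n. of_real (ln (real n)) ^ k * 1) (Complex c t)"
    proof -
      have "(\<lambda>n. (- complex_of_real (ln (real n))) ^ k * 1) = (\<lambda>n. (-1) ^ k * (of_real (ln (real n)) ^ k * 1))"
        by (auto simp: power_minus[of "of_real (ln _)"])
      then show ?thesis using dser_cmult[OF slow_ln_power[OF slow_1], of "Complex c t" "(-1) ^ k" k] c by simp
    qed
    finally have "norm (dser (\<lambda>n. of_real (ln (real n)) ^ k * 1) (Complex c t)) \<le> C2 * T"
      by (simp add: norm_mult norm_power C2_def)
    also have "\<dots> \<le> C2 * (T ^ 6) ^ (k + 1)"
    proof -
      have "T ^ 1 \<le> T ^ (6 * (k + 1))" using T1 by (intro power_increasing) auto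
      then show ?thesis using C by (simp only: power_mult power_one_right) (intro mult_left_mono, auto)
    qed
    finally have p2: "norm (dser (\<lambda>n. of_real (ln (real n)) ^ k * 1) (Complex c t)) \<le> C2 * \<tau> powr (1/2)" unfolding T6 .
    have "dser (\<lambda>n. of_real (ln (real n)) ^ k * (mangoldt n - 1)) (Complex c t) =
       dser (\<lambda>n. of_real (ln (real n)) ^ k * mangoldt n) (Complex c t) + - dser (\<lambda>n. of_real (ln (real n)) ^ k * 1) (Complex c t)"
    proof -
      have s1: "slow (\<lambda>n. of_real (ln (real n)) ^ k * mangoldt n)" using slow_ln_power[OF slow_mangoldt[OF slow_1], of k] by simp
      have s2: "slow (\<lambda>n. of_real (ln (real n)) ^ k * 1)" by (rule slow_ln_power[OF slow_1])
      have "dser (\<lambda>n. of_real (ln (real n)) ^ k * (mangoldt n - 1)) (Complex c t) = dser (\<lambda>n. of_real (ln (real n)) ^ k * mangoldt n + - (of_real (ln (real n)) ^ k * 1)) (Complex c t)"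
        by (simp add: algebra_simps)
      also have "\<dots> = dser (\<lambda>n. of_real (ln (real n)) ^ k * mangoldt n) (Complex c t) + dser (\<lambda>n. - (of_real (ln (real n)) ^ k * 1)) (Complex c t)"
        by (rule dser_add[OF s1 slow_uminus[OF s2]]) (use c in simp)
      also have "dser (\<lambda>n. - (of_real (ln (real n)) ^ k * 1)) (Complex c t) = - dser (\<lambda>n. of_real (ln (real n)) ^ k * 1) (Complex c t)"
        by (rule dser_uminus[OF s2]) (use c in simp)
      finally show ?thesis .
    qed
    then have "norm (dser (\<lambda>n. of_real (ln (real n)) ^ k * (mangoldt n - 1)) (Complex c t)) \<le> C1 * \<tau> powr (1/2) + C2 * \<tau> powr (1/2)"
      using p1 p2 norm_triangle_ineq[of "dser (\<lambda>n. of_real (ln (real n)) ^ k * mangoldt n) (Complex c t)" "- dser (\<lambda>n. of_real (ln (real n)) ^ k * 1) (Complex c t)"] by simp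
    then show "norm (dser (\<lambda>n. of_real (ln (real n)) ^ k * (mangoldt n - 1)) (Complex c t)) \<le> (C1 + C2) * (\<bar>t\<bar> + 2) powr (1/2)"
      by (simp add: \<tau>_def algebra_simps)
  qed (use C in simp)
qed

text \<open>In \<open>- \<zeta>' / \<zeta> - \<zeta>\<close> the poles at 1 cancel, and what remains
  is holomorphic near a compact rectangle. On its left edge
  \<open>norm (zg z - 1) \<le> (3/4) * (5/4) < 1\<close>, which excludes zeros there and explains
  the height 3/4.\<close>

lemma log_deriv_zeta_small:
  obtains C where "C > 0" "\<And>c t. 1 < c \<Longrightarrow> c \<le> 2 \<Longrightarrow> \<bar>t\<bar> \<le> 3/4 \<Longrightarrow>
     norm (dser (\<lambda>n. of_real (ln (real n)) ^ k * (mangoldt n - 1)) (Complex c t)) \<le> C"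
proof -
  define G where "G = (\<lambda>s. if s = 1 then deriv zg 1 else (zg s - zg 1) / (s - 1))"
  have one: "(1::complex) \<in> interior {s. Re s > 0}" by (simp add: interior_open open_Re_gt)
  have holG: "G holomorphic_on {s. Re s > 0}" unfolding G_def by (rule pole_lemma[OF zg_holomorphic one])
  define U where "U = {s. Re s > 0} \<inter> zg -` (- {0})"
  have opU: "open U" unfolding U_def
  proof (rule continuous_open_preimage)
    show "continuous_on {s. Re s > 0} zg" by (rule holomorphic_on_imp_continuous_on[OF zg_holomorphic])
    show "open {s. Re s > 0}" by (rule open_Re_gt)
    show "open (- {0::complex})" by auto
  qed
  define H where "H = (\<lambda>s. - deriv zg s / zg s - G s)"
  have holH: "H holomorphic_on U"
  proof -
    have "zg holomorphic_on U" "G holomorphic_on U" "deriv zg holomorphic_on U"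
      using zg_holomorphic holG holomorphic_deriv[OF zg_holomorphic open_Re_gt]
      by (auto elim!: holomorphic_on_subset simp: U_def)
    then show ?thesis unfolding H_def
      by (intro holomorphic_on_diff holomorphic_on_divide holomorphic_on_minus) (auto simp: U_def)
  qed
  define K where "K = cbox (Complex 1 (-(3/4))) (Complex 2 (3/4))"
  have Kin: "z \<in> K \<longleftrightarrow> 1 \<le> Re z \<and> Re z \<le> 2 \<and> \<bar>Im z\<bar> \<le> 3/4" for z
    by (auto simp: K_def in_cbox_complex_iff abs_le_iff)
  have KU: "K \<subseteq> U"
  proof
    fix z assume z: "z \<in> K"
    have "zg z \<noteq> 0"
    proof (cases "Re z > 1")
      case True
      then have "z \<noteq> 1" by auto
      then show ?thesis using zg_eq[OF True] dser_nonzero[OF cmul_one True] by simp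
    next
      case False
      then have re: "Re z = 1" using z Kin by auto
      have n1: "norm (z - 1) \<le> 3/4" using re z by (simp add: Kin cmod_def)
      have n2: "norm z \<le> 5/4"
      proof -
        have "(Im z)\<^sup>2 \<le> (3/4)\<^sup>2" using z by (intro abs_le_square_iff[THEN iffD1]) (auto simp: Kin)
        then have "(norm z)\<^sup>2 \<le> (5/4)\<^sup>2" unfolding cmod_power2 re by (simp add: power_divide)
        then show ?thesis by (rule power2_le_imp_le) simp
      qed
      have "norm (zg z - 1) \<le> norm (z - 1) * (norm z / 1)" using zg_near[of z] re by simp
      also have "\<dots> \<le> 3/4 * (5/4 / 1)" using n1 n2 by (intro mult_mono divide_right_mono) auto
      finally have "norm (zg z - 1) < 1" by simp
      then show ?thesis by auto
    qed
    then show "z \<in> U" using z by (auto simp: U_def Kin)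
  qed
  have "continuous_on K ((deriv ^^ k) H)"
    by (rule continuous_on_subset[OF holomorphic_on_imp_continuous_on[OF holomorphic_higher_deriv[OF holH opU]] KU])
  then have "bounded ((deriv ^^ k) H ` K)" by (intro compact_imp_bounded compact_continuous_image) (auto simp: K_def)
  then obtain C where C: "C > 0" "\<And>z. z \<in> K \<Longrightarrow> norm ((deriv ^^ k) H z) \<le> C" by (auto simp: bounded_pos)
  show ?thesis
  proof (rule that[OF C(1)])
    fix c t :: real assume c: "1 < c" "c \<le> 2" and t: "\<bar>t\<bar> \<le> 3/4"
    define s where "s = Complex c t"
    have sla: "slow (\<lambda>n. mangoldt n - 1)"
      using slow_add[OF slow_mangoldt[OF slow_1] slow_uminus[OF slow_1]] by simp
    have "norm ((deriv ^^ k) H s) \<le> C" by (rule C(2)) (use c t in \<open>simp add: Kin s_def\<close>)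
    also have "(deriv ^^ k) H s = (deriv ^^ k) (dser (\<lambda>n. mangoldt n - 1)) s"
    proof (rule higher_deriv_transform_within_open[OF _ _ open_Re_gt[of 1]])
      have "{s. Re s > 1} \<subseteq> U"
      proof
        fix z assume "z \<in> {s. Re s > 1}"
        then have z: "Re z > 1" by simp
        then have "z \<noteq> 1" by auto
        then show "z \<in> U" using zg_eq[OF z] dser_nonzero[OF cmul_one z] z by (simp add: U_def)
      qed
      then show "H holomorphic_on {s. Re s > 1}" by (rule holomorphic_on_subset[OF holH])
      show "dser (\<lambda>n. mangoldt n - 1) holomorphic_on {s. Re s > 1}" by (rule dser_holomorphic[OF sla])
      show "s \<in> {s. Re s > 1}" using c by (simp add: s_def)
      fix w assume "w \<in> {s. Re s > 1}"
      then have w: "Re w > 1" by simp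
      then have w1: "w \<noteq> 1" by auto
      define X where "X = dser (\<lambda>_. 1) w"
      define Y where "Y = dser (\<lambda>n. mangoldt n * 1) w"
      have X0: "X \<noteq> 0" using dser_nonzero[OF cmul_one w] by (simp add: X_def)
      have "eventually (\<lambda>z. z \<in> {s. Re s > 1}) (nhds w)" using w by (intro eventually_nhds_in_open open_Re_gt) auto
      then have "eventually (\<lambda>z. zg z = (z - 1) * dser (\<lambda>_. 1) z) (nhds w)" by eventually_elim (use zg_eq in auto)
      then have "deriv zg w = deriv (\<lambda>z. (z - 1) * dser (\<lambda>_. 1) z) w" by (rule deriv_cong_ev) simp
      also have "\<dots> = (w - 1) * - (Y * X) + 1 * X"
      proof (rule DERIV_imp_deriv)
        have d1: "((\<lambda>z. z - 1) has_field_derivative 1) (at w)" by (auto intro!: derivative_eq_intros)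
        show "((\<lambda>z. (z - 1) * dser (\<lambda>_. 1) z) has_field_derivative (w - 1) * - (Y * X) + 1 * X) (at w)"
          using DERIV_mult'[OF d1 dser_deriv_mangoldt[OF cmul_one w]] by (simp add: X_def Y_def)
      qed
      finally have dz: "deriv zg w = (w - 1) * - (Y * X) + 1 * X" .
      have zw: "zg w = (w - 1) * X" using zg_eq[OF w] by (simp add: X_def)
      have alg: "- (a * - (Y * X) + 1 * X) / (a * X) - (a * X - 1) / a = Y - X" if "a \<noteq> 0" for a using that X0 by (simp add: field_simps)
      have "H w = Y - X"
        unfolding H_def dz G_def using w1 alg[of "w - 1"] by (simp add: zw)
      moreover have "dser (\<lambda>n. mangoldt n - 1) w = Y - X"
      proof -
        have "dser (\<lambda>n. mangoldt n * 1 + - 1) w = dser (\<lambda>n. mangoldt n * 1) w + dser (\<lambda>n. - 1) w"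
          by (rule dser_add[OF slow_mangoldt[OF slow_1] slow_uminus[OF slow_1] w])
        moreover have "dser (\<lambda>n. - 1) w = - X" unfolding X_def by (rule dser_uminus[OF slow_1 w])
        ultimately show ?thesis by (simp add: Y_def)
      qed
      ultimately show "H w = dser (\<lambda>n. mangoldt n - 1) w" by simp
    qed
    also have "\<dots> = dser (\<lambda>n. (- of_real (ln (real n))) ^ k * (mangoldt n - 1)) s"
      by (rule dser_higher_deriv[OF sla]) (use c in \<open>simp add: s_def\<close>)
    also have "\<dots> = (-1) ^ k * dser (\<lambda>n. of_real (ln (real n)) ^ k * (mangoldt n - 1)) s"
    proof -
      have "(\<lambda>n. (- complex_of_real (ln (real n))) ^ k * (mangoldt n - 1)) = (\<lambda>n. (-1) ^ k * (of_real (ln (real n)) ^ k * (mangoldt n - 1)))"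
        by (auto simp: power_minus[of "of_real (ln _)"])
      then show ?thesis using dser_cmult[OF slow_ln_power[OF sla], of s "(-1) ^ k" k] c by (simp add: s_def)
    qed
    finally show "norm (dser (\<lambda>n. of_real (ln (real n)) ^ k * (mangoldt n - 1)) (Complex c t)) \<le> C"
      by (simp add: s_def norm_mult norm_power)
  qed
qed

theorem log_deriv_zeta:
  obtains C where "C > 0" "\<And>c t. 1 < c \<Longrightarrow> c \<le> 2 \<Longrightarrow>
     norm (dser (\<lambda>n. of_real (ln (real n)) ^ k * (mangoldt n - 1)) (Complex c t)) \<le> C * (\<bar>t\<bar> + 2) powr (1/2)"
proof -
  obtain C1 where C1: "C1 > 0" "\<And>c t. 1 < c \<Longrightarrow> c \<le> 2 \<Longrightarrow> \<bar>t\<bar> \<ge> 3/4 \<Longrightarrow>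
     norm (dser (\<lambda>n. of_real (ln (real n)) ^ k * (mangoldt n - 1)) (Complex c t)) \<le> C1 * (\<bar>t\<bar> + 2) powr (1/2)"
    by (rule log_deriv_zeta_large) blast
  obtain C2 where C2: "C2 > 0" "\<And>c t. 1 < c \<Longrightarrow> c \<le> 2 \<Longrightarrow> \<bar>t\<bar> \<le> 3/4 \<Longrightarrow>
     norm (dser (\<lambda>n. of_real (ln (real n)) ^ k * (mangoldt n - 1)) (Complex c t)) \<le> C2"
    by (rule log_deriv_zeta_small) blast
  show ?thesis
  proof (rule that[of "C1 + C2"])
    fix c t :: real assume c: "1 < c" "c \<le> 2"
    have p: "1 \<le> (\<bar>t\<bar> + 2) powr (1/2)" by (intro ge_one_powr_ge_zero) auto
    then have "C2 * 1 \<le> C2 * (\<bar>t\<bar> + 2) powr (1/2)" using C2 by (intro mult_left_mono) auto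
    moreover have "0 \<le> C1 * (\<bar>t\<bar> + 2) powr (1/2)" "0 \<le> C2 * (\<bar>t\<bar> + 2) powr (1/2)" using C1 C2 by auto
    ultimately show "norm (dser (\<lambda>n. of_real (ln (real n)) ^ k * (mangoldt n - 1)) (Complex c t)) \<le> (C1 + C2) * (\<bar>t\<bar> + 2) powr (1/2)"
      using C1(2)[OF c, of t] C2(2)[OF c, of t] by (cases "\<bar>t\<bar> \<ge> 3/4") (auto simp: algebra_simps)
  qed (use C1 C2 in simp)
qed

section \<open>Sums over the von Mangoldt function\<close>

text \<open>The segment is a diameter of the circle with centre \<open>c\<close> and radius
  \<open>T\<close>. For \<open>y \<le> 1\<close> it is replaced by the right half circle, where
  \<open>y powr s\<close> is small and no pole is met; for \<open>y \<ge> 1\<close> by the left one,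
  where the poles 0 and -1 contribute \<open>1 - 1/y\<close>.\<close>

lemma perron_kernel:
  fixes y c T :: real
  assumes "y > 0" "1 < c" "c \<le> 2" "T \<ge> 12"
  defines "k \<equiv> \<lambda>s. of_real y powr s / (s * (s + 1))"
  shows "(\<lambda>t. k (Complex c t)) integrable_on {-T..T}"
    and "norm (integral {-T..T} (\<lambda>t. k (Complex c t)) - of_real (2 * pi * max 0 (1 - 1/y))) \<le> 30 * y powr c / T"
proof -
  have T0: "T > 0" using assms by simp
  have hol: "k holomorphic_on - {0, -1}"
    unfolding k_def using assms(1) by (intro holomorphic_intros) (auto simp: add_eq_0_iff2)
  define S where "S = {s. Re s > 0}"
  have holS: "k holomorphic_on S" by (rule holomorphic_on_subset[OF hol]) (auto simp: S_def complex_eq_iff)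
  have cS: "convex S" unfolding S_def by (rule convex_halfspace_Re_gt)
  define K where "K = (\<lambda>t. k (of_real c + of_real T * cis t) * of_real T * \<i> * cis t)"
  have avoid: "of_real c + of_real T * cis t \<notin> {0, -1}" for t
  proof
    assume "of_real c + of_real T * cis t \<in> {0, -1}"
    then have "norm (of_real c + of_real T * cis t) \<le> 1" by auto
    moreover have "norm (of_real T * cis t + of_real c) \<ge> T - c"
      using norm_diff_ineq[of "of_real T * cis t" "of_real c"] assms by (simp add: norm_mult)
    ultimately show False using assms by (simp add: add.commute)
  qed
  have cK: "continuous_on A K" for A
  proof -
    have "continuous_on A (\<lambda>t. k (of_real c + of_real T * cis t))"
      by (rule continuous_on_compose2[OF holomorphic_on_imp_continuous_on[OF hol]])
         (use avoid in \<open>auto intro!: continuous_intros simp: cis_conv_exp\<close>)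
    then show ?thesis unfolding K_def cis_conv_exp by (intro continuous_intros) (simp add: cis_conv_exp)
  qed
  have iK: "K integrable_on {a..b}" for a b by (rule integrable_continuous_real[OF cK])
  define p1 where "p1 = part_circlepath (of_real c) T 0 (pi/2)"
  define p2 where "p2 = part_circlepath (of_real c) T (3/2*pi) (2*pi)"
  define l where "l = linepath (Complex c (-T)) (Complex c T)"
  have ends: "pathstart p1 = of_real (c + T)" "pathfinish p1 = Complex c T"
     "pathstart p2 = Complex c (-T)" "pathfinish p2 = of_real (c + T)"
  proof -
    have x: "exp (\<i> * complex_of_real a) = cis a" for a by (simp add: cis_conv_exp)
    have "3/2*pi = pi/2 + pi" by simp
    then have "cos (3/2*pi) = 0" "sin (3/2*pi) = -1"
      using cos_periodic_pi[of "pi/2"] sin_periodic_pi[of "pi/2"] by (simp_all only: cos_pi_half sin_pi_half minus_zero)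
    then show "pathstart p1 = of_real (c + T)" "pathfinish p1 = Complex c T"
      "pathstart p2 = Complex c (-T)" "pathfinish p2 = of_real (c + T)"
      unfolding p1_def p2_def pathstart_part_circlepath pathfinish_part_circlepath x
      by (simp_all add: complex_eq_iff del: times_divide_eq_left)
  qed
  have inS1: "path_image p1 \<subseteq> S" "path_image p2 \<subseteq> S" "path_image l \<subseteq> S"
  proof -
    have "cos t \<ge> 0" if "0 \<le> t" "t \<le> pi/2" for t using that by (intro cos_ge_zero) auto
    moreover have "cos t \<ge> 0" if "3/2*pi \<le> t" "t \<le> 2*pi" for t
    proof -
      have "cos t = cos (2*pi - t)" by simp
      also have "\<dots> \<ge> 0" using that by (intro cos_ge_zero) auto
      finally show ?thesis .
    qed
    moreover have "closed_segment 0 (pi/2) = {0..pi/2}" "closed_segment (3/2*pi) (2*pi) = {3/2*pi..2*pi}"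
      by (simp_all add: closed_segment_eq_real_ivl)
    ultimately show "path_image p1 \<subseteq> S" "path_image p2 \<subseteq> S"
      using assms(2) T0 unfolding p1_def p2_def S_def path_image_part_circlepath'
      by (auto intro!: add_pos_nonneg mult_nonneg_nonneg simp del: times_divide_eq_left)
    have "closed_segment (Complex c (-T)) (Complex c T) \<subseteq> {s. Re s > 1}"
      by (rule closed_segment_subset) (use assms convex_halfspace_Re_gt[of 1] in auto)
    then show "path_image l \<subseteq> S" unfolding l_def S_def by (auto simp: subset_iff)
  qed
  let ?p = "l +++ reversepath p1 +++ reversepath p2"
  have vp: "valid_path l" "valid_path p1" "valid_path p2" by (simp_all add: l_def p1_def p2_def)
  have el: "pathstart l = Complex c (-T)" "pathfinish l = Complex c T" by (simp_all add: l_def)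
  have op: "open S" unfolding S_def by (rule open_halfspace_Re_gt)
  have ci: "k contour_integrable_on l" "k contour_integrable_on p1" "k contour_integrable_on p2"
    by (rule contour_integrable_holomorphic_simple[OF holS op], simp add: vp, rule inS1)+
  have "(k has_contour_integral 0) ?p"
    by (rule Cauchy_theorem_convex_simple[OF holS cS])
       (use vp el ends inS1 in \<open>auto simp: path_image_join valid_path_join_eq intro!: valid_path_join\<close>)
  then have "contour_integral ?p k = 0" by (rule contour_integral_unique)
  also have "contour_integral ?p k = contour_integral l k + (- contour_integral p1 k + - contour_integral p2 k)"
    using vp el ends ci by (simp add: contour_integral_join contour_integral_reversepath contour_integrable_reversepath contour_integrable_joinI)
  finally have eq: "contour_integral l k = contour_integral p1 k + contour_integral p2 k" by (simp add: algebra_simps)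
  have ep1: "contour_integral p1 k = integral {0..pi/2} K" unfolding p1_def K_def by (subst contour_integral_part_circlepath_eq) auto
  have ep2: "contour_integral p2 k = integral {3/2*pi..2*pi} K" unfolding p2_def K_def by (subst contour_integral_part_circlepath_eq) auto
  have "k contour_integrable_on l" by (rule ci)
  then have il: "((\<lambda>t. k (Complex c t)) has_integral (-\<i> * contour_integral l k)) {-T..T}"
    using has_contour_integral_linepath_same_Re_iff[of "Complex c (-T)" c "Complex c T" "-T" T k "contour_integral l k"] T0
    by (simp add: l_def has_contour_integral_integral)
  then show "(\<lambda>t. k (Complex c t)) integrable_on {-T..T}" by blast
  have Kb: "norm (K t) \<le> 4 * y powr c / T" if "(y \<le> 1 \<and> cos t \<ge> 0) \<or> (y \<ge> 1 \<and> cos t \<le> 0)" for t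
  proof -
    define s where "s = of_real c + of_real T * cis t"
    have n1: "norm s \<ge> T - c" using norm_triangle_ineq2[of "of_real T * cis t" "- of_real c"] assms by (simp add: s_def norm_mult add.commute)
    have n2: "norm (s + 1) \<ge> T - (c + 1)"
    proof -
      have "s + 1 = of_real T * cis t + of_real (c + 1)" by (simp add: s_def)
      moreover have "norm (of_real (c + 1) :: complex) = c + 1" using assms by (simp del: of_real_add)
      ultimately have "T - (c + 1) \<le> norm (s + 1)"
        using norm_diff_ineq[of "of_real T * cis t" "of_real (c + 1)"] assms(4) by (simp only: norm_mult norm_of_real norm_cis)
      then show ?thesis .
    qed
    have "norm (of_real y powr s) = y powr (c + T * cos t)" using assms by (simp add: norm_powr_real_powr s_def)
    also have "\<dots> \<le> y powr c"
    proof (cases "y \<le> 1")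
      case True
      show ?thesis
      proof (cases "y = 1")
        case False
        then have "cos t \<ge> 0" using True that by auto
        then show ?thesis using True assms T0 by (intro powr_mono') auto
      qed simp
    next
      case False
      then show ?thesis using that T0 by (intro powr_mono) (auto intro: mult_nonneg_nonpos)
    qed
    finally have n3: "norm (of_real y powr s) \<le> y powr c" .
    have "(T/2) * (T/2) \<le> norm s * norm (s + 1)" using n1 n2 assms by (intro mult_mono) auto
    moreover have "norm (K t) = norm (of_real y powr s) * T / (norm s * norm (s + 1))"
      using T0 by (simp add: K_def k_def s_def[symmetric] norm_mult norm_divide)
    moreover have "norm (of_real y powr s) * T \<le> y powr c * T" using n3 T0 by (intro mult_right_mono) auto
    moreover have "0 < (T/2) * (T/2)" "0 \<le> y powr c * T" using T0 by auto
    ultimately have "norm (K t) \<le> y powr c * T / ((T/2) * (T/2))"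
      using frac_le by metis
    then show ?thesis using T0 by (simp add: field_simps)
  qed
  have Ib: "norm (integral {a..b} K) \<le> 4 * y powr c / T * (b - a)"
    if "a \<le> b" "\<And>t. t \<in> {a..b} \<Longrightarrow> (y \<le> 1 \<and> cos t \<ge> 0) \<or> (y \<ge> 1 \<and> cos t \<le> 0)" for a b
    using that by (intro integral_bound[OF _ cK]) (auto intro: Kb)
  have pi4: "4 * y powr c / T * pi \<le> 30 * y powr c / T"
  proof -
    have "4 * y powr c / T * pi \<le> 4 * y powr c / T * 4" using pi_less_4 T0 by (intro mult_left_mono) auto
    also have "\<dots> \<le> 30 * y powr c / T" using T0 by (simp add: field_simps)
    finally show ?thesis .
  qed
  have main: "norm (contour_integral l k - \<i> * of_real (2 * pi * max 0 (1 - 1/y))) \<le> 30 * y powr c / T"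
  proof (cases "y \<le> 1")
    case True
    then have m0: "max 0 (1 - 1/y) = 0" using assms by (simp add: max_def field_simps)
    have "norm (integral {0..pi/2} K) \<le> 4 * y powr c / T * (pi/2 - 0)"
      by (rule Ib) (use True in \<open>auto intro!: cos_ge_zero\<close>)
    moreover have "norm (integral {3/2*pi..2*pi} K) \<le> 4 * y powr c / T * (2*pi - 3/2*pi)"
    proof (rule Ib)
      fix t assume t: "t \<in> {3/2*pi..2*pi}"
      have "cos t = cos (2*pi - t)" by simp
      also have "\<dots> \<ge> 0" using t by (intro cos_ge_zero) auto
      finally have "cos t \<ge> 0" .
      then show "(y \<le> 1 \<and> cos t \<ge> 0) \<or> (y \<ge> 1 \<and> cos t \<le> 0)" using True by simp
    qed simp
    ultimately have "norm (contour_integral l k) \<le> 4 * y powr c / T * (pi/2 - 0) + 4 * y powr c / T * (2*pi - 3/2*pi)"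
      unfolding eq ep1 ep2 by (intro order_trans[OF norm_triangle_ineq] add_mono)
    also have "\<dots> = 4 * y powr c / T * pi" by (simp add: algebra_simps)
    finally show ?thesis using pi4 m0 by simp
  next
    case False
    then have y1: "y \<ge> 1" by simp
    then have m1: "max 0 (1 - 1/y) = 1 - 1/y" by (simp add: max_def field_simps)
    have "norm (0 - of_real c :: complex) < T" "norm (-1 - of_real c :: complex) < T"
    proof -
      have "-1 - of_real c = (of_real (-1 - c) :: complex)" by simp
      then have "norm (-1 - of_real c :: complex) = \<bar>-1 - c\<bar>" by (metis norm_of_real)
      then show "norm (-1 - of_real c :: complex) < T" using assms by simp
    qed (use assms in simp)
    note nz = this
    have ey: "(\<lambda>s. complex_of_real y powr s) holomorphic_on A" for A using assms(1) by (intro holomorphic_intros) auto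
    \<comment> \<open>Partial fractions \<open>1 / s - 1 / (s + 1)\<close> give the full circle by
      Cauchy's formula; removing the two right arcs, which equal the segment, leaves the left arc as
      the error.\<close>
    have c1: "((\<lambda>u. of_real y powr u / (u - 0)) has_contour_integral (2 * of_real pi * \<i> * of_real y powr 0)) (circlepath (of_real c) T)"
      by (rule Cauchy_integral_circlepath) (use nz ey holomorphic_on_imp_continuous_on in auto)
    have c2: "((\<lambda>u. of_real y powr u / (u - (-1))) has_contour_integral (2 * of_real pi * \<i> * of_real y powr (-1))) (circlepath (of_real c) T)"
      by (rule Cauchy_integral_circlepath) (use nz ey holomorphic_on_imp_continuous_on in auto)
    have yinv: "complex_of_real y powr (-1) = of_real (1/y)" using assms(1) by (simp add: powr_minus field_simps)
    have "(k has_contour_integral (2 * of_real pi * \<i> * of_real y powr 0 - 2 * of_real pi * \<i> * of_real y powr (-1))) (circlepath (of_real c) T)"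
    proof (rule has_contour_integral_eq[OF has_contour_integral_diff[OF c1 c2]])
      fix x assume "x \<in> path_image (circlepath (complex_of_real c) T)"
      then have "norm (x - of_real c) = T" using T0 by (auto simp: path_image_circlepath dist_norm norm_minus_commute)
      then have "x \<noteq> 0" "x + 1 \<noteq> 0" using nz by (auto simp: add_eq_0_iff2 norm_minus_commute)
      then show "of_real y powr x / (x - 0) - of_real y powr x / (x - - 1) = k x"
        by (simp add: k_def field_simps)
    qed
    then have "contour_integral (circlepath (of_real c) T) k = \<i> * of_real (2 * pi * (1 - 1/y))"
      unfolding yinv using assms(1) by (subst contour_integral_unique) (auto simp: algebra_simps)
    moreover have "contour_integral (circlepath (of_real c) T) k = integral {0..2*pi} K"
      unfolding circlepath_def K_def by (subst contour_integral_part_circlepath_eq) auto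
    moreover have "integral {0..2*pi} K = integral {0..pi/2} K + integral {pi/2..3/2*pi} K + integral {3/2*pi..2*pi} K"
      using Henstock_Kurzweil_Integration.integral_combine[of 0 "pi/2" "2*pi" K] Henstock_Kurzweil_Integration.integral_combine[of "pi/2" "3/2*pi" "2*pi" K] iK by (simp add: add.assoc)
    ultimately have "contour_integral l k - \<i> * of_real (2 * pi * max 0 (1 - 1/y)) = - integral {pi/2..3/2*pi} K"
      unfolding eq ep1 ep2 m1 by (simp add: algebra_simps)
    also have "norm \<dots> \<le> 4 * y powr c / T * (3/2*pi - pi/2)"
      unfolding norm_minus_cancel
    proof (rule Ib)
      fix t assume t: "t \<in> {pi/2..3/2*pi}"
      have "cos t = - cos (t - pi)" by (simp add: cos_diff)
      moreover have "cos (t - pi) \<ge> 0" using t by (intro cos_ge_zero) auto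
      ultimately show "(y \<le> 1 \<and> cos t \<ge> 0) \<or> (y \<ge> 1 \<and> cos t \<le> 0)" using y1 by simp
    qed simp
    also have "3/2*pi - pi/2 = pi" by simp
    finally show ?thesis using pi4 by linarith
  qed
  have "integral {-T..T} (\<lambda>t. k (Complex c t)) = -\<i> * contour_integral l k" using il by (rule integral_unique)
  then have "norm (integral {-T..T} (\<lambda>t. k (Complex c t)) - of_real (2 * pi * max 0 (1 - 1/y))) =
      norm (-\<i> * (contour_integral l k - \<i> * of_real (2 * pi * max 0 (1 - 1/y))))" by (simp add: algebra_simps)
  also have "\<dots> = norm (contour_integral l k - \<i> * of_real (2 * pi * max 0 (1 - 1/y)))" by (simp add: norm_mult)
  finally show "norm (integral {-T..T} (\<lambda>t. k (Complex c t)) - of_real (2 * pi * max 0 (1 - 1/y))) \<le> 30 * y powr c / T"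
    using main by simp
qed

text \<open>The weight \<open>1 - n / x\<close> corresponds to a kernel that decays like
  \<open>1 / t^2\<close>. Against a growth of order \<open>|t| powr (1/2)\<close> the integral over
  the whole line converges absolutely, so the bound has no factor depending on a truncation
  height.\<close>

lemma riesz_mean_bound:
  fixes b :: "nat \<Rightarrow> complex"
  assumes "slow b" "1 < c" "c \<le> 2" "x \<ge> 1" "M \<ge> 0"
    and B: "\<And>t. norm (dser b (Complex c t)) \<le> M * (\<bar>t\<bar> + 2) powr (1/2)"
  shows "norm (\<Sum>n\<in>{1..nat \<lfloor>x\<rfloor>}. b n * of_real (1 - real n / x)) \<le> 100 * M * x powr c"
proof -
  define S where "S = (\<Sum>n\<in>{1..nat \<lfloor>x\<rfloor>}. b n * of_real (1 - real n / x))"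
  define k where "k = (\<lambda>y s. complex_of_real y powr s / (s * (s + 1)))"
  define W where "W = (\<Sum>n. norm (b n) * real n powr (-c))"
  have sW: "summable (\<lambda>n. norm (b n) * real n powr (-c))" using assms(1,2) by (auto simp: slow_def)
  have kd: "norm (1 / (Complex c t * (Complex c t + 1))) \<le> (\<bar>t\<bar> + 1) powr (-2) * 4" for t
  proof -
    have l: "(\<bar>t\<bar> + 1) / 2 \<le> norm z" if "Im z = t" "Re z \<ge> 1" for z
      using abs_Im_le_cmod[of z] complex_Re_le_cmod[of z] that by (simp add: field_simps)
    have nz: "Complex c t \<noteq> 0" "Complex c t + 1 \<noteq> 0" using assms(2) by (auto simp: complex_eq_iff)
    have "((\<bar>t\<bar> + 1) / 2) * ((\<bar>t\<bar> + 1) / 2) \<le> norm (Complex c t) * norm (Complex c t + 1)"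
      using assms by (intro mult_mono l) auto
    then have "1 / (norm (Complex c t) * norm (Complex c t + 1)) \<le> 1 / (((\<bar>t\<bar> + 1) / 2) * ((\<bar>t\<bar> + 1) / 2))"
      using nz by (intro divide_left_mono mult_pos_pos) auto
    also have "\<dots> = (\<bar>t\<bar> + 1) powr (-2) * 4" by (simp add: powr_minus powr_numeral power2_eq_square field_simps)
    finally show ?thesis by (simp add: norm_divide norm_mult)
  qed
  have kx: "k (x / real n) s = k x s * of_nat n powr (-s)" for n s
  proof (cases "n = 0")
    case False
    have p: "complex_of_real y powr z = exp (z * of_real (ln y))" if "y > 0" for y z
      using that by (simp add: powr_def Ln_of_real)
    have "complex_of_real (x / real n) powr s = complex_of_real x powr s * complex_of_real (real n) powr (-s)"
      unfolding p[of "x / real n", OF divide_pos_pos] using assms(4) False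
      by (subst p, simp)+ (simp add: ln_div exp_add[symmetric] algebra_simps)
    then show ?thesis by (simp add: k_def)
  qed (simp add: k_def)
  have kxb: "norm (k x (Complex c t)) \<le> x powr c * ((\<bar>t\<bar> + 1) powr (-2) * 4)" for t
  proof -
    have "norm (k x (Complex c t)) = x powr c * norm (1 / (Complex c t * (Complex c t + 1)))"
      using assms(4) by (simp add: k_def norm_divide norm_powr_real_powr)
    also have "\<dots> \<le> x powr c * ((\<bar>t\<bar> + 1) powr (-2) * 4)" by (intro mult_left_mono kd) simp
    finally show ?thesis .
  qed
  have kxb4: "norm (k x (Complex c t)) \<le> x powr c * 4" for t
  proof -
    have ne: "\<bar>t\<bar> + 1 \<noteq> 0" by linarith
    have "(\<bar>t\<bar> + 1) powr (-2) \<le> (\<bar>t\<bar> + 1) powr 0" by (intro powr_mono) auto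
    then have "(\<bar>t\<bar> + 1) powr (-2) \<le> 1" using ne by simp
    then have "x powr c * ((\<bar>t\<bar> + 1) powr (-2) * 4) \<le> x powr c * 4" by (intro mult_left_mono) auto
    with kxb[of t] show ?thesis by linarith
  qed
  have ckx: "continuous_on A (\<lambda>t. k y (Complex c t))" if "y > 0" for A y
  proof -
    have e: "Complex c = (\<lambda>t. of_real c + \<i> * of_real t)" by (auto simp: complex_eq_iff)
    have nz: "of_real c + \<i> * of_real t \<noteq> 0" "of_real c + \<i> * of_real t + 1 \<noteq> 0" for t using assms(2) by (auto simp: complex_eq_iff)
    show ?thesis unfolding k_def e using that nz by (intro continuous_intros) auto
  qed
  have main: "2 * pi * norm S \<le> 32 * M * x powr c + 30 * x powr c * W / T" if T: "T \<ge> 12" for T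
  proof -
    have u: "uniform_limit {-T..T} (\<lambda>N t. \<Sum>n<N. b n * k (x / real n) (Complex c t)) (\<lambda>t. \<Sum>n. b n * k (x / real n) (Complex c t)) sequentially"
    proof (rule Weierstrass_m_test[where M = "\<lambda>n. (x powr c * 4) * (norm (b n) * real n powr (-c))"])
      fix n t
      have "norm (b n * k (x / real n) (Complex c t)) = norm (k x (Complex c t)) * (norm (b n) * real n powr (-c))"
        by (simp add: kx norm_mult)
      also have "\<dots> \<le> (x powr c * 4) * (norm (b n) * real n powr (-c))" by (intro mult_right_mono kxb4) auto
      finally show "norm (b n * k (x / real n) (Complex c t)) \<le> (x powr c * 4) * (norm (b n) * real n powr (-c))" .
    qed (intro summable_mult sW)
    have cN: "continuous_on {-T..T} (\<lambda>t. \<Sum>n<N. b n * k (x / real n) (Complex c t))" for N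
    proof (intro continuous_intros)
      fix n show "continuous_on {-T..T} (\<lambda>t. k (x / real n) (Complex c t))"
      proof (cases "n = 0")
        case True then show ?thesis by (simp add: k_def)
      next
        case False then show ?thesis using assms(4) by (intro ckx) auto
      qed
    qed
    obtain I J where IJ: "\<And>N. ((\<lambda>t. \<Sum>n<N. b n * k (x / real n) (Complex c t)) has_integral I N) {-T..T}"
       "((\<lambda>t. \<Sum>n. b n * k (x / real n) (Complex c t)) has_integral J) {-T..T}" "I \<longlonglongrightarrow> J"
      using uniform_limit_integral[OF u cN] by auto
    have Jb: "norm J \<le> 32 * M * x powr c"
    proof -
      have e: "(\<Sum>n. b n * k (x / real n) (Complex c t)) = dser b (Complex c t) * k x (Complex c t)" for t
      proof -
        have "(\<lambda>n. b n * of_nat n powr (- Complex c t)) sums dser b (Complex c t)" by (rule slow_sums) (use assms in auto)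
        from sums_mult2[OF this, of "k x (Complex c t)"] show ?thesis by (simp add: kx sums_iff mult_ac)
      qed
      define h where "h = (\<lambda>t. (8 * M * x powr c) * (\<bar>t\<bar> + 1) powr (-(3/2)))"
      have hb: "norm (dser b (Complex c t) * k x (Complex c t)) \<le> h t" for t
      proof -
        have "(\<bar>t\<bar> + 2) powr (1/2) \<le> (4 * (\<bar>t\<bar> + 1)) powr (1/2)" by (intro powr_mono2) auto
        also have "\<dots> = 4 powr (1/2) * (\<bar>t\<bar> + 1) powr (1/2)" by (rule powr_mult)
        also have "4 powr (1/2) = (2::real)" by (simp add: powr_half_sqrt)
        finally have "norm (dser b (Complex c t)) \<le> M * (2 * (\<bar>t\<bar> + 1) powr (1/2))"
          using B[of t] assms(5) by (meson mult_left_mono order_trans)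
        then have "norm (dser b (Complex c t) * k x (Complex c t)) \<le> M * (2 * (\<bar>t\<bar> + 1) powr (1/2)) * (x powr c * ((\<bar>t\<bar> + 1) powr (-2) * 4))"
          unfolding norm_mult using kxb[of t] assms(5) by (intro mult_mono) auto
        also have "\<dots> = (8 * M * x powr c) * ((\<bar>t\<bar> + 1) powr (1/2) * (\<bar>t\<bar> + 1) powr (-2))" by simp
        also have "(\<bar>t\<bar> + 1) powr (1/2) * (\<bar>t\<bar> + 1) powr (-2) = (\<bar>t\<bar> + 1) powr (-(3/2))" by (simp add: powr_add[symmetric])
        finally show ?thesis by (simp add: h_def)
      qed
      define G1 where "G1 = (\<lambda>t::real. 2 * (1 - t) powr (-(1/2)))"
      define G2 where "G2 = (\<lambda>t::real. - 2 * (1 + t) powr (-(1/2)))"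
      have i1: "((\<lambda>t. (\<bar>t\<bar> + 1) powr (-(3/2))) has_integral (G1 0 - G1 (-T))) {-T..0}"
      proof (rule fundamental_theorem_of_calculus)
        fix t assume t: "t \<in> {-T..0}"
        have "(G1 has_real_derivative (1 - t) powr (-(3/2))) (at t within {-T..0})"
          unfolding G1_def using t by (auto intro!: derivative_eq_intros)
        then show "(G1 has_vector_derivative (\<bar>t\<bar> + 1) powr (-(3/2))) (at t within {-T..0})"
          using t by (simp add: has_real_derivative_iff_has_vector_derivative)
      qed (use T in auto)
      have i2: "((\<lambda>t. (\<bar>t\<bar> + 1) powr (-(3/2))) has_integral (G2 T - G2 0)) {0..T}"
      proof (rule fundamental_theorem_of_calculus)
        fix t assume t: "t \<in> {0..T}"
        have "(G2 has_real_derivative (1 + t) powr (-(3/2))) (at t within {0..T})"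
          unfolding G2_def using t by (auto intro!: derivative_eq_intros)
        then show "(G2 has_vector_derivative (\<bar>t\<bar> + 1) powr (-(3/2))) (at t within {0..T})"
          using t by (simp add: has_real_derivative_iff_has_vector_derivative add.commute)
      qed (use T in auto)
      have "((\<lambda>t. (\<bar>t\<bar> + 1) powr (-(3/2))) has_integral (G1 0 - G1 (-T) + (G2 T - G2 0))) {-T..T}"
        by (rule has_integral_combine[OF _ _ i1 i2]) (use T in auto)
      then have hi: "(h has_integral (8 * M * x powr c) * (G1 0 - G1 (-T) + (G2 T - G2 0))) {-T..T}"
        unfolding h_def by (rule has_integral_mult_right)
      have "norm J \<le> (8 * M * x powr c) * (G1 0 - G1 (-T) + (G2 T - G2 0))"
      proof -
        have J: "((\<lambda>t. dser b (Complex c t) * k x (Complex c t)) has_integral J) {-T..T}" using IJ(2) by (simp add: e)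
        have "norm (integral {-T..T} (\<lambda>t. dser b (Complex c t) * k x (Complex c t))) \<le> integral {-T..T} h"
          by (rule integral_norm_bound_integral[OF has_integral_integrable[OF J] has_integral_integrable[OF hi]]) (rule hb)
        then show ?thesis using integral_unique[OF J] integral_unique[OF hi] by simp
      qed
      also have "\<dots> \<le> (8 * M * x powr c) * 4"
        using assms(5) by (intro mult_left_mono) (auto simp: G1_def G2_def)
      finally show ?thesis by simp
    qed
    \<comment> \<open>Each term reproduces its Riesz weight up to the kernel error; for
      \<open>n > x\<close> the weight is 0, so enlarging \<open>N\<close> adds errors only, and
      these sum to a multiple of \<open>W\<close>.\<close>
    have IN: "norm (I N - of_real (2 * pi) * S) \<le> 30 * x powr c * W / T" if N: "real N > x" for N
    proof -
      have "((\<lambda>t. b n * k (x / real n) (Complex c t)) has_integral b n * integral {-T..T} (\<lambda>t. k (x / real n) (Complex c t))) {-T..T}" for n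
      proof (rule has_integral_mult_right)
        show "((\<lambda>t. k (x / real n) (Complex c t)) has_integral integral {-T..T} (\<lambda>t. k (x / real n) (Complex c t))) {-T..T}"
        proof (cases "n = 0")
          case False
          then show ?thesis using perron_kernel(1)[of "x / real n" c T] assms T by (simp add: k_def has_integral_integral)
        qed (simp add: k_def)
      qed
      then have "((\<lambda>t. \<Sum>n<N. b n * k (x / real n) (Complex c t)) has_integral (\<Sum>n<N. b n * integral {-T..T} (\<lambda>t. k (x / real n) (Complex c t)))) {-T..T}"
        by (intro has_integral_sum) auto
      then have "I N = (\<Sum>n<N. b n * integral {-T..T} (\<lambda>t. k (x / real n) (Complex c t)))"
        using IJ(1)[of N] has_integral_unique by blast
      moreover have "of_real (2 * pi) * S = (\<Sum>n<N. if n = 0 then 0 else b n * of_real (2 * pi * max 0 (1 - 1 / (x / real n))))"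
      proof -
        have fl: "nat \<lfloor>x\<rfloor> < N" using N assms(4) by (simp add: nat_less_iff floor_less_iff)
        have "(\<Sum>n<N. if n = 0 then 0 else b n * of_real (2 * pi * max 0 (1 - 1 / (x / real n)))) =
          (\<Sum>n\<in>{1..nat \<lfloor>x\<rfloor>}. if n = 0 then 0 else b n * of_real (2 * pi * max 0 (1 - 1 / (x / real n))))"
        proof (rule sum.mono_neutral_right)
          show "{1..nat \<lfloor>x\<rfloor>} \<subseteq> {..<N}" using fl by auto
          show "\<forall>n\<in>{..<N} - {1..nat \<lfloor>x\<rfloor>}. (if n = 0 then 0 else b n * of_real (2 * pi * max 0 (1 - 1 / (x / real n)))) = 0"
          proof
            fix n assume "n \<in> {..<N} - {1..nat \<lfloor>x\<rfloor>}"
            then have "n = 0 \<or> real n > x" using assms(4) by (auto simp: not_le nat_less_iff floor_less_iff)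
            then have "n = 0 \<or> 1 - 1 / (x / real n) \<le> 0" using assms(4) by auto
            then show "(if n = 0 then 0 else b n * of_real (2 * pi * max 0 (1 - 1 / (x / real n)))) = 0" by (auto simp: max_def)
          qed
        qed simp
        also have "\<dots> = of_real (2 * pi) * S"
          unfolding S_def sum_distrib_left
        proof (rule sum.cong)
          fix n assume n: "n \<in> {1..nat \<lfloor>x\<rfloor>}"
          then have "real n \<le> x" using assms(4) by (simp add: le_nat_iff le_floor_iff)
          then have "max 0 (1 - 1 / (x / real n)) = 1 - real n / x" using assms(4) by (simp add: max_def)
          then show "(if n = 0 then 0 else b n * of_real (2 * pi * max 0 (1 - 1 / (x / real n)))) = of_real (2 * pi) * (b n * of_real (1 - real n / x))"
            using n by simp
        qed simp
        finally show ?thesis by simp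
      qed
      ultimately have "norm (I N - of_real (2 * pi) * S) \<le> (\<Sum>n<N. norm (b n * integral {-T..T} (\<lambda>t. k (x / real n) (Complex c t)) - (if n = 0 then 0 else b n * of_real (2 * pi * max 0 (1 - 1 / (x / real n))))))"
        by (simp only: sum_subtractf[symmetric] norm_sum)
      also have "\<dots> \<le> (\<Sum>n<N. (30 * x powr c / T) * (norm (b n) * real n powr (-c)))"
      proof (rule sum_mono)
        fix n
        show "norm (b n * integral {-T..T} (\<lambda>t. k (x / real n) (Complex c t)) - (if n = 0 then 0 else b n * of_real (2 * pi * max 0 (1 - 1 / (x / real n))))) \<le> (30 * x powr c / T) * (norm (b n) * real n powr (-c))"
        proof (cases "n = 0")
          case True then show ?thesis by (simp add: k_def)
        next
          case False
          have "norm (integral {-T..T} (\<lambda>t. k (x / real n) (Complex c t)) - of_real (2 * pi * max 0 (1 - 1 / (x / real n)))) \<le> 30 * (x / real n) powr c / T"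
            using perron_kernel(2)[of "x / real n" c T] assms T False by (simp add: k_def)
          then have "norm (b n) * norm (integral {-T..T} (\<lambda>t. k (x / real n) (Complex c t)) - of_real (2 * pi * max 0 (1 - 1 / (x / real n)))) \<le> norm (b n) * (30 * (x / real n) powr c / T)"
            by (rule mult_left_mono) simp
          also have "(x / real n) powr c = x powr c * real n powr (-c)" using assms(4) by (simp add: powr_divide powr_minus field_simps)
          finally show ?thesis
            by (simp only: False if_False right_diff_distrib[symmetric] norm_mult) (simp add: mult_ac)
        qed
      qed
      also have "\<dots> \<le> (30 * x powr c / T) * W"
        unfolding W_def sum_distrib_left[symmetric] using T sW by (intro mult_left_mono sum_le_suminf) auto
      finally show ?thesis by simp
    qed
    have "norm (J - of_real (2 * pi) * S) \<le> 30 * x powr c * W / T"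
    proof (rule LIMSEQ_le_const2)
      show "(\<lambda>N. norm (I N - of_real (2 * pi) * S)) \<longlonglongrightarrow> norm (J - of_real (2 * pi) * S)" by (intro tendsto_intros IJ)
      obtain N0 where "real N0 > x" using reals_Archimedean2 by blast
      then show "\<exists>N. \<forall>n\<ge>N. norm (I n - of_real (2 * pi) * S) \<le> 30 * x powr c * W / T"
        using IN by (intro exI[of _ N0]) fastforce
    qed
    moreover have "norm (of_real (2 * pi) * S) = 2 * pi * norm S" by (simp add: norm_mult)
    ultimately show ?thesis using Jb norm_triangle_ineq3[of J "of_real (2 * pi) * S"] by linarith
  qed
  \<comment> \<open>\<open>W\<close> may be huge when \<open>c\<close> is close to 1, but it does
    not depend on \<open>T\<close>; its term disappears in the limit.\<close>
  have lim: "((\<lambda>T. 32 * M * x powr c + 30 * x powr c * W / T) \<longlongrightarrow> 32 * M * x powr c + 0) at_top"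
    by (intro tendsto_add tendsto_const tendsto_divide_0[OF tendsto_const filterlim_at_top_imp_at_infinity[OF filterlim_ident]])
  have "2 * pi * norm S \<le> 32 * M * x powr c + 0"
    by (rule tendsto_lowerbound[OF lim]) (use main in \<open>auto intro!: eventually_mono[OF eventually_ge_at_top[of 12]]\<close>)
  moreover have "2 * norm S \<le> 2 * pi * norm S" using pi_gt3 by (intro mult_right_mono) auto
  ultimately have "norm S \<le> 16 * (M * x powr c)" by simp
  also have "\<dots> \<le> 100 * (M * x powr c)" using assms(5) by (intro mult_right_mono) auto
  finally show ?thesis by (simp add: S_def)
qed

lemma ln_power_le_sqrt:
  assumes "x \<ge> 1" "j \<ge> 1"
  shows "ln x ^ j \<le> (2 * real j) ^ j * sqrt x"
proof -
  have "ln x \<le> x powr (1 / (2 * real j)) / (1 / (2 * real j))" using assms by (intro ln_powr_bound) auto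
  then have "ln x ^ j \<le> (2 * real j * x powr (1 / (2 * real j))) ^ j" using assms by (intro power_mono) (auto simp: mult_ac)
  also have "\<dots> = (2 * real j) ^ j * (x powr (1 / (2 * real j))) ^ j" by (simp add: power_mult_distrib)
  also have "(x powr (1 / (2 * real j))) ^ j = x powr (real j * (1 / (2 * real j)))" using assms by (simp add: powr_power mult.commute)
  also have "\<dots> = sqrt x" using assms by (simp add: powr_half_sqrt)
  finally show ?thesis .
qed

text \<open>The weighted coefficients \<open>b n = (ln n) ^ (2 * j) * a n\<close> have a Riesz mean
  without any logarithmic loss. Removing the Riesz weight by differencing costs
  \<open>L ^ (j + 1)\<close>, and removing the weight \<open>(ln n) ^ (2 * j)\<close> by partial
  summation gains \<open>L ^ (2 * j)\<close>. The net factor is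
  \<open>L powr (1 - j)\<close>.\<close>

theorem log_saving:
  assumes j: "j \<ge> 1"
  obtains C where "C > 0"
    "\<And>a M N. (\<And>n. n \<ge> 1 \<Longrightarrow> norm (a n :: complex) \<le> 1 + ln (real n)) \<Longrightarrow> M \<ge> 0 \<Longrightarrow>
       (\<And>c t. 1 < c \<Longrightarrow> c \<le> 2 \<Longrightarrow> norm (dser (\<lambda>n. of_real (ln (real n)) ^ (2 * j) * a n) (Complex c t)) \<le> M * (\<bar>t\<bar> + 2) powr (1/2)) \<Longrightarrow>
       N \<ge> 16 \<Longrightarrow> norm (\<Sum>n\<in>{1..N}. a n) \<le> C * (M + 1) * real N * ln (real N) powr (1 - real j)"
proof -
  define Cj where "Cj = (2 * real j) ^ j"
  have Cj: "Cj \<ge> 1" unfolding Cj_def using j by (intro one_le_power) auto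
  define D where "D = 1500 + 2 * Cj * 3 ^ (2 * j + 1)"
  have D: "D > 0" using Cj by (auto simp: D_def intro!: add_pos_nonneg)
  define C where "C = 2 * D * 2 ^ (2 * j) + 8 * Cj"
  have C: "C > 0" using D Cj by (auto simp: C_def intro!: add_pos_nonneg)
  show ?thesis
  proof (rule that[OF C])
    fix a :: "nat \<Rightarrow> complex" and M :: real and N :: nat
    assume a: "\<And>n. n \<ge> 1 \<Longrightarrow> norm (a n) \<le> 1 + ln (real n)" and M: "M \<ge> 0"
      and B: "\<And>c t. 1 < c \<Longrightarrow> c \<le> 2 \<Longrightarrow> norm (dser (\<lambda>n. of_real (ln (real n)) ^ (2 * j) * a n) (Complex c t)) \<le> M * (\<bar>t\<bar> + 2) powr (1/2)"
      and N: "N \<ge> 16"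
    define b where "b = (\<lambda>n. of_real (ln (real n)) ^ (2 * j) * a n)"
    have sl_a: "slow a"
    proof (rule slow_mono)
      show "slow (\<lambda>n. 1 + of_real (ln (real n)) * 1)" by (intro slow_add slow_1 slow_ln)
      fix n :: nat assume "n \<ge> 1"
      have "norm (1 + of_real (ln (real n)) * 1 :: complex) = norm (complex_of_real (1 + ln (real n)))" by simp
      also have "\<dots> = 1 + ln (real n)" unfolding norm_of_real using \<open>n \<ge> 1\<close> by simp
      finally show "norm (a n) \<le> 1 * norm (1 + of_real (ln (real n)) * 1 :: complex)" using a[OF \<open>n \<ge> 1\<close>] by simp
    qed
    have sl: "slow b" unfolding b_def by (rule slow_ln_power[OF sl_a])
    define S where "S = (\<lambda>n. \<Sum>i\<in>{1..n}. b i)"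
    define R where "R = (\<lambda>n. \<Sum>i\<in>{1..n}. b i * of_nat (n - i))"
    have Rb: "norm (R n) \<le> 300 * M * real n ^ 2" if n: "n \<ge> 3" for n
    proof -
      define x where "x = real n"
      have ln1: "ln x \<ge> 1"
      proof -
        have "exp 1 \<le> x" using n exp_le by (simp add: x_def)
        then show ?thesis using n by (simp add: x_def ln_ge_iff)
      qed
      \<comment> \<open>With this abscissa \<open>x powr c\<close> is only
        \<open>exp 1 * x\<close>.\<close>
      define c where "c = 1 + 1 / ln x"
      have c: "1 < c" "c \<le> 2" using ln1 by (auto simp: c_def)
      have "norm (\<Sum>i\<in>{1..nat \<lfloor>x\<rfloor>}. b i * of_real (1 - real i / x)) \<le> 100 * M * x powr c"
        by (rule riesz_mean_bound[OF sl c]) (use n M B[OF c] in \<open>auto simp: x_def b_def\<close>)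
      also have "x powr c = x * exp 1" using n ln1 by (simp add: c_def powr_add x_def) (simp add: powr_def)
      also have "100 * M * (x * exp 1) \<le> 100 * M * (x * 3)" using exp_le M n by (intro mult_left_mono) (auto simp: x_def)
      finally have 1: "norm (\<Sum>i\<in>{1..n}. b i * of_real (1 - real i / x)) \<le> 300 * M * x" by (simp add: x_def)
      have "R n = of_real x * (\<Sum>i\<in>{1..n}. b i * of_real (1 - real i / x))"
        unfolding R_def sum_distrib_left
      proof (rule sum.cong)
        fix i assume "i \<in> {1..n}"
        then have "complex_of_nat (n - i) = of_real x * of_real (1 - real i / x)" using n by (simp add: x_def of_nat_diff field_simps)
        then show "b i * of_nat (n - i) = of_real x * (b i * of_real (1 - real i / x))" by simp
      qed simp
      then have "norm (R n) = x * norm (\<Sum>i\<in>{1..n}. b i * of_real (1 - real i / x))" by (simp add: norm_mult x_def)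
      also have "\<dots> \<le> x * (300 * M * x)" by (intro mult_left_mono 1) (simp add: x_def)
      finally show ?thesis by (simp add: x_def power2_eq_square mult_ac)
    qed
    have Sb: "norm (S n) \<le> D * (M + 1) * real n * ln (real n) ^ (j + 1)" if n: "n \<ge> 3" for n
    proof -
      define L where "L = ln (real n)"
      have L1: "L \<ge> 1"
      proof -
        have "exp 1 \<le> real n" using n exp_le by (meson numeral_le_real_of_nat_iff order_trans)
        then show ?thesis using n by (simp add: L_def ln_ge_iff)
      qed
      \<comment> \<open>Dividing a difference of \<open>R\<close>, of size \<open>M * n^2\<close>,
        by \<open>h\<close> gives \<open>M * n * L ^ j\<close>; the new terms, bounded trivially,
        give \<open>h * (3 * L) ^ (2 * j + 1)\<close>. This \<open>h\<close> makes the two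
        comparable up to a single \<open>L\<close>.\<close>
      define h where "h = nat \<lceil>real n / L ^ j\<rceil>"
      have h1: "real n / L ^ j \<le> real h" by (simp add: h_def real_nat_ceiling_ge)
      have Lj: "L ^ j \<ge> 1" using L1 by (rule one_le_power)
      have "real n / L ^ j \<le> real n" using Lj n by (simp add: divide_le_eq)
      then have hn: "h \<le> n" unfolding h_def by (simp add: nat_ceiling_le_eq)
      have h0: "h \<ge> 1" using h1 n Lj by (simp add: h_def Suc_le_eq)
      have h2: "real h \<le> 2 * Cj * (real n / L ^ j)"
      proof -
        have "real h \<le> real n / L ^ j + 1" using n Lj by (simp add: h_def)
        moreover have "L ^ j \<le> Cj * real n"
        proof -
          have "L ^ j \<le> Cj * sqrt (real n)" unfolding L_def Cj_def using n j by (intro ln_power_le_sqrt) auto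
          also have "sqrt (real n) \<le> real n" using n by (intro real_le_lsqrt) (auto simp: power2_eq_square)
          finally show ?thesis using Cj by (simp add: mult_left_mono)
        qed
        then have "1 \<le> Cj * (real n / L ^ j)" using Lj by (simp add: field_simps)
        moreover have "1 * (real n / L ^ j) \<le> Cj * (real n / L ^ j)" using Cj Lj by (intro mult_right_mono) auto
        ultimately show ?thesis by linarith
      qed
      have bb: "norm (b i) \<le> (3 * L) ^ (2 * j + 1)" if i: "1 \<le> i" "i \<le> n + h" for i
      proof -
        have "ln (real i) \<le> ln (2 * real n)" using i hn n by (intro ln_mono) auto
        also have "\<dots> = ln 2 + L" using n by (simp add: ln_mult L_def)
        also have "ln 2 \<le> (1::real)" using ln_2_less_1 by simp
        finally have li: "ln (real i) \<le> 1 + L" by simp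
        have l0: "0 \<le> ln (real i)" using i by simp
        have "norm (b i) = ln (real i) ^ (2 * j) * norm (a i)" using l0 by (simp add: b_def norm_mult norm_power)
        also have "\<dots> \<le> (3 * L) ^ (2 * j) * (3 * L)"
          using li l0 L1 a[OF i(1)] by (intro mult_mono power_mono) auto
        finally show ?thesis by (simp only: power_add power_one_right)
      qed
      have split: "R (n + h) - R n = of_nat h * S n + (\<Sum>i\<in>{n<..n+h}. b i * of_nat (n + h - i))"
      proof -
        have un: "{1..n+h} = {1..n} \<union> {n<..n+h}" by auto
        have "R (n + h) = (\<Sum>i\<in>{1..n}. b i * of_nat (n + h - i)) + (\<Sum>i\<in>{n<..n+h}. b i * of_nat (n + h - i))"
          unfolding R_def un by (rule sum.union_disjoint) auto
        moreover have "(\<Sum>i\<in>{1..n}. b i * of_nat (n + h - i)) = (\<Sum>i\<in>{1..n}. b i * of_nat (n - i) + of_nat h * b i)"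
          by (rule sum.cong) (auto simp: of_nat_diff algebra_simps)
        ultimately show ?thesis by (simp add: R_def S_def sum.distrib sum_distrib_left)
      qed
      have "norm (of_nat h * S n) \<le> norm (R (n + h)) + norm (R n) + norm (\<Sum>i\<in>{n<..n+h}. b i * of_nat (n + h - i))"
      proof -
        have "of_nat h * S n = R (n + h) - R n - (\<Sum>i\<in>{n<..n+h}. b i * of_nat (n + h - i))" using split by simp
        then have "norm (of_nat h * S n) \<le> norm (R (n + h) - R n) + norm (\<Sum>i\<in>{n<..n+h}. b i * of_nat (n + h - i))"
          using norm_triangle_ineq4 by metis
        then show ?thesis using norm_triangle_ineq4[of "R (n+h)" "R n"] by linarith
      qed
      also have "norm (R (n + h)) \<le> 300 * M * (2 * real n) ^ 2"
      proof -
        have "norm (R (n + h)) \<le> 300 * M * real (n + h) ^ 2" using n by (intro Rb) simp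
        also have "\<dots> \<le> 300 * M * (2 * real n) ^ 2" using hn M by (intro mult_left_mono power_mono) auto
        finally show ?thesis .
      qed
      also have "norm (R n) \<le> 300 * M * real n ^ 2" by (rule Rb[OF n])
      also have "norm (\<Sum>i\<in>{n<..n+h}. b i * of_nat (n + h - i)) \<le> (\<Sum>i\<in>{n<..n+h}. (3 * L) ^ (2 * j + 1) * real h)"
      proof (rule order_trans[OF norm_sum], rule sum_mono)
        fix i assume i: "i \<in> {n<..n+h}"
        show "norm (b i * of_nat (n + h - i)) \<le> (3 * L) ^ (2 * j + 1) * real h"
          unfolding norm_mult norm_of_nat using i L1 by (intro mult_mono bb) auto
      qed
      also have "\<dots> = real h * ((3 * L) ^ (2 * j + 1) * real h)" by simp
      finally have "real h * norm (S n) \<le> 1500 * M * real n ^ 2 + real h * ((3 * L) ^ (2 * j + 1) * real h)"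
        by (simp add: norm_mult power2_eq_square)
      then have "norm (S n) \<le> (1500 * M * real n ^ 2 + real h * ((3 * L) ^ (2 * j + 1) * real h)) / real h"
        using h0 by (simp add: pos_le_divide_eq mult.commute)
      also have "\<dots> = 1500 * M * real n ^ 2 / real h + (3 * L) ^ (2 * j + 1) * real h" using h0 by (simp add: add_divide_distrib)
      also have "1500 * M * real n ^ 2 / real h \<le> 1500 * M * real n ^ 2 / (real n / L ^ j)"
        using h1 h0 n Lj M by (intro divide_left_mono mult_pos_pos divide_pos_pos) auto
      also have "\<dots> = 1500 * M * (real n * L ^ j)" using n by (simp add: power2_eq_square)
      also have "\<dots> \<le> 1500 * (M + 1) * (real n * L ^ (j + 1))"
        using M L1 n by (intro mult_mono power_increasing) auto
      also have "(3 * L) ^ (2 * j + 1) * real h \<le> (3 * L) ^ (2 * j + 1) * (2 * Cj * (real n / L ^ j))"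
        using L1 by (intro mult_left_mono h2) auto
      also have "\<dots> = 2 * Cj * 3 ^ (2 * j + 1) * (real n * (L ^ (2 * j + 1) / L ^ j))" by (simp add: power_mult_distrib)
      also have "L ^ (2 * j + 1) / L ^ j = L ^ (j + 1)"
      proof -
        have "L ^ (2 * j + 1) = L ^ (j + 1) * L ^ j" unfolding power_add[symmetric] by (rule arg_cong[of _ _ "(^) L"]) simp
        then show ?thesis using L1 by simp
      qed
      also have "2 * Cj * 3 ^ (2 * j + 1) * (real n * L ^ (j + 1)) \<le> 2 * Cj * 3 ^ (2 * j + 1) * ((M + 1) * (real n * L ^ (j + 1)))"
        using Cj mult_right_mono[of 1 "M + 1" "real n * L ^ (j + 1)"] M L1 by (intro mult_left_mono) auto
      finally show ?thesis by (simp add: D_def L_def[symmetric] algebra_simps)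
    qed
    define L where "L = ln (real N)"
    have L1: "L \<ge> 1"
    proof -
      have "exp 1 \<le> real N" using N exp_le by linarith
      then show ?thesis using N by (simp add: L_def ln_ge_iff)
    qed
    \<comment> \<open>Up to about \<open>sqrt N\<close> the trivial bound suffices; beyond it
      \<open>ln n\<close> is at least \<open>L / 2\<close>, so the weight divided out is of full
      size.\<close>
    define m where "m = nat \<lceil>sqrt (real N)\<rceil>"
    have m1: "sqrt (real N) \<le> real m" by (simp add: m_def real_nat_ceiling_ge)
    have s4: "sqrt (real N) \<ge> 4" using N by (simp add: real_le_rsqrt)
    have m4: "m \<ge> 4" using s4 m1 by linarith
    have m2: "real m \<le> 2 * sqrt (real N)" using s4 by (simp add: m_def) linarith
    have sN: "sqrt (real N) * sqrt (real N) = real N" by simp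
    have "2 * sqrt (real N) \<le> sqrt (real N) * sqrt (real N)" using s4 by (intro mult_right_mono) auto
    then have mN: "m \<le> N" using m2 sN by linarith
    define w where "w = (\<lambda>n. 1 / ln (real n) ^ (2 * j))"
    have wd: "w (Suc n) \<le> w n" "w n \<ge> 0" if "n \<ge> 2" for n
      using that unfolding w_def by (auto intro!: divide_left_mono power_mono)
    define E where "E = D * (M + 1) * real N * L ^ (j + 1)"
    have SE: "norm (S n) \<le> E" if "3 \<le> n" "n \<le> N" for n
    proof -
      have "norm (S n) \<le> D * (M + 1) * real n * ln (real n) ^ (j + 1)" by (rule Sb[OF that(1)])
      also have "\<dots> \<le> D * (M + 1) * real N * L ^ (j + 1)"
        unfolding L_def using that D M by (intro mult_mono power_mono) auto
      finally show ?thesis by (simp add: E_def)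
    qed
    have E0: "E \<ge> 0" using D M L1 by (simp add: E_def)
    have ab: "a n = b n * of_real (w n)" if "n \<ge> 2" for n using that by (simp add: b_def w_def)
    have abel: "norm (\<Sum>n\<in>{m<..m+r}. a n) \<le> 2 * E * w m" if "m + r \<le> N" for r
    proof -
      have eq: "(\<Sum>n\<in>{m<..m+r}. a n) = (S (m+r) - S m) * of_real (w (m+r)) + (\<Sum>n\<in>{m..<m+r}. (S n - S m) * of_real (w n - w (Suc n)))"
      proof (induction r)
        case (Suc r)
        have s: "{m<..m + Suc r} = insert (m + Suc r) {m<..m+r}" "{m..<m + Suc r} = insert (m+r) {m..<m+r}" by auto
        have S1: "S (m + Suc r) = S (m+r) + b (m + Suc r)" by (simp add: S_def)
        have a1: "a (m + Suc r) = b (m + Suc r) * of_real (w (m + Suc r))" using m4 by (intro ab) simp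
        show ?case unfolding s by (subst sum.insert, simp, simp)+ (simp add: Suc a1[simplified] S1[simplified] algebra_simps)
      qed simp
      have d2: "norm (S n - S m) \<le> 2 * E" if "m \<le> n" "n \<le> N" for n
        using norm_triangle_ineq4[of "S n" "S m"] SE[of n] SE[of m] that m4 mN by auto
      have "norm (\<Sum>n\<in>{m<..m+r}. a n) \<le> 2 * E * w (m+r) + (\<Sum>n\<in>{m..<m+r}. 2 * E * (w n - w (Suc n)))"
        unfolding eq
      proof (intro order_trans[OF norm_triangle_ineq] add_mono order_trans[OF norm_sum] sum_mono)
        show "norm ((S (m+r) - S m) * of_real (w (m+r))) \<le> 2 * E * w (m+r)"
          unfolding norm_mult using d2[of "m+r"] that wd(2)[of "m+r"] m4 E0 by (auto intro!: mult_mono)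
        fix n assume n: "n \<in> {m..<m+r}"
        then have "w (Suc n) \<le> w n" using wd m4 by auto
        then show "norm ((S n - S m) * of_real (w n - w (Suc n))) \<le> 2 * E * (w n - w (Suc n))"
          unfolding norm_mult norm_of_real using d2[of n] that n E0 by (intro mult_mono) auto
      qed
      also have "(\<Sum>n\<in>{m..<m+r}. 2 * E * (w n - w (Suc n))) = 2 * E * (w m - w (m+r))"
      proof -
        have "(\<Sum>n\<in>{m..<m+r}. w n - w (Suc n)) = w m - w (m+r)" using sum_Suc_diff'[of m "m+r" "\<lambda>n. - w n"] by simp
        then show ?thesis unfolding sum_distrib_left[symmetric] by simp
      qed
      finally show ?thesis by (simp add: algebra_simps)
    qed
    have wm: "w m \<le> 2 ^ (2 * j) / L ^ (2 * j)"
    proof -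
      have "L / 2 = ln (sqrt (real N))" using N by (simp add: L_def ln_sqrt)
      also have "\<dots> \<le> ln (real m)" using m1 s4 N by (intro ln_mono) auto
      finally have "1 / ln (real m) ^ (2 * j) \<le> 1 / (L / 2) ^ (2 * j)" using L1 by (intro divide_left_mono power_mono) auto
      then show ?thesis by (simp add: w_def power_divide)
    qed
    have Lp: "L ^ (j + 1) / L ^ (2 * j) = L powr (1 - real j)"
    proof -
      have "L ^ (j + 1) / L ^ (2 * j) = L powr real (j + 1) / L powr real (2 * j)" using L1 by (simp only: powr_realpow)
      also have "\<dots> = L powr (real (j + 1) - real (2 * j))" by (simp only: powr_diff)
      finally show ?thesis by simp
    qed
    have p2: "norm (\<Sum>n\<in>{m<..N}. a n) \<le> 2 * D * 2 ^ (2 * j) * (M + 1) * real N * L powr (1 - real j)"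
    proof -
      have "norm (\<Sum>n\<in>{m<..N}. a n) \<le> 2 * E * w m" using abel[of "N - m"] mN by simp
      also have "\<dots> \<le> 2 * E * (2 ^ (2 * j) / L ^ (2 * j))" using E0 wm by (intro mult_left_mono) auto
      also have "\<dots> = 2 * D * 2 ^ (2 * j) * (M + 1) * real N * (L ^ (j + 1) / L ^ (2 * j))" by (simp add: E_def)
      finally show ?thesis unfolding Lp .
    qed
    have p1: "norm (\<Sum>n\<in>{1..m}. a n) \<le> 8 * Cj * (M + 1) * real N * L powr (1 - real j)"
    proof -
      have "norm (\<Sum>n\<in>{1..m}. a n) \<le> (\<Sum>n\<in>{1..m}. 2 * L)"
      proof (rule order_trans[OF norm_sum], rule sum_mono)
        fix n assume n: "n \<in> {1..m}"
        then have "ln (real n) \<le> L" unfolding L_def using mN by (intro ln_mono) auto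
        then show "norm (a n) \<le> 2 * L" using a[of n] n L1 by simp
      qed
      also have "\<dots> = real m * (2 * L)" by simp
      also have "\<dots> \<le> 2 * sqrt (real N) * (2 * L)" using m2 L1 by (intro mult_right_mono) auto
      also have "\<dots> \<le> 8 * Cj * real N * L powr (1 - real j)"
      proof -
        have "L ^ j \<le> Cj * sqrt (real N)" unfolding L_def Cj_def using N j by (intro ln_power_le_sqrt) auto
        then have "sqrt (real N) * L ^ j \<le> sqrt (real N) * (Cj * sqrt (real N))" by (rule mult_left_mono) simp
        also have "\<dots> = Cj * real N" using sN by (simp add: mult_ac)
        finally have "sqrt (real N) \<le> Cj * real N / L ^ j" using L1 by (simp add: pos_le_divide_eq)
        then have "2 * sqrt (real N) * (2 * L) \<le> 2 * (Cj * real N / L ^ j) * (2 * L)" using L1 by (intro mult_right_mono) auto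
        also have "\<dots> = 4 * Cj * real N * (L / L ^ j)" by simp
        also have "L / L ^ j = L powr (1 - real j)" using L1 by (simp add: powr_diff powr_realpow)
        also have "4 * Cj * real N * L powr (1 - real j) \<le> 8 * Cj * real N * L powr (1 - real j)" using Cj by (intro mult_right_mono) auto
        finally show ?thesis .
      qed
      also have "\<dots> = 8 * Cj * 1 * real N * L powr (1 - real j)" by simp
      also have "\<dots> \<le> 8 * Cj * (M + 1) * real N * L powr (1 - real j)" using M Cj by (intro mult_right_mono mult_left_mono) auto
      finally show ?thesis .
    qed
    have un: "{1..N} = {1..m} \<union> {m<..N}" using mN m4 by auto
    have "(\<Sum>n\<in>{1..N}. a n) = (\<Sum>n\<in>{1..m}. a n) + (\<Sum>n\<in>{m<..N}. a n)" unfolding un by (rule sum.union_disjoint) auto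
    then have "norm (\<Sum>n\<in>{1..N}. a n) \<le> norm (\<Sum>n\<in>{1..m}. a n) + norm (\<Sum>n\<in>{m<..N}. a n)" using norm_triangle_ineq by metis
    then show "norm (\<Sum>n\<in>{1..N}. a n) \<le> C * (M + 1) * real N * ln (real N) powr (1 - real j)"
      using p1 p2 by (simp add: C_def L_def[symmetric] algebra_simps)
  qed
qed

section \<open>The large sieve\<close>

definition expsum :: "nat set \<Rightarrow> (nat \<Rightarrow> complex) \<Rightarrow> real \<Rightarrow> complex" where
  "expsum J a x = (\<Sum>n\<in>J. a n * cis (2 * pi * real n * x))"

lemma has_vector_derivative_cis:
  "((\<lambda>x. cis (c * x)) has_vector_derivative (\<i> * of_real c * cis (c * x))) (at x within S)"
proof -
  have "((\<lambda>z. exp (\<i> * of_real c * z)) has_field_derivative (exp (\<i> * of_real c * of_real x) * (\<i> * of_real c))) (at (of_real x))"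
    by (auto intro!: derivative_eq_intros)
  then have "((\<lambda>x. exp (\<i> * of_real c * of_real x)) has_vector_derivative (exp (\<i> * of_real c * of_real x) * (\<i> * of_real c))) (at x within S)"
    by (rule has_vector_derivative_at_within[OF has_vector_derivative_real_field])
  then show ?thesis by (simp add: cis_conv_exp mult_ac)
qed

lemma integral_cis:
  fixes k :: int
  assumes "k \<noteq> 0"
  shows "((\<lambda>x. cis (2 * pi * of_int k * x)) has_integral 0) {c..c+1}"
proof -
  let ?w = "2 * pi * of_int k"
  let ?F = "\<lambda>x. cis (?w * x) / (\<i> * of_real ?w)"
  have nz: "\<i> * complex_of_real ?w \<noteq> 0" using assms by simp
  have "((\<lambda>x. cis (?w * x)) has_integral ?F (c+1) - ?F c) {c..c+1}"
  proof (rule fundamental_theorem_of_calculus)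
    fix x assume "x \<in> {c..c+1}"
    have "(?F has_vector_derivative (\<i> * of_real ?w * cis (?w * x)) / (\<i> * of_real ?w)) (at x within {c..c+1})"
      by (rule has_vector_derivative_divide[OF has_vector_derivative_cis])
    then show "(?F has_vector_derivative cis (?w * x)) (at x within {c..c+1})" using nz by simp
  qed simp
  moreover have "cis (?w * (c+1)) = cis (?w * c)"
    using cis_multiple_2pi[of "of_int k"] by (simp add: distrib_left cis_mult[symmetric])
  ultimately show ?thesis by simp
qed

lemma expsum_parseval:
  fixes b :: "nat \<Rightarrow> complex"
  assumes "finite J"
  shows "((\<lambda>x. (norm (\<Sum>n\<in>J. b n * cis (2 * pi * of_int (int n - u) * x)))\<^sup>2) has_integral (\<Sum>n\<in>J. (norm (b n))\<^sup>2)) {c..c+1}"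
proof -
  have 1: "((\<lambda>x. b n * cnj (b m) * cis (2 * pi * of_int (int n - int m) * x)) has_integral (if n = m then of_real ((norm (b n))\<^sup>2) else 0)) {c..c+1}" for n m
  proof (cases "n = m")
    case True
    have "((\<lambda>x::real. complex_of_real ((norm (b n))\<^sup>2)) has_integral of_real ((norm (b n))\<^sup>2)) {c..c+1}"
      using has_integral_const_real[of "complex_of_real ((norm (b n))\<^sup>2)" c "c+1"] by simp
    then show ?thesis using True by (simp add: complex_norm_square[symmetric])
  next
    case False
    from has_integral_mult_right[OF integral_cis[of "int n - int m" c], of "b n * cnj (b m)"] show ?thesis using False by simp
  qed
  have 2: "((\<lambda>x. \<Sum>n\<in>J. \<Sum>m\<in>J. b n * cnj (b m) * cis (2 * pi * of_int (int n - int m) * x)) has_integral (\<Sum>n\<in>J. \<Sum>m\<in>J. if n = m then of_real ((norm (b n))\<^sup>2) else 0)) {c..c+1}"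
    using assms 1 by (intro has_integral_sum) auto
  have 3: "(\<Sum>n\<in>J. \<Sum>m\<in>J. if n = m then complex_of_real ((norm (b n))\<^sup>2) else 0) = of_real (\<Sum>n\<in>J. (norm (b n))\<^sup>2)"
    using assms by (simp add: sum.delta)
  have 4: "(\<Sum>n\<in>J. \<Sum>m\<in>J. b n * cnj (b m) * cis (2 * pi * of_int (int n - int m) * x)) =
     of_real ((norm (\<Sum>n\<in>J. b n * cis (2 * pi * of_int (int n - u) * x)))\<^sup>2)" for x
  proof -
    have e: "cis (2 * pi * of_int (int n - int m) * x) = cis (2 * pi * of_int (int n - u) * x) * cnj (cis (2 * pi * of_int (int m - u) * x))" for n m
      unfolding cis_cnj cis_mult by (rule arg_cong[of _ _ cis]) (simp add: algebra_simps)
    show ?thesis unfolding complex_norm_square sum_product cnj_sum e by (simp add: sum_product mult_ac)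
  qed
  from has_integral_linear[OF 2 bounded_linear_Re] show ?thesis unfolding 3 4 by (simp add: o_def)
qed

text \<open>The square \<open>\<phi>\<close> of the modulus at a point is at most its mean over the
  surrounding interval of length \<open>d\<close> plus its total variation there. The intervals do
  not overlap, so Parseval applies to the sum. Shifting the frequencies by \<open>u\<close> leaves
  the modulus unchanged and makes differentiation cost only a factor
  \<open>2 * pi * H\<close>.\<close>

lemma large_sieve:
  fixes a :: "nat \<Rightarrow> complex"
  assumes J: "J \<subseteq> {u<..u+H}" and H: "H \<ge> 1" and X: "finite X" and d: "d > 0"
    and XI: "X \<subseteq> {c + d/2..c + 1 - d/2}"
    and sp: "\<And>x y. x \<in> X \<Longrightarrow> y \<in> X \<Longrightarrow> x \<noteq> y \<Longrightarrow> \<bar>x - y\<bar> \<ge> d"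
  shows "(\<Sum>x\<in>X. (norm (expsum J a x))\<^sup>2) \<le> (1/d + 50 * real H) * (\<Sum>n\<in>J. (norm (a n))\<^sup>2)"
proof -
  have fJ: "finite J" using J finite_subset by blast
  define h where "h = real H"
  have h: "h \<ge> 1" using H by (simp add: h_def)
  define S where "S = (\<Sum>n\<in>J. (norm (a n))\<^sup>2)"
  define G where "G = (\<lambda>x. \<Sum>n\<in>J. a n * cis (2 * pi * of_int (int n - int u) * x))"
  define a' where "a' = (\<lambda>n. \<i> * of_real (2 * pi * of_int (int n - int u)) * a n)"
  define G' where "G' = (\<lambda>x. \<Sum>n\<in>J. a' n * cis (2 * pi * of_int (int n - int u) * x))"
  have nG: "norm (expsum J a x) = norm (G x)" for x
  proof -
    have "expsum J a x = cis (2 * pi * real u * x) * G x"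
      unfolding expsum_def G_def sum_distrib_left
      by (rule sum.cong) (auto simp: cis_mult algebra_simps)
    then show ?thesis by (simp add: norm_mult)
  qed
  have dG: "(G has_vector_derivative G' x) (at x within T)" for x T
  proof -
    have "((\<lambda>x. a n * cis (2 * pi * of_int (int n - int u) * x)) has_vector_derivative a' n * cis (2 * pi * of_int (int n - int u) * x)) (at x within T)" for n
      using has_vector_derivative_mult_right[OF has_vector_derivative_cis[of "2 * pi * of_int (int n - int u)" x T], of "a n"]
      by (simp add: a'_def mult_ac)
    then show ?thesis unfolding G_def G'_def by (rule has_vector_derivative_sum)
  qed
  have cG: "continuous_on T G" for T
    by (intro continuous_on_vector_derivative[of T G G']) (auto intro: dG)
  have cG': "continuous_on T G'" for T
    unfolding G'_def cis_conv_exp by (intro continuous_intros)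
  define \<phi> where "\<phi> = (\<lambda>x. (norm (G x))\<^sup>2)"
  define \<phi>' where "\<phi>' = (\<lambda>x. 2 * (G x \<bullet> G' x))"
  have d\<phi>: "(\<phi> has_vector_derivative \<phi>' x) (at x within T)" for x T
  proof -
    have "((\<lambda>x. G x \<bullet> G x) has_vector_derivative G x \<bullet> G' x + G' x \<bullet> G x) (at x within T)"
      using dG[of x T] unfolding has_vector_derivative_def
      by (auto intro!: derivative_eq_intros simp: algebra_simps)
    then show ?thesis by (simp add: \<phi>_def \<phi>'_def power2_norm_eq_inner inner_commute)
  qed
  \<comment> \<open>The variation is at most the integral of \<open>2 * norm G * norm G'\<close>;
    the arithmetic-geometric mean with weight \<open>h\<close> balances the two factors. The later
    constant 40 exceeds \<open>4 * pi^2\<close>.\<close>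
  define g where "g = (\<lambda>x. (1/d + h) * \<phi> x + (norm (G' x))\<^sup>2 / h)"
  have cg: "continuous_on T g" for T unfolding g_def \<phi>_def using h by (intro continuous_intros cG cG') auto
  have g0: "g x \<ge> 0" for x using h d by (auto simp: g_def \<phi>_def)
  have intg: "g integrable_on {s..t}" for s t by (rule integrable_continuous_real[OF cg])
  have loc: "\<phi> x \<le> integral {x - d/2..x + d/2} g" for x
  proof -
    let ?I = "{x - d/2..x + d/2}"
    have c\<phi>: "continuous_on T \<phi>" for T unfolding \<phi>_def by (intro continuous_intros cG)
    \<comment> \<open>The minimum over the interval is at most the mean, and \<open>\<phi> x\<close>
      exceeds it by at most the variation.\<close>
    have "\<exists>y\<in>?I. \<forall>z\<in>?I. \<phi> y \<le> \<phi> z"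
      by (rule continuous_attains_inf) (use d c\<phi> in auto)
    then obtain y where y: "y \<in> ?I" "\<And>z. z \<in> ?I \<Longrightarrow> \<phi> y \<le> \<phi> z" by blast
    define k where "k = (\<lambda>z. h * \<phi> z + (norm (G' z))\<^sup>2 / h)"
    have ck: "continuous_on T k" for T unfolding k_def using h by (intro continuous_intros c\<phi> cG') auto
    have k0: "k z \<ge> 0" for z using h by (auto simp: k_def \<phi>_def)
    have kb: "\<bar>\<phi>' z\<bar> \<le> k z" for z
    proof -
      have "\<bar>\<phi>' z\<bar> \<le> 2 * (norm (G z) * norm (G' z))" using Cauchy_Schwarz_ineq2[of "G z" "G' z"] by (simp add: \<phi>'_def)
      also have "\<dots> \<le> k z"
      proof -
        have "0 \<le> (h * norm (G z) - norm (G' z))\<^sup>2 / h" using h by simp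
        also have "\<dots> = k z - 2 * (norm (G z) * norm (G' z))"
          using h by (simp add: k_def \<phi>_def power2_eq_square field_simps)
        finally show ?thesis by simp
      qed
      finally show ?thesis .
    qed
    have ineq: "\<bar>\<phi> t - \<phi> s\<bar> \<le> integral ?I k" if st: "s \<le> t" "s \<in> ?I" "t \<in> ?I" for s t
    proof -
      have "(\<phi>' has_integral (\<phi> t - \<phi> s)) {s..t}"
        by (rule fundamental_theorem_of_calculus[OF st(1)]) (rule d\<phi>)
      then have "norm (integral {s..t} \<phi>') \<le> integral {s..t} k"
        by (intro integral_norm_bound_integral[OF has_integral_integrable integrable_continuous_real[OF ck]]) (use kb in auto)
      also have "integral {s..t} k \<le> integral ?I k"
        using st k0 by (intro integral_subset_le integrable_continuous_real ck) auto
      finally show ?thesis using \<open>(\<phi>' has_integral (\<phi> t - \<phi> s)) {s..t}\<close> by (simp add: has_integral_iff)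
    qed
    have 1: "\<phi> x - \<phi> y \<le> integral ?I k"
      using ineq[of x y] ineq[of y x] y(1) d by (cases "x \<le> y") auto
    have "integral ?I (\<lambda>_. \<phi> y) \<le> integral ?I \<phi>"
      by (intro integral_le integrable_continuous_real c\<phi> continuous_intros) (use y in auto)
    then have 2: "d * \<phi> y \<le> integral ?I \<phi>" using d by simp
    have "integral ?I g = integral ?I (\<lambda>z. (1/d) * \<phi> z + k z)" by (rule integral_cong) (simp add: g_def k_def algebra_simps)
    also have "\<dots> = (1/d) * integral ?I \<phi> + integral ?I k"
      by (subst integral_add) (auto intro!: integrable_continuous_real continuous_intros c\<phi> ck simp del: times_divide_eq_left)
    finally have 3: "integral ?I g = (1/d) * integral ?I \<phi> + integral ?I k" .
    have "\<phi> y \<le> (1/d) * integral ?I \<phi>" using 2 d by (simp add: field_simps)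
    then show ?thesis using 1 3 by linarith
  qed
  have "(\<Sum>x\<in>X. (norm (expsum J a x))\<^sup>2) \<le> (\<Sum>x\<in>X. integral {x - d/2..x + d/2} g)"
    unfolding nG using loc by (intro sum_mono) (simp add: \<phi>_def)
  also have "\<dots> \<le> integral {c..c+1} g"
  proof -
    have un: "(g has_integral (\<Sum>x\<in>X. integral {x - d/2..x + d/2} g)) (\<Union>x\<in>X. {x - d/2..x + d/2})"
    proof (rule has_integral_UN[OF X])
      show "\<And>x. x \<in> X \<Longrightarrow> (g has_integral integral {x - d/2..x + d/2} g) {x - d/2..x + d/2}"
        using intg by (simp add: has_integral_integral)
      show "pairwise (\<lambda>i i'. negligible ({i - d/2..i + d/2} \<inter> {i' - d/2..i' + d/2})) X"
      proof (rule pairwiseI)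
        fix x y assume xy: "x \<in> X" "y \<in> X" "x \<noteq> y"
        have "{x - d/2..x + d/2} \<inter> {y - d/2..y + d/2} \<subseteq> {(x + y) / 2}"
          using sp[OF xy] by (auto simp: abs_if field_simps split: if_splits)
        then show "negligible ({x - d/2..x + d/2} \<inter> {y - d/2..y + d/2})"
          using negligible_subset negligible_sing by blast
      qed
    qed
    have "integral (\<Union>x\<in>X. {x - d/2..x + d/2}) g \<le> integral {c..c+1} g"
    proof (rule integral_subset_le)
      show "(\<Union>x\<in>X. {x - d/2..x + d/2}) \<subseteq> {c..c+1}" using XI by fastforce
    qed (use un intg g0 in \<open>auto simp: has_integral_iff\<close>)
    then show ?thesis using un by (simp add: has_integral_iff)
  qed
  also have "integral {c..c+1} g = (1/d + h) * S + (\<Sum>n\<in>J. (norm (a' n))\<^sup>2) / h"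
  proof (rule integral_unique)
    show "(g has_integral (1/d + h) * S + (\<Sum>n\<in>J. (norm (a' n))\<^sup>2) / h) {c..c+1}"
      unfolding g_def \<phi>_def G_def G'_def S_def
      by (intro has_integral_add has_integral_mult_right has_integral_divide expsum_parseval fJ)
  qed
  also have "(\<Sum>n\<in>J. (norm (a' n))\<^sup>2) / h \<le> (\<Sum>n\<in>J. 40 * h\<^sup>2 * (norm (a n))\<^sup>2) / h"
  proof (rule divide_right_mono[OF sum_mono])
    fix n assume "n \<in> J"
    then have n: "0 \<le> real_of_int (int n - int u)" "real_of_int (int n - int u) \<le> h" using J by (auto simp: h_def)
    have "(norm (a' n))\<^sup>2 = 4 * pi\<^sup>2 * (real_of_int (int n - int u))\<^sup>2 * (norm (a n))\<^sup>2"
      unfolding a'_def norm_mult norm_of_real by (simp add: abs_mult power_mult_distrib)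
    also have "pi\<^sup>2 \<le> 3.15\<^sup>2" using pi_approx by (intro power_mono) auto
    then have "4 * pi\<^sup>2 * (real_of_int (int n - int u))\<^sup>2 * (norm (a n))\<^sup>2 \<le> 40 * h\<^sup>2 * (norm (a n))\<^sup>2"
      using n by (intro mult_right_mono mult_mono power_mono) (auto simp: power2_eq_square)
    finally show "(norm (a' n))\<^sup>2 \<le> 40 * h\<^sup>2 * (norm (a n))\<^sup>2" .
  qed (use h in simp)
  also have "(\<Sum>n\<in>J. 40 * h\<^sup>2 * (norm (a n))\<^sup>2) / h = 40 * h * S"
    using h by (simp add: S_def sum_distrib_left[symmetric] power2_eq_square)
  also have "(1/d + h) * S + 40 * h * S \<le> (1/d + 50 * h) * S"
    using h by (simp add: S_def algebra_simps sum_nonneg mult_right_mono)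
  finally show ?thesis by (simp add: S_def h_def)
qed

lemma large_sieve_farey:
  fixes a :: "nat \<Rightarrow> complex"
  assumes J: "J \<subseteq> {u<..u+H}" and H: "H \<ge> 1" and U: "U \<ge> 1"
  shows "(\<Sum>d\<in>{1..U}. \<Sum>b\<in>{b\<in>{1..d}. coprime b d}. (norm (expsum J a (real b / real d)))\<^sup>2) \<le> (real U ^ 2 + 50 * real H) * (\<Sum>n\<in>J. (norm (a n))\<^sup>2)"
proof -
  define P where "P = (SIGMA d:{1..U}. {b\<in>{1..d}. coprime b d})"
  define r where "r = (\<lambda>(d::nat, b::nat). real b / real d)"
  define \<delta> where "\<delta> = 1 / real U ^ 2"
  have \<delta>: "\<delta> > 0" using U by (simp add: \<delta>_def)
  have key: "\<bar>r p - r p'\<bar> \<ge> \<delta>" if "p \<in> P" "p' \<in> P" "p \<noteq> p'" for p p'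
  proof -
    obtain d b d' b' where p: "p = (d, b)" "p' = (d', b')" by (cases p, cases p')
    have h: "1 \<le> d" "d \<le> U" "1 \<le> d'" "d' \<le> U" "coprime b d" "coprime b' d'" "1 \<le> b" "1 \<le> b'"
      using that p by (auto simp: P_def)
    have ne: "int b * int d' - int b' * int d \<noteq> 0"
    proof
      assume "int b * int d' - int b' * int d = 0"
      then have e: "b * d' = b' * d" by (metis eq_iff_diff_eq_0 of_nat_eq_iff of_nat_mult)
      have "d dvd d'" using h e by (metis coprime_commute coprime_dvd_mult_right_iff dvd_triv_right)
      moreover have "d' dvd d" using h e by (metis coprime_commute coprime_dvd_mult_right_iff dvd_triv_right)
      ultimately have "d = d'" by (rule dvd_antisym)
      then show False using e h that p by simp
    qed
    have "r p - r p' = of_int (int b * int d' - int b' * int d) / (real d * real d')"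
      using h by (simp add: p r_def field_simps)
    then have "\<bar>r p - r p'\<bar> = of_int \<bar>int b * int d' - int b' * int d\<bar> / (real d * real d')"
      by (simp add: abs_divide abs_mult)
    also have "\<dots> \<ge> 1 / (real U * real U)"
      using h ne by (intro frac_le mult_mono) (auto simp: abs_if not_less split: if_splits)
    finally show ?thesis by (simp add: \<delta>_def power2_eq_square)
  qed
  have inj: "inj_on r P"
  proof (rule inj_onI, rule ccontr)
    fix x y assume "x \<in> P" "y \<in> P" "r x = r y" "x \<noteq> y"
    from key[OF this(1,2,4)] show False using \<open>r x = r y\<close> \<delta> by simp
  qed
  have fP: "finite P" unfolding P_def by (intro finite_SigmaI) auto
  have "(\<Sum>d\<in>{1..U}. \<Sum>b\<in>{b\<in>{1..d}. coprime b d}. (norm (expsum J a (real b / real d)))\<^sup>2) = (\<Sum>p\<in>P. (norm (expsum J a (r p)))\<^sup>2)"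
    unfolding P_def r_def by (subst sum.Sigma) (auto intro!: sum.cong)
  also have "\<dots> = (\<Sum>x\<in>r ` P. (norm (expsum J a x))\<^sup>2)" using inj by (simp add: sum.reindex)
  also have "\<dots> \<le> (1/\<delta> + 50 * real H) * (\<Sum>n\<in>J. (norm (a n))\<^sup>2)"
  \<comment> \<open>The numerator runs up to the denominator, so the fractions lie between
    \<open>\<delta>\<close> and 1. Cutting the circle at \<open>\<delta> / 2\<close> leaves room for
    half an interval at both ends.\<close>
  proof (rule large_sieve[OF J H _ \<delta>, where c = "\<delta>/2"])
    show "r ` P \<subseteq> {\<delta>/2 + \<delta>/2..\<delta>/2 + 1 - \<delta>/2}"
    proof (rule image_subsetI)
      fix p assume "p \<in> P"
      then obtain d b where p: "p = (d, b)" "1 \<le> d" "d \<le> U" "1 \<le> b" "b \<le> d" by (cases p) (auto simp: P_def)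
      have "\<delta> \<le> 1 / real U" using U by (simp add: \<delta>_def power2_eq_square field_simps)
      also have "\<dots> \<le> real b / real d" using p by (intro frac_le) auto
      finally show "r p \<in> {\<delta>/2 + \<delta>/2..\<delta>/2 + 1 - \<delta>/2}" using p by (simp add: r_def)
    qed
    show "\<bar>x - y\<bar> \<ge> \<delta>" if "x \<in> r ` P" "y \<in> r ` P" "x \<noteq> y" for x y using that key by auto
  qed (use fP in auto)
  finally show ?thesis by (simp add: \<delta>_def)
qed

section \<open>The Siegel--Walfisz theorem\<close>

lemma psi_char:
  obtains C where "C > 0" "\<And>q \<psi> N. q > 0 \<Longrightarrow> dchar q \<psi> \<Longrightarrow> \<psi> \<noteq> chi0 q \<Longrightarrow> N \<ge> 16 \<Longrightarrow>
    norm (\<Sum>n\<in>{1..N}. mangoldt n * \<psi> n) \<le> C * real q * real N / ln (real N) ^ B"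
proof -
  define j where "j = Suc B"
  obtain C1 where C1: "C1 > 0" "\<And>a M N. (\<And>n. n \<ge> 1 \<Longrightarrow> norm (a n :: complex) \<le> 1 + ln (real n)) \<Longrightarrow> M \<ge> 0 \<Longrightarrow>
       (\<And>c t. 1 < c \<Longrightarrow> c \<le> 2 \<Longrightarrow> norm (dser (\<lambda>n. of_real (ln (real n)) ^ (2 * j) * a n) (Complex c t)) \<le> M * (\<bar>t\<bar> + 2) powr (1/2)) \<Longrightarrow>
       N \<ge> 16 \<Longrightarrow> norm (\<Sum>n\<in>{1..N}. a n) \<le> C1 * (M + 1) * real N * ln (real N) powr (1 - real j)"
    by (rule log_saving[of j]) (simp add: j_def, blast)
  obtain C2 where C2: "C2 > 0" "\<And>q \<psi> c t. q > 0 \<Longrightarrow> dchar q \<psi> \<Longrightarrow> \<psi> \<noteq> chi0 q \<Longrightarrow> 1 < c \<Longrightarrow> c \<le> 2 \<Longrightarrow>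
     norm (dser (\<lambda>n. of_real (ln (real n)) ^ (2 * j) * (mangoldt n * \<psi> n)) (Complex c t)) \<le> C2 * sqrt (real q) * (\<bar>t\<bar> + 2) powr (1/2)"
    by (rule log_deriv_char) blast
  show ?thesis
  proof (rule that[of "C1 * (C2 + 1)"])
    fix q \<psi> N assume q: "q > (0::nat)" and ch: "dchar q \<psi>" "\<psi> \<noteq> chi0 q" and N: "N \<ge> (16::nat)"
    have "norm (\<Sum>n\<in>{1..N}. mangoldt n * \<psi> n) \<le> C1 * (C2 * sqrt (real q) + 1) * real N * ln (real N) powr (1 - real j)"
    proof (rule C1(2))
      fix n :: nat assume n: "n \<ge> 1"
      have "norm (mangoldt n * \<psi> n) \<le> ln (real n) * 1"
        unfolding norm_mult using mangoldt_le[of n] dchar_norm_le[OF ch(1) q, of n] n by (intro mult_mono) auto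
      then show "norm (mangoldt n * \<psi> n) \<le> 1 + ln (real n)" by simp
    qed (use C2 q ch N in auto)
    also have "ln (real N) powr (1 - real j) = 1 / ln (real N) ^ B"
      using N by (simp add: j_def powr_minus_divide powr_realpow)
    also have "C1 * (C2 * sqrt (real q) + 1) * real N * (1 / ln (real N) ^ B) \<le> C1 * ((C2 + 1) * real q) * real N * (1 / ln (real N) ^ B)"
    proof (intro mult_right_mono mult_left_mono)
      have "sqrt (real q) \<le> real q" using q by (intro real_le_lsqrt) (auto simp: power2_eq_square)
      then have "C2 * sqrt (real q) \<le> C2 * real q" using C2 by (intro mult_left_mono) auto
      then show "C2 * sqrt (real q) + 1 \<le> (C2 + 1) * real q" using q by (simp add: algebra_simps)
    qed (use C1 N in auto)
    finally show "norm (\<Sum>n\<in>{1..N}. mangoldt n * \<psi> n) \<le> C1 * (C2 + 1) * real q * real N / ln (real N) ^ B" by (simp add: mult_ac)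
  qed (use C1 C2 in simp)
qed

lemma psi_zeta:
  obtains C where "C > 0" "\<And>N. N \<ge> 16 \<Longrightarrow> norm (\<Sum>n\<in>{1..N}. mangoldt n - 1 :: complex) \<le> C * real N / ln (real N) ^ B"
proof -
  define j where "j = Suc B"
  obtain C1 where C1: "C1 > 0" "\<And>a M N. (\<And>n. n \<ge> 1 \<Longrightarrow> norm (a n :: complex) \<le> 1 + ln (real n)) \<Longrightarrow> M \<ge> 0 \<Longrightarrow>
       (\<And>c t. 1 < c \<Longrightarrow> c \<le> 2 \<Longrightarrow> norm (dser (\<lambda>n. of_real (ln (real n)) ^ (2 * j) * a n) (Complex c t)) \<le> M * (\<bar>t\<bar> + 2) powr (1/2)) \<Longrightarrow>
       N \<ge> 16 \<Longrightarrow> norm (\<Sum>n\<in>{1..N}. a n) \<le> C1 * (M + 1) * real N * ln (real N) powr (1 - real j)"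
    by (rule log_saving[of j]) (simp add: j_def, blast)
  obtain C2 where C2: "C2 > 0" "\<And>c t. 1 < c \<Longrightarrow> c \<le> 2 \<Longrightarrow>
     norm (dser (\<lambda>n. of_real (ln (real n)) ^ (2 * j) * (mangoldt n - 1)) (Complex c t)) \<le> C2 * (\<bar>t\<bar> + 2) powr (1/2)"
    by (rule log_deriv_zeta) blast
  show ?thesis
  proof (rule that[of "C1 * (C2 + 1)"])
    fix N assume N: "N \<ge> (16::nat)"
    have "norm (\<Sum>n\<in>{1..N}. mangoldt n - 1 :: complex) \<le> C1 * (C2 + 1) * real N * ln (real N) powr (1 - real j)"
    proof (rule C1(2))
      fix n :: nat assume n: "n \<ge> 1"
      have "norm (mangoldt n - 1 :: complex) \<le> norm (mangoldt n :: complex) + norm (1 :: complex)" by (rule norm_triangle_ineq4)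
      then show "norm (mangoldt n - 1 :: complex) \<le> 1 + ln (real n)" using mangoldt_le[of n] n by simp
    qed (use C2 N in auto)
    also have "ln (real N) powr (1 - real j) = 1 / ln (real N) ^ B"
      using N by (simp add: j_def powr_minus_divide powr_realpow)
    finally show "norm (\<Sum>n\<in>{1..N}. mangoldt n - 1 :: complex) \<le> C1 * (C2 + 1) * real N / ln (real N) ^ B" by simp
  qed (use C1 C2 in simp)
qed

text \<open>One quantity for both discrepancies: between \<open>mangoldt\<close> and the logarithm
  on primes, and between the principal character and the constant 1.\<close>

definition bad_sum :: "nat \<Rightarrow> nat \<Rightarrow> real" where
  "bad_sum N q = (\<Sum>n\<in>{n\<in>{1..N}. \<not> prime n \<or> \<not> coprime n q}. mangoldt n)"

text \<open>A prime power counted here has base at most \<open>q\<close> (a prime dividing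
  \<open>q\<close>) or exponent at least 2, hence base at most \<open>sqrt N\<close>; the exponent
  is at most \<open>log 2 N\<close>.\<close>

lemma bad_sum_le:
  assumes q: "q > 0" and N: "N \<ge> 16"
  shows "bad_sum N q \<le> 6 * real q * sqrt (real N) * ln (real N) ^ 2"
proof -
  define r where "r = nat \<lfloor>sqrt (real N)\<rfloor>"
  define l where "l = nat \<lfloor>log 2 (real N)\<rfloor>"
  define S where "S = {n\<in>{1..N}. (\<not> prime n \<or> \<not> coprime n q) \<and> primepow n}"
  have s4: "sqrt (real N) \<ge> 4" using N by (simp add: real_le_rsqrt)
  have s1: "1 \<le> sqrt (real N)" using s4 by linarith
  have L0: "ln (real N) > 0" using N by simp
  have sub: "S \<subseteq> (\<lambda>(p, i). p ^ i) ` ({1..q + r} \<times> {1..l})"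
  proof
    fix n assume n: "n \<in> S"
    then obtain p i where p: "prime p" "i > 0" "n = p ^ i" by (auto simp: S_def primepow_def)
    have p2: "p \<ge> 2" using p prime_ge_2_nat by auto
    have nN: "n \<le> N" using n by (simp add: S_def)
    have "2 ^ i \<le> p ^ i" using p2 by (intro power_mono) auto
    then have "2 ^ i \<le> N" using nN p(3) by linarith
    then have "(2::real) ^ i \<le> real N" by (metis of_nat_le_iff of_nat_numeral of_nat_power)
    then have "real i \<le> log 2 (real N)" using N by (simp add: le_log_iff powr_realpow)
    then have il: "i \<le> l" by (simp add: l_def le_nat_floor)
    have "p \<le> q + r"
    proof (cases "i = 1")
      case True
      then have "\<not> coprime p q" using n p by (auto simp: S_def)
      then have "p dvd q" using p(1) prime_imp_coprime by blast
      then show ?thesis using q dvd_imp_le[of p q] by simp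
    next
      case False
      then have "p ^ 2 \<le> p ^ i" using p p2 by (intro power_increasing) auto
      then have "p ^ 2 \<le> N" using nN p(3) by linarith
      then have "(real p) ^ 2 \<le> real N" by (metis of_nat_le_iff of_nat_power)
      then have "real p \<le> sqrt (real N)" by (rule real_le_rsqrt)
      then have "p \<le> r" by (simp add: r_def le_nat_floor)
      then show ?thesis by simp
    qed
    then show "n \<in> (\<lambda>(p, i). p ^ i) ` ({1..q + r} \<times> {1..l})" using p p2 il by (intro image_eqI[of _ _ "(p, i)"]) auto
  qed
  have "card S \<le> card ({1..q + r} \<times> {1..l})" by (rule surj_card_le[OF _ sub]) simp
  then have "card S \<le> (q + r) * l" by simp
  then have cS: "real (card S) \<le> real (q + r) * real l" by (metis of_nat_le_iff of_nat_mult)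
  have "bad_sum N q = (\<Sum>n\<in>S. mangoldt n)"
    unfolding bad_sum_def S_def by (rule sum.mono_neutral_right) (auto simp: mangoldt_def)
  also have "\<dots> \<le> (\<Sum>n\<in>S. ln (real N))"
  proof (rule sum_mono)
    fix n assume n: "n \<in> S"
    then have "mangoldt n \<le> ln (real n)" by (intro mangoldt_le) (auto simp: S_def)
    also have "\<dots> \<le> ln (real N)" using n by (intro ln_mono) (auto simp: S_def)
    finally show "mangoldt n \<le> ln (real N)" .
  qed
  also have "\<dots> = real (card S) * ln (real N)" by simp
  also have "\<dots> \<le> (real (q + r) * real l) * ln (real N)" using cS L0 by (intro mult_right_mono) auto
  also have "\<dots> \<le> ((3 * real q * sqrt (real N)) * (2 * ln (real N))) * ln (real N)"
  proof (intro mult_right_mono mult_mono)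
    have "real r \<le> sqrt (real N)" by (simp add: r_def)
    moreover have "real q * 1 \<le> real q * sqrt (real N)" using s1 by (intro mult_left_mono) auto
    moreover have "1 * sqrt (real N) \<le> real q * sqrt (real N)" using q by (intro mult_right_mono) auto
    moreover have "0 \<le> real q * sqrt (real N)" by simp
    ultimately show "real (q + r) \<le> 3 * real q * sqrt (real N)" by simp
    have "real l \<le> log 2 (real N)" using N by (simp add: l_def)
    also have "\<dots> = ln (real N) / ln 2" by (simp add: log_def)
    also have "\<dots> \<le> ln (real N) / (1/2)" using L0 ln2_ge_two_thirds by (intro divide_left_mono) auto
    finally show "real l \<le> 2 * ln (real N)" by simp
  qed (use L0 in auto)
  also have "\<dots> = 6 * real q * sqrt (real N) * ln (real N) ^ 2" by (simp add: power2_eq_square)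
  finally show ?thesis .
qed

text \<open>Orthogonality of characters, with \<open>psi_char\<close> for the nonprincipal ones and
  \<open>psi_zeta\<close> for the principal one. The factor \<open>q\<close> in the error is
  affordable because the later exponential sum estimates use moduli below a power of the
  logarithm.\<close>

theorem siegel_walfisz:
  obtains C where "C > 0" "\<And>q a N. q > 0 \<Longrightarrow> coprime a q \<Longrightarrow> N \<ge> 16 \<Longrightarrow>
    \<bar>theta {1..N} q a - real N / real (totient q)\<bar> \<le> C * real q * real N / ln (real N) ^ B"
proof -
  obtain C1 where C1: "C1 > 0" "\<And>q \<psi> N. q > 0 \<Longrightarrow> dchar q \<psi> \<Longrightarrow> \<psi> \<noteq> chi0 q \<Longrightarrow> N \<ge> 16 \<Longrightarrow>
    norm (\<Sum>n\<in>{1..N}. mangoldt n * \<psi> n) \<le> C1 * real q * real N / ln (real N) ^ B"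
    by (rule psi_char) blast
  obtain C2 where C2: "C2 > 0" "\<And>N. N \<ge> 16 \<Longrightarrow> norm (\<Sum>n\<in>{1..N}. mangoldt n - 1 :: complex) \<le> C2 * real N / ln (real N) ^ B"
    by (rule psi_zeta) blast
  define Cj where "Cj = (2 * real (B + 2)) ^ (B + 2)"
  have Cj: "Cj > 0" by (simp add: Cj_def)
  show ?thesis
  proof (rule that[of "C1 + C2 + 12 * Cj"])
    fix q a N assume q: "q > (0::nat)" and a: "coprime a q" and N: "N \<ge> (16::nat)"
    define X where "X = real N / ln (real N) ^ B"
    define \<phi> where "\<phi> = real (totient q)"
    define E where "E = bad_sum N q"
    have L0: "ln (real N) > 0" using N by simp
    have X0: "X > 0" using N L0 by (simp add: X_def)
    have \<phi>1: "\<phi> \<ge> 1" using q by (simp add: \<phi>_def Suc_le_eq)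
    have q1: "real q \<ge> 1" using q by simp
    have E0: "E \<ge> 0" unfolding E_def bad_sum_def by (intro sum_nonneg mangoldt_nonneg)
    have EX: "E \<le> 6 * Cj * real q * X"
    proof -
      have "ln (real N) ^ (B + 2) \<le> Cj * sqrt (real N)" unfolding Cj_def using N by (intro ln_power_le_sqrt) auto
      then have "sqrt (real N) * ln (real N) ^ (B + 2) \<le> sqrt (real N) * (Cj * sqrt (real N))" by (intro mult_left_mono) auto
      also have "\<dots> = Cj * real N" by simp
      finally have "sqrt (real N) * ln (real N) ^ 2 * ln (real N) ^ B \<le> Cj * real N" by (simp add: power_add power2_eq_square mult_ac)
      then have "sqrt (real N) * ln (real N) ^ 2 \<le> Cj * X" using L0 by (simp add: X_def pos_le_divide_eq)
      then have "6 * real q * (sqrt (real N) * ln (real N) ^ 2) \<le> 6 * real q * (Cj * X)" by (intro mult_left_mono) auto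
      then show ?thesis using bad_sum_le[OF q N] by (simp add: E_def mult_ac)
    qed
    define P where "P = (\<Sum>n\<in>{1..N}. if [n = a] (mod q) then mangoldt n else (0::real))"
    have thP: "\<bar>theta {1..N} q a - P\<bar> \<le> E"
    proof -
      have "theta {1..N} q a = (\<Sum>n\<in>{1..N}. if prime n \<and> [n = a] (mod q) then mangoldt n else (0::real))"
      proof -
        have "theta {1..N} q a = (\<Sum>p\<in>{p\<in>{1..N}. prime p \<and> [p = a] (mod q)}. mangoldt p)"
          unfolding theta_def by (rule sum.cong) auto
        also have "\<dots> = (\<Sum>n\<in>{1..N}. if prime n \<and> [n = a] (mod q) then mangoldt n else (0::real))" by (rule sum.inter_filter) simp
        finally show ?thesis .
      qed
      then have "P - theta {1..N} q a = (\<Sum>n\<in>{1..N}. if \<not> prime n \<and> [n = a] (mod q) then mangoldt n else (0::real))"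
        unfolding P_def by (simp only: sum_subtractf[symmetric]) (auto intro!: sum.cong)
      moreover have "\<dots> \<le> (\<Sum>n\<in>{1..N}. if \<not> prime n \<or> \<not> coprime n q then mangoldt n else (0::real))"
        by (intro sum_mono) (auto simp: mangoldt_nonneg)
      moreover have "\<dots> = E" unfolding E_def bad_sum_def by (rule sum.inter_filter[symmetric]) simp
      moreover have "0 \<le> (\<Sum>n\<in>{1..N}. if \<not> prime n \<and> [n = a] (mod q) then mangoldt n else (0::real))"
        by (intro sum_nonneg) (auto simp: mangoldt_nonneg)
      ultimately show ?thesis by simp
    qed
    define F where "F = (\<lambda>\<psi>. \<Sum>n\<in>{1..N}. mangoldt n * (\<psi> n :: complex))"
    have orth: "of_real (\<phi> * P) = (\<Sum>\<psi> | dchar q \<psi>. cnj (\<psi> a) * F \<psi>)"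
    proof -
      have "(\<Sum>\<psi> | dchar q \<psi>. cnj (\<psi> a) * F \<psi>) = (\<Sum>n\<in>{1..N}. mangoldt n * (\<Sum>\<psi> | dchar q \<psi>. cnj (\<psi> a) * \<psi> n))"
        unfolding F_def sum_distrib_left by (subst sum.swap) (simp add: mult_ac)
      also have "\<dots> = (\<Sum>n\<in>{1..N}. of_real (\<phi> * (if [n = a] (mod q) then mangoldt n else 0)))"
        unfolding dchar_orthogonality[OF q a] by (intro sum.cong) (auto simp: \<phi>_def)
      also have "\<dots> = of_real (\<phi> * P)" unfolding P_def by (simp add: sum_distrib_left)
      finally show ?thesis by simp
    qed
    have split: "(\<Sum>\<psi> | dchar q \<psi>. cnj (\<psi> a) * F \<psi>) = F (chi0 q) + (\<Sum>\<psi>\<in>{\<psi>. dchar q \<psi>} - {chi0 q}. cnj (\<psi> a) * F \<psi>)"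
      using sum.remove[OF finite_dchars[OF q], of "chi0 q" "\<lambda>\<psi>. cnj (\<psi> a) * F \<psi>"] dchar_chi0 a by (simp add: chi0_def)
    have F0: "norm (F (chi0 q) - of_nat N) \<le> C2 * X + E"
    proof -
      have "F (chi0 q) - of_nat N = (\<Sum>n\<in>{1..N}. mangoldt n - 1) - of_real (\<Sum>n\<in>{1..N}. if \<not> coprime n q then mangoldt n else 0)"
      proof -
        have one: "complex_of_nat N = (\<Sum>n\<in>{1..N}. 1)" by simp
        show ?thesis unfolding F_def of_real_sum one sum_subtractf[symmetric] by (rule sum.cong) (auto simp: chi0_def)
      qed
      then have "norm (F (chi0 q) - of_nat N) \<le> norm (\<Sum>n\<in>{1..N}. mangoldt n - 1 :: complex) + norm (complex_of_real (\<Sum>n\<in>{1..N}. if \<not> coprime n q then mangoldt n else 0))"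
        by (simp only: norm_triangle_ineq4)
      moreover have "norm (complex_of_real (\<Sum>n\<in>{1..N}. if \<not> coprime n q then mangoldt n else 0)) \<le> E"
      proof -
        have "0 \<le> (\<Sum>n\<in>{1..N}. if \<not> coprime n q then mangoldt n else (0::real))" by (intro sum_nonneg) (auto simp: mangoldt_nonneg)
        moreover have "(\<Sum>n\<in>{1..N}. if \<not> coprime n q then mangoldt n else (0::real)) \<le> (\<Sum>n\<in>{1..N}. if \<not> prime n \<or> \<not> coprime n q then mangoldt n else (0::real))"
          by (intro sum_mono) (auto simp: mangoldt_nonneg)
        moreover have "(\<Sum>n\<in>{1..N}. if \<not> prime n \<or> \<not> coprime n q then mangoldt n else (0::real)) = E" unfolding E_def bad_sum_def by (rule sum.inter_filter[symmetric]) simp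
        ultimately show ?thesis unfolding norm_of_real by simp
      qed
      moreover have "norm (\<Sum>n\<in>{1..N}. mangoldt n - 1 :: complex) \<le> C2 * X" using C2(2)[OF N] by (simp add: X_def)
      ultimately show ?thesis by linarith
    qed
    have F1: "norm (\<Sum>\<psi>\<in>{\<psi>. dchar q \<psi>} - {chi0 q}. cnj (\<psi> a) * F \<psi>) \<le> \<phi> * (C1 * real q * X)"
    proof -
      have "norm (\<Sum>\<psi>\<in>{\<psi>. dchar q \<psi>} - {chi0 q}. cnj (\<psi> a) * F \<psi>) \<le> (\<Sum>\<psi>\<in>{\<psi>. dchar q \<psi>} - {chi0 q}. C1 * real q * X)"
      proof (rule order_trans[OF norm_sum], rule sum_mono)
        fix \<psi> assume "\<psi> \<in> {\<psi>. dchar q \<psi>} - {chi0 q}"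
        then have p: "dchar q \<psi>" "\<psi> \<noteq> chi0 q" by auto
        have "norm (cnj (\<psi> a) * F \<psi>) \<le> 1 * (C1 * real q * X)"
          unfolding norm_mult complex_mod_cnj F_def using dchar_norm_le[OF p(1) q, of a] C1(2)[OF q p N] by (intro mult_mono) (auto simp: X_def)
        then show "norm (cnj (\<psi> a) * F \<psi>) \<le> C1 * real q * X" by simp
      qed
      also have "\<dots> = real (card ({\<psi>. dchar q \<psi>} - {chi0 q})) * (C1 * real q * X)" by simp
      also have "\<dots> \<le> \<phi> * (C1 * real q * X)"
      proof (rule mult_right_mono)
        have "card ({\<psi>. dchar q \<psi>} - {chi0 q}) \<le> card {\<psi>. dchar q \<psi>}" using finite_dchars[OF q] by (intro card_mono) auto
        then show "real (card ({\<psi>. dchar q \<psi>} - {chi0 q})) \<le> \<phi>" using card_dchars[OF q] by (simp add: \<phi>_def)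
      qed (use C1 X0 in auto)
      finally show ?thesis .
    qed
    have "of_real (\<phi> * P - real N) = (F (chi0 q) - of_nat N) + (\<Sum>\<psi>\<in>{\<psi>. dchar q \<psi>} - {chi0 q}. cnj (\<psi> a) * F \<psi>)"
      using orth split by simp
    then have "norm (complex_of_real (\<phi> * P - real N)) \<le> norm (F (chi0 q) - of_nat N) + norm (\<Sum>\<psi>\<in>{\<psi>. dchar q \<psi>} - {chi0 q}. cnj (\<psi> a) * F \<psi>)"
      by (simp only: norm_triangle_ineq)
    then have "norm (complex_of_real (\<phi> * P - real N)) \<le> (C2 * X + E) + \<phi> * (C1 * real q * X)"
      using F0 F1 by linarith
    then have "\<bar>\<phi> * P - real N\<bar> \<le> (C2 * X + E) + \<phi> * (C1 * real q * X)" unfolding norm_of_real .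
    also have "\<dots> \<le> \<phi> * (C2 * X + E) + \<phi> * (C1 * real q * X)"
      using \<phi>1 C2 X0 E0 mult_right_mono[of 1 \<phi> "C2 * X + E"] by simp
    finally have "\<phi> * \<bar>P - real N / \<phi>\<bar> \<le> \<phi> * (C2 * X + E + C1 * real q * X)"
    proof -
      have e1: "\<phi> * P - real N = \<phi> * (P - real N / \<phi>)" using \<phi>1 by (simp add: field_simps)
      have "\<bar>\<phi> * P - real N\<bar> = \<phi> * \<bar>P - real N / \<phi>\<bar>" unfolding e1 abs_mult using \<phi>1 by simp
      moreover assume "\<bar>\<phi> * P - real N\<bar> \<le> \<phi> * (C2 * X + E) + \<phi> * (C1 * real q * X)"
      ultimately show ?thesis by (simp add: algebra_simps)
    qed
    then have "\<bar>P - real N / \<phi>\<bar> \<le> C2 * X + E + C1 * real q * X" using \<phi>1 by simp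
    then have "\<bar>theta {1..N} q a - real N / \<phi>\<bar> \<le> C2 * X + 2 * E + C1 * real q * X" using thP by linarith
    also have "\<dots> \<le> C2 * (real q * X) + 2 * (6 * Cj * real q * X) + C1 * real q * X"
    proof -
      have "1 * X \<le> real q * X" using q1 X0 by (intro mult_right_mono) auto
      then have "C2 * X \<le> C2 * (real q * X)" using C2 by (intro mult_left_mono) auto
      then show ?thesis using EX by linarith
    qed
    also have "\<dots> = (C1 + C2 + 12 * Cj) * real q * X" by (simp add: algebra_simps)
    finally show "\<bar>theta {1..N} q a - real N / real (totient q)\<bar> \<le> (C1 + C2 + 12 * Cj) * real q * real N / ln (real N) ^ B"
      by (simp add: \<phi>_def X_def)
  qed (use C1 C2 Cj in simp)
qed

lemma theta_trivial: "0 \<le> theta {1..N} q a" "theta {1..N} q a \<le> real N * ln (real N)"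
proof -
  show "0 \<le> theta {1..N} q a" unfolding theta_def by (intro sum_nonneg) (auto dest: prime_gt_0_nat)
  have "theta {1..N} q a \<le> (\<Sum>p\<in>{p\<in>{1..N}. prime p \<and> [p = a] (mod q)}. ln (real N))"
    unfolding theta_def by (rule order_trans[OF eq_refl sum_mono]) (auto intro!: sum.cong)
  also have "\<dots> = real (card {p\<in>{1..N}. prime p \<and> [p = a] (mod q)}) * ln (real N)" by simp
  also have "\<dots> \<le> real N * ln (real N)"
  proof (cases "N = 0")
    case False
    have "card {p\<in>{1..N}. prime p \<and> [p = a] (mod q)} \<le> card {1..N}" by (intro card_mono) auto
    then show ?thesis using False by (intro mult_right_mono) auto
  qed simp
  finally show "theta {1..N} q a \<le> real N * ln (real N)" .
qed

text \<open>The error is expressed through \<open>x\<close> so that it serves both ends of a block,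
  however small the left end is: below \<open>sqrt x\<close> the trivial bound suffices. The
  threshold 256 makes \<open>sqrt x \<ge> 16\<close>.\<close>

lemma siegel_walfisz_uniform:
  obtains C where "C > 0" "\<And>q a N x. q > 0 \<Longrightarrow> coprime a q \<Longrightarrow> x \<ge> 256 \<Longrightarrow> real N \<le> x \<Longrightarrow>
    \<bar>theta {1..N} q a - real N / real (totient q)\<bar> \<le> C * real q * x / ln x ^ B"
proof -
  obtain C where C: "C > 0" "\<And>q a N. q > 0 \<Longrightarrow> coprime a q \<Longrightarrow> N \<ge> 16 \<Longrightarrow>
    \<bar>theta {1..N} q a - real N / real (totient q)\<bar> \<le> C * real q * real N / ln (real N) ^ B"
    by (rule siegel_walfisz) blast
  define Cj where "Cj = (2 * real (B + 1)) ^ (B + 1)"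
  have Cj: "Cj > 0" by (simp add: Cj_def)
  show ?thesis
  proof (rule that[of "C * 2 ^ B + 2 * Cj"])
    fix q a N and x :: real assume q: "q > (0::nat)" and a: "coprime a q" and x: "x \<ge> 256" and N: "real N \<le> x"
    have q1: "real q \<ge> 1" using q by simp
    have t1: "real (totient q) \<ge> 1" using q by (simp add: Suc_le_eq)
    have lx: "ln x \<ge> 1"
    proof -
      have "exp 1 \<le> x" using x exp_le by linarith
      then show ?thesis using x by (simp add: ln_ge_iff)
    qed
    have s16: "sqrt x \<ge> 16" using x by (simp add: real_le_rsqrt)
    define X where "X = x / ln x ^ B"
    have X0: "X > 0" using x lx by (simp add: X_def)
    have "\<bar>theta {1..N} q a - real N / real (totient q)\<bar> \<le> (C * 2 ^ B + 2 * Cj) * (real q * X)"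
    proof (cases "real N \<ge> sqrt x")
      case True
      then have N16: "N \<ge> 16" using s16 by linarith
      have "ln x / 2 = ln (sqrt x)" using x by (simp add: ln_sqrt)
      also have "\<dots> \<le> ln (real N)" using True x by (intro ln_mono) auto
      finally have l: "ln x / 2 \<le> ln (real N)" .
      have "C * real q * real N / ln (real N) ^ B \<le> C * real q * x / (ln x / 2) ^ B"
        using l lx N C by (intro frac_le mult_left_mono power_mono) auto
      also have "\<dots> = C * 2 ^ B * (real q * X)" by (simp add: X_def power_divide)
      also have "\<dots> \<le> (C * 2 ^ B + 2 * Cj) * (real q * X)" using Cj X0 by (intro mult_right_mono) auto
      finally show ?thesis using C(2)[OF q a N16] by linarith
    next
      case False
      have lN: "ln (real N) \<le> ln x"
      proof (cases "N = 0")
        case True then show ?thesis using lx by simp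
      next
        case f: False then show ?thesis using N by (intro ln_mono) auto
      qed
      have "real N * ln (real N) \<le> sqrt x * ln x"
        using False lN lx x by (cases "N = 0") (auto intro!: mult_mono)
      moreover have "real N / real (totient q) \<le> real N" using t1 by (simp add: divide_le_eq mult_le_cancel_left1)
      moreover have "real N * 1 \<le> sqrt x * ln x" using False lx x by (intro mult_mono) auto
      moreover have "0 \<le> real N / real (totient q)" by simp
      ultimately have "\<bar>theta {1..N} q a - real N / real (totient q)\<bar> \<le> 2 * (sqrt x * ln x)"
        using theta_trivial[of N q a] by linarith
      also have "sqrt x * ln x \<le> Cj * X"
      proof -
        have "ln x ^ (B + 1) \<le> Cj * sqrt x" unfolding Cj_def using x by (intro ln_power_le_sqrt) auto
        then have "sqrt x * ln x ^ (B + 1) \<le> sqrt x * (Cj * sqrt x)" using x by (intro mult_left_mono) auto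
        also have "\<dots> = Cj * x" using x by simp
        finally have "sqrt x * ln x * ln x ^ B \<le> Cj * x" by (simp add: mult_ac)
        then show ?thesis using lx by (simp add: X_def pos_le_divide_eq)
      qed
      then have "2 * (sqrt x * ln x) \<le> 2 * Cj * (1 * X)" by simp
      also have "\<dots> \<le> (C * 2 ^ B + 2 * Cj) * (real q * X)"
        using C Cj X0 q1 by (intro mult_mono) auto
      finally show ?thesis by simp
    qed
    then show "\<bar>theta {1..N} q a - real N / real (totient q)\<bar> \<le> (C * 2 ^ B + 2 * Cj) * real q * x / ln x ^ B"
      by (simp add: X_def mult_ac)
  qed (use C Cj in \<open>auto intro!: add_pos_pos\<close>)
qed

section \<open>Dyadic decomposition of partitions\<close>

text \<open>Cauchy's inequality for \<open>D\<close> terms and one more, written without dividing by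
  \<open>D\<close> so that it also starts the induction at \<open>D = 0\<close>.\<close>

lemma add_square_weighted_le:
  fixes y w p r D :: real
  assumes "y\<^sup>2 \<le> D * p" "w\<^sup>2 \<le> r" "p \<ge> 0" "D \<ge> 0"
  shows "(y + w)\<^sup>2 \<le> (D + 1) * (p + r)"
proof -
  have r: "r \<ge> 0" using assms(2) zero_le_power2[of w] by linarith
  have "(2 * (y * w))\<^sup>2 = 4 * (y\<^sup>2 * w\<^sup>2)" by (simp add: power_mult_distrib)
  also have "\<dots> \<le> 4 * ((D * p) * r)" using assms r by (intro mult_left_mono mult_mono) auto
  also have "\<dots> \<le> 4 * ((D * p) * r) + (p - D * r)\<^sup>2" by simp
  also have "\<dots> = (p + D * r)\<^sup>2" by (simp add: power2_eq_square algebra_simps)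
  finally have "2 * (y * w) \<le> p + D * r" by (rule power2_le_imp_le) (use assms r in auto)
  then show ?thesis using assms(1,2) by (simp add: power2_eq_square algebra_simps)
qed

lemma finite_dyadic_blocks: "finite {k. u \<le> k * 2 ^ m \<and> (k + 1) * 2 ^ m \<le> (v::nat)}"
proof (rule finite_subset)
  show "{k. u \<le> k * 2 ^ m \<and> (k + 1) * 2 ^ m \<le> v} \<subseteq> {..v}"
  proof
    fix k assume "k \<in> {k. u \<le> k * 2 ^ m \<and> (k + 1) * 2 ^ m \<le> v}"
    then have "(k + 1) * 2 ^ m \<le> v" by simp
    moreover have "(k + 1) * 1 \<le> (k + 1) * (2 ^ m :: nat)" by (intro mult_le_mono2) simp
    ultimately show "k \<in> {..v}" by simp
  qed
qed simp

text \<open>Induction on the number \<open>D\<close> of available levels. Trimming both ends to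
  multiples of the next power of two removes at most one block on each side, and the weighted Cauchy
  inequality lets the constant grow by only 2 per level. With no level left,
  \<open>v < 2 ^ L\<close> and divisibility force \<open>v = 0\<close>.\<close>

lemma dyadic_chain:
  fixes g :: "nat \<Rightarrow> real"
  assumes "L = l + D" "u \<le> v" "v < 2 ^ L" "2 ^ l dvd u" "2 ^ l dvd v"
  shows "(g v - g u)\<^sup>2 \<le> 2 * real D * (\<Sum>m\<in>{l..<L}. \<Sum>k\<in>{k. u \<le> k * 2 ^ m \<and> (k + 1) * 2 ^ m \<le> v}.
    (g ((k + 1) * 2 ^ m) - g (k * 2 ^ m))\<^sup>2)"
  using assms
proof (induction D arbitrary: l u v)
  case 0
  then have "v = 0" by (auto dest: dvd_imp_le)
  then show ?case using 0 by simp
next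
  case (Suc D)
  define f where "f = (\<lambda>m k. (g ((k + 1) * 2 ^ m) - g (k * 2 ^ m))\<^sup>2)"
  define K where "K = (\<lambda>m u v. {k::nat. u \<le> k * 2 ^ m \<and> (k + 1) * 2 ^ m \<le> v})"
  have f0: "f m k \<ge> 0" for m k by (simp add: f_def)
  have finK: "finite (K m u v)" for m u v unfolding K_def by (rule finite_dyadic_blocks)
  define S where "S = (\<Sum>m\<in>{Suc l..<L}. sum (f m) (K m u v))"
  have S0: "S \<ge> 0" unfolding S_def by (intro sum_nonneg f0)
  have split: "(\<Sum>m\<in>{l..<L}. sum (f m) (K m u v)) = sum (f l) (K l u v) + S"
    unfolding S_def using Suc.prems(1) by (subst sum.atLeast_Suc_lessThan) auto
  obtain s t where s: "u = 2 ^ l * s" and t: "v = 2 ^ l * t" using Suc.prems by (elim dvdE)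
  have st: "s \<le> t" using Suc.prems(2) by (simp add: s t)
  show ?case
  proof (cases "s = t")
    case True
    have "0 \<le> 2 * real (Suc D) * (\<Sum>m\<in>{l..<L}. sum (f m) (K m u v))"
      by (intro mult_nonneg_nonneg sum_nonneg f0) auto
    then show ?thesis using True by (simp add: s t f_def K_def)
  next
    case False
    \<comment> \<open>The left end is rounded up and the right end down; \<open>s < t\<close>
      prevents them from crossing.\<close>
    define u' where "u' = 2 ^ Suc l * ((s + 1) div 2)"
    define v' where "v' = 2 ^ Suc l * (t div 2)"
    have "(s + 1) div 2 \<le> t div 2" using False st by linarith
    then have uv: "u' \<le> v'" by (simp add: u'_def v'_def)
    have "u \<le> u'" unfolding s u'_def power_Suc mult.assoc[of 2] mult.left_commute[of 2] by (intro mult_le_mono2) linarith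
    have "v' \<le> v" unfolding t v'_def power_Suc mult.assoc[of 2] mult.left_commute[of 2] by (intro mult_le_mono2) linarith
    have ih: "(g v' - g u')\<^sup>2 \<le> 2 * real D * (\<Sum>m\<in>{Suc l..<L}. sum (f m) (K m u' v'))"
      unfolding f_def K_def
    proof (rule Suc.IH[OF _ uv])
      show "v' < 2 ^ L" using \<open>v' \<le> v\<close> Suc.prems(3) by linarith
    qed (use Suc.prems(1) in \<open>auto simp: u'_def v'_def\<close>)
    have "(\<Sum>m\<in>{Suc l..<L}. sum (f m) (K m u' v')) \<le> S" unfolding S_def
      using \<open>u \<le> u'\<close> \<open>v' \<le> v\<close> by (intro sum_mono sum_mono2 finK f0) (auto simp: K_def)
    then have "2 * real D * (\<Sum>m\<in>{Suc l..<L}. sum (f m) (K m u' v')) \<le> 2 * real D * S"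
      by (intro mult_left_mono) auto
    then have y: "(g v' - g u')\<^sup>2 \<le> real D * (2 * S)" using ih by simp
    define w1 where "w1 = g u' - g u"
    define w2 where "w2 = g v - g v'"
    have w1: "w1\<^sup>2 = (if odd s then f l s else 0)"
    proof (cases "odd s")
      case True
      then have "(s + 1) div 2 * 2 = s + 1" by presburger
      then have "u' = (s + 1) * 2 ^ l" unfolding u'_def power_Suc by (metis mult.assoc mult.commute)
      then show ?thesis using True by (simp add: w1_def f_def s mult.commute)
    next
      case False
      then have "(s + 1) div 2 * 2 = s" by simp
      then have "u' = u" unfolding u'_def power_Suc s by (metis mult.assoc mult.commute)
      then show ?thesis using False by (simp add: w1_def)
    qed
    have w2: "w2\<^sup>2 = (if odd t then f l (t - 1) else 0)"
    proof (cases "odd t")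
      case True
      then have t2: "t div 2 * 2 = t - 1" "t = t - 1 + 1" by presburger+
      from t2(1) have v': "v' = (t - 1) * 2 ^ l" unfolding v'_def power_Suc by (metis mult.assoc mult.commute)
      have "v = (t - 1 + 1) * 2 ^ l" using t2(2) t by (simp add: mult.commute)
      then show ?thesis using True by (simp add: w2_def f_def v' del: One_nat_def diff_add_inverse2 diff_Suc_1)
    next
      case False
      then have "t div 2 * 2 = t" by simp
      then have "v' = v" unfolding v'_def power_Suc t by (metis mult.assoc mult.commute)
      then show ?thesis using False by (simp add: w2_def)
    qed
    \<comment> \<open>The removed blocks: \<open>s\<close> occurs only when it is odd, and
      \<open>t - 1\<close> only when it is even, so they never coincide.\<close>
    define E where "E = (if odd s then {s} else {}) \<union> (if odd t then {t - 1} else {})"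
    have "w1\<^sup>2 + w2\<^sup>2 = sum (f l) E" unfolding w1 w2 E_def
      using st False by (auto simp: sum.insert_if)
    also have "\<dots> \<le> sum (f l) (K l u v)"
    proof (rule sum_mono2[OF finK _ f0])
      show "E \<subseteq> K l u v"
      proof
        fix k assume "k \<in> E"
        then have k: "s \<le> k" "k + 1 \<le> t" using st False by (auto simp: E_def split: if_splits)
        show "k \<in> K l u v" unfolding K_def s t using mult_le_mono2[OF k(1), of "2 ^ l"] mult_le_mono2[OF k(2), of "2 ^ l"]
          by (simp add: mult.commute)
      qed
    qed
    finally have "w1\<^sup>2 + w2\<^sup>2 \<le> sum (f l) (K l u v)" .
    moreover have "(w1 + w2)\<^sup>2 \<le> 2 * (w1\<^sup>2 + w2\<^sup>2)" using zero_le_power2[of "w1 - w2"]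
      by (simp add: power2_eq_square algebra_simps)
    ultimately have w: "(w1 + w2)\<^sup>2 \<le> 2 * sum (f l) (K l u v)"
      by (meson mult_left_mono order_trans zero_le_numeral)
    have "(g v - g u)\<^sup>2 = ((g v' - g u') + (w1 + w2))\<^sup>2" by (simp add: w1_def w2_def)
    also have "\<dots> \<le> (real D + 1) * (2 * S + 2 * sum (f l) (K l u v))"
      by (rule add_square_weighted_le[OF y w]) (use S0 in auto)
    also have "\<dots> = 2 * real (Suc D) * (sum (f l) (K l u v) + S)" by (simp add: algebra_simps)
    finally show ?thesis using split by (simp add: f_def K_def)
  qed
qed

lemma theta_block:
  assumes "u \<le> v"
  shows "theta {u<..v} q a = theta {1..v} q a - theta {1..u} q a"
proof -
  have un: "{p. p \<in> {1..v} \<and> prime p \<and> [p = a] (mod q)} =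
    {p. p \<in> {1..u} \<and> prime p \<and> [p = a] (mod q)} \<union> {p. p \<in> {u<..v} \<and> prime p \<and> [p = a] (mod q)}"
    using assms by auto
  have "theta {1..v} q a = theta {1..u} q a + theta {u<..v} q a"
    unfolding theta_def un by (rule sum.union_disjoint) auto
  then show ?thesis by simp
qed

lemma partition_variation:
  assumes P: "P \<in> interval_partitions n" and "n < 2 ^ L"
  shows "(\<Sum>I\<in>P. (theta I q a - real (card I) / c)\<^sup>2) \<le>
    2 * real L * (\<Sum>m<L. \<Sum>k\<in>{k. (k + 1) * 2 ^ m \<le> n}. (theta {k * 2 ^ m<..(k + 1) * 2 ^ m} q a - 2 ^ m / c)\<^sup>2)"
proof -
  define g where "g = (\<lambda>N. theta {1..N} q a - real N / c)"
  define f where "f = (\<lambda>m k. (theta {k * 2 ^ m<..(k + 1) * 2 ^ m} q a - 2 ^ m / c)\<^sup>2)"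
  define K where "K = (\<lambda>m I. {k::nat. {k * 2 ^ m<..(k + 1) * 2 ^ m} \<subseteq> I})"
  have f0: "f m k \<ge> 0" for m k by (simp add: f_def)
  have gd: "g v - g u = theta {u<..v} q a - real (v - u) / c" if "u \<le> v" for u v
    using that by (simp add: g_def theta_block of_nat_diff diff_divide_distrib)
  have fg: "(g ((k + 1) * 2 ^ m) - g (k * 2 ^ m))\<^sup>2 = f m k" for m k
    by (subst gd) (simp_all add: f_def)
  have cover: "\<Union>P = {1..n}" and disj: "pairwise disjnt P" using P by (auto simp: interval_partitions_def)
  have finP: "finite P" using cover by (intro finite_UnionD) simp
  have K_eq: "K m {u<..v} = {k. u \<le> k * 2 ^ m \<and> (k + 1) * 2 ^ m \<le> v}" for m u v
  proof -
    have "{k * 2 ^ m<..(k + 1) * 2 ^ m} \<subseteq> {u<..v} \<longleftrightarrow> u \<le> k * 2 ^ m \<and> (k + 1) * 2 ^ m \<le> v" for k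
    proof
      assume s: "{k * 2 ^ m<..(k + 1) * 2 ^ m} \<subseteq> {u<..v}"
      have "k * 2 ^ m + 1 \<in> {k * 2 ^ m<..(k + 1) * 2 ^ m}" "(k + 1) * 2 ^ m \<in> {k * 2 ^ m<..(k + 1) * (2 ^ m :: nat)}"
        by (auto simp: Suc_le_eq)
      then have "k * 2 ^ m + 1 \<in> {u<..v}" "(k + 1) * 2 ^ m \<in> {u<..v}" using s by blast+
      then show "u \<le> k * 2 ^ m \<and> (k + 1) * 2 ^ m \<le> v" by simp
    qed auto
    then show ?thesis unfolding K_def by blast
  qed
  have finK: "finite (K m I)" if "I \<in> P" for m I
  proof -
    have "K m I \<subseteq> K m {0<..n}" using that cover unfolding K_def by fastforce
    then show ?thesis unfolding K_eq using finite_dyadic_blocks finite_subset by blast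
  qed
  have "(theta I q a - real (card I) / c)\<^sup>2 \<le> 2 * real L * (\<Sum>m<L. sum (f m) (K m I))" if I: "I \<in> P" for I
  proof -
    obtain b d where bd: "b \<le> d" "I = {b..d}" using P I by (auto simp: interval_partitions_def)
    have "I \<subseteq> {1..n}" using I cover by blast
    then have b1: "1 \<le> b" "d \<le> n" using bd by auto
    \<comment> \<open>The function \<open>g\<close> counts from 1 up to its argument, so an interval
      that starts at \<open>b\<close> is an increment from \<open>b - 1\<close>.\<close>
    have I': "I = {b - 1<..d}" using bd b1 by auto
    have "(g d - g (b - 1))\<^sup>2 \<le> 2 * real L * (\<Sum>m\<in>{0..<L}. \<Sum>k\<in>{k. b - 1 \<le> k * 2 ^ m \<and> (k + 1) * 2 ^ m \<le> d}.
      (g ((k + 1) * 2 ^ m) - g (k * 2 ^ m))\<^sup>2)"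
      by (rule dyadic_chain) (use bd b1 assms(2) in auto)
    then have "(g d - g (b - 1))\<^sup>2 \<le> 2 * real L * (\<Sum>m<L. sum (f m) (K m I))"
      unfolding fg I' K_eq by (simp add: lessThan_atLeast0)
    moreover have "g d - g (b - 1) = theta I q a - real (card I) / c"
      using bd b1 by (subst gd) (auto simp: I')
    ultimately show ?thesis by simp
  qed
  then have "(\<Sum>I\<in>P. (theta I q a - real (card I) / c)\<^sup>2) \<le> (\<Sum>I\<in>P. 2 * real L * (\<Sum>m<L. sum (f m) (K m I)))"
    by (rule sum_mono)
  also have "\<dots> = 2 * real L * (\<Sum>m<L. \<Sum>I\<in>P. sum (f m) (K m I))"
    by (subst sum.swap) (simp add: sum_distrib_left)
  also have "\<dots> \<le> 2 * real L * (\<Sum>m<L. sum (f m) {k. (k + 1) * 2 ^ m \<le> n})"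
  proof (intro mult_left_mono sum_mono)
    fix m
    have "(\<Sum>I\<in>P. sum (f m) (K m I)) = sum (f m) (\<Union>I\<in>P. K m I)"
    proof (rule sum.UNION_disjoint[symmetric])
      show "\<forall>I\<in>P. \<forall>J\<in>P. I \<noteq> J \<longrightarrow> K m I \<inter> K m J = {}"
      proof (intro ballI impI equals0I)
        fix I J k assume IJ: "I \<in> P" "J \<in> P" "I \<noteq> J" and k: "k \<in> K m I \<inter> K m J"
        have "(k + 1) * 2 ^ m \<in> {k * 2 ^ m<..(k + 1) * (2 ^ m :: nat)}" by simp
        then have "(k + 1) * 2 ^ m \<in> I \<inter> J" using k unfolding K_def by blast
        then show False using IJ disj by (meson disjnt_iff pairwiseD IntD1 IntD2)
      qed
    qed (use finP finK in auto)
    also have "\<dots> \<le> sum (f m) {k. (k + 1) * 2 ^ m \<le> n}"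
    proof (rule sum_mono2[OF _ _ f0])
      show "finite {k. (k + 1) * 2 ^ m \<le> n}" using finite_dyadic_blocks[of 0 m n] by simp
      show "(\<Union>I\<in>P. K m I) \<subseteq> {k. (k + 1) * 2 ^ m \<le> n}"
      proof
        fix k assume "k \<in> (\<Union>I\<in>P. K m I)"
        then obtain I where "I \<in> P" "k \<in> K m I" by blast
        moreover have "(k + 1) * 2 ^ m \<in> {k * 2 ^ m<..(k + 1) * (2 ^ m :: nat)}" by simp
        ultimately have "(k + 1) * 2 ^ m \<in> \<Union>P" unfolding K_def by blast
        then show "k \<in> {k. (k + 1) * 2 ^ m \<le> n}" unfolding cover by simp
      qed
    qed
    finally show "(\<Sum>I\<in>P. sum (f m) (K m I)) \<le> sum (f m) {k. (k + 1) * 2 ^ m \<le> n}" .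
  qed simp
  finally show ?thesis by (simp add: f_def)
qed

lemma interval_partitions_finite_nonempty:
  "finite (interval_partitions n)" "n \<ge> 1 \<Longrightarrow> interval_partitions n \<noteq> {}"
proof -
  have "interval_partitions n \<subseteq> Pow (Pow {1..n})" by (auto simp: interval_partitions_def)
  then show "finite (interval_partitions n)" by (rule finite_subset) simp
  assume "n \<ge> 1"
  then have "{{1..n}} \<in> interval_partitions n" unfolding interval_partitions_def by auto
  then show "interval_partitions n \<noteq> {}" by blast
qed

section \<open>The variance over one block\<close>

lemma harmonic_le: "N \<ge> 1 \<Longrightarrow> (\<Sum>m\<in>{1..N}. 1 / real m) \<le> 1 + ln (real N)"
proof (induction N rule: dec_induct)
  case (step N)
  have "ln (real N / (real N + 1)) \<le> real N / (real N + 1) - 1" using step by (intro ln_le_minus_one) auto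
  also have "\<dots> = - (1 / (real N + 1))" by (simp add: field_simps)
  finally have "1 / (real N + 1) \<le> ln (real N + 1) - ln (real N)" using step by (simp add: ln_div)
  then show ?case using step by (simp add: add.commute)
qed simp

lemma sum_inverse_squares_le: "N \<ge> 1 \<Longrightarrow> (\<Sum>m\<in>{1..N}. 1 / (real m)\<^sup>2) \<le> 2 - 1 / real N"
proof (induction N rule: dec_induct)
  case (step N)
  have n: "real N > 0" using step by simp
  have "1 / (real N + 1)\<^sup>2 \<le> 1 / (real N * (real N + 1))"
    using n by (intro divide_left_mono) (auto simp: power2_eq_square)
  also have "\<dots> = 1 / real N - 1 / (real N + 1)" using n by (simp add: field_simps)
  finally show ?case using step by (simp add: add.commute)
qed simp

section \<open>Exponential sums over primes and residue classes\<close>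

abbreviation (input) reduced :: "nat \<Rightarrow> nat set" where
  "reduced q \<equiv> {b \<in> {1..q}. coprime b q}"

lemma card_reduced: "card (reduced q) = totient q"
proof -
  have "reduced q = totatives q" by (auto simp: totatives_def)
  then show ?thesis by (simp add: totient_def)
qed

lemma div_div_self_nat: "d dvd q \<Longrightarrow> q > 0 \<Longrightarrow> q div (q div d) = (d::nat)"
  by (elim dvdE) auto

text \<open>The fractions \<open>b / q\<close> are grouped by their lowest terms; the hypothesis on
  \<open>G\<close> says that it depends on the fraction only.\<close>

lemma farey_sum:
  fixes G :: "nat \<Rightarrow> nat \<Rightarrow> 'a::comm_monoid_add"
  assumes q: "q > 0" and G: "\<And>k d b. k > 0 \<Longrightarrow> d > 0 \<Longrightarrow> G (k * d) (k * b) = G d b"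
  shows "(\<Sum>b\<in>{1..q}. G q b) = (\<Sum>d\<in>{d. d dvd q}. \<Sum>b\<in>reduced d. G d b)"
proof -
  have fin: "finite {d. d dvd q}" using q by simp
  have "(\<Sum>b\<in>{1..q}. G q b) = (\<Sum>(d, b)\<in>(SIGMA d:{d. d dvd q}. reduced d). G d b)"
  proof (rule sum.reindex_bij_witness[where i = "\<lambda>(d, b). b * (q div d)" and j = "\<lambda>b. (q div gcd b q, b div gcd b q)"], goal_cases)
    case (1 b)
    then show ?case using q by (simp add: div_div_self_nat)
  next
    case (2 b)
    have g: "gcd b q > 0" "gcd b q dvd b" "gcd b q dvd q" using q by auto
    have "b div gcd b q > 0" using 2 g by (simp add: div_greater_zero_iff dvd_imp_le)
    moreover have "coprime (b div gcd b q) (q div gcd b q)" by (rule div_gcd_coprime) (use q in auto)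
    moreover have "b div gcd b q \<le> q div gcd b q" using 2 by (intro div_le_mono) simp
    moreover have "q div gcd b q dvd q" using g by (metis dvd_div_mult_self dvd_triv_left)
    ultimately show ?case by simp
  next
    case (3 z)
    obtain d b where z: "z = (d, b)" by force
    then have d: "d dvd q" "b \<ge> 1" "b \<le> d" "coprime b d" using 3 by auto
    have "gcd ((q div d) * b) ((q div d) * d) = (q div d) * gcd b d" by (rule gcd_mult_distrib_nat[symmetric])
    then have "gcd (b * (q div d)) q = q div d" using d by (simp add: mult.commute)
    moreover have "q div d > 0" using d q by (simp add: div_greater_zero_iff dvd_imp_le)
    moreover have "q div (q div d) = d" using d q by (simp add: div_div_self_nat)
    ultimately show ?case using z by simp
  next
    case (4 z)
    obtain d b where z: "z = (d, b)" by force
    then have d: "d dvd q" "b \<ge> 1" "b \<le> d" "coprime b d" using 4 by auto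
    have p: "q div d > 0" using d q by (simp add: div_greater_zero_iff dvd_imp_le)
    have "b * (q div d) \<le> d * (q div d)" using d by (intro mult_le_mono1)
    then show ?case using z d p by simp
  next
    case (5 b)
    have g: "gcd b q > 0" "gcd b q dvd b" "gcd b q dvd q" using q by auto
    have "G (gcd b q * (q div gcd b q)) (gcd b q * (b div gcd b q)) = G (q div gcd b q) (b div gcd b q)"
      using g q by (intro G) (auto simp: div_greater_zero_iff dvd_imp_le)
    then show ?case using g by simp
  qed
  also have "\<dots> = (\<Sum>d\<in>{d. d dvd q}. \<Sum>b\<in>reduced d. G d b)" using fin by (subst sum.Sigma) auto
  finally show ?thesis .
qed

lemma residue_unique:
  assumes "a \<in> {1..q}" "b \<in> {1..q}" "[a = b] (mod q)"
  shows "a = (b::nat)"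
proof -
  have *: "a = b" if "a \<in> {1..q}" "b \<in> {1..q}" "[a = b] (mod q)" "b \<le> a" for a b :: nat
  proof -
    have "q dvd a - b" using that by (simp add: cong_altdef_nat)
    moreover have "a - b < q" using that by auto
    ultimately have "a - b = 0" by (metis dvd_imp_le leD not_gr0)
    then show ?thesis using that by simp
  qed
  show ?thesis using *[of a b] *[of b a] assms by (metis cong_sym nat_le_linear)
qed

lemma cis_periodic_cong:
  assumes "[p = a] (mod q)" "q > 0"
  shows "cis (2 * pi * real p * (real b / real q)) = cis (2 * pi * real a * (real b / real q))"
proof -
  have "int q dvd int p - int a" using assms by (simp add: cong_iff_dvd_diff flip: cong_int_iff)
  then obtain k where "int p - int a = int q * k" by (elim dvdE)
  then have "real_of_int (int p - int a) = real_of_int (int q * k)" by simp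
  then have p: "real p = real a + real q * of_int k" by simp
  have "2 * pi * real p * (real b / real q) = 2 * pi * real a * (real b / real q) + 2 * pi * of_int (k * int b)"
    unfolding p using assms(2) by (simp add: field_simps)
  moreover have "cis (2 * pi * of_int (k * int b)) = 1" by (rule cis_multiple_2pi) auto
  ultimately show ?thesis by (simp add: cis_mult[symmetric])
qed

lemma sum_cis_orthogonal:
  assumes "s \<in> {1..q}" "t \<in> {1..q}"
  shows "(\<Sum>b\<in>{1..q}. cis (2 * pi * real s * (real b / real q)) * cnj (cis (2 * pi * real t * (real b / real q)))) =
    (if s = t then of_nat q else 0)"
proof -
  have q: "q > 0" using assms by simp
  have shift: "(\<Sum>b\<in>{1..q}. h b) = (\<Sum>b<q. h b)" if "h q = h 0" for h :: "nat \<Rightarrow> complex"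
  proof -
    have "(\<Sum>b\<in>{1..q}. h b) = (\<Sum>b<q. h (Suc b))" by (simp add: sum.atLeast1_atMost_eq)
    also have "\<dots> = (\<Sum>b<q. h b) + h q - h 0" using sum.lessThan_Suc_shift[of h q] by simp
    finally show ?thesis using that by simp
  qed
  have *: "(\<Sum>b\<in>{1..q}. cis (2 * pi * real s * (real b / real q)) * cnj (cis (2 * pi * real t * (real b / real q)))) =
    (if s = t then of_nat q else 0)" if "s \<le> t" "s \<in> {1..q}" "t \<in> {1..q}" for s t
  proof -
    define j where "j = t - s"
    have j: "real t = real s + real j" "j < q" "j = 0 \<longleftrightarrow> s = t" using that by (auto simp: j_def)
    have e: "cis (2 * pi * real s * (real b / real q)) * cnj (cis (2 * pi * real t * (real b / real q))) =
      cis (- (2 * pi * real b / real q)) ^ j" for b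
      unfolding cis_cnj cis_mult Complex.DeMoivre by (rule arg_cong[of _ _ cis]) (simp add: j(1) algebra_simps)
    have "cis (- (2 * pi * real q / real q)) = 1" using q cis_multiple_2pi[of "-1"] by simp
    then have "(\<Sum>b\<in>{1..q}. cis (- (2 * pi * real b / real q)) ^ j) = (\<Sum>b<q. cis (- (2 * pi * real b / real q)) ^ j)"
      by (intro shift) simp
    then show ?thesis unfolding e using sum_roots_unity[OF q j(2)] j(3) by simp
  qed
  show ?thesis
  proof (cases "s \<le> t")
    case True then show ?thesis using * assms by blast
  next
    case False
    have "(\<Sum>b\<in>{1..q}. cis (2 * pi * real s * (real b / real q)) * cnj (cis (2 * pi * real t * (real b / real q)))) =
      cnj (\<Sum>b\<in>{1..q}. cis (2 * pi * real t * (real b / real q)) * cnj (cis (2 * pi * real s * (real b / real q))))"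
      unfolding cnj_sum complex_cnj_mult complex_cnj_cnj by (simp only: mult.commute)
    also have "\<dots> = 0" using *[of t s] False assms by (simp del: times_divide_eq_right)
    finally show ?thesis using False by simp
  qed
qed

lemma parseval_residues:
  assumes "q > 0"
  shows "(\<Sum>b\<in>{1..q}. (norm (expsum {1..q} f (real b / real q)))\<^sup>2) = real q * (\<Sum>a\<in>{1..q}. (norm (f a))\<^sup>2)"
proof -
  define e where "e = (\<lambda>a b. cis (2 * pi * real a * (real b / real q)))"
  have "complex_of_real (\<Sum>b\<in>{1..q}. (norm (expsum {1..q} f (real b / real q)))\<^sup>2) =
    (\<Sum>b\<in>{1..q}. (\<Sum>s\<in>{1..q}. f s * e s b) * (\<Sum>t\<in>{1..q}. cnj (f t) * cnj (e t b)))"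
    unfolding of_real_sum complex_norm_square expsum_def e_def by (simp add: cnj_sum)
  also have "\<dots> = (\<Sum>b\<in>{1..q}. \<Sum>s\<in>{1..q}. \<Sum>t\<in>{1..q}. f s * cnj (f t) * (e s b * cnj (e t b)))"
    by (simp add: sum_product mult_ac)
  also have "\<dots> = (\<Sum>s\<in>{1..q}. \<Sum>t\<in>{1..q}. \<Sum>b\<in>{1..q}. f s * cnj (f t) * (e s b * cnj (e t b)))"
    by (subst sum.swap, rule sum.cong[OF refl], rule sum.swap)
  also have "\<dots> = (\<Sum>s\<in>{1..q}. \<Sum>t\<in>{1..q}. if s = t then of_nat q * (f s * cnj (f s)) else 0)"
  proof (intro sum.cong refl)
    fix s t assume st: "s \<in> {1..q}" "t \<in> {1..q}"
    show "(\<Sum>b\<in>{1..q}. f s * cnj (f t) * (e s b * cnj (e t b))) = (if s = t then of_nat q * (f s * cnj (f s)) else 0)"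
      unfolding sum_distrib_left[symmetric] e_def sum_cis_orthogonal[OF st] by simp
  qed
  also have "\<dots> = (\<Sum>s\<in>{1..q}. of_nat q * (f s * cnj (f s)))"
    by (intro sum.cong refl) (simp add: sum.delta)
  also have "\<dots> = complex_of_real (real q * (\<Sum>a\<in>{1..q}. (norm (f a))\<^sup>2))"
    unfolding of_real_mult of_real_sum complex_norm_square by (simp add: sum_distrib_left)
  finally show ?thesis by (simp only: of_real_eq_iff)
qed

definition prime_weight :: "nat \<Rightarrow> complex" where
  "prime_weight n = complex_of_real (if prime n then ln (real n) else 0)"

text \<open>The phase at \<open>b / q\<close> depends only on the class of the prime. All classes
  occur, so primes dividing \<open>q\<close> are included and the identity is exact.\<close>

lemma expsum_primes_residues:
  assumes q: "q > 0" and J: "finite J"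
  shows "expsum J prime_weight (real b / real q) = expsum {1..q} (\<lambda>a. complex_of_real (theta J q a)) (real b / real q)"
proof -
  define e where "e = (\<lambda>a. cis (2 * pi * real a * (real b / real q)))"
  define S where "S = (\<lambda>a. {p. p \<in> J \<and> prime p \<and> [p = a] (mod q)})"
  have fin: "finite (S a)" for a using J by (simp add: S_def)
  have un: "{p\<in>J. prime p} = (\<Union>a\<in>{1..q}. S a)"
  proof (intro equalityI subsetI)
    fix p assume p: "p \<in> {p\<in>J. prime p}"
    define a where "a = (if p mod q = 0 then q else p mod q)"
    have "a \<in> {1..q}" "[p = a] (mod q)" using q by (auto simp: a_def Cong.cong_def intro: less_imp_le)
    then show "p \<in> (\<Union>a\<in>{1..q}. S a)" using p unfolding S_def by blast
  qed (auto simp: S_def)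
  have "expsum {1..q} (\<lambda>a. complex_of_real (theta J q a)) (real b / real q) =
    (\<Sum>a\<in>{1..q}. \<Sum>p\<in>S a. complex_of_real (ln (real p)) * e a)"
    unfolding expsum_def theta_def S_def e_def by (simp add: sum_distrib_right)
  also have "\<dots> = (\<Sum>a\<in>{1..q}. \<Sum>p\<in>S a. complex_of_real (ln (real p)) * e p)"
  proof (intro sum.cong refl)
    fix a p assume "p \<in> S a"
    then have "e p = e a" unfolding S_def e_def using cis_periodic_cong[OF _ q] by blast
    then show "complex_of_real (ln (real p)) * e a = complex_of_real (ln (real p)) * e p" by simp
  qed
  also have "\<dots> = (\<Sum>p\<in>(\<Union>a\<in>{1..q}. S a). complex_of_real (ln (real p)) * e p)"
  proof (rule sum.UNION_disjoint[symmetric])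
    show "\<forall>a\<in>{1..q}. \<forall>a'\<in>{1..q}. a \<noteq> a' \<longrightarrow> S a \<inter> S a' = {}"
    proof (intro ballI impI equals0I)
      fix a a' p assume a: "a \<in> {1..q}" "a' \<in> {1..q}" "a \<noteq> a'" and p: "p \<in> S a \<inter> S a'"
      then have "[a = a'] (mod q)" unfolding S_def using cong_trans cong_sym by blast
      then show False using residue_unique a by blast
    qed
  qed (use fin in auto)
  also have "\<dots> = (\<Sum>p\<in>J. if prime p then complex_of_real (ln (real p)) * e p else 0)"
    unfolding un[symmetric] using J by (rule sum.inter_filter)
  also have "\<dots> = expsum J prime_weight (real b / real q)"
    unfolding expsum_def prime_weight_def e_def by (intro sum.cong) auto
  finally show ?thesis by simp
qed

text \<open>A prime in a non-reduced class divides \<open>q\<close>, hence lies in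
  \<open>{1..q}\<close> and is itself the representative \<open>a\<close>.\<close>

lemma theta_noncoprime:
  assumes "a \<in> {1..q}" "\<not> coprime a q"
  shows "theta J q a \<le> (if a \<in> prime_factors q then ln (real a) else 0)"
proof -
  have sub: "{p. p \<in> J \<and> prime p \<and> [p = a] (mod q)} \<subseteq> (if a \<in> prime_factors q then {a} else {})"
  proof
    fix p assume "p \<in> {p. p \<in> J \<and> prime p \<and> [p = a] (mod q)}"
    then have p: "prime p" "[p = a] (mod q)" by auto
    have "\<not> coprime p q" using assms(2) p(2) cong_imp_coprime cong_sym by blast
    then have d: "p dvd q" using p(1) prime_imp_coprime by blast
    then have "p \<in> {1..q}" using assms(1) p(1) by (auto dest: dvd_imp_le prime_gt_0_nat)
    then have "p = a" using residue_unique[OF _ assms(1) p(2)] by blast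
    then show "p \<in> (if a \<in> prime_factors q then {a} else {})" using p(1) d assms(1) by (auto simp: in_prime_factors_iff)
  qed
  have "theta J q a \<le> (\<Sum>p\<in>(if a \<in> prime_factors q then {a} else {}). ln (real p))"
    unfolding theta_def using sub assms(1) by (intro sum_mono2) (auto split: if_splits)
  then show ?thesis by (auto split: if_splits)
qed

lemma sum_ln_prime_factors_le:
  assumes "q > 0"
  shows "(\<Sum>p\<in>prime_factors q. ln (real p)) \<le> ln (real q)"
proof -
  have "(\<Prod>p\<in>prime_factors q. p) \<le> (\<Prod>p\<in>prime_factors q. p ^ multiplicity p q)"
  proof (intro prod_mono conjI)
    fix p assume "p \<in> prime_factors q"
    then have "multiplicity p q \<ge> 1" "p \<ge> 1"
      using assms by (auto simp: in_prime_factors_iff prime_factors_multiplicity dest: prime_gt_0_nat)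
    then show "p \<le> p ^ multiplicity p q" using self_le_power[of p "multiplicity p q"] by simp
  qed simp
  also have "\<dots> = q" using prime_factorization_nat[of q] assms by simp
  finally have le: "real (\<Prod>p\<in>prime_factors q. p) \<le> real q" by (simp only: of_nat_le_iff)
  have pos: "real p > 0" if "p \<in> prime_factors q" for p using that by (auto simp: in_prime_factors_iff prime_gt_0_nat)
  have "(\<Sum>p\<in>prime_factors q. ln (real p)) = ln (\<Prod>p\<in>prime_factors q. real p)"
    using pos by (subst ln_prod) auto
  also have "\<dots> \<le> ln (real q)" using le pos by (intro ln_mono) (auto intro!: prod_pos)
  finally show ?thesis .
qed

text \<open>At an integral frequency the exponential sum is the theta function of the block. Reading
  this frequency both as \<open>1 / 1\<close> and as \<open>q / q\<close> compares modulus 1 with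
  modulus \<open>q\<close>; the non-reduced classes hold at most the prime divisors of
  \<open>q\<close>.\<close>

lemma reduced_theta_ge:
  assumes q: "q > 0" and J: "finite J"
  shows "theta J 1 1 - ln (real q) \<le> (\<Sum>a\<in>reduced q. theta J q a)"
proof -
  have "complex_of_real (theta J 1 1) = expsum {1..1} (\<lambda>a. complex_of_real (theta J 1 a)) (real 1 / real 1)"
    using cis_multiple_2pi[of 1] by (simp add: expsum_def)
  also have "\<dots> = expsum J prime_weight (real 1 / real 1)" using J by (subst expsum_primes_residues) auto
  also have "\<dots> = expsum J prime_weight (real q / real q)" using q by simp
  also have "\<dots> = (\<Sum>a\<in>{1..q}. complex_of_real (theta J q a) * cis (2 * pi * of_nat a))"
    using q J by (subst expsum_primes_residues) (auto simp: expsum_def)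
  also have "\<dots> = complex_of_real (\<Sum>a\<in>{1..q}. theta J q a)" by (simp add: cis_multiple_2pi)
  finally have "theta J 1 1 = (\<Sum>a\<in>{1..q}. theta J q a)" by (simp only: of_real_eq_iff)
  also have "\<dots> = (\<Sum>a\<in>reduced q. theta J q a) + (\<Sum>a\<in>{a\<in>{1..q}. \<not> coprime a q}. theta J q a)"
  proof -
    have un: "{1..q} = reduced q \<union> {a\<in>{1..q}. \<not> coprime a q}" by blast
    show ?thesis by (subst un) (rule sum.union_disjoint, auto)
  qed
  also have "(\<Sum>a\<in>{a\<in>{1..q}. \<not> coprime a q}. theta J q a) \<le> ln (real q)"
  proof -
    have "(\<Sum>a\<in>{a\<in>{1..q}. \<not> coprime a q}. theta J q a) \<le>
      (\<Sum>a\<in>{a\<in>{1..q}. \<not> coprime a q}. if a \<in> prime_factors q then ln (real a) else 0)"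
      by (intro sum_mono theta_noncoprime) auto
    also have "\<dots> = (\<Sum>a\<in>{a\<in>{a\<in>{1..q}. \<not> coprime a q}. a \<in> prime_factors q}. ln (real a))"
      by (rule sum.inter_filter[symmetric]) simp
    also have "\<dots> \<le> (\<Sum>p\<in>prime_factors q. ln (real p))"
      by (intro sum_mono2) (auto simp: in_prime_factors_iff Suc_le_eq dest: prime_gt_0_nat)
    finally show ?thesis using sum_ln_prime_factors_le[OF q] by linarith
  qed
  finally show ?thesis by simp
qed

section \<open>Partial summation of the large sieve over moduli\<close>

lemma divide_succ_split:
  fixes y z :: real
  assumes "z > 0"
  shows "y / z = y / (z + 1) + y / (z * (z + 1))"
proof -
  have "y / (z + 1) + y / (z * (z + 1)) = y * z / (z * (z + 1)) + y / (z * (z + 1))" using assms by simp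
  also have "\<dots> = y * (z + 1) / (z * (z + 1))" by (simp add: add_divide_distrib[symmetric] distrib_left)
  also have "\<dots> = y / z" using assms by simp
  finally show ?thesis by simp
qed

text \<open>Partial summation as an induction on \<open>Y\<close> that keeps the boundary term
  \<open>(\<Sum>d. g d) / (Y + 1)\<close>. The part \<open>Y^2\<close> of the hypothesis turns into
  \<open>Y\<close>, while \<open>K\<close> is divided by the smallest index
  \<open>R\<close>.\<close>

lemma sum_over_index_le:
  fixes g :: "nat \<Rightarrow> real"
  assumes g: "\<And>d. g d \<ge> 0" and S: "S \<ge> 0" and K: "K \<ge> 0"
    and G: "\<And>Y. Y \<ge> 1 \<Longrightarrow> (\<Sum>d\<in>{1..Y}. g d) \<le> ((real Y)\<^sup>2 + K) * S" and R: "R \<ge> 1"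
  shows "(\<Sum>d\<in>{R..Y}. g d / real d) \<le> (2 * real Y + K / real R) * S"
proof (cases "R \<le> Y")
  case False
  then show ?thesis using S K by simp
next
  case True
  have A: "(\<Sum>d\<in>{R..Y}. g d) \<le> ((real Y)\<^sup>2 + K) * S" if "Y \<ge> 1" for Y
    using G[OF that] by (rule order_trans[rotated]) (use R g in \<open>auto intro!: sum_mono2\<close>)
  have inc: "((real Z)\<^sup>2 + K) * S / (real Z * (real Z + 1)) \<le> (1 + K * (1 / real Z - 1 / (real Z + 1))) * S" if "Z \<ge> 1" for Z
  proof -
    have z: "real Z > 0" using that by simp
    have "((real Z)\<^sup>2 + K) / (real Z * (real Z + 1)) = real Z / (real Z + 1) + K * (1 / real Z - 1 / (real Z + 1))"
      using divide_succ_split[OF z, of 1] z by (simp add: add_divide_distrib power2_eq_square)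
    also have "\<dots> \<le> 1 + K * (1 / real Z - 1 / (real Z + 1))" by simp
    finally show ?thesis using S by (metis mult_right_mono times_divide_eq_left)
  qed
  have "(\<Sum>d\<in>{R..Y}. g d / real d) \<le> (\<Sum>d\<in>{R..Y}. g d) / (real Y + 1) + (real Y + K * (1 / real R - 1 / (real Y + 1))) * S"
    using True
  proof (induction Y rule: dec_induct)
    case base
    have r: "real R > 0" using R by simp
    have "g R / real R = g R / (real R + 1) + g R / (real R * (real R + 1))" by (rule divide_succ_split[OF r])
    also have "g R / (real R * (real R + 1)) \<le> ((real R)\<^sup>2 + K) * S / (real R * (real R + 1))"
      using A[OF R] r by (intro divide_right_mono) auto
    also have "\<dots> \<le> (1 + K * (1 / real R - 1 / (real R + 1))) * S" by (rule inc[OF R])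
    also have "\<dots> \<le> (real R + K * (1 / real R - 1 / (real R + 1))) * S"
      using R S by (intro mult_right_mono) auto
    finally show ?case by simp
  next
    case (step Y)
    define z where "z = real Y + 1"
    define B where "B = (\<Sum>d\<in>{R..Suc Y}. g d)"
    have z: "z > 0" "z = real (Suc Y)" by (auto simp: z_def)
    have B: "B = (\<Sum>d\<in>{R..Y}. g d) + g (Suc Y)" using step by (simp add: B_def)
    have "(\<Sum>d\<in>{R..Suc Y}. g d / real d) = (\<Sum>d\<in>{R..Y}. g d / real d) + g (Suc Y) / z"
      using step by (simp add: z_def add.commute)
    also have "\<dots> \<le> (B - g (Suc Y)) / z + (real Y + K * (1 / real R - 1 / z)) * S + g (Suc Y) / z"
      using step.IH by (simp add: B z_def)
    also have "\<dots> = B / z + (real Y + K * (1 / real R - 1 / z)) * S" by (simp add: diff_divide_distrib)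
    also have "B / z = B / (z + 1) + B / (z * (z + 1))" by (rule divide_succ_split[OF z(1)])
    also have "B / (z * (z + 1)) \<le> (z\<^sup>2 + K) * S / (z * (z + 1))"
      using A[of "Suc Y"] z by (intro divide_right_mono) (auto simp: B_def)
    also have "(z\<^sup>2 + K) * S / (z * (z + 1)) \<le> (1 + K * (1 / z - 1 / (z + 1))) * S"
      unfolding z(2) by (rule inc) simp
    finally have "(\<Sum>d\<in>{R..Suc Y}. g d / real d) \<le> B / (z + 1) + (1 + K * (1 / z - 1 / (z + 1))) * S + (real Y + K * (1 / real R - 1 / z)) * S"
      by simp
    also have "\<dots> = B / (z + 1) + (z + K * (1 / real R - 1 / (z + 1))) * S" by (simp add: z_def algebra_simps)
    finally show ?case by (simp add: B_def z(2))
  qed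
  also have "(\<Sum>d\<in>{R..Y}. g d) / (real Y + 1) \<le> (real Y + K / (real Y + 1)) * S"
  proof -
    have Y: "Y \<ge> 1" using True R by simp
    have "(real Y)\<^sup>2 / (real Y + 1) \<le> real Y" by (simp add: power2_eq_square field_simps)
    then have "((real Y)\<^sup>2 + K) / (real Y + 1) * S \<le> (real Y + K / (real Y + 1)) * S"
      using S by (intro mult_right_mono) (auto simp: add_divide_distrib)
    then show ?thesis using divide_right_mono[OF A[OF Y], of "real Y + 1"] by simp
  qed
  finally show ?thesis by (simp add: algebra_simps)
qed

text \<open>Writing \<open>q = m * d\<close> separates the weight into \<open>1 / m\<close> and
  \<open>1 / d\<close>. The sum over \<open>d\<close> then runs up to \<open>N div m\<close>, whose
  main term leaves a convergent sum of \<open>1 / m^2\<close>; only the term with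
  \<open>K / R\<close> meets the harmonic sum.\<close>

lemma divisor_weighted_le:
  fixes g :: "nat \<Rightarrow> real"
  assumes g: "\<And>d. g d \<ge> 0" and S: "S \<ge> 0" and K: "K \<ge> 0"
    and G: "\<And>Y. Y \<ge> 1 \<Longrightarrow> (\<Sum>d\<in>{1..Y}. g d) \<le> ((real Y)\<^sup>2 + K) * S" and R: "R \<ge> 1" and N: "N \<ge> 1"
  shows "(\<Sum>q\<in>{1..N}. (\<Sum>d\<in>{d. d dvd q \<and> R \<le> d}. g d) / real q) \<le> (4 * real N + K / real R * (1 + ln (real N))) * S"
proof -
  have "(\<Sum>q\<in>{1..N}. (\<Sum>d\<in>{d. d dvd q \<and> R \<le> d}. g d) / real q) =
    (\<Sum>(q, d)\<in>(SIGMA q:{1..N}. {d. d dvd q \<and> R \<le> d}). g d / real q)"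
    by (subst sum.Sigma[symmetric]) (auto simp: sum_divide_distrib)
  also have "\<dots> = (\<Sum>(m, d)\<in>(SIGMA m:{1..N}. {R..N div m}). g d / real d / real m)"
  proof (rule sum.reindex_bij_witness[where i = "\<lambda>(m, d). (m * d, d)" and j = "\<lambda>(q, d). (q div d, d)"], goal_cases)
    case (2 z)
    then obtain q d where z: "z = (q, d)" "1 \<le> q" "q \<le> N" "d dvd q" "R \<le> d" by auto
    then have d: "d > 0" "d \<le> q" using R by (auto dest: dvd_imp_le)
    then have "q div d \<ge> 1" using z by (simp add: Suc_le_eq div_greater_zero_iff)
    moreover have "q div d \<le> N" using z div_le_dividend[of q d] by linarith
    moreover have "d * (q div d) \<le> N" using z by simp
    then have "d \<le> N div (q div d)" using \<open>q div d \<ge> 1\<close> by (simp add: less_eq_div_iff_mult_less_eq)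
    ultimately show ?case using z by simp
  next
    case (4 z)
    then obtain m d where z: "z = (m, d)" "1 \<le> m" "m \<le> N" "R \<le> d" "d \<le> N div m" by auto
    then have "m * d \<le> N" by (simp add: less_eq_div_iff_mult_less_eq mult.commute)
    then show ?case using z R by auto
  next
    case (5 z)
    then obtain q d where z: "z = (q, d)" "d dvd q" "R \<le> d" by auto
    then show ?case using R by (auto simp: real_of_nat_div)
  qed (use R in auto)
  also have "\<dots> = (\<Sum>m\<in>{1..N}. (\<Sum>d\<in>{R..N div m}. g d / real d) / real m)"
    by (subst sum.Sigma[symmetric]) (auto simp: sum_divide_distrib)
  also have "\<dots> \<le> (\<Sum>m\<in>{1..N}. 2 * real N * S * (1 / (real m)\<^sup>2) + K / real R * S * (1 / real m))"
  proof (rule sum_mono)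
    fix m assume m: "m \<in> {1..N}"
    then have m0: "real m > 0" by simp
    have "real (N div m) \<le> real N / real m" by (rule of_nat_div_le_of_nat)
    then have "(2 * real (N div m) + K / real R) * S \<le> (2 * (real N / real m) + K / real R) * S"
      using S by (intro mult_right_mono) auto
    then have "(\<Sum>d\<in>{R..N div m}. g d / real d) \<le> (2 * (real N / real m) + K / real R) * S"
      using sum_over_index_le[OF g S K G R, of "N div m"] by linarith
    then have "(\<Sum>d\<in>{R..N div m}. g d / real d) / real m \<le> (2 * (real N / real m) + K / real R) * S / real m"
      using m0 by (intro divide_right_mono) auto
    also have "\<dots> = 2 * real N * S * (1 / (real m)\<^sup>2) + K / real R * S * (1 / real m)"
      using m0 by (simp add: field_simps power2_eq_square)
    finally show "(\<Sum>d\<in>{R..N div m}. g d / real d) / real m \<le> 2 * real N * S * (1 / (real m)\<^sup>2) + K / real R * S * (1 / real m)" .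
  qed
  also have "\<dots> = 2 * real N * S * (\<Sum>m\<in>{1..N}. 1 / (real m)\<^sup>2) + K / real R * S * (\<Sum>m\<in>{1..N}. 1 / real m)"
    by (simp only: sum.distrib sum_distrib_left)
  also have "\<dots> \<le> 2 * real N * S * 2 + K / real R * S * (1 + ln (real N))"
  proof (intro add_mono mult_left_mono)
    have "0 \<le> 1 / real N" by simp
    then show "(\<Sum>m\<in>{1..N}. 1 / (real m)\<^sup>2) \<le> 2" using sum_inverse_squares_le[OF N] by linarith
    show "(\<Sum>m\<in>{1..N}. 1 / real m) \<le> 1 + ln (real N)" by (rule harmonic_le[OF N])
  qed (use S K in auto)
  finally show ?thesis by (simp add: algebra_simps add_divide_distrib)
qed

lemma one_le_ln: "x \<ge> 256 \<Longrightarrow> ln x \<ge> (1::real)"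
proof -
  assume x: "x \<ge> 256"
  have "exp 1 \<le> x" using x exp_le by linarith
  then show ?thesis using x by (simp add: ln_ge_iff)
qed

lemma ln_power_le_self:
  fixes x :: real
  assumes "x \<ge> 256"
  shows "ln x ^ j \<le> (2 * real (j + 1)) ^ (j + 1) * x"
proof -
  have "ln x ^ j \<le> ln x ^ (j + 1)" using one_le_ln[OF assms] by (intro power_increasing) auto
  also have "\<dots> \<le> (2 * real (j + 1)) ^ (j + 1) * sqrt x" using assms by (intro ln_power_le_sqrt) auto
  also have "\<dots> \<le> (2 * real (j + 1)) ^ (j + 1) * x"
    using assms by (intro mult_left_mono) (auto simp: real_le_lsqrt power2_eq_square)
  finally show ?thesis .
qed

lemma theta_nonneg: "theta J q a \<ge> 0"
  unfolding theta_def by (intro sum_nonneg) (auto dest: prime_gt_0_nat)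

section \<open>The main term of the exponential sums\<close>

lemma siegel_walfisz_blocks:
  obtains C where "C > 0" "\<And>q a x u H. q > 0 \<Longrightarrow> a \<in> {1..q} \<Longrightarrow> x \<ge> 256 \<Longrightarrow> real (u + H) \<le> x \<Longrightarrow>
    \<bar>theta {u<..u + H} q a - (if coprime a q then real H / real (totient q) else 0)\<bar> \<le> C * real q * (x / ln x ^ B)"
proof -
  obtain C where C: "C > 0" "\<And>q a N x. q > 0 \<Longrightarrow> coprime a q \<Longrightarrow> x \<ge> 256 \<Longrightarrow> real N \<le> x \<Longrightarrow>
    \<bar>theta {1..N} q a - real N / real (totient q)\<bar> \<le> C * real q * x / ln x ^ B"
    by (rule siegel_walfisz_uniform) blast
  define K where "K = (2 * real (B + 1)) ^ (B + 1)"
  have K: "K > 0" by (simp add: K_def)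
  show ?thesis
  proof (rule that[of "2 * C + K"])
    fix q a u H :: nat and x :: real
    assume q: "q > 0" and a: "a \<in> {1..q}" and x: "x \<ge> 256" and uH: "real (u + H) \<le> x"
    define X where "X = x / ln x ^ B"
    have l: "ln x \<ge> 1" by (rule one_le_ln[OF x])
    have X: "X > 0" using x l by (simp add: X_def)
    have KX: "1 \<le> K * X" using ln_power_le_self[OF x, of B] l by (simp add: X_def K_def le_divide_eq)
    show "\<bar>theta {u<..u + H} q a - (if coprime a q then real H / real (totient q) else 0)\<bar> \<le> (2 * C + K) * real q * (x / ln x ^ B)"
    proof (cases "coprime a q")
      case True
      have 1: "\<bar>theta {1..u} q a - real u / real (totient q)\<bar> \<le> C * real q * X"
        using C(2)[OF q True x, of u] uH by (simp add: X_def)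
      have 2: "\<bar>theta {1..u + H} q a - real (u + H) / real (totient q)\<bar> \<le> C * real q * X"
        using C(2)[OF q True x, of "u + H"] uH by (simp add: X_def)
      have "theta {u<..u + H} q a - real H / real (totient q) =
        (theta {1..u + H} q a - real (u + H) / real (totient q)) - (theta {1..u} q a - real u / real (totient q))"
        by (simp add: theta_block add_divide_distrib)
      then have "\<bar>theta {u<..u + H} q a - real H / real (totient q)\<bar> \<le> 2 * (C * real q * X)" using 1 2 by linarith
      also have "\<dots> \<le> (2 * C + K) * real q * X" using K X by (simp add: algebra_simps)
      finally show ?thesis using True by (simp add: X_def)
    next
      case False
      have "theta {u<..u + H} q a \<le> (if a \<in> prime_factors q then ln (real a) else 0)" by (rule theta_noncoprime[OF a False])
      also have "\<dots> \<le> ln (real q)" using a q by auto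
      also have "\<dots> \<le> real q * 1" using q ln_le_minus_one[of "real q"] by simp
      also have "\<dots> \<le> real q * (K * X)" using KX by (intro mult_left_mono) auto
      also have "\<dots> \<le> (2 * C + K) * real q * X" using C(1) X by (simp add: algebra_simps)
      finally show ?thesis using False theta_nonneg by (simp add: X_def)
    qed
  qed (use C K in auto)
qed

text \<open>The Ramanujan sum divided by the totient: the expected exponential sum over primes at
  \<open>b / q\<close>, per integer of the block.\<close>

definition singular_coeff :: "nat \<Rightarrow> nat \<Rightarrow> complex" where
  "singular_coeff q b = expsum {1..q} (\<lambda>a. complex_of_real (if coprime a q then 1 / real (totient q) else 0)) (real b / real q)"

lemma norm_singular_coeff_le:
  assumes "q > 0"
  shows "norm (singular_coeff q b) \<le> 1"
proof -
  have "norm (singular_coeff q b) \<le> (\<Sum>a\<in>{1..q}. if coprime a q then 1 / real (totient q) else 0)"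
    unfolding singular_coeff_def expsum_def by (rule sum_norm_le) (auto simp: norm_mult norm_divide)
  also have "\<dots> = (\<Sum>a\<in>reduced q. 1 / real (totient q))" by (rule sum.inter_filter[symmetric]) simp
  also have "\<dots> = 1" using assms card_reduced[of q] by simp
  finally show ?thesis .
qed

text \<open>One factor of the modulus is the Siegel--Walfisz error in a class, the other the number
  of classes.\<close>

lemma expsum_primes_approx:
  obtains C where "C > 0" "\<And>d b x u H. d > 0 \<Longrightarrow> x \<ge> 256 \<Longrightarrow> real (u + H) \<le> x \<Longrightarrow>
    norm (expsum {u<..u + H} prime_weight (real b / real d) - of_nat H * singular_coeff d b) \<le> C * (real d)\<^sup>2 * (x / ln x ^ B)"
proof -
  obtain C where C: "C > 0" "\<And>q a x u H. q > 0 \<Longrightarrow> a \<in> {1..q} \<Longrightarrow> x \<ge> 256 \<Longrightarrow> real (u + H) \<le> x \<Longrightarrow>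
    \<bar>theta {u<..u + H} q a - (if coprime a q then real H / real (totient q) else 0)\<bar> \<le> C * real q * (x / ln x ^ B)"
    by (rule siegel_walfisz_blocks) blast
  show ?thesis
  proof (rule that[OF C(1)])
    fix d b u H :: nat and x :: real
    assume d: "d > 0" and x: "x \<ge> 256" and uH: "real (u + H) \<le> x"
    define J where "J = {u<..u + H}"
    define r where "r = (\<lambda>a. theta J d a - (if coprime a d then real H / real (totient d) else 0))"
    have "expsum J prime_weight (real b / real d) - of_nat H * singular_coeff d b =
      (\<Sum>a\<in>{1..d}. complex_of_real (r a) * cis (2 * pi * real a * (real b / real d)))"
    proof -
      have "expsum J prime_weight (real b / real d) = expsum {1..d} (\<lambda>a. complex_of_real (theta J d a)) (real b / real d)"
        by (rule expsum_primes_residues[OF d]) (simp add: J_def)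
      then show ?thesis unfolding singular_coeff_def expsum_def sum_distrib_left
        by (simp only: sum_subtractf[symmetric]) (intro sum.cong refl, simp add: r_def algebra_simps)
    qed
    also have "norm \<dots> \<le> (\<Sum>a\<in>{1..d}. C * real d * (x / ln x ^ B))"
    proof (rule sum_norm_le)
      fix a assume "a \<in> {1..d}"
      then show "norm (complex_of_real (r a) * cis (2 * pi * real a * (real b / real d))) \<le> C * real d * (x / ln x ^ B)"
        using C(2)[OF d _ x uH] unfolding norm_mult norm_of_real norm_cis r_def J_def mult_1_right by blast
    qed
    also have "\<dots> = C * (real d)\<^sup>2 * (x / ln x ^ B)" by (simp add: power2_eq_square)
    finally show "norm (expsum {u<..u + H} prime_weight (real b / real d) - of_nat H * singular_coeff d b) \<le> C * (real d)\<^sup>2 * (x / ln x ^ B)"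
      by (simp add: J_def)
  qed
qed

text \<open>Both sides equal \<open>\<mu>(d) / \<phi>(d)\<close> in lowest terms, but no evaluation is needed: each is the mean
  value of \<open>e(p b / d) ln p\<close> over the primes.\<close>

lemma singular_coeff_cancel:
  assumes "k > 0" "d > 0"
  shows "singular_coeff (k * d) (k * b) = singular_coeff d b"
proof (rule ccontr)
  assume ne: "singular_coeff (k * d) (k * b) \<noteq> singular_coeff d b"
  define \<delta> where "\<delta> = norm (singular_coeff (k * d) (k * b) - singular_coeff d b)"
  have \<delta>: "\<delta> > 0" using ne by (simp add: \<delta>_def)
  obtain C where C: "C > 0" "\<And>d b x u H. d > 0 \<Longrightarrow> x \<ge> 256 \<Longrightarrow> real (u + H) \<le> x \<Longrightarrow>
    norm (expsum {u<..u + H} prime_weight (real b / real d) - of_nat H * singular_coeff d b) \<le> C * (real d)\<^sup>2 * (x / ln x ^ 1)"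
    by (rule expsum_primes_approx) blast
  define M where "M = C * (real d)\<^sup>2 + C * (real (k * d))\<^sup>2"
  define N where "N = nat \<lceil>max 256 (exp (M / \<delta> + 1))\<rceil>"
  have N: "real N \<ge> 256" "real N \<ge> exp (M / \<delta> + 1)" unfolding N_def by linarith+
  have l: "ln (real N) \<ge> M / \<delta> + 1" using N by (simp add: ln_ge_iff)
  have M: "M \<ge> 0" using C(1) by (simp add: M_def)
  have l0: "ln (real N) > 0" using l M \<delta> by (smt (verit) divide_nonneg_pos)
  have fr: "real (k * b) / real (k * d) = real b / real d" using assms by simp
  define F where "F = expsum {0<..0 + N} prime_weight (real b / real d)"
  have 1: "norm (F - of_nat N * singular_coeff d b) \<le> C * (real d)\<^sup>2 * (real N / ln (real N))"
    using C(2)[of d "real N" 0 N b] assms N by (simp add: F_def)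
  have 2: "norm (F - of_nat N * singular_coeff (k * d) (k * b)) \<le> C * (real (k * d))\<^sup>2 * (real N / ln (real N))"
    using C(2)[of "k * d" "real N" 0 N "k * b"] assms N unfolding fr F_def by simp
  have "real N * \<delta> = norm (of_nat N * (singular_coeff (k * d) (k * b) - singular_coeff d b))"
    by (simp add: \<delta>_def norm_mult)
  also have "\<dots> = norm ((F - of_nat N * singular_coeff d b) - (F - of_nat N * singular_coeff (k * d) (k * b)))"
    by (rule arg_cong[of _ _ norm]) (simp add: algebra_simps)
  also have "\<dots> \<le> C * (real d)\<^sup>2 * (real N / ln (real N)) + C * (real (k * d))\<^sup>2 * (real N / ln (real N))"
    using norm_triangle_ineq4[of "F - of_nat N * singular_coeff d b" "F - of_nat N * singular_coeff (k * d) (k * b)"] 1 2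
    by linarith
  also have "\<dots> = real N * (M / ln (real N))" by (simp add: M_def add_divide_distrib algebra_simps)
  finally have "real N * \<delta> \<le> real N * (M / ln (real N))" .
  then have "\<delta> \<le> M / ln (real N)" using N(1) by (subst (asm) mult_le_cancel_left_pos) auto
  then have "\<delta> * ln (real N) \<le> M" using l0 by (simp add: le_divide_eq)
  moreover have "\<delta> * (M / \<delta> + 1) \<le> \<delta> * ln (real N)" using l \<delta> by (intro mult_left_mono) auto
  moreover have "\<delta> * (M / \<delta> + 1) = M + \<delta>" using \<delta> by (simp add: field_simps)
  ultimately show False using \<delta> by linarith
qed

text \<open>Parseval for the uniform distribution on the reduced classes, regrouped by lowest terms.
  Multiplied by \<open>H^2 / q\<close> it is exactly \<open>H^2\<close> over the totient, so the
  main term of the variance cancels without error.\<close>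

lemma singular_energy:
  assumes "q > 0"
  shows "(\<Sum>d\<in>{d. d dvd q}. \<Sum>b\<in>reduced d. (norm (singular_coeff d b))\<^sup>2) = real q / real (totient q)"
proof -
  have "(\<Sum>d\<in>{d. d dvd q}. \<Sum>b\<in>reduced d. (norm (singular_coeff d b))\<^sup>2) = (\<Sum>b\<in>{1..q}. (norm (singular_coeff q b))\<^sup>2)"
    by (rule farey_sum[symmetric]) (use assms singular_coeff_cancel in auto)
  also have "\<dots> = real q * (\<Sum>a\<in>{1..q}. (norm (complex_of_real (if coprime a q then 1 / real (totient q) else 0)))\<^sup>2)"
    unfolding singular_coeff_def by (rule parseval_residues[OF assms])
  also have "(\<Sum>a\<in>{1..q}. (norm (complex_of_real (if coprime a q then 1 / real (totient q) else 0)))\<^sup>2) =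
    (\<Sum>a\<in>{1..q}. if coprime a q then (1 / real (totient q))\<^sup>2 else 0)"
    by (intro sum.cong refl) (simp add: norm_divide)
  also have "\<dots> = (\<Sum>a\<in>reduced q. (1 / real (totient q))\<^sup>2)" by (rule sum.inter_filter[symmetric]) simp
  also have "\<dots> = 1 / real (totient q)" using assms card_reduced[of q] by (simp add: power2_eq_square)
  finally show ?thesis by simp
qed

section \<open>The variance over reduced residue classes\<close>

definition farey_energy :: "nat set \<Rightarrow> nat \<Rightarrow> real" where
  "farey_energy J d = (\<Sum>b\<in>reduced d. (norm (expsum J prime_weight (real b / real d)))\<^sup>2)"

lemma farey_energy_nonneg: "farey_energy J d \<ge> 0"
  unfolding farey_energy_def by (intro sum_nonneg) simp

text \<open>After expanding the square, the quadratic part is enlarged to all classes, which only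
  adds nonnegative terms and makes Parseval applicable; the linear part stays on the reduced
  classes.\<close>

lemma residue_variance_le:
  assumes q: "q > 0" and J: "finite J"
  shows "(\<Sum>a\<in>reduced q. (theta J q a - h / real (totient q))\<^sup>2) \<le>
    (\<Sum>d\<in>{d. d dvd q}. farey_energy J d) / real q - 2 * h * (\<Sum>a\<in>reduced q. theta J q a) / real (totient q) + h\<^sup>2 / real (totient q)"
proof -
  have t: "real (totient q) > 0" using q by simp
  have "(\<Sum>a\<in>reduced q. (theta J q a - h / real (totient q))\<^sup>2) =
    (\<Sum>a\<in>reduced q. (theta J q a)\<^sup>2 - 2 * h / real (totient q) * theta J q a + (h / real (totient q))\<^sup>2)"
    by (intro sum.cong refl) (simp add: power2_diff)
  also have "\<dots> = (\<Sum>a\<in>reduced q. (theta J q a)\<^sup>2) - 2 * h / real (totient q) * (\<Sum>a\<in>reduced q. theta J q a)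
      + real (totient q) * (h / real (totient q))\<^sup>2"
    by (simp only: sum.distrib sum_subtractf sum_distrib_left sum_constant card_reduced)
  also have "real (totient q) * (h / real (totient q))\<^sup>2 = h\<^sup>2 / real (totient q)"
    using t by (simp add: power2_eq_square)
  also have "(\<Sum>a\<in>reduced q. (theta J q a)\<^sup>2) \<le> (\<Sum>d\<in>{d. d dvd q}. farey_energy J d) / real q"
  proof -
    have "real q * (\<Sum>a\<in>reduced q. (theta J q a)\<^sup>2) \<le> real q * (\<Sum>a\<in>{1..q}. (norm (complex_of_real (theta J q a)))\<^sup>2)"
      by (intro mult_left_mono) (auto intro!: sum_mono2)
    also have "\<dots> = (\<Sum>b\<in>{1..q}. (norm (expsum J prime_weight (real b / real q)))\<^sup>2)"
      unfolding expsum_primes_residues[OF q J] by (rule parseval_residues[OF q, symmetric])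
    also have "\<dots> = (\<Sum>d\<in>{d. d dvd q}. farey_energy J d)"
      unfolding farey_energy_def by (rule farey_sum[OF q]) simp
    finally show ?thesis using q by (simp add: le_divide_eq mult.commute)
  qed
  finally show ?thesis by simp
qed

text \<open>\<open>totient_lower\<close> costs one logarithm more than the true order; in both uses
  the length of the block or the Siegel--Walfisz saving absorbs it.\<close>

lemma sum_inverse_totient_le:
  assumes N: "N \<ge> 1" "real N \<le> x" and l: "ln x \<ge> 1"
  shows "(\<Sum>q\<in>{1..N}. 1 / real (totient q)) \<le> 6 * (ln x)\<^sup>2" "(\<Sum>q\<in>{1..N}. 1 / real q) \<le> 2 * ln x"
proof -
  have lN: "ln (real N) \<le> ln x" using N by (intro ln_mono) auto
  show h: "(\<Sum>q\<in>{1..N}. 1 / real q) \<le> 2 * ln x" using harmonic_le[OF N(1)] lN l by linarith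
  have "(\<Sum>q\<in>{1..N}. 1 / real (totient q)) \<le> (\<Sum>q\<in>{1..N}. 3 * ln x * (1 / real q))"
  proof (rule sum_mono)
    fix q assume q: "q \<in> {1..N}"
    then have q0: "real q > 0" "real (totient q) > 0" by auto
    have "ln (real q) \<le> ln x" using q N by (intro ln_mono) auto
    then have "log 2 (real q) \<le> ln x / ln 2" by (simp add: log_def divide_right_mono)
    also have "\<dots> \<le> 2 * ln x"
    proof -
      have "ln x * 1 \<le> ln x * (2 * ln 2)" using l ln2_ge_two_thirds by (intro mult_left_mono) auto
      then show ?thesis by (simp add: divide_le_eq mult_ac)
    qed
    finally have "1 + log 2 (real q) \<le> 3 * ln x" using l by linarith
    then have "real (totient q) * (1 + log 2 (real q)) \<le> real (totient q) * (3 * ln x)" by (intro mult_left_mono) auto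
    moreover have "real q \<le> real (totient q) * (1 + log 2 (real q))" using totient_lower[of q] q by simp
    ultimately have "real q \<le> real (totient q) * (3 * ln x)" by (rule order_trans[rotated])
    then show "1 / real (totient q) \<le> 3 * ln x * (1 / real q)" using q0 by (simp add: field_simps)
  qed
  also have "\<dots> = 3 * ln x * (\<Sum>q\<in>{1..N}. 1 / real q)" by (simp only: sum_distrib_left)
  also have "\<dots> \<le> 3 * ln x * (2 * ln x)" using h l by (intro mult_left_mono) auto
  finally show "(\<Sum>q\<in>{1..N}. 1 / real (totient q)) \<le> 6 * (ln x)\<^sup>2" by (simp add: power2_eq_square)
qed

lemma farey_energy_weighted_le:
  assumes "H \<ge> 1" "R \<ge> 1" "N \<ge> 1"
  shows "(\<Sum>q\<in>{1..N}. (\<Sum>d\<in>{d. d dvd q \<and> R \<le> d}. farey_energy {u<..u + H} d) / real q) \<le>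
    (4 * real N + 50 * real H / real R * (1 + ln (real N))) * (\<Sum>n\<in>{u<..u + H}. (norm (prime_weight n))\<^sup>2)"
proof (rule divisor_weighted_le)
  fix Y :: nat assume "Y \<ge> 1"
  then show "(\<Sum>d\<in>{1..Y}. farey_energy {u<..u + H} d) \<le> ((real Y)\<^sup>2 + 50 * real H) * (\<Sum>n\<in>{u<..u + H}. (norm (prime_weight n))\<^sup>2)"
    unfolding farey_energy_def using assms by (intro large_sieve_farey) auto
qed (use assms farey_energy_nonneg in \<open>auto intro!: sum_nonneg\<close>)

text \<open>The cross term has a favourable sign, as theta is nonnegative, and is dropped, while
  \<open>H^2\<close> over the totient is kept. The condition \<open>H * ln x \<le> Q\<close> reduces
  both the large sieve and this square to the desired size.\<close>

lemma short_block_variance: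
  fixes x Q :: real
  assumes Q: "1 \<le> Q" "Q \<le> x" and l: "ln x \<ge> 1" and H: "H \<ge> 1" "real H * ln x \<le> Q"
  shows "(\<Sum>q\<in>{1..nat \<lfloor>Q\<rfloor>}. \<Sum>a\<in>reduced q. (theta {u<..u + H} q a - real H / real (totient q))\<^sup>2) \<le>
    104 * Q * (\<Sum>n\<in>{u<..u + H}. (norm (prime_weight n))\<^sup>2) + 6 * real H * Q * ln x"
proof -
  define J where "J = {u<..u + H}"
  define S where "S = (\<Sum>n\<in>J. (norm (prime_weight n))\<^sup>2)"
  define N where "N = nat \<lfloor>Q\<rfloor>"
  have N: "N \<ge> 1" "real N \<le> Q" "real N \<le> x" using Q unfolding N_def by linarith+
  have S: "S \<ge> 0" unfolding S_def by (intro sum_nonneg) simp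
  have lN: "ln (real N) \<le> ln x" using N by (intro ln_mono) auto
  have "(\<Sum>q\<in>{1..N}. \<Sum>a\<in>reduced q. (theta J q a - real H / real (totient q))\<^sup>2) \<le>
    (\<Sum>q\<in>{1..N}. (\<Sum>d\<in>{d. d dvd q \<and> 1 \<le> d}. farey_energy J d) / real q + (real H)\<^sup>2 * (1 / real (totient q)))"
  proof (rule sum_mono)
    fix q assume q: "q \<in> {1..N}"
    have "{d. d dvd q \<and> 1 \<le> d} = {d. d dvd q}" using q by (auto simp: Suc_le_eq intro: Nat.gr0I)
    moreover have "0 \<le> 2 * real H * (\<Sum>a\<in>reduced q. theta J q a) / real (totient q)"
      by (intro divide_nonneg_nonneg mult_nonneg_nonneg sum_nonneg theta_nonneg) auto
    ultimately show "(\<Sum>a\<in>reduced q. (theta J q a - real H / real (totient q))\<^sup>2) \<le>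
      (\<Sum>d\<in>{d. d dvd q \<and> 1 \<le> d}. farey_energy J d) / real q + (real H)\<^sup>2 * (1 / real (totient q))"
      using residue_variance_le[of q J "real H"] q by (simp add: J_def)
  qed
  also have "\<dots> = (\<Sum>q\<in>{1..N}. (\<Sum>d\<in>{d. d dvd q \<and> 1 \<le> d}. farey_energy J d) / real q) + (real H)\<^sup>2 * (\<Sum>q\<in>{1..N}. 1 / real (totient q))"
    by (simp only: sum.distrib sum_distrib_left)
  also have "\<dots> \<le> (4 * real N + 50 * real H / real 1 * (1 + ln (real N))) * S + (real H)\<^sup>2 * (6 * (ln x)\<^sup>2)"
    unfolding S_def J_def using H N l by (intro add_mono mult_left_mono farey_energy_weighted_le sum_inverse_totient_le) auto
  also have "\<dots> \<le> 104 * Q * S + 6 * real H * Q * ln x"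
  proof (intro add_mono mult_right_mono S)
    have "50 * real H * (1 + ln (real N)) \<le> 50 * real H * (2 * ln x)" using lN l by (intro mult_left_mono) auto
    then have "50 * real H / real 1 * (1 + ln (real N)) \<le> 100 * (real H * ln x)" by (simp only: of_nat_1 div_by_1 mult_ac)
    then show "4 * real N + 50 * real H / real 1 * (1 + ln (real N)) \<le> 104 * Q" using N H by linarith
    have "(6 * real H * ln x) * (real H * ln x) \<le> (6 * real H * ln x) * Q" using H l by (intro mult_left_mono) auto
    then show "(real H)\<^sup>2 * (6 * (ln x)\<^sup>2) \<le> 6 * real H * Q * ln x" by (simp add: power2_eq_square mult_ac)
  qed
  finally show ?thesis by (simp add: J_def S_def N_def)
qed

text \<open>Now \<open>H^2\<close> over the totient is too large to keep. It is spread over the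
  divisors of \<open>q\<close> by \<open>singular_energy\<close> and subtracted from the Farey
  energies of the denominators below \<open>R\<close>, where the exponential sums are known; the
  large sieve bounds the denominators from \<open>R\<close> on, with a gain of
  \<open>1 / R\<close>.\<close>

lemma long_block_variance:
  obtains C where "C > 0" "\<And>x Q u H. x \<ge> 256 \<Longrightarrow> 1 \<le> Q \<Longrightarrow> Q \<le> x \<Longrightarrow> x \<le> Q * ln x ^ r \<Longrightarrow> H \<ge> 1 \<Longrightarrow>
    x \<le> real H * ln x ^ Suc r \<Longrightarrow> real (u + H) \<le> x \<Longrightarrow>
    (\<Sum>q\<in>{1..nat \<lfloor>Q\<rfloor>}. \<Sum>a\<in>reduced q. (theta {u<..u + H} q a - real H / real (totient q))\<^sup>2) \<le>
    104 * Q * (\<Sum>n\<in>{u<..u + H}. (norm (prime_weight n))\<^sup>2) + C * real H * Q"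
proof -
  define p where "p = Suc r"
  \<comment> \<open>The small denominators contribute about
    \<open>lx ^ (4 * p + 1) * x^2 / lx ^ B\<close>, while
    \<open>x^2 \<le> H * Q * lx ^ (p + r)\<close>. With \<open>p = r + 1\<close> the exponents add
    up to exactly \<open>6 * p\<close>.\<close>
  define B where "B = 6 * p"
  obtain C0 where C0: "C0 > 0" "\<And>q a x u H. q > 0 \<Longrightarrow> a \<in> {1..q} \<Longrightarrow> x \<ge> 256 \<Longrightarrow> real (u + H) \<le> x \<Longrightarrow>
    \<bar>theta {u<..u + H} q a - (if coprime a q then real H / real (totient q) else 0)\<bar> \<le> C0 * real q * (x / ln x ^ B)"
    by (rule siegel_walfisz_blocks) blast
  obtain C1 where C1: "C1 > 0" "\<And>d b x u H. d > 0 \<Longrightarrow> x \<ge> 256 \<Longrightarrow> real (u + H) \<le> x \<Longrightarrow>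
    norm (expsum {u<..u + H} prime_weight (real b / real d) - of_nat H * singular_coeff d b) \<le> C1 * (real d)\<^sup>2 * (x / ln x ^ B)"
    by (rule expsum_primes_approx) blast
  define K where "K = (2 * real (Suc B + 1)) ^ (Suc B + 1)"
  have K: "K > 0" by (simp add: K_def)
  define C2 where "C2 = 32 * C1 * (2 + 4 * C1)"
  have C2: "C2 > 0" using C1(1) by (simp add: C2_def)
  show ?thesis
  proof (rule that[of "12 * (C0 + K) + C2"])
    fix x Q :: real and u H :: nat
    assume x: "x \<ge> 256" and Q: "1 \<le> Q" "Q \<le> x" and xQ: "x \<le> Q * ln x ^ r" and H: "H \<ge> 1"
      and xH: "x \<le> real H * ln x ^ Suc r" and uH: "real (u + H) \<le> x"
    define J where "J = {u<..u + H}"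
    define S where "S = (\<Sum>n\<in>J. (norm (prime_weight n))\<^sup>2)"
    define N where "N = nat \<lfloor>Q\<rfloor>"
    define lx where "lx = ln x"
    define X where "X = x / lx ^ B"
    \<comment> \<open>Large enough for \<open>(H / R) * lx \<le> Q\<close>: one has
      \<open>H \<le> x \<le> Q * lx ^ r\<close>, and \<open>p\<close> is
      \<open>r + 1\<close>.\<close>
    define R where "R = nat \<lceil>lx ^ p\<rceil>"
    define E where "E = C1 * (real R)\<^sup>2 * X"
    have l: "lx \<ge> 1" unfolding lx_def by (rule one_le_ln[OF x])
    have lp: "lx ^ j \<ge> 1" "lx ^ j > 0" for j using l by (auto intro: one_le_power)
    have X: "X > 0" "X * lx ^ B = x" using x l by (auto simp: X_def)
    have R: "real R \<ge> lx ^ p" "real R \<le> 2 * lx ^ p" "R \<ge> 1" using lp(1)[of p] unfolding R_def by linarith+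
    have N: "N \<ge> 1" "real N \<le> Q" "real N \<le> x" using Q unfolding N_def by linarith+
    have S: "S \<ge> 0" unfolding S_def by (intro sum_nonneg) simp
    have E: "E > 0" using C1(1) R(3) X by (simp add: E_def)
    have Hx: "real H \<le> x" using uH by simp
    have lN: "ln (real N) \<le> lx" unfolding lx_def using N by (intro ln_mono) auto
    have lK: "lx \<le> K * X"
    proof -
      have "lx * lx ^ B \<le> K * x" using ln_power_le_self[OF x, of "Suc B"] by (simp add: K_def lx_def)
      then show ?thesis using lp(2)[of B] by (simp add: X_def le_divide_eq)
    qed
    define T where "T = (real R)\<^sup>2 * (E * (2 * x + E))"
    have perq: "(\<Sum>a\<in>reduced q. (theta J q a - real H / real (totient q))\<^sup>2) \<le>
      2 * real H * ((C0 + K) * X) * (1 / real (totient q)) + T * (1 / real q) + (\<Sum>d\<in>{d. d dvd q \<and> R \<le> d}. farey_energy J d) / real q"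
      if q: "q \<in> {1..N}" for q
    proof -
      have q0: "q > 0" "real q > 0" "real (totient q) > 0" using q by auto
      define \<Theta> where "\<Theta> = (\<Sum>a\<in>reduced q. theta J q a)"
      define me where "me = (\<lambda>d. (real H)\<^sup>2 * (\<Sum>b\<in>reduced d. (norm (singular_coeff d b))\<^sup>2))"
      \<comment> \<open>Only a deficit of primes in the reduced classes can hurt, so a one-sided
        bound is enough; it combines Siegel--Walfisz for modulus 1 with the loss \<open>ln q\<close>
        from primes dividing \<open>q\<close>.\<close>
      have \<Theta>: "real H - \<Theta> \<le> (C0 + K) * X"
      proof -
        have "ln (real q) \<le> ln x" using q N by (intro ln_mono) auto
        moreover have "\<bar>theta J 1 1 - real H\<bar> \<le> C0 * X" using C0(2)[of 1 1 x u H] x uH by (simp add: J_def X_def lx_def)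
        moreover have "theta J 1 1 - ln (real q) \<le> \<Theta>" unfolding \<Theta>_def using reduced_theta_ge[OF q0(1), of J] by (simp add: J_def)
        ultimately have "real H - \<Theta> \<le> C0 * X + lx" unfolding lx_def by linarith
        then show ?thesis using lK by (simp add: distrib_right)
      qed
      have small: "farey_energy J d - me d \<le> real R * (E * (2 * x + E))" if d: "d > 0" "d < R" for d
      proof -
        have "farey_energy J d - me d = (\<Sum>b\<in>reduced d. (norm (expsum J prime_weight (real b / real d)))\<^sup>2 - (real H * norm (singular_coeff d b))\<^sup>2)"
          by (simp only: farey_energy_def me_def sum_subtractf power_mult_distrib sum_distrib_left)
        also have "\<dots> \<le> (\<Sum>b\<in>reduced d. E * (2 * x + E))"
        proof (rule sum_mono)
          fix b
          define F where "F = expsum J prime_weight (real b / real d)"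
          define m where "m = real H * norm (singular_coeff d b)"
          have m: "0 \<le> m" "m \<le> x"
          proof -
            have "m \<le> real H * 1" unfolding m_def using norm_singular_coeff_le[OF d(1)] by (intro mult_left_mono) auto
            then show "m \<le> x" using Hx by linarith
          qed (simp add: m_def)
          have "norm F - m \<le> norm (F - of_nat H * singular_coeff d b)"
            using norm_triangle_ineq2[of F "of_nat H * singular_coeff d b"] by (simp add: m_def norm_mult)
          also have "\<dots> \<le> C1 * (real d)\<^sup>2 * X" using C1(2)[OF d(1) x uH, of b] by (simp add: F_def J_def X_def lx_def)
          also have "\<dots> \<le> E" unfolding E_def using C1(1) X d by (intro mult_right_mono mult_left_mono power_mono) auto
          finally have "norm F \<le> m + E" by simp
          then have "(norm F)\<^sup>2 \<le> (m + E)\<^sup>2" by (intro power_mono) auto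
          also have "\<dots> = m\<^sup>2 + E * (2 * m + E)" by (simp add: power2_eq_square algebra_simps)
          also have "E * (2 * m + E) \<le> E * (2 * x + E)" using E m by (intro mult_left_mono) auto
          finally show "(norm (expsum J prime_weight (real b / real d)))\<^sup>2 - (real H * norm (singular_coeff d b))\<^sup>2 \<le> E * (2 * x + E)"
            by (simp add: F_def m_def)
        qed
        also have "\<dots> = real (card (reduced d)) * (E * (2 * x + E))" by (simp only: sum_constant)
        also have "\<dots> \<le> real R * (E * (2 * x + E))"
        proof (rule mult_right_mono)
          have "card (reduced d) \<le> card {1..d}" by (intro card_mono) auto
          then show "real (card (reduced d)) \<le> real R" using d by simp
        qed (use E x in auto)
        finally show ?thesis .
      qed
      have fin: "finite {d. d dvd q}" using q0 by simp
      \<comment> \<open>The total of \<open>me d\<close> over all divisors is the main term. Below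
        \<open>R\<close> it is compared with the actual energy; from \<open>R\<close> on,
        \<open>me d\<close> is nonnegative and is discarded.\<close>
      have "(\<Sum>d\<in>{d. d dvd q}. farey_energy J d) - (real H)\<^sup>2 * (real q / real (totient q)) = (\<Sum>d\<in>{d. d dvd q}. farey_energy J d - me d)"
        unfolding singular_energy[OF q0(1), symmetric] me_def by (simp only: sum_subtractf sum_distrib_left)
      also have "\<dots> = (\<Sum>d\<in>{d. d dvd q \<and> d < R}. farey_energy J d - me d) + (\<Sum>d\<in>{d. d dvd q \<and> R \<le> d}. farey_energy J d - me d)"
      proof -
        have un: "{d. d dvd q} = {d. d dvd q \<and> d < R} \<union> {d. d dvd q \<and> R \<le> d}" by auto
        have f: "finite {d. d dvd q \<and> d < R}" "finite {d. d dvd q \<and> R \<le> d}" using fin by (auto intro: finite_subset)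
        show ?thesis unfolding un by (rule sum.union_disjoint) (use f in auto)
      qed
      also have "\<dots> \<le> T + (\<Sum>d\<in>{d. d dvd q \<and> R \<le> d}. farey_energy J d)"
      proof (rule add_mono)
        have "(\<Sum>d\<in>{d. d dvd q \<and> d < R}. farey_energy J d - me d) \<le> (\<Sum>d\<in>{d. d dvd q \<and> d < R}. real R * (E * (2 * x + E)))"
          using q0(1) by (intro sum_mono small) (auto intro!: Nat.gr0I)
        also have "\<dots> = real (card {d. d dvd q \<and> d < R}) * (real R * (E * (2 * x + E)))" by (simp only: sum_constant)
        also have "\<dots> \<le> real R * (real R * (E * (2 * x + E)))"
        proof (rule mult_right_mono)
          have "card {d. d dvd q \<and> d < R} \<le> card {..<R}" by (intro card_mono) auto
          then show "real (card {d. d dvd q \<and> d < R}) \<le> real R" by simp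
        qed (use E x in auto)
        also have "\<dots> = T" by (simp add: T_def power2_eq_square mult_ac)
        finally show "(\<Sum>d\<in>{d. d dvd q \<and> d < R}. farey_energy J d - me d) \<le> T" .
        show "(\<Sum>d\<in>{d. d dvd q \<and> R \<le> d}. farey_energy J d - me d) \<le> (\<Sum>d\<in>{d. d dvd q \<and> R \<le> d}. farey_energy J d)"
          by (intro sum_mono) (simp add: me_def sum_nonneg)
      qed
      finally have "((\<Sum>d\<in>{d. d dvd q}. farey_energy J d) - (real H)\<^sup>2 * (real q / real (totient q))) / real q \<le>
        (T + (\<Sum>d\<in>{d. d dvd q \<and> R \<le> d}. farey_energy J d)) / real q"
        using q0 by (intro divide_right_mono) auto
      then have main: "(\<Sum>d\<in>{d. d dvd q}. farey_energy J d) / real q - (real H)\<^sup>2 / real (totient q) \<le>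
        T * (1 / real q) + (\<Sum>d\<in>{d. d dvd q \<and> R \<le> d}. farey_energy J d) / real q"
        using q0 by (simp add: diff_divide_distrib add_divide_distrib)
      have "(\<Sum>a\<in>reduced q. (theta J q a - real H / real (totient q))\<^sup>2) \<le>
        (\<Sum>d\<in>{d. d dvd q}. farey_energy J d) / real q - 2 * real H * \<Theta> / real (totient q) + (real H)\<^sup>2 / real (totient q)"
        unfolding \<Theta>_def by (rule residue_variance_le[OF q0(1)]) (simp add: J_def)
      \<comment> \<open>Completing to \<open>H - \<Theta>\<close> separates the deficit in the
        linear part from the excess of the energy over its expected value.\<close>
      also have "\<dots> = 2 * real H * (real H - \<Theta>) * (1 / real (totient q)) + ((\<Sum>d\<in>{d. d dvd q}. farey_energy J d) / real q - (real H)\<^sup>2 / real (totient q))"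
        using q0 by (simp add: field_simps power2_eq_square)
      also have "\<dots> \<le> 2 * real H * ((C0 + K) * X) * (1 / real (totient q)) + (T * (1 / real q) + (\<Sum>d\<in>{d. d dvd q \<and> R \<le> d}. farey_energy J d) / real q)"
        using \<Theta> main by (intro add_mono mult_right_mono mult_left_mono) auto
      finally show ?thesis by simp
    qed
    have "(\<Sum>q\<in>{1..N}. \<Sum>a\<in>reduced q. (theta J q a - real H / real (totient q))\<^sup>2) \<le>
      (\<Sum>q\<in>{1..N}. 2 * real H * ((C0 + K) * X) * (1 / real (totient q)) + T * (1 / real q) + (\<Sum>d\<in>{d. d dvd q \<and> R \<le> d}. farey_energy J d) / real q)"
      by (rule sum_mono[OF perq])
    also have "\<dots> = 2 * real H * ((C0 + K) * X) * (\<Sum>q\<in>{1..N}. 1 / real (totient q)) + T * (\<Sum>q\<in>{1..N}. 1 / real q) +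
      (\<Sum>q\<in>{1..N}. (\<Sum>d\<in>{d. d dvd q \<and> R \<le> d}. farey_energy J d) / real q)"
      by (simp only: sum.distrib sum_distrib_left)
    also have "\<dots> \<le> 2 * real H * ((C0 + K) * X) * (6 * lx\<^sup>2) + T * (2 * lx) +
      (4 * real N + 50 * real H / real R * (1 + ln (real N))) * S"
    proof (intro add_mono mult_left_mono)
      show "(\<Sum>q\<in>{1..N}. 1 / real (totient q)) \<le> 6 * lx\<^sup>2" "(\<Sum>q\<in>{1..N}. 1 / real q) \<le> 2 * lx"
        unfolding lx_def using N l sum_inverse_totient_le[of N x] by (auto simp: lx_def)
      show "(\<Sum>q\<in>{1..N}. (\<Sum>d\<in>{d. d dvd q \<and> R \<le> d}. farey_energy J d) / real q) \<le> (4 * real N + 50 * real H / real R * (1 + ln (real N))) * S"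
        unfolding J_def S_def by (rule farey_energy_weighted_le[OF H R(3) N(1)])
    qed (use C0 K X E x in \<open>auto simp: T_def\<close>)
    also have "\<dots> \<le> 12 * (C0 + K) * real H * Q + C2 * real H * Q + 104 * Q * S"
    proof (intro add_mono)
      have "X * lx\<^sup>2 * lx ^ r = X * lx ^ (r + 2)" by (simp add: power_add power2_eq_square)
      also have "\<dots> \<le> X * lx ^ B" using X l by (intro mult_left_mono power_increasing) (auto simp: B_def p_def)
      also have "\<dots> \<le> Q * lx ^ r" using X xQ by (simp add: lx_def)
      finally have "X * lx\<^sup>2 \<le> Q" using lp(2)[of r] by (simp add: mult_le_cancel_right_pos)
      then have "12 * (C0 + K) * real H * (X * lx\<^sup>2) \<le> 12 * (C0 + K) * real H * Q" using C0(1) K by (intro mult_left_mono) auto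
      then show "2 * real H * ((C0 + K) * X) * (6 * lx\<^sup>2) \<le> 12 * (C0 + K) * real H * Q" by (simp add: algebra_simps)
    next
      define Y where "Y = lx ^ (2 * p) * X"
      have Y: "Y > 0" "Y * lx ^ (4 * p) = x"
      proof -
        have "Y * lx ^ (4 * p) = X * (lx ^ (2 * p) * lx ^ (4 * p))" by (simp add: Y_def mult_ac)
        also have "lx ^ (2 * p) * lx ^ (4 * p) = lx ^ B" by (simp add: B_def power_add[symmetric])
        finally show "Y * lx ^ (4 * p) = x" using X by simp
        show "Y > 0" using X lp(2) by (simp add: Y_def)
      qed
      have R2: "(real R)\<^sup>2 \<le> 4 * lx ^ (2 * p)"
      proof -
        have "(real R)\<^sup>2 \<le> (2 * lx ^ p)\<^sup>2" using R by (intro power_mono) auto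
        also have "\<dots> = 4 * lx ^ (2 * p)" by (simp add: power_mult_distrib power_mult[symmetric] mult.commute)
        finally show ?thesis .
      qed
      have EY: "E \<le> 4 * C1 * Y"
      proof -
        have "E \<le> C1 * (4 * lx ^ (2 * p)) * X" unfolding E_def using R2 C1(1) X by (intro mult_right_mono mult_left_mono) auto
        then show ?thesis by (simp add: Y_def mult_ac)
      qed
      have "Y * 1 \<le> Y * lx ^ (4 * p)" using Y(1) lp(1) by (intro mult_left_mono) auto
      then have "4 * C1 * Y \<le> 4 * C1 * x" using Y C1(1) by (intro mult_left_mono) auto
      then have E2: "2 * x + E \<le> (2 + 4 * C1) * x" using EY by (simp add: distrib_right)
      have "lx ^ (p + r) * (lx ^ (2 * p + 1) * Y * x) = (lx ^ (p + r) * lx ^ (2 * p + 1)) * Y * x" by (simp only: mult_ac)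
      also have "lx ^ (p + r) * lx ^ (2 * p + 1) = lx ^ (4 * p)" unfolding power_add[symmetric] by (rule arg_cong[of _ _ "power lx"]) (simp add: p_def)
      also have "lx ^ (4 * p) * Y * x = x * x" using Y by (simp add: mult_ac)
      also have "\<dots> \<le> (real H * lx ^ p) * (Q * lx ^ r)" using xH xQ x Q l by (intro mult_mono) (auto simp: p_def lx_def)
      also have "\<dots> = lx ^ (p + r) * (real H * Q)" by (simp add: power_add mult_ac)
      finally have key: "lx ^ (2 * p + 1) * Y * x \<le> real H * Q" using lp(2)[of "p + r"] by (simp only: mult_le_cancel_left_pos)
      have "T * (2 * lx) \<le> (4 * lx ^ (2 * p)) * ((4 * C1 * Y) * ((2 + 4 * C1) * x)) * (2 * lx)"
        unfolding T_def using R2 EY E2 E x l Y C1(1) by (intro mult_right_mono mult_mono) auto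
      also have "\<dots> = C2 * (lx ^ (2 * p + 1) * Y * x)" by (simp add: C2_def mult_ac)
      also have "\<dots> \<le> C2 * (real H * Q)" using key C2 by (intro mult_left_mono) auto
      finally show "T * (2 * lx) \<le> C2 * real H * Q" by (simp add: mult_ac)
    next
      have "real H * lx \<le> Q * lx ^ r * lx" using Hx xQ l by (intro mult_right_mono) (auto simp: lx_def)
      also have "\<dots> = Q * lx ^ p" by (simp add: p_def mult_ac)
      also have "\<dots> \<le> Q * real R" using R Q by (intro mult_left_mono) auto
      finally have HR: "real H / real R * lx \<le> Q" using R(3) by (simp add: divide_le_eq)
      have "50 * (real H / real R) * (1 + ln (real N)) \<le> 50 * (real H / real R) * (2 * lx)"
        using lN l by (intro mult_left_mono) auto
      then have "50 * real H / real R * (1 + ln (real N)) \<le> 100 * (real H / real R * lx)" by simp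
      then have "4 * real N + 50 * real H / real R * (1 + ln (real N)) \<le> 104 * Q" using N HR by linarith
      then show "(4 * real N + 50 * real H / real R * (1 + ln (real N))) * S \<le> 104 * Q * S" using S by (rule mult_right_mono)
    qed
    also have "\<dots> = 104 * Q * S + (12 * (C0 + K) + C2) * real H * Q" by (simp add: algebra_simps)
    finally show "(\<Sum>q\<in>{1..nat \<lfloor>Q\<rfloor>}. \<Sum>a\<in>reduced q. (theta {u<..u + H} q a - real H / real (totient q))\<^sup>2) \<le>
      104 * Q * (\<Sum>n\<in>{u<..u + H}. (norm (prime_weight n))\<^sup>2) + (12 * (C0 + K) + C2) * real H * Q"
      by (simp only: J_def S_def N_def)
  qed (use C0 K C2 in auto)
qed

text \<open>If \<open>H * ln x > Q\<close>, then \<open>x \<le> Q * ln x ^ r\<close> forces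
  \<open>x \<le> H * ln x ^ (r + 1)\<close>, which is the hypothesis of the long case. The short
  case pays one logarithm in its second term.\<close>

lemma block_variance:
  obtains C where "C > 0" "\<And>x Q u H. x \<ge> 256 \<Longrightarrow> 1 \<le> Q \<Longrightarrow> Q \<le> x \<Longrightarrow> x \<le> Q * ln x ^ r \<Longrightarrow> H \<ge> 1 \<Longrightarrow> real (u + H) \<le> x \<Longrightarrow>
    (\<Sum>q\<in>{1..nat \<lfloor>Q\<rfloor>}. \<Sum>a\<in>reduced q. (theta {u<..u + H} q a - real H / real (totient q))\<^sup>2) \<le>
    104 * Q * (\<Sum>n\<in>{u<..u + H}. (norm (prime_weight n))\<^sup>2) + C * (real H * Q * ln x)"
proof -
  obtain C where C: "C > 0" "\<And>x Q u H. x \<ge> 256 \<Longrightarrow> 1 \<le> Q \<Longrightarrow> Q \<le> x \<Longrightarrow> x \<le> Q * ln x ^ r \<Longrightarrow> H \<ge> 1 \<Longrightarrow>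
    x \<le> real H * ln x ^ Suc r \<Longrightarrow> real (u + H) \<le> x \<Longrightarrow>
    (\<Sum>q\<in>{1..nat \<lfloor>Q\<rfloor>}. \<Sum>a\<in>reduced q. (theta {u<..u + H} q a - real H / real (totient q))\<^sup>2) \<le>
    104 * Q * (\<Sum>n\<in>{u<..u + H}. (norm (prime_weight n))\<^sup>2) + C * real H * Q"
    by (rule long_block_variance) blast
  show ?thesis
  proof (rule that[of "C + 6"])
    fix x Q :: real and u H :: nat
    assume x: "x \<ge> 256" and Q: "1 \<le> Q" "Q \<le> x" and xQ: "x \<le> Q * ln x ^ r" and H: "H \<ge> 1" and uH: "real (u + H) \<le> x"
    have l: "ln x \<ge> 1" by (rule one_le_ln[OF x])
    have HQ: "real H * Q \<ge> 0" "real H * Q * ln x \<ge> 0" using Q l by auto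
    show "(\<Sum>q\<in>{1..nat \<lfloor>Q\<rfloor>}. \<Sum>a\<in>reduced q. (theta {u<..u + H} q a - real H / real (totient q))\<^sup>2) \<le>
      104 * Q * (\<Sum>n\<in>{u<..u + H}. (norm (prime_weight n))\<^sup>2) + (C + 6) * (real H * Q * ln x)"
    proof (cases "real H * ln x \<le> Q")
      case True
      have "6 * real H * Q * ln x \<le> (C + 6) * (real H * Q * ln x)" using C(1) HQ by (simp add: algebra_simps)
      then show ?thesis using short_block_variance[OF Q l H True, of u] by linarith
    next
      case False
      have "Q * ln x ^ r \<le> (real H * ln x) * ln x ^ r" using False l by (intro mult_right_mono) auto
      then have xH: "x \<le> real H * ln x ^ Suc r" using xQ by (simp add: mult_ac)
      have "C * (real H * Q) * 1 \<le> (C + 6) * (real H * Q) * ln x" using C(1) HQ Q l by (intro mult_mono) auto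
      then have "C * real H * Q \<le> (C + 6) * (real H * Q * ln x)" by (simp add: mult_ac)
      then show ?thesis using C(2)[OF x Q xQ H xH uH] by linarith
    qed
  qed (use C in auto)
qed

section \<open>Summation over blocks, lengths and partitions\<close>

lemma sum_prime_weight_squares_le:
  obtains C where "C > 0" "\<And>x n. x \<ge> 256 \<Longrightarrow> real n \<le> x \<Longrightarrow> (\<Sum>k\<in>{0<..n}. (norm (prime_weight k))\<^sup>2) \<le> C * (x * ln x)"
proof -
  obtain C where C: "C > 0" "\<And>q a x u H. q > 0 \<Longrightarrow> a \<in> {1..q} \<Longrightarrow> x \<ge> 256 \<Longrightarrow> real (u + H) \<le> x \<Longrightarrow>
    \<bar>theta {u<..u + H} q a - (if coprime a q then real H / real (totient q) else 0)\<bar> \<le> C * real q * (x / ln x ^ 0)"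
    by (rule siegel_walfisz_blocks) blast
  show ?thesis
  proof (rule that[of "C + 1"])
    fix x :: real and n :: nat assume x: "x \<ge> 256" and n: "real n \<le> x"
    have l: "ln x \<ge> 1" by (rule one_le_ln[OF x])
    have "(\<Sum>k\<in>{0<..n}. (norm (prime_weight k))\<^sup>2) \<le> (\<Sum>k\<in>{0<..n}. if prime k then ln x * ln (real k) else 0)"
    proof (rule sum_mono)
      fix k assume k: "k \<in> {0<..n}"
      then have "ln (real k) \<le> ln x" "0 \<le> ln (real k)" using n by auto
      then show "(norm (prime_weight k))\<^sup>2 \<le> (if prime k then ln x * ln (real k) else 0)"
        by (auto simp: prime_weight_def power2_eq_square intro: mult_right_mono)
    qed
    also have "\<dots> = (\<Sum>k\<in>{k\<in>{0<..n}. prime k}. ln x * ln (real k))" by (rule sum.inter_filter[symmetric]) simp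
    also have "\<dots> = ln x * theta {0<..0 + n} 1 1" by (simp add: theta_def sum_distrib_left)
    also have "\<dots> \<le> ln x * ((C + 1) * x)"
    proof (rule mult_left_mono)
      have "\<bar>theta {0<..0 + n} 1 1 - real n\<bar> \<le> C * x" using C(2)[of 1 1 x 0 n] x n by simp
      then show "theta {0<..0 + n} 1 1 \<le> (C + 1) * x" using n by (simp add: distrib_right)
    qed (use l in auto)
    finally show "(\<Sum>k\<in>{0<..n}. (norm (prime_weight k))\<^sup>2) \<le> (C + 1) * (x * ln x)" by (simp add: mult_ac)
  qed (use C in auto)
qed

lemma sum_blocks:
  fixes s :: "nat \<Rightarrow> real"
  shows "(\<Sum>k<M. \<Sum>n\<in>{k * H<..(k + 1) * H}. s n) = (\<Sum>n\<in>{0<..M * H}. s n)"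
proof (induction M)
  case (Suc M)
  have un: "{0<..Suc M * H} = {0<..M * H} \<union> {M * H<..(M + 1) * H}" by auto
  have "(\<Sum>n\<in>{0<..Suc M * H}. s n) = (\<Sum>n\<in>{0<..M * H}. s n) + (\<Sum>n\<in>{M * H<..(M + 1) * H}. s n)"
    unfolding un by (rule sum.union_disjoint) auto
  then show ?case using Suc by simp
qed simp

text \<open>The blocks of one length are disjoint and lie below \<open>x\<close>, so the two terms
  of \<open>block_variance\<close> add up to the squares of \<open>ln p\<close> over the primes up
  to \<open>x\<close> and to a total length of at most \<open>x\<close>.\<close>

lemma level_variance:
  obtains C where "C > 0" "\<And>x Q m. x \<ge> 256 \<Longrightarrow> 1 \<le> Q \<Longrightarrow> Q \<le> x \<Longrightarrow> x \<le> Q * ln x ^ r \<Longrightarrow>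
    (\<Sum>k\<in>{k. (k + 1) * 2 ^ m \<le> nat \<lfloor>x\<rfloor>}. \<Sum>q\<in>{1..nat \<lfloor>Q\<rfloor>}. \<Sum>a\<in>reduced q.
      (theta {k * 2 ^ m<..(k + 1) * 2 ^ m} q a - 2 ^ m / real (totient q))\<^sup>2) \<le> C * (x * Q * ln x)"
proof -
  obtain C where C: "C > 0" "\<And>x Q u H. x \<ge> 256 \<Longrightarrow> 1 \<le> Q \<Longrightarrow> Q \<le> x \<Longrightarrow> x \<le> Q * ln x ^ r \<Longrightarrow> H \<ge> 1 \<Longrightarrow> real (u + H) \<le> x \<Longrightarrow>
    (\<Sum>q\<in>{1..nat \<lfloor>Q\<rfloor>}. \<Sum>a\<in>reduced q. (theta {u<..u + H} q a - real H / real (totient q))\<^sup>2) \<le>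
    104 * Q * (\<Sum>n\<in>{u<..u + H}. (norm (prime_weight n))\<^sup>2) + C * (real H * Q * ln x)"
    by (rule block_variance) blast
  obtain D where D: "D > 0" "\<And>x n. x \<ge> 256 \<Longrightarrow> real n \<le> x \<Longrightarrow> (\<Sum>k\<in>{0<..n}. (norm (prime_weight k))\<^sup>2) \<le> D * (x * ln x)"
    by (rule sum_prime_weight_squares_le) blast
  show ?thesis
  proof (rule that[of "104 * D + C"])
    fix x Q :: real and m :: nat
    assume x: "x \<ge> 256" and Q: "1 \<le> Q" "Q \<le> x" and xQ: "x \<le> Q * ln x ^ r"
    define n where "n = nat \<lfloor>x\<rfloor>"
    define H :: nat where "H = 2 ^ m"
    define M where "M = n div H"
    have H: "H \<ge> 1" by (simp add: H_def)
    have n: "real n \<le> x" using x unfolding n_def by linarith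
    have l: "ln x \<ge> 1" by (rule one_le_ln[OF x])
    have MH: "real (M * H) \<le> x"
    proof -
      have "M * H \<le> n" by (simp add: M_def)
      then have "real (M * H) \<le> real n" by (simp only: of_nat_le_iff)
      then show ?thesis using n by linarith
    qed
    have set: "{k. (k + 1) * H \<le> n} = {..<M}"
    proof -
      have "(k + 1) * H \<le> n \<longleftrightarrow> k < M" for k
        using H less_eq_div_iff_mult_less_eq[of H "k + 1" n] by (auto simp: M_def)
      then show ?thesis by auto
    qed
    have "(\<Sum>k<M. \<Sum>q\<in>{1..nat \<lfloor>Q\<rfloor>}. \<Sum>a\<in>reduced q. (theta {k * H<..(k + 1) * H} q a - real H / real (totient q))\<^sup>2) \<le>
      (\<Sum>k<M. 104 * Q * (\<Sum>n\<in>{k * H<..(k + 1) * H}. (norm (prime_weight n))\<^sup>2) + C * (real H * Q * ln x))"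
    proof (rule sum_mono)
      fix k assume "k \<in> {..<M}"
      then have "(k + 1) * H \<le> M * H" by (intro mult_le_mono1) auto
      then have "real (k * H + H) \<le> real (M * H)" by (simp only: of_nat_le_iff) simp
      then have kH: "real (k * H + H) \<le> x" using MH by linarith
      have e: "(k + 1) * H = k * H + H" by simp
      show "(\<Sum>q\<in>{1..nat \<lfloor>Q\<rfloor>}. \<Sum>a\<in>reduced q. (theta {k * H<..(k + 1) * H} q a - real H / real (totient q))\<^sup>2) \<le>
        104 * Q * (\<Sum>n\<in>{k * H<..(k + 1) * H}. (norm (prime_weight n))\<^sup>2) + C * (real H * Q * ln x)"
        unfolding e by (rule C(2)[OF x Q xQ H kH])
    qed
    also have "\<dots> = 104 * Q * (\<Sum>k<M. \<Sum>n\<in>{k * H<..(k + 1) * H}. (norm (prime_weight n))\<^sup>2) + C * (real (M * H) * (Q * ln x))"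
      by (simp add: sum.distrib sum_distrib_left)
    also have "\<dots> = 104 * Q * (\<Sum>n\<in>{0<..M * H}. (norm (prime_weight n))\<^sup>2) + C * (real (M * H) * (Q * ln x))"
      by (simp only: sum_blocks)
    also have "\<dots> \<le> 104 * Q * (D * (x * ln x)) + C * (x * (Q * ln x))"
      using Q C(1) l MH D(2)[OF x MH] by (intro add_mono mult_left_mono mult_right_mono) auto
    also have "\<dots> = (104 * D + C) * (x * Q * ln x)" by (simp add: algebra_simps)
    finally show "(\<Sum>k\<in>{k. (k + 1) * 2 ^ m \<le> nat \<lfloor>x\<rfloor>}. \<Sum>q\<in>{1..nat \<lfloor>Q\<rfloor>}. \<Sum>a\<in>reduced q.
      (theta {k * 2 ^ m<..(k + 1) * 2 ^ m} q a - 2 ^ m / real (totient q))\<^sup>2) \<le> (104 * D + C) * (x * Q * ln x)"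
      unfolding set[symmetric] by (simp add: H_def n_def)
  qed (use C D in auto)
qed

lemma max_variation_large:
  obtains C where "C > 0" "\<And>x Q. x \<ge> 256 \<Longrightarrow> 1 \<le> Q \<Longrightarrow> Q \<le> x \<Longrightarrow> x \<le> Q * ln x ^ r \<Longrightarrow>
    (\<Sum>q\<in>{1..nat \<lfloor>Q\<rfloor>}. \<Sum>a\<in>reduced q.
       Max ((\<lambda>P. \<Sum>I\<in>P. (theta I q a - real (card I) / real (totient q))\<^sup>2) ` interval_partitions (nat \<lfloor>x\<rfloor>)))
    \<le> C * x * Q * ln x ^ 3"
proof -
  obtain C where C: "C > 0" "\<And>x Q m. x \<ge> 256 \<Longrightarrow> 1 \<le> Q \<Longrightarrow> Q \<le> x \<Longrightarrow> x \<le> Q * ln x ^ r \<Longrightarrow>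
    (\<Sum>k\<in>{k. (k + 1) * 2 ^ m \<le> nat \<lfloor>x\<rfloor>}. \<Sum>q\<in>{1..nat \<lfloor>Q\<rfloor>}. \<Sum>a\<in>reduced q.
      (theta {k * 2 ^ m<..(k + 1) * 2 ^ m} q a - 2 ^ m / real (totient q))\<^sup>2) \<le> C * (x * Q * ln x)"
    by (rule level_variance) blast
  show ?thesis
  proof (rule that[of "32 * C"])
    fix x Q :: real
    assume x: "x \<ge> 256" and Q: "1 \<le> Q" "Q \<le> x" and xQ: "x \<le> Q * ln x ^ r"
    define n where "n = nat \<lfloor>x\<rfloor>"
    have n: "real n \<le> x" "n \<ge> 1" using x unfolding n_def by linarith+
    have l: "ln x \<ge> 1" by (rule one_le_ln[OF x])
    \<comment> \<open>The added 1 makes \<open>n < 2 ^ L\<close> strict. Of the two factors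
      \<open>L \<le> 4 * ln x\<close>, one comes from Cauchy's inequality and one from the number of
      lengths, whence \<open>2 * 4^2 = 32\<close>.\<close>
    define L where "L = nat \<lceil>log 2 x\<rceil> + 1"
    have lg: "log 2 x \<ge> 0" using x by simp
    have L: "real L \<le> log 2 x + 2" "log 2 x < real L" using lg unfolding L_def by linarith+
    have "log 2 x \<le> 2 * ln x"
    proof -
      have "ln x * 1 \<le> ln x * (2 * ln 2)" using l ln2_ge_two_thirds by (intro mult_left_mono) auto
      then show ?thesis by (simp add: log_def divide_le_eq mult_ac)
    qed
    then have L4: "real L \<le> 4 * ln x" using L l by linarith
    have "x < 2 powr real L" using L(2) x by (simp add: log_less_iff)
    then have "x < 2 ^ L" by (simp add: powr_realpow)
    then have "real n < 2 ^ L" using n(1) by linarith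
    then have "real n < real (2 ^ L)" by simp
    then have nL: "n < 2 ^ L" by (simp only: of_nat_less_iff)
    define f where "f = (\<lambda>m k q a. (theta {k * 2 ^ m<..(k + 1) * 2 ^ m} q a - 2 ^ m / real (totient q))\<^sup>2)"
    have "(\<Sum>q\<in>{1..nat \<lfloor>Q\<rfloor>}. \<Sum>a\<in>reduced q.
       Max ((\<lambda>P. \<Sum>I\<in>P. (theta I q a - real (card I) / real (totient q))\<^sup>2) ` interval_partitions n)) \<le>
      (\<Sum>q\<in>{1..nat \<lfloor>Q\<rfloor>}. \<Sum>a\<in>reduced q. 2 * real L * (\<Sum>m<L. \<Sum>k\<in>{k. (k + 1) * 2 ^ m \<le> n}. f m k q a))"
    proof (intro sum_mono)
      fix q a
      show "Max ((\<lambda>P. \<Sum>I\<in>P. (theta I q a - real (card I) / real (totient q))\<^sup>2) ` interval_partitions n) \<le>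
        2 * real L * (\<Sum>m<L. \<Sum>k\<in>{k. (k + 1) * 2 ^ m \<le> n}. f m k q a)"
        using interval_partitions_finite_nonempty[of n] n(2) partition_variation[OF _ nL] unfolding f_def by (subst Max_le_iff) auto
    qed
    also have "\<dots> = 2 * real L * (\<Sum>q\<in>{1..nat \<lfloor>Q\<rfloor>}. \<Sum>a\<in>reduced q. \<Sum>m<L. \<Sum>k\<in>{k. (k + 1) * 2 ^ m \<le> n}. f m k q a)"
      by (simp only: sum_distrib_left)
    also have "(\<Sum>q\<in>{1..nat \<lfloor>Q\<rfloor>}. \<Sum>a\<in>reduced q. \<Sum>m<L. \<Sum>k\<in>{k. (k + 1) * 2 ^ m \<le> n}. f m k q a) =
      (\<Sum>m<L. \<Sum>q\<in>{1..nat \<lfloor>Q\<rfloor>}. \<Sum>a\<in>reduced q. \<Sum>k\<in>{k. (k + 1) * 2 ^ m \<le> n}. f m k q a)"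
      by (subst (2) sum.swap, rule sum.cong[OF refl], rule sum.swap)
    also have "\<dots> = (\<Sum>m<L. \<Sum>k\<in>{k. (k + 1) * 2 ^ m \<le> n}. \<Sum>q\<in>{1..nat \<lfloor>Q\<rfloor>}. \<Sum>a\<in>reduced q. f m k q a)"
    proof (rule sum.cong[OF refl])
      fix m
      have "(\<Sum>q\<in>{1..nat \<lfloor>Q\<rfloor>}. \<Sum>a\<in>reduced q. \<Sum>k\<in>{k. (k + 1) * 2 ^ m \<le> n}. f m k q a) =
        (\<Sum>q\<in>{1..nat \<lfloor>Q\<rfloor>}. \<Sum>k\<in>{k. (k + 1) * 2 ^ m \<le> n}. \<Sum>a\<in>reduced q. f m k q a)"
        by (rule sum.cong[OF refl], rule sum.swap)
      also have "\<dots> = (\<Sum>k\<in>{k. (k + 1) * 2 ^ m \<le> n}. \<Sum>q\<in>{1..nat \<lfloor>Q\<rfloor>}. \<Sum>a\<in>reduced q. f m k q a)"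
        by (rule sum.swap)
      finally show "(\<Sum>q\<in>{1..nat \<lfloor>Q\<rfloor>}. \<Sum>a\<in>reduced q. \<Sum>k\<in>{k. (k + 1) * 2 ^ m \<le> n}. f m k q a) =
        (\<Sum>k\<in>{k. (k + 1) * 2 ^ m \<le> n}. \<Sum>q\<in>{1..nat \<lfloor>Q\<rfloor>}. \<Sum>a\<in>reduced q. f m k q a)" .
    qed
    also have "2 * real L * \<dots> \<le> 2 * real L * (\<Sum>m<L. C * (x * Q * ln x))"
      unfolding f_def n_def using C(2)[OF x Q xQ] by (intro mult_left_mono sum_mono) auto
    also have "\<dots> = 2 * C * x * Q * ln x * (real L)\<^sup>2" by (simp add: power2_eq_square)
    also have "\<dots> \<le> 2 * C * x * Q * ln x * (4 * ln x)\<^sup>2" using L4 C(1) x Q l by (intro mult_left_mono power_mono) auto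
    also have "\<dots> = 32 * C * x * Q * ln x ^ 3" by (simp add: power2_eq_square power3_eq_cube)
    finally show "(\<Sum>q\<in>{1..nat \<lfloor>Q\<rfloor>}. \<Sum>a\<in>reduced q.
       Max ((\<lambda>P. \<Sum>I\<in>P. (theta I q a - real (card I) / real (totient q))\<^sup>2) ` interval_partitions (nat \<lfloor>x\<rfloor>)))
      \<le> 32 * C * x * Q * ln x ^ 3" by (simp only: n_def)
  qed (use C in auto)
qed

theorem theorem4:
  fixes A :: real
  assumes "A > 0"
  shows "\<exists>C>0. \<forall>x Q :: real. x > 1 \<and> Q > 0 \<and> x * (ln x) powr (-A) \<le> Q \<and> Q \<le> x \<longrightarrow>
    (\<Sum>q\<in>{1..nat \<lfloor>Q\<rfloor>}. \<Sum>a\<in>{a. a \<in> {1..q} \<and> coprime a q}.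
       Max ((\<lambda>P. \<Sum>I\<in>P. (theta I q a - real (card I) / real (totient q))\<^sup>2)
             ` interval_partitions (nat \<lfloor>x\<rfloor>)))
    \<le> C * x * Q * (ln x) ^ 3"
proof -
  \<comment> \<open>The analytic part works with integral powers of the logarithm; rounding
    \<open>A\<close> up only weakens the lower bound for \<open>Q\<close>.\<close>
  define r where "r = nat \<lceil>A\<rceil>"
  define V where "V = (\<lambda>n N. \<Sum>q\<in>{1..N}. \<Sum>a\<in>{a. a \<in> {1..q} \<and> coprime a q}.
       Max ((\<lambda>P. \<Sum>I\<in>P. (theta I q a - real (card I) / real (totient q))\<^sup>2) ` interval_partitions n))"
  obtain C where C: "C > 0" "\<And>x Q. x \<ge> 256 \<Longrightarrow> 1 \<le> Q \<Longrightarrow> Q \<le> x \<Longrightarrow> x \<le> Q * ln x ^ r \<Longrightarrow>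
    V (nat \<lfloor>x\<rfloor>) (nat \<lfloor>Q\<rfloor>) \<le> C * x * Q * ln x ^ 3"
    unfolding V_def by (rule max_variation_large) blast
  \<comment> \<open>For \<open>x < 256\<close> only the integer parts of \<open>x\<close> and
    \<open>Q\<close> enter the left-hand side, so finitely many values occur.\<close>
  define M where "M = (\<Sum>n<256. \<Sum>N<256. \<bar>V n N\<bar>)"
  \<comment> \<open>In that range \<open>ln x < ln 256\<close> and the lower bound for
    \<open>Q\<close> give \<open>1 \<le> ln 256 powr A * Q\<close>, which turns the constant
    \<open>M\<close> into a multiple of \<open>Q\<close>.\<close>
  define D where "D = C + M * ln 256 powr A"
  have M: "M \<ge> 0" unfolding M_def by (intro sum_nonneg) auto
  have D: "D > 0" "C \<le> D" using C(1) M by (auto simp: D_def intro: add_pos_nonneg)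
  have "V (nat \<lfloor>x\<rfloor>) (nat \<lfloor>Q\<rfloor>) \<le> D * x * Q * ln x ^ 3"
    if x: "x > 1" and Q: "Q > 0" "Q \<le> x" and AQ: "x * ln x powr (- A) \<le> Q" for x Q :: real
  proof -
    have l0: "ln x > 0" using x by simp
    \<comment> \<open>The two bounds for \<open>Q\<close> are compatible only if
      \<open>ln x powr A \<ge> 1\<close>, hence \<open>ln x \<ge> 1\<close> since \<open>A\<close>
      is positive; the right-hand side is thus bounded away from zero in terms of
      \<open>Q\<close>.\<close>
    have "x * ln x powr (- A) \<le> x * 1" using AQ Q by linarith
    then have "ln x powr (- A) \<le> 1" using x by (subst (asm) mult_le_cancel_left_pos) auto
    then have "1 \<le> ln x powr A" using l0 by (simp add: powr_minus inverse_le_1_iff)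
    have l: "ln x \<ge> 1"
    proof (rule ccontr)
      assume "\<not> ln x \<ge> 1"
      then have "ln x powr A < 1 powr A" using l0 assms by (intro powr_less_mono2) auto
      then show False using \<open>1 \<le> ln x powr A\<close> by simp
    qed
    have pos: "x * Q * ln x ^ 3 \<ge> 0" using x Q l by simp
    have R0: "D * x * Q * ln x ^ 3 \<ge> 0" using D pos by (simp add: mult.assoc)
    show ?thesis
    proof (cases "Q < 1")
      case True
      then have "nat \<lfloor>Q\<rfloor> = 0" by linarith
      then show ?thesis using R0 by (simp add: V_def)
    next
      case Q1: False
      show ?thesis
      proof (cases "x \<ge> 256")
        case True
        have "x = x * ln x powr (- A) * ln x powr A" using l by (simp add: powr_minus)
        also have "\<dots> \<le> Q * ln x powr A" using AQ by (intro mult_right_mono) auto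
        also have "\<dots> \<le> Q * ln x powr real r" using Q l unfolding r_def by (intro mult_left_mono powr_mono) linarith+
        also have "\<dots> = Q * ln x ^ r" using l by (simp add: powr_realpow)
        finally have "V (nat \<lfloor>x\<rfloor>) (nat \<lfloor>Q\<rfloor>) \<le> C * x * Q * ln x ^ 3" using C(2) True Q Q1 by auto
        also have "\<dots> \<le> D * x * Q * ln x ^ 3" using D(2) pos by (simp add: mult.assoc mult_right_mono)
        finally show ?thesis .
      next
        case False
        have "nat \<lfloor>x\<rfloor> < 256" "nat \<lfloor>Q\<rfloor> < 256" using False Q by linarith+
        then have "\<bar>V (nat \<lfloor>x\<rfloor>) (nat \<lfloor>Q\<rfloor>)\<bar> \<le> (\<Sum>N<256. \<bar>V (nat \<lfloor>x\<rfloor>) N\<bar>)"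
          by (intro member_le_sum[of _ _ "\<lambda>N. \<bar>V (nat \<lfloor>x\<rfloor>) N\<bar>"]) auto
        also have "\<dots> \<le> M" unfolding M_def using \<open>nat \<lfloor>x\<rfloor> < 256\<close>
          by (intro member_le_sum[of _ _ "\<lambda>n. \<Sum>N<256. \<bar>V n N\<bar>"]) (auto intro: sum_nonneg)
        finally have "V (nat \<lfloor>x\<rfloor>) (nat \<lfloor>Q\<rfloor>) \<le> M" by linarith
        also have "M * 1 \<le> M * (ln 256 powr A * Q)"
        proof (rule mult_left_mono[OF _ M])
          have "1 \<le> x * (ln x powr A * ln x powr (- A))" using l x by (simp add: powr_minus)
          also have "\<dots> = ln x powr A * (x * ln x powr (- A))" by simp
          also have "\<dots> \<le> ln 256 powr A * Q" using AQ False x l assms by (intro mult_mono powr_mono2) auto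
          finally show "1 \<le> ln 256 powr A * Q" .
        qed
        then have "M \<le> M * ln 256 powr A * Q * 1" by simp
        also have "\<dots> \<le> D * Q * (x * ln x ^ 3)"
        proof (intro mult_mono)
          have "1 * 1 \<le> x * ln x ^ 3" using x l by (intro mult_mono one_le_power) auto
          then show "1 \<le> x * ln x ^ 3" by simp
        qed (use C D M Q in \<open>auto simp: D_def\<close>)
        finally show ?thesis by (simp add: mult_ac)
      qed
    qed
  qed
  then show ?thesis using D(1) unfolding V_def by blast
qed

end
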